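(* Let $\pi:E\to M$ be a vector bundle of rank $m$ over a smooth manifold, $A=C^\infty(M)$, $P=\Gamma(\pi)$, $\mathcal{A}=A\oplus P$ the associated diolic algebra, and $k\ge 1$. Then the module $\mathcal{S}^k(\mathcal{A})\cong\mathrm{Smbl}_k(\mathcal{A})_0$ of diolic symbols of order $k$ and degree $0$ coincides (as an $A$-module) with the module of $\mathrm{Der}(P)$-valued symmetric $(k-1)$-derivations of $A$ with symmetric multi-symbols, i.e. of symmetric maps $$\Delta:\underbrace{A\times\cdots\times A}_{k-1}\to\mathrm{Der}(P)$$ that are derivations in each argument and satisfy $$\Delta(f_1,\dots,f_{k-1},gp)=\sigma_\Delta(f_1,\dots,f_{k-1},g)\,p+g\,\Delta(f_1,\dots,f_{k-1},p)$$ for all $f_1,\dots,f_{k-1},g\in A$, $p\in P$, where $\sigma_\Delta$ is symmetric in all of its $k$ arguments.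
   Context: The diolic algebra $\mathcal{A}=A\oplus P$ is the $\mathbb{Z}$-graded commutative algebra with $\mathcal{A}_0=A$, $\mathcal{A}_1=P$, all other components zero, with products given by the multiplication of $A$, the $A$-module structure of $P$, and $P\cdot P=0$. For a homogeneous linear map $\varphi:\mathcal{A}\to\mathcal{A}$ and homogeneous $a\in\mathcal{A}$ put $\delta_a\varphi=a\circ\varphi-(-1)^{\deg a\deg\varphi}\varphi\circ a$; $\varphi$ is a graded differential operator of order $\leq k$ if $\delta_{a_0}\circ\cdots\circ\delta_{a_k}(\varphi)=0$ for all homogeneous $a_0,\dots,a_k\in\mathcal{A}$. $\mathrm{Diff}_k(\mathcal{A})_0$ denotes such operators of degree $0$; explicitly they are pairs $(\Delta_A,\Delta_P)$ with $\Delta_A\in\mathrm{Diff}_k(A,A)$, $\Delta_P\in\mathrm{Diff}_k(P,P)$ and $\delta_a^k(\Delta_A)=\delta_a^k(\Delta_P)$ for all $a\in A$. Set $\mathrm{Smbl}_k(\mathcal{A})_0:=\mathrm{Diff}_k(\mathcal{A})_0/\mathrm{Diff}_{k-1}(\mathcal{A})_0$. The symbol $\mathcal{S}^k(\mathcal{A})$ is the paper's name for the module of tensor-type objects corresponding to $\mathrm{Smbl}_k(\mathcal{A})_0$ (the middle term of the sequence $0\to\mathrm{Sym}^{k-1}(D(A))\otimes\mathrm{End}(P)\to\mathcal{S}^k(\mathcal{A})\to\mathrm{Sym}^k(D(A))\to0$). $\mathrm{Der}(P)$ is the $A$-module of Der-operators: $\mathbb{R}$-linear maps $\nabla:P\to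 P$ for which there is $X\in D(A)$ (the symbol) with $\nabla(ap)=X(a)p+a\nabla(p)$. We write $\Delta(f_1,\dots,f_{k-1},p):=\Delta(f_1,\dots,f_{k-1})(p)$, and $\sigma_\Delta(f_1,\dots,f_{k-1},\cdot)\in D(A)$ is the symbol of $\Delta(f_1,\dots,f_{k-1})$. *)

theory Defs
  imports "HOL-Analysis.Analysis" "HOL-Algebra.AbelCoset" "HOL-Algebra.Module"
    "HOL-Library.Multiset"
begin

section \<open>Smooth manifolds and vector bundles\<close>

text \<open>
  \<open>Euclidean_space n\<close> is the library's \<open>\<real>\<^sup>n\<close> for a natural number \<open>n\<close> (possibly \<open>0\<close>): its points
  are the sequences vanishing from index \<open>n\<close> on. \<open>C_on n k U f\<close> is only meant for \<open>U\<close> open in that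
  space; differentiability and partial derivatives at points of \<open>U\<close> then depend on \<open>f\<close> on \<open>U\<close> only.
\<close>

definition partial_deriv :: "nat \<Rightarrow> ((nat \<Rightarrow> real) \<Rightarrow> real) \<Rightarrow> (nat \<Rightarrow> real) \<Rightarrow> real" where
  "partial_deriv i f x = deriv (\<lambda>t. f (x(i := t))) (x i)"

fun C_on :: "nat \<Rightarrow> nat \<Rightarrow> (nat \<Rightarrow> real) set \<Rightarrow> ((nat \<Rightarrow> real) \<Rightarrow> real) \<Rightarrow> bool" where
  "C_on n 0 U f \<longleftrightarrow> continuous_map (subtopology (Euclidean_space n) U) euclideanreal f"
| "C_on n (Suc k) U f \<longleftrightarrow>
     continuous_map (subtopology (Euclidean_space n) U) euclideanreal f \<and>
     (\<forall>i<n. (\<forall>x\<in>U. (\<lambda>t. f (x(i := t))) field_differentiable (at (x i))) \<and>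
            C_on n k U (partial_deriv i f))"

definition Cinf_on :: "nat \<Rightarrow> (nat \<Rightarrow> real) set \<Rightarrow> ((nat \<Rightarrow> real) \<Rightarrow> real) \<Rightarrow> bool" where
  "Cinf_on n U f \<longleftrightarrow> (\<forall>k. C_on n k U f)"

record 'a manifold =
  mtop :: "'a topology"
  mdim :: nat
  atlas :: "('a set \<times> ('a \<Rightarrow> nat \<Rightarrow> real)) set"

definition smooth_manifold :: "'a manifold \<Rightarrow> bool" where
  "smooth_manifold M \<longleftrightarrow>
     Hausdorff_space (mtop M) \<and> second_countable (mtop M) \<and>
     (\<Union>(U, \<phi>)\<in>atlas M. U) = topspace (mtop M) \<and>
     (\<forall>(U, \<phi>)\<in>atlas M.
        openin (mtop M) U \<and> openin (Euclidean_space (mdim M)) (\<phi> ` U) \<and>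
        homeomorphic_map (subtopology (mtop M) U)
          (subtopology (Euclidean_space (mdim M)) (\<phi> ` U)) \<phi>) \<and>
     (\<forall>(U, \<phi>)\<in>atlas M. \<forall>(V, \<psi>)\<in>atlas M. \<forall>i<mdim M.
        Cinf_on (mdim M) (\<phi> ` (U \<inter> V)) (\<lambda>y. \<psi> (inv_into U \<phi> y) i))"

text \<open>Only meant for \<open>W\<close> open in \<open>M\<close>.\<close>

definition smooth_on :: "'a manifold \<Rightarrow> 'a set \<Rightarrow> ('a \<Rightarrow> real) \<Rightarrow> bool" where
  "smooth_on M W f \<longleftrightarrow>
     (\<forall>(U, \<phi>)\<in>atlas M. Cinf_on (mdim M) (\<phi> ` (U \<inter> W)) (f \<circ> inv_into U \<phi>))"

text \<open>
  A vector bundle is given by a bundle atlas: fibrewise linear bijections onto \<open>\<real>\<^sup>m\<close> with smooth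
  transition matrices. The topology and the smooth structure of the total space are the ones
  induced by this atlas, so they are not separate data. The vector space axioms for the fibres are
  not listed, since they are transported along the trivialisations.
\<close>

record ('a, 'e) vbundle =
  total :: "'e set"
  proj :: "'e \<Rightarrow> 'a"
  fibre_add :: "'e \<Rightarrow> 'e \<Rightarrow> 'e"
  fibre_zero :: "'a \<Rightarrow> 'e"
  fibre_scale :: "real \<Rightarrow> 'e \<Rightarrow> 'e"
  bundle_rank :: nat
  bundle_atlas :: "('a set \<times> ('e \<Rightarrow> nat \<Rightarrow> real)) set"

definition fibre :: "('a, 'e) vbundle \<Rightarrow> 'a \<Rightarrow> 'e set" where
  "fibre E x = {e \<in> total E. proj E e = x}"

definition vector_bundle :: "'a manifold \<Rightarrow> ('a, 'e) vbundle \<Rightarrow> bool" where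
  "vector_bundle M E \<longleftrightarrow>
     proj E ` total E \<subseteq> topspace (mtop M) \<and>
     (\<forall>x\<in>topspace (mtop M). fibre_zero E x \<in> fibre E x \<and>
        (\<forall>u\<in>fibre E x. \<forall>v\<in>fibre E x. fibre_add E u v \<in> fibre E x) \<and>
        (\<forall>r. \<forall>u\<in>fibre E x. fibre_scale E r u \<in> fibre E x)) \<and>
     (\<Union>(U, \<Phi>)\<in>bundle_atlas E. U) = topspace (mtop M) \<and>
     (\<forall>(U, \<Phi>)\<in>bundle_atlas E. openin (mtop M) U \<and>
        (\<forall>x\<in>U. bij_betw \<Phi> (fibre E x) (topspace (Euclidean_space (bundle_rank E))) \<and>
           (\<forall>i. \<Phi> (fibre_zero E x) i = 0) \<and>
           (\<forall>u\<in>fibre E x. \<forall>v\<in>fibre E x. \<forall>i. \<Phi> (fibre_add E u v) i = \<Phi> u i + \<Phi> v i) \<and>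
           (\<forall>r. \<forall>u\<in>fibre E x. \<forall>i. \<Phi> (fibre_scale E r u) i = r * \<Phi> u i))) \<and>
     (\<forall>(U, \<Phi>)\<in>bundle_atlas E. \<forall>(V, \<Psi>)\<in>bundle_atlas E. \<forall>i<bundle_rank E. \<forall>j<bundle_rank E.
        smooth_on M (U \<inter> V)
          (\<lambda>x. \<Psi> (inv_into (fibre E x) \<Phi> (\<lambda>l. if l = j then 1 else 0)) i))"

text \<open>
  The \<open>\<real>\<close>-algebra \<open>A = C\<^sup>\<infinity>(M)\<close> and the \<open>A\<close>-module \<open>P = \<Gamma>(E)\<close>. Here, as for every module
  below, maps are made extensional on their domain so that equality is equality of maps, and the
  ring fields \<open>mult\<close> and \<open>one\<close> of the record of a module that is not an algebra are left undefined.
\<close>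

definition smooth_functions :: "'a manifold \<Rightarrow> (real, 'a \<Rightarrow> real) module" where
  "smooth_functions M =
    \<lparr>carrier = {f \<in> extensional (topspace (mtop M)). smooth_on M (topspace (mtop M)) f},
     mult = (\<lambda>f g. \<lambda>x\<in>topspace (mtop M). f x * g x),
     one = (\<lambda>x\<in>topspace (mtop M). 1),
     zero = (\<lambda>x\<in>topspace (mtop M). 0),
     add = (\<lambda>f g. \<lambda>x\<in>topspace (mtop M). f x + g x),
     smult = (\<lambda>r f. \<lambda>x\<in>topspace (mtop M). r * f x)\<rparr>"

definition smooth_sections :: "'a manifold \<Rightarrow> ('a, 'e) vbundle \<Rightarrow> ('a \<Rightarrow> real, 'a \<Rightarrow> 'e) module" where
  "smooth_sections M E =
    \<lparr>carrier = {s. s \<in> (\<Pi>\<^sub>E x\<in>topspace (mtop M). fibre E x) \<and>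
       (\<forall>(U, \<Phi>)\<in>bundle_atlas E. \<forall>i<bundle_rank E. smooth_on M U (\<lambda>x. \<Phi> (s x) i))},
     mult = undefined,
     one = undefined,
     zero = (\<lambda>x\<in>topspace (mtop M). fibre_zero E x),
     add = (\<lambda>s t. \<lambda>x\<in>topspace (mtop M). fibre_add E (s x) (t x)),
     smult = (\<lambda>f s. \<lambda>x\<in>topspace (mtop M). fibre_scale E (f x) (s x))\<rparr>"


section \<open>Graded differential operators\<close>

text \<open>
  A graded commutative \<open>\<real>\<close>-algebra is an algebra \<open>B\<close> together with its homogeneous components
  \<open>C d\<close>, \<open>d \<in> \<int>\<close>. In \<open>graded_delta B d e b \<phi>\<close>, \<open>d\<close> is the degree of \<open>\<phi>\<close> and \<open>e\<close> that of \<open>b\<close>.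
  The degrees are parameters since they cannot be read off from zero elements, for which all
  choices give the same result.
\<close>

definition graded_hom ::
  "(real, 'b) module \<Rightarrow> (int \<Rightarrow> 'b set) \<Rightarrow> int \<Rightarrow> ('b \<Rightarrow> 'b) set" where
  "graded_hom B C d = {\<phi> \<in> carrier B \<rightarrow>\<^sub>E carrier B.
     (\<forall>x\<in>carrier B. \<forall>y\<in>carrier B. \<phi> (x \<oplus>\<^bsub>B\<^esub> y) = \<phi> x \<oplus>\<^bsub>B\<^esub> \<phi> y) \<and>
     (\<forall>r. \<forall>x\<in>carrier B. \<phi> (r \<odot>\<^bsub>B\<^esub> x) = r \<odot>\<^bsub>B\<^esub> \<phi> x) \<and>
     (\<forall>i. \<phi> ` C i \<subseteq> C (i + d))}"

definition graded_delta ::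
  "(real, 'b) module \<Rightarrow> int \<Rightarrow> int \<Rightarrow> 'b \<Rightarrow> ('b \<Rightarrow> 'b) \<Rightarrow> ('b \<Rightarrow> 'b)" where
  "graded_delta B d e b \<phi> = (\<lambda>x\<in>carrier B.
     if even (d * e) then b \<otimes>\<^bsub>B\<^esub> \<phi> x \<ominus>\<^bsub>B\<^esub> \<phi> (b \<otimes>\<^bsub>B\<^esub> x)
     else b \<otimes>\<^bsub>B\<^esub> \<phi> x \<oplus>\<^bsub>B\<^esub> \<phi> (b \<otimes>\<^bsub>B\<^esub> x))"

text \<open>Iterated \<open>\<delta>\<close> along a list of pairs (degree, element), the head of the list acting first.\<close>

fun graded_deltas ::
  "(real, 'b) module \<Rightarrow> int \<Rightarrow> (int \<times> 'b) list \<Rightarrow> ('b \<Rightarrow> 'b) \<Rightarrow> ('b \<Rightarrow> 'b)" where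
  "graded_deltas B d [] \<phi> = \<phi>"
| "graded_deltas B d ((e, b) # bs) \<phi> = graded_deltas B (d + e) bs (graded_delta B d e b \<phi>)"

definition graded_diff ::
  "(real, 'b) module \<Rightarrow> (int \<Rightarrow> 'b set) \<Rightarrow> nat \<Rightarrow> int \<Rightarrow> ('b \<Rightarrow> 'b) set" where
  "graded_diff B C k d = {\<phi> \<in> graded_hom B C d.
     \<forall>bs. length bs = Suc k \<and> (\<forall>(e, b)\<in>set bs. b \<in> C e) \<longrightarrow>
       graded_deltas B d bs \<phi> = (\<lambda>x\<in>carrier B. \<zero>\<^bsub>B\<^esub>)}"


section \<open>The diolic algebra and its symbols\<close>

text \<open>
  From here on \<open>A\<close> is an \<open>\<real>\<close>-algebra and \<open>P\<close> an \<open>A\<close>-module. A real number \<open>r\<close> acts on an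
  \<open>A\<close>-module through the element \<open>r \<odot> \<one>\<close> of \<open>A\<close>.
\<close>

definition diolic :: "(real, 'f) module \<Rightarrow> ('f, 'p) module \<Rightarrow> (real, 'f \<times> 'p) module" where
  "diolic A P =
    \<lparr>carrier = carrier A \<times> carrier P,
     mult = (\<lambda>(a, p) (b, q). (a \<otimes>\<^bsub>A\<^esub> b, (a \<odot>\<^bsub>P\<^esub> q) \<oplus>\<^bsub>P\<^esub> (b \<odot>\<^bsub>P\<^esub> p))),
     one = (\<one>\<^bsub>A\<^esub>, \<zero>\<^bsub>P\<^esub>),
     zero = (\<zero>\<^bsub>A\<^esub>, \<zero>\<^bsub>P\<^esub>),
     add = (\<lambda>(a, p) (b, q). (a \<oplus>\<^bsub>A\<^esub> b, p \<oplus>\<^bsub>P\<^esub> q)),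
     smult = (\<lambda>r (a, p). (r \<odot>\<^bsub>A\<^esub> a, (r \<odot>\<^bsub>A\<^esub> \<one>\<^bsub>A\<^esub>) \<odot>\<^bsub>P\<^esub> p))\<rparr>"

definition diolic_component ::
  "(real, 'f) module \<Rightarrow> ('f, 'p) module \<Rightarrow> int \<Rightarrow> ('f \<times> 'p) set" where
  "diolic_component A P d =
     (if d = 0 then carrier A \<times> {\<zero>\<^bsub>P\<^esub>}
      else if d = 1 then {\<zero>\<^bsub>A\<^esub>} \<times> carrier P
      else {(\<zero>\<^bsub>A\<^esub>, \<zero>\<^bsub>P\<^esub>)})"

text \<open>\<open>Diff\<^sub>k(\<A>)\<^sub>0\<close> with the left multiplication by elements of \<open>\<A>\<^sub>0 = A\<close>.\<close>

definition diolic_diff ::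
  "(real, 'f) module \<Rightarrow> ('f, 'p) module \<Rightarrow> nat \<Rightarrow> ('f, 'f \<times> 'p \<Rightarrow> 'f \<times> 'p) module" where
  "diolic_diff A P k =
    \<lparr>carrier = graded_diff (diolic A P) (diolic_component A P) k 0,
     mult = undefined,
     one = undefined,
     zero = (\<lambda>x\<in>carrier (diolic A P). \<zero>\<^bsub>diolic A P\<^esub>),
     add = (\<lambda>\<phi> \<psi>. \<lambda>x\<in>carrier (diolic A P). \<phi> x \<oplus>\<^bsub>diolic A P\<^esub> \<psi> x),
     smult = (\<lambda>a \<phi>. \<lambda>x\<in>carrier (diolic A P). (a, \<zero>\<^bsub>P\<^esub>) \<otimes>\<^bsub>diolic A P\<^esub> \<phi> x)\<rparr>"

definition quotient_module :: "('f, 'q) module \<Rightarrow> 'q set \<Rightarrow> ('f, 'q set) module" where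
  "quotient_module Q N =
    \<lparr>carrier = a_rcosets\<^bsub>Q\<^esub> N,
     mult = undefined,
     one = undefined,
     zero = N,
     add = (<+>\<^bsub>Q\<^esub>),
     smult = (\<lambda>a X. \<Union>x\<in>X. N +>\<^bsub>Q\<^esub> (a \<odot>\<^bsub>Q\<^esub> x))\<rparr>"

text \<open>\<open>Smbl\<^sub>k(\<A>)\<^sub>0\<close>, for \<open>k \<ge> 1\<close>.\<close>

definition diolic_smbl ::
  "(real, 'f) module \<Rightarrow> ('f, 'p) module \<Rightarrow> nat \<Rightarrow> ('f, ('f \<times> 'p \<Rightarrow> 'f \<times> 'p) set) module" where
  "diolic_smbl A P k = quotient_module (diolic_diff A P k) (carrier (diolic_diff A P (k - 1)))"


section \<open>Der-operators and symmetric multi-derivations\<close>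

definition derivations :: "(real, 'f) module \<Rightarrow> ('f, 'q) module \<Rightarrow> ('f \<Rightarrow> 'q) set" where
  "derivations A Q = {X \<in> carrier A \<rightarrow>\<^sub>E carrier Q.
     (\<forall>f\<in>carrier A. \<forall>g\<in>carrier A. X (f \<oplus>\<^bsub>A\<^esub> g) = X f \<oplus>\<^bsub>Q\<^esub> X g) \<and>
     (\<forall>r. \<forall>f\<in>carrier A. X (r \<odot>\<^bsub>A\<^esub> f) = (r \<odot>\<^bsub>A\<^esub> \<one>\<^bsub>A\<^esub>) \<odot>\<^bsub>Q\<^esub> X f) \<and>
     (\<forall>f\<in>carrier A. \<forall>g\<in>carrier A.
        X (f \<otimes>\<^bsub>A\<^esub> g) = (f \<odot>\<^bsub>Q\<^esub> X g) \<oplus>\<^bsub>Q\<^esub> (g \<odot>\<^bsub>Q\<^esub> X f))}"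

definition self_module :: "(real, 'f) module \<Rightarrow> ('f, 'f) module" where
  "self_module A =
    \<lparr>carrier = carrier A, mult = mult A, one = one A, zero = zero A, add = add A,
     smult = mult A\<rparr>"

definition is_der_op ::
  "(real, 'f) module \<Rightarrow> ('f, 'p) module \<Rightarrow> ('f \<Rightarrow> 'f) \<Rightarrow> ('p \<Rightarrow> 'p) \<Rightarrow> bool" where
  "is_der_op A P X T \<longleftrightarrow>
     X \<in> derivations A (self_module A) \<and> T \<in> carrier P \<rightarrow>\<^sub>E carrier P \<and>
     (\<forall>p\<in>carrier P. \<forall>q\<in>carrier P. T (p \<oplus>\<^bsub>P\<^esub> q) = T p \<oplus>\<^bsub>P\<^esub> T q) \<and>
     (\<forall>r. \<forall>p\<in>carrier P.
        T ((r \<odot>\<^bsub>A\<^esub> \<one>\<^bsub>A\<^esub>) \<odot>\<^bsub>P\<^esub> p) = (r \<odot>\<^bsub>A\<^esub> \<one>\<^bsub>A\<^esub>) \<odot>\<^bsub>P\<^esub> T p) \<and>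
     (\<forall>a\<in>carrier A. \<forall>p\<in>carrier P.
        T (a \<odot>\<^bsub>P\<^esub> p) = (X a \<odot>\<^bsub>P\<^esub> p) \<oplus>\<^bsub>P\<^esub> (a \<odot>\<^bsub>P\<^esub> T p))"

definition Der :: "(real, 'f) module \<Rightarrow> ('f, 'p) module \<Rightarrow> ('f, 'p \<Rightarrow> 'p) module" where
  "Der A P =
    \<lparr>carrier = {T. \<exists>X. is_der_op A P X T},
     mult = undefined,
     one = undefined,
     zero = (\<lambda>p\<in>carrier P. \<zero>\<^bsub>P\<^esub>),
     add = (\<lambda>T T'. \<lambda>p\<in>carrier P. T p \<oplus>\<^bsub>P\<^esub> T' p),
     smult = (\<lambda>a T. \<lambda>p\<in>carrier P. a \<odot>\<^bsub>P\<^esub> T p)\<rparr>"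

text \<open>
  A map in \<open>j\<close> arguments is a function on lists of length \<open>j\<close>; it is symmetric if its value depends
  only on the multiset of arguments.
\<close>

definition tuples :: "(real, 'f) module \<Rightarrow> nat \<Rightarrow> 'f list set" where
  "tuples A j = {fs. length fs = j \<and> set fs \<subseteq> carrier A}"

definition symmetric_map :: "(real, 'f) module \<Rightarrow> nat \<Rightarrow> ('f list \<Rightarrow> 'q) \<Rightarrow> bool" where
  "symmetric_map A j \<Delta> \<longleftrightarrow>
     (\<forall>fs\<in>tuples A j. \<forall>gs\<in>tuples A j. mset fs = mset gs \<longrightarrow> \<Delta> fs = \<Delta> gs)"

definition sym_multiderivations ::
  "(real, 'f) module \<Rightarrow> nat \<Rightarrow> ('f, 'q) module \<Rightarrow> ('f list \<Rightarrow> 'q) set" where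
  "sym_multiderivations A j Q = {\<Delta> \<in> tuples A j \<rightarrow>\<^sub>E carrier Q.
     symmetric_map A j \<Delta> \<and>
     (\<forall>us vs. set us \<subseteq> carrier A \<and> set vs \<subseteq> carrier A \<and> Suc (length us + length vs) = j \<longrightarrow>
        (\<lambda>f\<in>carrier A. \<Delta> (us @ f # vs)) \<in> derivations A Q)}"

text \<open>
  The module of \<open>Der(P)\<close>-valued symmetric \<open>(k - 1)\<close>-derivations with symmetric multi-symbol.
  The multi-symbol \<open>\<sigma>\<close> is a function of \<open>k\<close> arguments such that \<open>\<sigma>(f\<^sub>1, \<dots>, f\<^bsub>k-1\<^esub>, \<cdot>)\<close> is a symbol
  of the Der-operator \<open>\<Delta>(f\<^sub>1, \<dots>, f\<^bsub>k-1\<^esub>)\<close>.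
\<close>

definition diolic_multiderivations ::
  "(real, 'f) module \<Rightarrow> ('f, 'p) module \<Rightarrow> nat \<Rightarrow> ('f, 'f list \<Rightarrow> 'p \<Rightarrow> 'p) module" where
  "diolic_multiderivations A P k =
    \<lparr>carrier = {\<Delta> \<in> sym_multiderivations A (k - 1) (Der A P).
       \<exists>\<sigma>. symmetric_map A k \<sigma> \<and>
         (\<forall>fs\<in>tuples A (k - 1). is_der_op A P (\<lambda>g\<in>carrier A. \<sigma> (fs @ [g])) (\<Delta> fs))},
     mult = undefined,
     one = undefined,
     zero = (\<lambda>fs\<in>tuples A (k - 1). \<zero>\<^bsub>Der A P\<^esub>),
     add = (\<lambda>\<Delta> \<Delta>'. \<lambda>fs\<in>tuples A (k - 1). \<Delta> fs \<oplus>\<^bsub>Der A P\<^esub> \<Delta>' fs),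
     smult = (\<lambda>a \<Delta>. \<lambda>fs\<in>tuples A (k - 1). a \<odot>\<^bsub>Der A P\<^esub> \<Delta> fs)\<rparr>"

text \<open>
  The multi-symbol of an operator \<open>\<phi>\<close> of order \<open>\<le> k\<close> and degree \<open>0\<close>: with \<open>[\<phi>, b] = -\<delta>\<^sub>b \<phi>\<close>,
  \<open>\<Delta>(f\<^sub>1, \<dots>, f\<^bsub>k-1\<^esub>)(p) = [\<dots>[[\<phi>, f\<^sub>1], f\<^sub>2] \<dots>, p](1) \<in> \<A>\<^sub>1 = P\<close>. All \<open>\<delta>\<close>'s here act on operators of
  degree \<open>0\<close>, so the only sign is \<open>(-1)\<^sup>k\<close>. For \<open>k = 1\<close> and \<open>\<phi> = (X, \<nabla>)\<close> with \<open>X(1) = 0\<close> this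
  is \<open>\<nabla>\<close> itself.
\<close>

definition diolic_multisymbol ::
  "(real, 'f) module \<Rightarrow> ('f, 'p) module \<Rightarrow> nat \<Rightarrow> ('f \<times> 'p \<Rightarrow> 'f \<times> 'p) \<Rightarrow> 'f list \<Rightarrow> 'p \<Rightarrow> 'p" where
  "diolic_multisymbol A P k \<phi> = (\<lambda>fs\<in>tuples A (k - 1). \<lambda>p\<in>carrier P.
     let q = snd (graded_deltas (diolic A P) 0
                    (map (\<lambda>f. (0, (f, \<zero>\<^bsub>P\<^esub>))) fs @ [(1, (\<zero>\<^bsub>A\<^esub>, p))]) \<phi> \<one>\<^bsub>diolic A P\<^esub>)
     in if even k then q else \<ominus>\<^bsub>P\<^esub> q)"

definition module_iso ::
  "('r, 's) ring_scheme \<Rightarrow> ('r, 'x) module \<Rightarrow> ('r, 'y) module \<Rightarrow> ('x \<Rightarrow> 'y) set" where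
  "module_iso R Q N = {h. bij_betw h (carrier Q) (carrier N) \<and>
     (\<forall>x\<in>carrier Q. \<forall>y\<in>carrier Q. h (x \<oplus>\<^bsub>Q\<^esub> y) = h x \<oplus>\<^bsub>N\<^esub> h y) \<and>
     (\<forall>a\<in>carrier R. \<forall>x\<in>carrier Q. h (a \<odot>\<^bsub>Q\<^esub> x) = a \<odot>\<^bsub>N\<^esub> h x)}"

end

theory Submission
  imports Defs "HOL-Real_Asymp.Real_Asymp"
begin

text \<open>
  Since the degree of an operator under consideration is zero and \<open>P \<cdot> P = 0\<close>, the diolic algebra
  \<open>B = A \<oplus> P\<close> behaves like an ordinary commutative ring: the square-zero extension of \<open>A\<close> by \<open>P\<close>. Write
  \<open>ad f \<phi> = \<phi> \<circ> f - f \<circ> \<phi>\<close> for \<open>f\<close> in \<open>A\<close>. An operator \<open>\<phi>\<close> has order at most \<open>k\<close> if and only if every \<open>k\<close>-fold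
  commutator of \<open>\<phi>\<close> with functions is the multiplication by an element of \<open>B\<close> (\<open>graded_diff_iff\<close>).
  Let \<open>k = j + 1\<close>.

  \<^bold>\<open>The symbol.\<close> If \<open>\<phi>\<close> has order at most \<open>k\<close>, then a \<open>j\<close>-fold commutator \<open>\<psi>\<close> of \<open>\<phi>\<close> has order at most
  one, so that \<open>x \<mapsto> \<psi>(x) - x \<psi>(1)\<close> obeys the Leibniz rule on \<open>B\<close>. On \<open>A\<close> it is a vector field \<open>\<sigma>\<close>,
  on \<open>P\<close> it is a Der-operator with the symbol \<open>\<sigma>\<close>. Commutators with functions commute, and
  \<open>ad (f g) = f ad g + g ad f + ad f ad g\<close>, where the last term contributes nothing to the symbol. Hence
  the Der-operator is a symmetric multiderivation of the \<open>j\<close> functions, and \<open>\<sigma>\<close>, being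
  a \<open>k\<close>-fold commutator, is symmetric in all of its arguments (\<open>sym_der_symb\<close>).

  \<^bold>\<open>The kernel.\<close> If the Der-operators vanish, then \<open>\<sigma>(f\<^sub>1, \<dots>, f\<^sub>k) p = 0\<close> for all sections \<open>p\<close>. The rank is
  positive, so \<open>P\<close> is faithful and \<open>\<sigma> = 0\<close>. Thus all \<open>j\<close>-fold commutators of \<open>\<phi>\<close> are multiplications and
  the order of \<open>\<phi>\<close> is at most \<open>k - 1\<close> (\<open>symb_kernel\<close>).

  \<^bold>\<open>Surjectivity.\<close> Let \<open>T\<close> consist of a multiderivation \<open>\<Delta>\<close> and its symbol \<open>\<sigma>\<close>. Suppose that there
  are functions \<open>y\<^sub>l\<close> and Der-operators \<open>Y\<^sub>l\<close> such that \<open>v = \<Sum>\<^sub>l v(y\<^sub>l) Y\<^sub>l\<close> for all vector fields \<open>v\<close>, as it is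
  the case for coordinates and the coordinate derivatives in a trivialisation. By induction \<open>T(y\<^sub>l, \<cdot>)\<close> is the
  symbol of an operator \<open>\<phi>\<^sub>l\<close>. By the Leibniz rule the symbol of \<open>\<Sum>\<^sub>l Y\<^sub>l \<circ> \<phi>\<^sub>l\<close> is \<open>j T + \<nabla>T\<close>, where
  \<open>\<nabla>T = \<Sum>\<^sub>l \<sigma>(\<cdot>, y\<^sub>l) Y\<^sub>l\<close>. The same construction for \<open>\<nabla>T\<close> has the symbol \<open>(j + 1) \<nabla>T\<close>, because
  \<open>\<nabla>\<nabla>T = \<nabla>T\<close>, and a linear combination of the two operators has the symbol \<open>T\<close>. In order to work with
  globally defined functions only, the equation for \<open>v\<close> is weakened by a factor \<open>w\<close> that is positive
  near a given point, which leads to the symbol \<open>w\<^bsup>2j\<^esup> T\<close> (\<open>local_surjectivity\<close>). A partition of unity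
  then yields an operator with the symbol \<open>T\<close> (\<open>symbols_surjective\<close>).

  The theorem follows from the isomorphism theorem for modules (\<open>diolic_symbols_iso\<close>).
  The facts on manifolds that enter are Hadamard's lemma, by which a derivation at a point is determined
  by its values on coordinates, the existence of bump functions, and the Lindelof property.
\<close>

section \<open>The diolic algebra as a commutative ring\<close>

text \<open>
  The real vector space structure of \<open>A\<close> enters through the elements \<open>r \<cdot> 1\<close>. The assumptions say
  that \<open>r \<mapsto> r \<cdot> 1\<close> is a ring homomorphism which determines the scalar multiplication.
\<close>

locale diolic_module = module A P for A :: "(real, 'f) module" and P :: "('f, 'p) module" +
  fixes B :: "(real, 'f \<times> 'p) module" (structure)
  assumes B_def: "B = diolic A P"
    and scalar_closed: "r \<odot>\<^bsub>A\<^esub> \<one>\<^bsub>A\<^esub> \<in> carrier A"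
    and scalar_smult: "a \<in> carrier A \<Longrightarrow> r \<odot>\<^bsub>A\<^esub> a = (r \<odot>\<^bsub>A\<^esub> \<one>\<^bsub>A\<^esub>) \<otimes>\<^bsub>A\<^esub> a"
    and scalar_add: "(r + s) \<odot>\<^bsub>A\<^esub> \<one>\<^bsub>A\<^esub> = (r \<odot>\<^bsub>A\<^esub> \<one>\<^bsub>A\<^esub>) \<oplus>\<^bsub>A\<^esub> (s \<odot>\<^bsub>A\<^esub> \<one>\<^bsub>A\<^esub>)"
    and scalar_mult: "(r * s) \<odot>\<^bsub>A\<^esub> \<one>\<^bsub>A\<^esub> = (r \<odot>\<^bsub>A\<^esub> \<one>\<^bsub>A\<^esub>) \<otimes>\<^bsub>A\<^esub> (s \<odot>\<^bsub>A\<^esub> \<one>\<^bsub>A\<^esub>)"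
    and scalar_one: "1 \<odot>\<^bsub>A\<^esub> \<one>\<^bsub>A\<^esub> = \<one>\<^bsub>A\<^esub>"
begin

abbreviation C where "C \<equiv> diolic_component A P"

definition emb0 :: "'f \<Rightarrow> 'f \<times> 'p" where "emb0 a = (a, \<zero>\<^bsub>P\<^esub>)"
definition emb1 :: "'p \<Rightarrow> 'f \<times> 'p" where "emb1 p = (\<zero>\<^bsub>A\<^esub>, p)"
definition scalar :: "real \<Rightarrow> 'f \<times> 'p" where "scalar r = emb0 (r \<odot>\<^bsub>A\<^esub> \<one>\<^bsub>A\<^esub>)"

lemma carrier_B: "carrier B = carrier A \<times> carrier P"
  by (simp add: B_def diolic_def)

lemma B_simps:
  "(a, p) \<oplus> (b, q) = (a \<oplus>\<^bsub>A\<^esub> b, p \<oplus>\<^bsub>P\<^esub> q)"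
  "(a, p) \<otimes> (b, q) = (a \<otimes>\<^bsub>A\<^esub> b, (a \<odot>\<^bsub>P\<^esub> q) \<oplus>\<^bsub>P\<^esub> (b \<odot>\<^bsub>P\<^esub> p))"
  "\<one> = (\<one>\<^bsub>A\<^esub>, \<zero>\<^bsub>P\<^esub>)" "\<zero> = (\<zero>\<^bsub>A\<^esub>, \<zero>\<^bsub>P\<^esub>)"
  by (simp_all add: B_def diolic_def)

lemma abelian_group_B: "abelian_group B"
proof (rule abelian_groupI)
  show "\<exists>y\<in>carrier B. y \<oplus> x = \<zero>" if "x \<in> carrier B" for x
  proof (cases x)
    case (Pair a p)
    then show ?thesis using that
      by (intro bexI[of _ "(\<ominus>\<^bsub>A\<^esub> a, \<ominus>\<^bsub>P\<^esub> p)"]) (auto simp: carrier_B B_simps R.l_neg M.l_neg)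
  qed
qed (auto simp: carrier_B B_simps R.a_ac M.a_ac)

lemma smult_lcomm:
  assumes "a \<in> carrier A" "b \<in> carrier A" "x \<in> carrier P"
  shows "a \<odot>\<^bsub>P\<^esub> (b \<odot>\<^bsub>P\<^esub> x) = b \<odot>\<^bsub>P\<^esub> (a \<odot>\<^bsub>P\<^esub> x)"
  using assms by (metis R.m_comm smult_assoc1)

lemma comm_monoid_B: "comm_monoid B"
  by (rule comm_monoidI)
    (auto simp: carrier_B B_simps R.m_ac M.a_ac smult_assoc1 smult_r_distr smult_lcomm)

lemma cring_B: "cring B"
  by (rule cringI[OF abelian_group_B comm_monoid_B])
    (auto simp: carrier_B B_simps R.l_distr M.a_ac smult_l_distr smult_r_distr)

sublocale B: cring B by (rule cring_B)

lemma emb_closed [simp, intro]: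
  "a \<in> carrier A \<Longrightarrow> emb0 a \<in> carrier B" "p \<in> carrier P \<Longrightarrow> emb1 p \<in> carrier B" "scalar r \<in> carrier B"
  by (auto simp: emb0_def emb1_def scalar_def carrier_B scalar_closed)

lemma fst_snd_closed [simp, intro]:
  "x \<in> carrier B \<Longrightarrow> fst x \<in> carrier A" "x \<in> carrier B \<Longrightarrow> snd x \<in> carrier P"
  by (auto simp: carrier_B)

lemma fst_snd_emb [simp]:
  "fst (emb0 a) = a" "snd (emb0 a) = \<zero>\<^bsub>P\<^esub>" "fst (emb1 p) = \<zero>\<^bsub>A\<^esub>" "snd (emb1 p) = p"
  by (auto simp: emb0_def emb1_def)

lemma fst_snd_ops [simp]:
  "fst (x \<oplus> y) = fst x \<oplus>\<^bsub>A\<^esub> fst y" "snd (x \<oplus> y) = snd x \<oplus>\<^bsub>P\<^esub> snd y"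
  "fst (x \<otimes> y) = fst x \<otimes>\<^bsub>A\<^esub> fst y"
  "snd (x \<otimes> y) = (fst x \<odot>\<^bsub>P\<^esub> snd y) \<oplus>\<^bsub>P\<^esub> (fst y \<odot>\<^bsub>P\<^esub> snd x)"
  "fst \<zero> = \<zero>\<^bsub>A\<^esub>" "snd \<zero> = \<zero>\<^bsub>P\<^esub>" "fst \<one> = \<one>\<^bsub>A\<^esub>" "snd \<one> = \<zero>\<^bsub>P\<^esub>"
  by (cases x; cases y; simp add: B_simps)+

lemma B_eqI: "fst x = fst y \<Longrightarrow> snd x = snd y \<Longrightarrow> x = y" for x y :: "'f \<times> 'p"
  by (rule prod_eqI)

lemma B_minus: "x \<in> carrier B \<Longrightarrow> \<ominus> x = (\<ominus>\<^bsub>A\<^esub> fst x, \<ominus>\<^bsub>P\<^esub> snd x)"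
  by (rule B.minus_equality) (auto simp: carrier_B B_simps R.l_neg M.l_neg)

lemma fst_snd_minus [simp]:
  "x \<in> carrier B \<Longrightarrow> fst (\<ominus> x) = \<ominus>\<^bsub>A\<^esub> fst x" "x \<in> carrier B \<Longrightarrow> snd (\<ominus> x) = \<ominus>\<^bsub>P\<^esub> snd x"
  by (simp_all add: B_minus)

lemma B_decomp: "x \<in> carrier B \<Longrightarrow> x = emb0 (fst x) \<oplus> emb1 (snd x)"
  by (rule B_eqI) auto

lemma emb0_add: "a \<in> carrier A \<Longrightarrow> b \<in> carrier A \<Longrightarrow> emb0 (a \<oplus>\<^bsub>A\<^esub> b) = emb0 a \<oplus> emb0 b"
  and emb0_mult: "a \<in> carrier A \<Longrightarrow> b \<in> carrier A \<Longrightarrow> emb0 (a \<otimes>\<^bsub>A\<^esub> b) = emb0 a \<otimes> emb0 b"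
  and emb1_add: "p \<in> carrier P \<Longrightarrow> q \<in> carrier P \<Longrightarrow> emb1 (p \<oplus>\<^bsub>P\<^esub> q) = emb1 p \<oplus> emb1 q"
  and emb0_emb1: "a \<in> carrier A \<Longrightarrow> p \<in> carrier P \<Longrightarrow> emb1 (a \<odot>\<^bsub>P\<^esub> p) = emb0 a \<otimes> emb1 p"
  and emb1_emb1: "p \<in> carrier P \<Longrightarrow> q \<in> carrier P \<Longrightarrow> emb1 p \<otimes> emb1 q = \<zero>"
  by (auto simp: emb0_def emb1_def B_simps)

lemmas emb_hom = emb0_add emb0_mult emb1_add emb0_emb1

lemma emb_one: "emb0 \<one>\<^bsub>A\<^esub> = \<one>" and emb0_zero: "emb0 \<zero>\<^bsub>A\<^esub> = \<zero>" and emb1_zero: "emb1 \<zero>\<^bsub>P\<^esub> = \<zero>"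
  by (simp_all add: emb0_def emb1_def B_simps)

lemma smult_B:
  assumes "x \<in> carrier B"
  shows "r \<odot>\<^bsub>B\<^esub> x = scalar r \<otimes> x"
proof (cases x)
  case (Pair a p)
  have "r \<odot>\<^bsub>B\<^esub> x = (r \<odot>\<^bsub>A\<^esub> a, (r \<odot>\<^bsub>A\<^esub> \<one>\<^bsub>A\<^esub>) \<odot>\<^bsub>P\<^esub> p)" using Pair by (simp add: B_def diolic_def)
  moreover have "scalar r \<otimes> x = ((r \<odot>\<^bsub>A\<^esub> \<one>\<^bsub>A\<^esub>) \<otimes>\<^bsub>A\<^esub> a, (r \<odot>\<^bsub>A\<^esub> \<one>\<^bsub>A\<^esub>) \<odot>\<^bsub>P\<^esub> p)"
    using assms Pair scalar_closed by (simp add: scalar_def emb0_def B_simps carrier_B)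
  ultimately show ?thesis using scalar_smult[of a r] assms Pair by (simp add: carrier_B)
qed

lemma emb0_smult: "a \<in> carrier A \<Longrightarrow> emb0 (r \<odot>\<^bsub>A\<^esub> a) = scalar r \<otimes> emb0 a"
  using scalar_closed by (auto simp: scalar_def scalar_smult[of a r] emb_hom)

lemma emb1_smult: "p \<in> carrier P \<Longrightarrow> emb1 ((r \<odot>\<^bsub>A\<^esub> \<one>\<^bsub>A\<^esub>) \<odot>\<^bsub>P\<^esub> p) = scalar r \<otimes> emb1 p"
  using scalar_closed by (auto simp: scalar_def emb_hom)

lemma scalar_hom: "scalar (r + s) = scalar r \<oplus> scalar s" "scalar (r * s) = scalar r \<otimes> scalar s" "scalar 1 = \<one>"
  using scalar_closed by (simp_all add: scalar_def scalar_add scalar_mult scalar_one emb_hom emb_one)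

lemma component_0: "x \<in> C 0 \<longleftrightarrow> (\<exists>a\<in>carrier A. x = emb0 a)"
  and component_1: "x \<in> C 1 \<longleftrightarrow> (\<exists>p\<in>carrier P. x = emb1 p)"
  and component_other: "d \<noteq> 0 \<Longrightarrow> d \<noteq> 1 \<Longrightarrow> x \<in> C d \<longleftrightarrow> x = \<zero>"
  by (auto simp: diolic_component_def emb0_def emb1_def B_simps)

section \<open>Operators of degree zero and their commutators\<close>

definition hom0 where "hom0 = graded_hom B C 0"

lemma hom0_add: "\<phi> \<in> hom0 \<Longrightarrow> x \<in> carrier B \<Longrightarrow> y \<in> carrier B \<Longrightarrow> \<phi> (x \<oplus> y) = \<phi> x \<oplus> \<phi> y"
  and hom0_closed [simp, intro]: "\<phi> \<in> hom0 \<Longrightarrow> x \<in> carrier B \<Longrightarrow> \<phi> x \<in> carrier B"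
  and hom0_ext: "\<phi> \<in> hom0 \<Longrightarrow> \<phi> \<in> extensional (carrier B)"
  by (auto simp: hom0_def graded_hom_def PiE_def)

lemma hom0_scalar: "\<phi> \<in> hom0 \<Longrightarrow> x \<in> carrier B \<Longrightarrow> \<phi> (scalar r \<otimes> x) = scalar r \<otimes> \<phi> x"
proof -
  assume "\<phi> \<in> hom0" "x \<in> carrier B"
  then have "\<phi> (r \<odot>\<^bsub>B\<^esub> x) = r \<odot>\<^bsub>B\<^esub> \<phi> x" by (auto simp: hom0_def graded_hom_def)
  then show ?thesis using smult_B \<open>\<phi> \<in> hom0\<close> \<open>x \<in> carrier B\<close> by simp
qed

lemma hom0_emb0: "\<phi> \<in> hom0 \<Longrightarrow> a \<in> carrier A \<Longrightarrow> snd (\<phi> (emb0 a)) = \<zero>\<^bsub>P\<^esub>"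
proof -
  assume "\<phi> \<in> hom0" "a \<in> carrier A"
  then have "\<phi> (emb0 a) \<in> C (0 + 0)" unfolding hom0_def graded_hom_def component_0[symmetric]
    using component_0 by blast
  then show ?thesis using component_0 by auto
qed

lemma hom0_emb1: "\<phi> \<in> hom0 \<Longrightarrow> p \<in> carrier P \<Longrightarrow> fst (\<phi> (emb1 p)) = \<zero>\<^bsub>A\<^esub>"
proof -
  assume "\<phi> \<in> hom0" "p \<in> carrier P"
  then have "\<phi> (emb1 p) \<in> C (1 + 0)" unfolding hom0_def graded_hom_def
    using component_1 by blast
  then show ?thesis using component_1 by auto
qed

lemma hom0_zero: "\<phi> \<in> hom0 \<Longrightarrow> \<phi> \<zero> = \<zero>"
  using hom0_add[of \<phi> \<zero> \<zero>] by (metis B.add.r_cancel_one' B.l_zero B.zero_closed hom0_closed)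

lemma hom0_minus: "\<phi> \<in> hom0 \<Longrightarrow> x \<in> carrier B \<Longrightarrow> \<phi> (\<ominus> x) = \<ominus> \<phi> x"
  using hom0_add[of \<phi> "\<ominus> x" x] hom0_zero[of \<phi>]
  by (metis B.a_inv_closed B.l_neg B.minus_equality hom0_closed)

text \<open>
  In degrees other than zero and one the diolic algebra vanishes, so compatibility with the grading
  amounts to the last two conditions.
\<close>

lemma hom0I:
  assumes "\<phi> \<in> extensional (carrier B)" "\<And>x. x \<in> carrier B \<Longrightarrow> \<phi> x \<in> carrier B"
    and add: "\<And>x y. x \<in> carrier B \<Longrightarrow> y \<in> carrier B \<Longrightarrow> \<phi> (x \<oplus> y) = \<phi> x \<oplus> \<phi> y"
    and scal: "\<And>r x. x \<in> carrier B \<Longrightarrow> \<phi> (scalar r \<otimes> x) = scalar r \<otimes> \<phi> x"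
    and c0: "\<And>a. a \<in> carrier A \<Longrightarrow> snd (\<phi> (emb0 a)) = \<zero>\<^bsub>P\<^esub>"
    and c1: "\<And>p. p \<in> carrier P \<Longrightarrow> fst (\<phi> (emb1 p)) = \<zero>\<^bsub>A\<^esub>"
  shows "\<phi> \<in> hom0"
proof -
  have z: "\<phi> \<zero> = \<zero>"
    using add[of \<zero> \<zero>] assms(2) by (metis B.add.r_cancel_one' B.l_zero B.zero_closed)
  have "\<phi> ` C i \<subseteq> C (i + 0)" for i
  proof (rule image_subsetI)
    fix x assume x: "x \<in> C i"
    consider "i = 0" | "i = 1" | "i \<noteq> 0" "i \<noteq> 1" by blast
    then show "\<phi> x \<in> C (i + 0)"
    proof cases
      case 1
      then obtain a where a: "a \<in> carrier A" "x = emb0 a" using x component_0 by auto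
      then have "\<phi> x = emb0 (fst (\<phi> x))" using c0 by (auto intro!: B_eqI)
      then show ?thesis using 1 a assms(2) component_0 by (metis add_0 emb_closed(1) fst_snd_closed(1))
    next
      case 2
      then obtain p where p: "p \<in> carrier P" "x = emb1 p" using x component_1 by auto
      then have "\<phi> x = emb1 (snd (\<phi> x))" using c1 by (auto intro!: B_eqI)
      then show ?thesis using 2 p assms(2) component_1 by (metis add_0_right emb_closed(2) fst_snd_closed(2))
    next
      case 3
      then show ?thesis using x z component_other by auto
    qed
  qed
  moreover have "\<phi> (r \<odot>\<^bsub>B\<^esub> x) = r \<odot>\<^bsub>B\<^esub> \<phi> x" if "x \<in> carrier B" for r x
    using smult_B scal assms(2) that by simp
  moreover have "\<phi> \<in> carrier B \<rightarrow>\<^sub>E carrier B" using assms(1,2) by (simp add: PiE_iff)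
  ultimately show ?thesis using add unfolding hom0_def graded_hom_def by blast
qed

definition ad where "ad f \<phi> = (\<lambda>x\<in>carrier B. \<phi> (emb0 f \<otimes> x) \<ominus> emb0 f \<otimes> \<phi> x)"

fun ads where
  "ads [] \<phi> = \<phi>"
| "ads (f # fs) \<phi> = ads fs (ad f \<phi>)"

lemma ad_apply: "x \<in> carrier B \<Longrightarrow> ad f \<phi> x = \<phi> (emb0 f \<otimes> x) \<ominus> emb0 f \<otimes> \<phi> x"
  by (simp add: ad_def)

lemma ad_hom0 [simp, intro]:
  assumes "\<phi> \<in> hom0" "f \<in> carrier A"
  shows "ad f \<phi> \<in> hom0"
proof (rule hom0I)
  show "ad f \<phi> \<in> extensional (carrier B)" by (simp add: ad_def)
  show "ad f \<phi> x \<in> carrier B" if "x \<in> carrier B" for x using assms that by (simp add: ad_apply)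
  fix x assume x: "x \<in> carrier B"
  show "ad f \<phi> (x \<oplus> y) = ad f \<phi> x \<oplus> ad f \<phi> y" if "y \<in> carrier B" for y
    using assms x that by (simp add: ad_apply B.r_distr hom0_add) (simp add: B.cring_simprules)
  have "emb0 f \<otimes> (scalar r \<otimes> x) = scalar r \<otimes> (emb0 f \<otimes> x)" for r
    using assms x by (simp add: B.m_lcomm)
  then show "ad f \<phi> (scalar r \<otimes> x) = scalar r \<otimes> ad f \<phi> x" for r
    using assms x by (simp add: ad_apply hom0_scalar) (simp add: B.cring_simprules)
next
  fix a assume "a \<in> carrier A"
  then show "snd (ad f \<phi> (emb0 a)) = \<zero>\<^bsub>P\<^esub>"
    using assms hom0_emb0[of \<phi> "f \<otimes>\<^bsub>A\<^esub> a"] hom0_emb0[of \<phi> a]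
    by (simp add: ad_apply emb_hom[symmetric] B.minus_eq)
next
  fix p assume "p \<in> carrier P"
  then show "fst (ad f \<phi> (emb1 p)) = \<zero>\<^bsub>A\<^esub>"
    using assms hom0_emb1[of \<phi> "f \<odot>\<^bsub>P\<^esub> p"] hom0_emb1[of \<phi> p]
    by (simp add: ad_apply emb_hom[symmetric] B.minus_eq)
qed

lemma ads_hom0 [simp, intro]: "\<phi> \<in> hom0 \<Longrightarrow> set fs \<subseteq> carrier A \<Longrightarrow> ads fs \<phi> \<in> hom0"
  by (induction fs arbitrary: \<phi>) auto

lemma ad_commute:
  assumes "\<phi> \<in> hom0" "f \<in> carrier A" "g \<in> carrier A"
  shows "ad f (ad g \<phi>) = ad g (ad f \<phi>)"
proof
  fix x
  show "ad f (ad g \<phi>) x = ad g (ad f \<phi>) x"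
  proof (cases "x \<in> carrier B")
    case True
    have "emb0 g \<otimes> (emb0 f \<otimes> x) = emb0 f \<otimes> (emb0 g \<otimes> x)"
      using assms True by (simp add: B.m_lcomm)
    then show ?thesis using assms True by (simp add: ad_apply) (simp add: B.cring_simprules)
  qed (simp add: ad_def)
qed

lemma ads_append: "ads (fs @ gs) \<phi> = ads gs (ads fs \<phi>)"
  by (induction fs arbitrary: \<phi>) auto

lemma ads_ad:
  assumes "\<phi> \<in> hom0" "f \<in> carrier A" "set fs \<subseteq> carrier A"
  shows "ads fs (ad f \<phi>) = ad f (ads fs \<phi>)"
  using assms
proof (induction fs arbitrary: \<phi>)
  case (Cons g fs)
  then have "ads (g # fs) (ad f \<phi>) = ads fs (ad f (ad g \<phi>))" by (simp add: ad_commute[of \<phi> f g])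
  also have "\<dots> = ad f (ads fs (ad g \<phi>))" using Cons by simp
  finally show ?case by simp
qed simp

lemma ads_perm:
  assumes "\<phi> \<in> hom0" "mset fs = mset gs" "set fs \<subseteq> carrier A"
  shows "ads fs \<phi> = ads gs \<phi>"
  using assms
proof (induction fs arbitrary: gs \<phi>)
  case (Cons f fs)
  then have "f \<in> set gs" by (metis list.set_intros(1) set_mset_mset)
  then obtain us vs where gs: "gs = us @ f # vs" by (metis split_list)
  have sub: "set gs \<subseteq> carrier A" using Cons.prems by (metis set_mset_mset)
  have "mset fs = mset (us @ vs)" using Cons.prems gs by simp
  then have "ads (f # fs) \<phi> = ads (us @ vs) (ad f \<phi>)" using Cons by simp
  also have "\<dots> = ads gs \<phi>" using Cons.prems sub by (simp add: gs ads_append ads_ad)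
  finally show ?case .
qed simp

section \<open>Graded differential operators of degree zero\<close>

definition opadd where "opadd \<phi> \<psi> = (\<lambda>x\<in>carrier B. \<phi> x \<oplus> \<psi> x)"
definition opsmult where "opsmult a \<phi> = (\<lambda>x\<in>carrier B. emb0 a \<otimes> \<phi> x)"
definition opneg where "opneg \<phi> = (\<lambda>x\<in>carrier B. \<ominus> \<phi> x)"
definition opzero where "opzero = (\<lambda>x\<in>carrier B. \<zero>)"

lemma op_apply [simp]:
  assumes "x \<in> carrier B"
  shows "opadd \<phi> \<psi> x = \<phi> x \<oplus> \<psi> x" "opsmult a \<phi> x = emb0 a \<otimes> \<phi> x" "opneg \<phi> x = \<ominus> \<phi> x" "opzero x = \<zero>"
  using assms by (simp_all add: opadd_def opsmult_def opneg_def opzero_def)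

lemma op_eqI:
  assumes "\<phi> \<in> extensional (carrier B)" "\<psi> \<in> extensional (carrier B)" "\<And>x. x \<in> carrier B \<Longrightarrow> \<phi> x = \<psi> x"
  shows "\<phi> = \<psi>"
  using assms by (rule extensionalityI)

lemma op_ext [simp]: "opadd \<phi> \<psi> \<in> extensional (carrier B)" "opsmult a \<phi> \<in> extensional (carrier B)"
  "opneg \<phi> \<in> extensional (carrier B)" "opzero \<in> extensional (carrier B)" "ad f \<phi> \<in> extensional (carrier B)"
  by (simp_all add: opadd_def opsmult_def opneg_def opzero_def ad_def)

lemma opzero_hom0 [simp]: "opzero \<in> hom0"
  by (rule hom0I) auto

lemma opadd_hom0 [simp]: assumes "\<phi> \<in> hom0" "\<psi> \<in> hom0" shows "opadd \<phi> \<psi> \<in> hom0"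
proof (rule hom0I)
  show "opadd \<phi> \<psi> (x \<oplus> y) = opadd \<phi> \<psi> x \<oplus> opadd \<phi> \<psi> y" if "x \<in> carrier B" "y \<in> carrier B" for x y
    using assms that by (simp add: hom0_add) (simp add: B.cring_simprules)
  show "opadd \<phi> \<psi> (scalar r \<otimes> x) = scalar r \<otimes> opadd \<phi> \<psi> x" if "x \<in> carrier B" for r x
    using assms that by (simp add: hom0_scalar B.r_distr)
qed (use assms in \<open>auto simp: hom0_emb0 hom0_emb1\<close>)

lemma opsmult_hom0 [simp]: assumes "a \<in> carrier A" "\<phi> \<in> hom0" shows "opsmult a \<phi> \<in> hom0"
proof (rule hom0I)
  show "opsmult a \<phi> (x \<oplus> y) = opsmult a \<phi> x \<oplus> opsmult a \<phi> y" if "x \<in> carrier B" "y \<in> carrier B" for x y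
    using assms that by (simp add: hom0_add B.r_distr)
  show "opsmult a \<phi> (scalar r \<otimes> x) = scalar r \<otimes> opsmult a \<phi> x" if "x \<in> carrier B" for r x
    using assms that by (simp add: hom0_scalar B.m_lcomm)
qed (use assms in \<open>auto simp: hom0_emb0 hom0_emb1\<close>)

lemma opneg_hom0 [simp]: assumes "\<phi> \<in> hom0" shows "opneg \<phi> \<in> hom0"
proof (rule hom0I)
  show "opneg \<phi> (x \<oplus> y) = opneg \<phi> x \<oplus> opneg \<phi> y" if "x \<in> carrier B" "y \<in> carrier B" for x y
    using assms that by (simp add: hom0_add B.minus_add)
  show "opneg \<phi> (scalar r \<otimes> x) = scalar r \<otimes> opneg \<phi> x" if "x \<in> carrier B" for r x
    using assms that by (simp add: hom0_scalar B.r_minus)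
qed (use assms in \<open>auto simp: hom0_emb0 hom0_emb1\<close>)

lemma ad_opadd:
  assumes "\<phi> \<in> hom0" "\<psi> \<in> hom0" "f \<in> carrier A"
  shows "ad f (opadd \<phi> \<psi>) = opadd (ad f \<phi>) (ad f \<psi>)"
  by (rule op_eqI) (use assms in \<open>auto simp: ad_apply B.cring_simprules\<close>)

lemma ad_opsmult:
  assumes "\<phi> \<in> hom0" "a \<in> carrier A" "f \<in> carrier A"
  shows "ad f (opsmult a \<phi>) = opsmult a (ad f \<phi>)"
  by (rule op_eqI) (use assms in \<open>auto simp: ad_apply B.cring_simprules\<close>)

lemma ad_opneg:
  assumes "\<phi> \<in> hom0" "f \<in> carrier A"
  shows "ad f (opneg \<phi>) = opneg (ad f \<phi>)"
  by (rule op_eqI) (use assms in \<open>auto simp: ad_apply B.cring_simprules\<close>)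

lemma ads_opadd:
  "\<phi> \<in> hom0 \<Longrightarrow> \<psi> \<in> hom0 \<Longrightarrow> set fs \<subseteq> carrier A \<Longrightarrow> ads fs (opadd \<phi> \<psi>) = opadd (ads fs \<phi>) (ads fs \<psi>)"
  by (induction fs arbitrary: \<phi> \<psi>) (auto simp: ad_opadd)

lemma ads_opsmult:
  "\<phi> \<in> hom0 \<Longrightarrow> a \<in> carrier A \<Longrightarrow> set fs \<subseteq> carrier A \<Longrightarrow> ads fs (opsmult a \<phi>) = opsmult a (ads fs \<phi>)"
  by (induction fs arbitrary: \<phi>) (auto simp: ad_opsmult)

lemma ads_opneg:
  "\<phi> \<in> hom0 \<Longrightarrow> set fs \<subseteq> carrier A \<Longrightarrow> ads fs (opneg \<phi>) = opneg (ads fs \<phi>)"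
  by (induction fs arbitrary: \<phi>) (auto simp: ad_opneg)

lemma ad_add:
  assumes "\<phi> \<in> hom0" "f \<in> carrier A" "g \<in> carrier A"
  shows "ad (f \<oplus>\<^bsub>A\<^esub> g) \<phi> = opadd (ad f \<phi>) (ad g \<phi>)"
proof (rule op_eqI)
  fix x assume "x \<in> carrier B"
  then show "ad (f \<oplus>\<^bsub>A\<^esub> g) \<phi> x = opadd (ad f \<phi>) (ad g \<phi>) x"
    using assms by (simp add: ad_apply emb0_add B.l_distr hom0_add) (simp add: B.cring_simprules)
qed auto

lemma ad_smult:
  assumes "\<phi> \<in> hom0" "f \<in> carrier A"
  shows "ad (r \<odot>\<^bsub>A\<^esub> f) \<phi> = opsmult (r \<odot>\<^bsub>A\<^esub> \<one>\<^bsub>A\<^esub>) (ad f \<phi>)"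
proof (rule op_eqI)
  fix x assume x: "x \<in> carrier B"
  have "r \<odot>\<^bsub>A\<^esub> f \<in> carrier A" using assms scalar_smult[of f r] scalar_closed by simp
  then show "ad (r \<odot>\<^bsub>A\<^esub> f) \<phi> x = opsmult (r \<odot>\<^bsub>A\<^esub> \<one>\<^bsub>A\<^esub>) (ad f \<phi>) x"
    using assms x by (simp add: ad_apply emb0_smult B.m_assoc hom0_scalar)
      (simp add: emb_one B.cring_simprules)
qed auto

lemma minus_zero_imp_eq:
  assumes "a \<in> carrier B" "b \<in> carrier B" "a \<ominus> b = \<zero>"
  shows "a = b"
proof -
  have "a = (a \<ominus> b) \<oplus> b" using assms(1,2) by (simp add: B.minus_eq B.a_assoc B.l_neg)
  then show ?thesis using assms by simp
qed

lemma telescope: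
  assumes "c \<in> carrier B" "d \<in> carrier B" "u \<in> carrier B" "e \<in> carrier B"
  shows "u \<ominus> e = (c \<oplus> (d \<ominus> e)) \<oplus> ((u \<ominus> d) \<ominus> c)"
proof -
  have "(c \<oplus> (d \<ominus> e)) \<oplus> ((u \<ominus> d) \<ominus> c) = (c \<oplus> \<ominus> c) \<oplus> ((d \<oplus> \<ominus> d) \<oplus> (u \<oplus> \<ominus> e))"
    using assms by (simp add: B.minus_eq B.a_ac)
  then show ?thesis using assms by (simp add: B.r_neg B.minus_eq)
qed

text \<open>
  Commutation is a derivation up to the last term. That term has lower order and vanishes
  in the symbol.
\<close>

lemma ad_mult:
  assumes "\<phi> \<in> hom0" "f \<in> carrier A" "g \<in> carrier A"
  shows "ad (f \<otimes>\<^bsub>A\<^esub> g) \<phi> = opadd (opadd (opsmult f (ad g \<phi>)) (opsmult g (ad f \<phi>))) (ad f (ad g \<phi>))"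
proof (rule op_eqI)
  fix x assume x: "x \<in> carrier B"
  define u v w z where "u = \<phi> (emb0 g \<otimes> (emb0 f \<otimes> x))" and "v = \<phi> (emb0 g \<otimes> x)"
    and "w = \<phi> (emb0 f \<otimes> x)" and "z = \<phi> x"
  define a b where "a = emb0 f" and "b = emb0 g"
  have cl: "u \<in> carrier B" "v \<in> carrier B" "w \<in> carrier B" "z \<in> carrier B" "a \<in> carrier B" "b \<in> carrier B"
    using assms x by (auto simp: u_def v_def w_def z_def a_def b_def)
  have "emb0 f \<otimes> emb0 g \<otimes> x = emb0 g \<otimes> (emb0 f \<otimes> x)"
    using assms x by (simp add: B.m_ac)
  then have "ad (f \<otimes>\<^bsub>A\<^esub> g) \<phi> x = u \<ominus> a \<otimes> b \<otimes> z"
    using assms x by (simp add: ad_apply emb0_mult u_def z_def a_def b_def)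
  also have "\<dots> = (a \<otimes> (v \<ominus> b \<otimes> z) \<oplus> (b \<otimes> w \<ominus> a \<otimes> b \<otimes> z)) \<oplus> ((u \<ominus> b \<otimes> w) \<ominus> a \<otimes> (v \<ominus> b \<otimes> z))"
    using cl by (intro telescope) auto
  also have "b \<otimes> w \<ominus> a \<otimes> b \<otimes> z = b \<otimes> (w \<ominus> a \<otimes> z)"
    using cl by (simp add: B.cring_simprules)
  also have "(a \<otimes> (v \<ominus> b \<otimes> z) \<oplus> b \<otimes> (w \<ominus> a \<otimes> z)) \<oplus> ((u \<ominus> b \<otimes> w) \<ominus> a \<otimes> (v \<ominus> b \<otimes> z))
      = opadd (opadd (opsmult f (ad g \<phi>)) (opsmult g (ad f \<phi>))) (ad f (ad g \<phi>)) x"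
    using assms x by (simp add: ad_apply u_def v_def w_def z_def a_def b_def)
  finally show "ad (f \<otimes>\<^bsub>A\<^esub> g) \<phi> x
      = opadd (opadd (opsmult f (ad g \<phi>)) (opsmult g (ad f \<phi>))) (ad f (ad g \<phi>)) x" .
qed auto

definition is_mult where "is_mult \<psi> \<longleftrightarrow> (\<forall>x\<in>carrier B. \<psi> x = x \<otimes> \<psi> \<one>)"

text \<open>
  One commutator less than in the definition of the order: \<open>\<delta>\<^sub>b \<psi> = 0\<close> for all homogeneous \<open>b\<close> says
  that \<open>\<psi>\<close> is a multiplication.
\<close>

definition order_le where
  "order_le j \<phi> \<longleftrightarrow> \<phi> \<in> hom0 \<and> (\<forall>fs\<in>tuples A j. is_mult (ads fs \<phi>))"

lemma is_mult_opneg: "\<psi> \<in> hom0 \<Longrightarrow> is_mult (opneg \<psi>) \<longleftrightarrow> is_mult \<psi>"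
proof -
  assume \<psi>: "\<psi> \<in> hom0"
  have "\<ominus> \<psi> x = x \<otimes> \<ominus> \<psi> \<one> \<longleftrightarrow> \<psi> x = x \<otimes> \<psi> \<one>" if "x \<in> carrier B" for x
    using \<psi> that by (metis B.minus_minus B.m_closed B.one_closed B.r_minus hom0_closed)
  then show ?thesis by (simp add: is_mult_def)
qed

lemma is_multD: "is_mult \<psi> \<Longrightarrow> x \<in> carrier B \<Longrightarrow> \<psi> x = x \<otimes> \<psi> \<one>"
  unfolding is_mult_def by blast

lemma is_mult_opadd:
  assumes "\<psi> \<in> hom0" "\<psi>' \<in> hom0" "is_mult \<psi>" "is_mult \<psi>'"
  shows "is_mult (opadd \<psi> \<psi>')"
  unfolding is_mult_def[of "opadd \<psi> \<psi>'"]
proof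
  fix x assume x: "x \<in> carrier B"
  show "opadd \<psi> \<psi>' x = x \<otimes> opadd \<psi> \<psi>' \<one>"
    using assms x is_multD[OF assms(3) x] is_multD[OF assms(4) x] by (simp add: B.r_distr)
qed

lemma is_mult_opsmult:
  assumes "\<psi> \<in> hom0" "a \<in> carrier A" "is_mult \<psi>"
  shows "is_mult (opsmult a \<psi>)"
  unfolding is_mult_def[of "opsmult a \<psi>"]
proof
  fix x assume x: "x \<in> carrier B"
  show "opsmult a \<psi> x = x \<otimes> opsmult a \<psi> \<one>"
    using assms x is_multD[OF assms(3) x] by (simp add: B.m_lcomm)
qed

lemma tuples_iff: "fs \<in> tuples A j \<longleftrightarrow> length fs = j \<and> set fs \<subseteq> carrier A"
  by (simp add: tuples_def)

lemma order_leD: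
  assumes "order_le j \<phi>"
  shows "\<phi> \<in> hom0" "fs \<in> tuples A j \<Longrightarrow> x \<in> carrier B \<Longrightarrow> ads fs \<phi> x = x \<otimes> ads fs \<phi> \<one>"
  using assms is_multD unfolding order_le_def by blast+

lemma order_le_closed:
  "order_le j \<phi> \<Longrightarrow> order_le j \<psi> \<Longrightarrow> order_le j (opadd \<phi> \<psi>)"
  "order_le j \<phi> \<Longrightarrow> a \<in> carrier A \<Longrightarrow> order_le j (opsmult a \<phi>)"
  "order_le j \<phi> \<Longrightarrow> order_le j (opneg \<phi>)"
  by (auto simp: order_le_def ads_opadd ads_opsmult ads_opneg tuples_iff is_mult_opadd is_mult_opsmult is_mult_opneg)

lemma ads_opzero: "set fs \<subseteq> carrier A \<Longrightarrow> ads fs opzero = opzero"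
proof (induction fs)
  case (Cons f fs)
  have "ad f opzero = opzero" by (rule op_eqI) (use Cons.prems in \<open>auto simp: ad_apply B.minus_eq\<close>)
  then show ?case using Cons by simp
qed simp

lemma order_le_opzero: "order_le j opzero"
  by (auto simp: order_le_def tuples_iff ads_opzero is_mult_def)

lemma order_le_ad: "order_le (Suc j) \<phi> \<Longrightarrow> f \<in> carrier A \<Longrightarrow> order_le j (ad f \<phi>)"
  unfolding order_le_def
proof (intro conjI ballI)
  fix fs assume *: "\<phi> \<in> hom0 \<and> (\<forall>fs\<in>tuples A (Suc j). is_mult (ads fs \<phi>))" "f \<in> carrier A" "fs \<in> tuples A j"
  then have "f # fs \<in> tuples A (Suc j)" by (simp add: tuples_iff)
  then show "is_mult (ads fs (ad f \<phi>))" using * by (metis ads.simps(2))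
qed auto

lemma is_mult_ad_zero: "\<psi> \<in> hom0 \<Longrightarrow> is_mult \<psi> \<Longrightarrow> f \<in> carrier A \<Longrightarrow> ad f \<psi> = opzero"
proof (rule op_eqI)
  fix x assume *: "\<psi> \<in> hom0" "is_mult \<psi>" "f \<in> carrier A" "x \<in> carrier B"
  then have "\<psi> (emb0 f \<otimes> x) = emb0 f \<otimes> x \<otimes> \<psi> \<one>" "\<psi> x = x \<otimes> \<psi> \<one>"
    unfolding is_mult_def by blast+
  then show "ad f \<psi> x = opzero x" using * by (simp add: ad_apply) (simp add: B.cring_simprules)
qed auto

lemma order_le_Suc: "order_le j \<phi> \<Longrightarrow> order_le (Suc j) \<phi>"
  unfolding order_le_def
proof (intro conjI ballI)
  fix fs assume *: "\<phi> \<in> hom0 \<and> (\<forall>fs\<in>tuples A j. is_mult (ads fs \<phi>))" "fs \<in> tuples A (Suc j)"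
  then obtain gs f where fs: "fs = gs @ [f]" by (cases fs rule: rev_cases) (auto simp: tuples_iff)
  have gs: "gs \<in> tuples A j" "f \<in> carrier A" using fs *(2) by (auto simp: tuples_iff)
  then have "ads fs \<phi> = opzero"
    using * fs by (auto simp: ads_append tuples_iff intro!: is_mult_ad_zero)
  then show "is_mult (ads fs \<phi>)" by (simp add: is_mult_def)
qed auto

lemma graded_delta_0:
  "\<phi> \<in> hom0 \<Longrightarrow> f \<in> carrier A \<Longrightarrow> graded_delta B 0 e (emb0 f) \<phi> = opneg (ad f \<phi>)"
  by (rule op_eqI) (auto simp: graded_delta_def ad_apply B.cring_simprules)

lemma graded_delta_opzero:
  assumes "b \<in> carrier B"
  shows "graded_delta B d e b opzero = opzero"
  by (rule op_eqI) (use assms in \<open>auto simp: graded_delta_def B.minus_eq\<close>)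

lemma component_closed: "b \<in> C e \<Longrightarrow> b \<in> carrier B"
  by (auto simp: diolic_component_def carrier_B split: if_splits)

lemma graded_deltas_opzero:
  "\<forall>(e, b)\<in>set bs. b \<in> C e \<Longrightarrow> graded_deltas B d bs opzero = opzero"
  by (induction bs arbitrary: d) (auto simp: graded_delta_opzero component_closed)

lemma graded_delta_zero:
  assumes "\<And>x. x \<in> carrier B \<Longrightarrow> \<phi> x \<in> carrier B" "\<phi> \<zero> = \<zero>"
  shows "graded_delta B d e \<zero> \<phi> = opzero"
  by (rule op_eqI) (use assms in \<open>auto simp: graded_delta_def B.minus_eq\<close>)

lemma delta_emb1_apply:
  "x \<in> carrier B \<Longrightarrow> graded_delta B 0 e b \<phi> x = b \<otimes> \<phi> x \<ominus> \<phi> (b \<otimes> x)"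
  by (simp add: graded_delta_def)

lemma emb1_mult: "p \<in> carrier P \<Longrightarrow> x \<in> carrier B \<Longrightarrow> emb1 p \<otimes> x = emb1 (fst x \<odot>\<^bsub>P\<^esub> p)"
  by (rule B_eqI) auto

lemma hom0_emb1_eq: "\<phi> \<in> hom0 \<Longrightarrow> p \<in> carrier P \<Longrightarrow> \<phi> (emb1 p) = emb1 (snd (\<phi> (emb1 p)))"
  by (rule B_eqI) (auto simp: hom0_emb1)

lemma hom0_emb0_eq: "\<phi> \<in> hom0 \<Longrightarrow> a \<in> carrier A \<Longrightarrow> \<phi> (emb0 a) = emb0 (fst (\<phi> (emb0 a)))"
  by (rule B_eqI) (auto simp: hom0_emb0)

text \<open>
  The next commutator after \<open>\<delta>\<^sub>p\<close> is trivial if it is taken with another element of degree one, since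
  \<open>P \<cdot> P = 0\<close>. If it is \<open>\<delta>\<^sub>a\<close> for a function \<open>a\<close>, it can be moved before \<open>\<delta>\<^sub>p\<close>, where it lowers the order
  of \<open>\<psi>\<close>. A multiplication commutes with \<open>p\<close>.
\<close>

lemma graded_deltas_delta_emb1:
  assumes "order_le j \<psi>" "length bs = j" "\<forall>(e, b)\<in>set bs. b \<in> C e" "p \<in> carrier P"
  shows "graded_deltas B 1 bs (graded_delta B 0 1 (emb1 p) \<psi>) = opzero"
  using assms
proof (induction bs arbitrary: j \<psi>)
  case Nil
  have h: "\<psi> \<in> hom0" using order_leD(1)[OF Nil.prems(1)] .
  have "[] \<in> tuples A j" using Nil.prems by (simp add: tuples_iff)
  then have m: "\<psi> x = x \<otimes> \<psi> \<one>" if "x \<in> carrier B" for x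
    using order_leD(2)[OF Nil.prems(1) _ that, of "[]"] by (simp only: ads.simps)
  have "graded_delta B 0 1 (emb1 p) \<psi> = opzero"
  proof (rule op_eqI)
    fix x assume x: "x \<in> carrier B"
    have "\<psi> (emb1 p \<otimes> x) = emb1 p \<otimes> x \<otimes> \<psi> \<one>" by (rule m) (use x \<open>p \<in> carrier P\<close> in auto)
    moreover have "emb1 p \<otimes> \<psi> x = emb1 p \<otimes> x \<otimes> \<psi> \<one>"
      by (subst m[OF x]) (use x h \<open>p \<in> carrier P\<close> in \<open>auto simp: B.m_assoc\<close>)
    ultimately show "graded_delta B 0 1 (emb1 p) \<psi> x = opzero x"
      using x h \<open>p \<in> carrier P\<close> by (simp add: delta_emb1_apply B.minus_eq B.r_neg)
  qed (auto simp: graded_delta_def)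
  then show ?case by simp
next
  case (Cons eb bs)
  obtain e b where eb: "eb = (e, b)" by (cases eb)
  have b: "b \<in> C e" and bs: "\<forall>(e, b)\<in>set bs. b \<in> C e" using Cons.prems eb by auto
  obtain j' where j: "j = Suc j'" using Cons.prems by (cases j) auto
  have h: "\<psi> \<in> hom0" using Cons.prems order_leD by blast
  note p = \<open>p \<in> carrier P\<close>
  let ?E = "graded_delta B 0 1 (emb1 p) \<psi>"
  have Ecl: "?E x \<in> carrier B" if "x \<in> carrier B" for x using that h p by (simp add: delta_emb1_apply)
  have E0: "?E \<zero> = \<zero>" using h p by (simp add: delta_emb1_apply hom0_zero B.minus_eq)
  consider "b = \<zero>" | a where "e = 0" "a \<in> carrier A" "b = emb0 a" | q where "e = 1" "q \<in> carrier P" "b = emb1 q"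
    using b component_0 component_1 component_other by metis
  then show ?case
  proof cases
    case 1
    then show ?thesis using eb graded_delta_zero[of ?E, OF Ecl E0] graded_deltas_opzero[OF bs] by simp
  next
    case 2
    have "graded_delta B 1 0 (emb0 a) ?E = graded_delta B 0 1 (emb1 p) (opneg (ad a \<psi>))"
    proof (rule op_eqI)
      fix x assume x: "x \<in> carrier B"
      have "emb1 p \<otimes> (emb0 a \<otimes> x) = emb0 a \<otimes> (emb1 p \<otimes> x)" using x 2 p by (simp add: B.m_lcomm)
      then show "graded_delta B 1 0 (emb0 a) ?E x = graded_delta B 0 1 (emb1 p) (opneg (ad a \<psi>)) x"
        using x 2 p h by (simp add: graded_delta_def ad_apply) (simp add: B.cring_simprules)
    qed (auto simp: graded_delta_def)
    moreover have "order_le j' (opneg (ad a \<psi>))"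
      using order_le_closed(3) order_le_ad Cons.prems(1) j 2 by blast
    ultimately show ?thesis using Cons.IH[of j' "opneg (ad a \<psi>)"] Cons.prems eb bs 2 j by simp
  next
    case 3
    have "graded_delta B 1 1 (emb1 q) ?E = opzero"
    proof (rule op_eqI)
      fix x assume x: "x \<in> carrier B"
      have "emb1 q \<otimes> (emb1 p \<otimes> \<psi> x) = \<zero>"
        using x h p 3 by (simp add: emb1_mult[of p] emb1_emb1)
      moreover have "emb1 q \<otimes> \<psi> (emb1 p \<otimes> x) = \<zero>"
      proof -
        have "\<psi> (emb1 p \<otimes> x) = emb1 (snd (\<psi> (emb1 (fst x \<odot>\<^bsub>P\<^esub> p))))"
          using x h p by (metis emb1_mult hom0_emb1_eq fst_snd_closed(1) smult_closed)
        then show ?thesis using x h p 3 by (simp add: emb1_emb1)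
      qed
      moreover have "emb1 p \<otimes> \<psi> (emb1 q \<otimes> x) = \<zero>"
      proof -
        have "\<psi> (emb1 q \<otimes> x) = emb1 (snd (\<psi> (emb1 (fst x \<odot>\<^bsub>P\<^esub> q))))"
          using x h 3 by (metis emb1_mult hom0_emb1_eq fst_snd_closed(1) smult_closed)
        then show ?thesis using x h p 3 by (simp add: emb1_emb1)
      qed
      moreover have "\<psi> (emb1 p \<otimes> (emb1 q \<otimes> x)) = \<zero>"
        using x h p 3 by (simp add: emb1_mult[of q] emb1_emb1 hom0_zero)
      ultimately show "graded_delta B 1 1 (emb1 q) ?E x = opzero x"
        using x h p 3 by (simp add: graded_delta_def B.minus_eq B.r_distr B.r_minus)
    qed (auto simp: graded_delta_def)
    then show ?thesis using eb 3 graded_deltas_opzero[OF bs] by simp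
  qed
qed

lemma graded_deltas_order_le:
  assumes "order_le j \<psi>" "length bs = Suc j" "\<forall>(e, b)\<in>set bs. b \<in> C e"
  shows "graded_deltas B 0 bs \<psi> = opzero"
  using assms
proof (induction j arbitrary: bs \<psi>)
  case 0
  then obtain e b where bs: "bs = [(e, b)]" "b \<in> C e" by (auto simp: length_Suc_conv)
  have h: "\<psi> \<in> hom0" using order_leD(1)[OF "0.prems"(1)] .
  have "[] \<in> tuples A 0" by (simp add: tuples_iff)
  then have m: "\<psi> x = x \<otimes> \<psi> \<one>" if "x \<in> carrier B" for x
    using order_leD(2)[OF "0.prems"(1) _ that, of "[]"] by (simp only: ads.simps)
  have "graded_delta B 0 e b \<psi> = opzero"
  proof (rule op_eqI)
    fix x assume x: "x \<in> carrier B"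
    have b: "b \<in> carrier B" using bs component_closed by blast
    have "\<psi> (b \<otimes> x) = b \<otimes> x \<otimes> \<psi> \<one>" by (rule m) (use x b in auto)
    moreover have "b \<otimes> \<psi> x = b \<otimes> x \<otimes> \<psi> \<one>"
      by (subst m[OF x]) (use x h b in \<open>auto simp: B.m_assoc\<close>)
    ultimately show "graded_delta B 0 e b \<psi> x = opzero x"
      using x h b by (simp add: delta_emb1_apply B.minus_eq B.r_neg)
  qed (auto simp: graded_delta_def)
  then show ?case using bs by simp
next
  case (Suc j)
  then obtain e b bs' where bs: "bs = (e, b) # bs'" by (cases bs) auto
  have b: "b \<in> C e" and bs': "\<forall>(e, b)\<in>set bs'. b \<in> C e" "length bs' = Suc j" using Suc.prems bs by auto
  have h: "\<psi> \<in> hom0" using Suc.prems order_leD by blast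
  consider "b = \<zero>" | a where "e = 0" "a \<in> carrier A" "b = emb0 a" | p where "e = 1" "p \<in> carrier P" "b = emb1 p"
    using b component_0 component_1 component_other by metis
  then show ?case
  proof cases
    case 1
    then show ?thesis using bs graded_delta_zero[of \<psi>, OF hom0_closed[OF h] hom0_zero[OF h]] graded_deltas_opzero[OF bs'(1)] by simp
  next
    case 2
    have "order_le j (opneg (ad a \<psi>))"
      using order_le_closed(3) order_le_ad Suc.prems(1) 2 by blast
    then show ?thesis using bs 2 Suc.IH[OF _ bs'(2,1)] h by (simp add: graded_delta_0)
  next
    case 3
    then show ?thesis using bs graded_deltas_delta_emb1[OF Suc.prems(1) bs'(2,1) 3(2)] by simp
  qed
qed

text \<open>
  The signs come from \<open>\<delta>\<^sub>f = - ad f\<close>.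
\<close>

lemma graded_deltas_emb0:
  assumes "\<phi> \<in> hom0" "set fs \<subseteq> carrier A"
  shows "graded_deltas B 0 (map (\<lambda>f. (0, emb0 f)) fs @ bs) \<phi>
    = graded_deltas B 0 bs (if even (length fs) then ads fs \<phi> else opneg (ads fs \<phi>))"
  using assms
proof (induction fs arbitrary: \<phi>)
  case (Cons f fs)
  have "opneg (opneg (ads fs (ad f \<phi>))) = ads fs (ad f \<phi>)"
    by (rule op_eqI) (use Cons.prems in \<open>auto intro: hom0_ext\<close>)
  then show ?case using Cons by (simp add: graded_delta_0 ads_opneg)
qed simp

text \<open>
  The graded commutators with elements of \<open>P\<close> impose no further conditions up to the last one, which
  together with the commutators with functions says that an operator is a multiplication.
\<close>

theorem graded_diff_iff: "\<phi> \<in> graded_diff B C k 0 \<longleftrightarrow> order_le k \<phi>"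
proof
  assume "order_le k \<phi>"
  then show "\<phi> \<in> graded_diff B C k 0"
    using graded_deltas_order_le[of k \<phi>] by (auto simp: graded_diff_def order_le_def hom0_def opzero_def)
next
  assume \<phi>: "\<phi> \<in> graded_diff B C k 0"
  then have h: "\<phi> \<in> hom0" by (simp add: graded_diff_def hom0_def)
  have "is_mult (ads fs \<phi>)" if fs: "fs \<in> tuples A k" for fs
  proof -
    define \<psi> where "\<psi> = (if even (length fs) then ads fs \<phi> else opneg (ads fs \<phi>))"
    have \<psi>: "\<psi> \<in> hom0" using h fs by (auto simp: \<psi>_def tuples_iff)
    have *: "\<psi> b = b \<otimes> \<psi> \<one>" if "b \<in> C e" for e b
    proof -
      have len: "length (map (\<lambda>f. (0, emb0 f)) fs @ [(e, b)]) = Suc k" using fs by (simp add: tuples_iff)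
      have hom: "\<forall>(e, b)\<in>set (map (\<lambda>f. (0, emb0 f)) fs @ [(e, b)]). b \<in> C e"
        using fs that by (auto simp: tuples_iff component_0)
      have "graded_deltas B 0 (map (\<lambda>f. (0, emb0 f)) fs @ [(e, b)]) \<phi> = opzero"
        using \<phi> len hom unfolding graded_diff_def opzero_def by blast
      then have "graded_delta B 0 e b \<psi> = opzero"
        using graded_deltas_emb0[OF h, of fs "[(e, b)]"] fs by (simp add: \<psi>_def tuples_iff)
      \<comment> \<open>evaluated at the unit, the last commutator compares \<open>\<psi>(b)\<close> with \<open>b \<psi>(1)\<close>\<close>
      then have "graded_delta B 0 e b \<psi> \<one> = \<zero>" by simp
      then have "b \<otimes> \<psi> \<one> \<ominus> \<psi> b = \<zero>"
        using component_closed[OF that] by (simp add: delta_emb1_apply)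
      then have "b \<otimes> \<psi> \<one> = \<psi> b"
        by (rule minus_zero_imp_eq[rotated 2])
          (simp_all only: component_closed[OF that] \<psi> B.m_closed B.one_closed hom0_closed)
      then show ?thesis by (rule sym)
    qed
    have "is_mult \<psi>"
      unfolding is_mult_def
    proof
      fix x assume x: "x \<in> carrier B"
      then have "\<psi> x = \<psi> (emb0 (fst x)) \<oplus> \<psi> (emb1 (snd x))"
        using \<psi> hom0_add[of \<psi> "emb0 (fst x)" "emb1 (snd x)"] B_decomp by auto
      also have "\<dots> = emb0 (fst x) \<otimes> \<psi> \<one> \<oplus> emb1 (snd x) \<otimes> \<psi> \<one>"
      proof -
        have "emb0 (fst x) \<in> C 0" "emb1 (snd x) \<in> C 1" using x component_0 component_1 by blast+
        from *[OF this(1)] *[OF this(2)] show ?thesis by (simp only:)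
      qed
      also have "\<dots> = (emb0 (fst x) \<oplus> emb1 (snd x)) \<otimes> \<psi> \<one>" using x \<psi> by (simp add: B.l_distr)
      also have "\<dots> = x \<otimes> \<psi> \<one>" using B_decomp[OF x] by simp
      finally show "\<psi> x = x \<otimes> \<psi> \<one>" .
    qed
    then show ?thesis using is_mult_opneg h fs by (auto simp: \<psi>_def tuples_iff split: if_splits)
  qed
  then show "order_le k \<phi>" using h by (simp add: order_le_def)
qed

section \<open>The multi-symbol\<close>

text \<open>
  For an operator of order at most one, subtracting the value at the unit removes the part of order zero.
\<close>

definition symb where
  "symb \<phi> fs = (\<lambda>x\<in>carrier B. ads fs \<phi> x \<ominus> x \<otimes> ads fs \<phi> \<one>)"

lemma symb_apply: "x \<in> carrier B \<Longrightarrow> symb \<phi> fs x = ads fs \<phi> x \<ominus> x \<otimes> ads fs \<phi> \<one>"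
  by (simp add: symb_def)

text \<open>
  A graded commutator with \<open>p\<close>, evaluated at the unit, is the negative of the symbol at \<open>p\<close>. The sign in the
  definition of the multi-symbol cancels this and the signs of \<open>\<delta>\<^sub>f = - ad f\<close>.
\<close>

lemma diolic_multisymbol_eq:
  assumes "\<phi> \<in> hom0"
  shows "diolic_multisymbol A P (Suc j) \<phi> = (\<lambda>fs\<in>tuples A j. \<lambda>p\<in>carrier P. snd (symb \<phi> fs (emb1 p)))"
  unfolding diolic_multisymbol_def diff_Suc_1
proof (intro restrict_ext)
  fix fs p assume fs: "fs \<in> tuples A j" and p: "p \<in> carrier P"
  define \<psi> where "\<psi> = (if even (length fs) then ads fs \<phi> else opneg (ads fs \<phi>))"
  have \<psi>: "\<psi> \<in> hom0" using assms fs by (auto simp: \<psi>_def tuples_iff)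
  have "graded_deltas (diolic A P) 0 (map (\<lambda>f. (0, f, \<zero>\<^bsub>P\<^esub>)) fs @ [(1, \<zero>\<^bsub>A\<^esub>, p)]) \<phi> \<one>\<^bsub>diolic A P\<^esub>
      = graded_deltas B 0 (map (\<lambda>f. (0, emb0 f)) fs @ [(1, emb1 p)]) \<phi> \<one>"
    by (simp add: B_def emb0_def emb1_def)
  also have "\<dots> = graded_delta B 0 1 (emb1 p) \<psi> \<one>"
    using graded_deltas_emb0[OF assms, of fs "[(1, emb1 p)]"] fs by (simp add: \<psi>_def tuples_iff)
  also have "\<dots> = emb1 p \<otimes> \<psi> \<one> \<ominus> \<psi> (emb1 p)" using p by (simp add: delta_emb1_apply)
  finally have q: "graded_deltas (diolic A P) 0 (map (\<lambda>f. (0, f, \<zero>\<^bsub>P\<^esub>)) fs @ [(1, \<zero>\<^bsub>A\<^esub>, p)]) \<phi> \<one>\<^bsub>diolic A P\<^esub>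
    = emb1 p \<otimes> \<psi> \<one> \<ominus> \<psi> (emb1 p)" .
  have cl: "ads fs \<phi> \<in> hom0" using assms fs by (auto simp: tuples_iff)
  show "(let q = snd (graded_deltas (diolic A P) 0 (map (\<lambda>f. (0, f, \<zero>\<^bsub>P\<^esub>)) fs @ [(1, \<zero>\<^bsub>A\<^esub>, p)]) \<phi> \<one>\<^bsub>diolic A P\<^esub>)
        in if even (Suc j) then q else \<ominus>\<^bsub>P\<^esub> q) = snd (symb \<phi> fs (emb1 p))"
  proof (cases "even j")
    case True
    then have "\<psi> = ads fs \<phi>" using fs by (simp add: \<psi>_def tuples_iff)
    moreover have "snd (\<ominus> (emb1 p \<otimes> ads fs \<phi> \<one> \<ominus> ads fs \<phi> (emb1 p))) = snd (symb \<phi> fs (emb1 p))"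
      using cl p by (intro arg_cong[of _ _ snd]) (simp add: symb_apply B.cring_simprules)
    ultimately show ?thesis using True cl p unfolding q by (simp add: Let_def)
  next
    case False
    then have "\<psi> = opneg (ads fs \<phi>)" using fs by (simp add: \<psi>_def tuples_iff)
    moreover have "emb1 p \<otimes> \<ominus> ads fs \<phi> \<one> \<ominus> \<ominus> ads fs \<phi> (emb1 p) = symb \<phi> fs (emb1 p)"
      using cl p by (simp add: symb_apply B.cring_simprules)
    ultimately show ?thesis using False cl p unfolding q by (simp add: Let_def)
  qed
qed

end

section \<open>Quotient modules\<close>

text \<open>
  A map that respects the operations and is onto transports the module axioms, so that they
  need not be verified for multiderivations directly.
\<close>

lemma module_surjective_image:
  fixes Q :: "('r, 'x) module" and N :: "('r, 'y) module"
  assumes Q: "Module.module R Q" and im: "h ` carrier Q = carrier N"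
    and add: "\<And>x y. x \<in> carrier Q \<Longrightarrow> y \<in> carrier Q \<Longrightarrow> h (x \<oplus>\<^bsub>Q\<^esub> y) = h x \<oplus>\<^bsub>N\<^esub> h y"
    and smult: "\<And>a x. a \<in> carrier R \<Longrightarrow> x \<in> carrier Q \<Longrightarrow> h (a \<odot>\<^bsub>Q\<^esub> x) = a \<odot>\<^bsub>N\<^esub> h x"
    and zero: "h \<zero>\<^bsub>Q\<^esub> = \<zero>\<^bsub>N\<^esub>"
  shows "Module.module R N"
proof -
  interpret Q: Module.module R Q by (rule Q)
  have pre: "\<exists>x\<in>carrier Q. y = h x" if "y \<in> carrier N" for y using im that by blast
  have hN: "h x \<in> carrier N" if "x \<in> carrier Q" for x using im that by blast
  show ?thesis
  proof (rule moduleI)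
    show "abelian_group N"
    proof (rule abelian_groupI)
      fix x y assume "x \<in> carrier N" "y \<in> carrier N"
      then obtain x' y' where xy: "x' \<in> carrier Q" "x = h x'" "y' \<in> carrier Q" "y = h y'" using pre by blast
      show "x \<oplus>\<^bsub>N\<^esub> y \<in> carrier N" using xy add[symmetric] hN by simp
      show "x \<oplus>\<^bsub>N\<^esub> y = y \<oplus>\<^bsub>N\<^esub> x" using xy add[of x' y'] add[of y' x'] Q.M.a_comm by simp
      fix z assume "z \<in> carrier N"
      then obtain z' where z: "z' \<in> carrier Q" "z = h z'" using pre by blast
      show "x \<oplus>\<^bsub>N\<^esub> y \<oplus>\<^bsub>N\<^esub> z = x \<oplus>\<^bsub>N\<^esub> (y \<oplus>\<^bsub>N\<^esub> z)"
        using xy z by (simp add: add[symmetric] Q.M.a_assoc)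
    next
      show "\<zero>\<^bsub>N\<^esub> \<in> carrier N" using hN[OF Q.M.zero_closed] zero by simp
      fix x assume "x \<in> carrier N"
      then obtain x' where x: "x' \<in> carrier Q" "x = h x'" using pre by blast
      show "\<zero>\<^bsub>N\<^esub> \<oplus>\<^bsub>N\<^esub> x = x" using x add[of "\<zero>\<^bsub>Q\<^esub>" x'] by (simp add: zero)
      have "h (\<ominus>\<^bsub>Q\<^esub> x') \<oplus>\<^bsub>N\<^esub> x = \<zero>\<^bsub>N\<^esub>"
        using x add[of "\<ominus>\<^bsub>Q\<^esub> x'" x'] by (simp add: zero Q.M.l_neg)
      then show "\<exists>y\<in>carrier N. y \<oplus>\<^bsub>N\<^esub> x = \<zero>\<^bsub>N\<^esub>" using x hN by blast
    qed
    show "cring R" by (rule Q.R.is_cring)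
  next
    fix a b x y assume a: "a \<in> carrier R" "b \<in> carrier R" and "x \<in> carrier N" "y \<in> carrier N"
    then obtain x' y' where xy: "x' \<in> carrier Q" "x = h x'" "y' \<in> carrier Q" "y = h y'" using pre by blast
    show "a \<odot>\<^bsub>N\<^esub> (x \<oplus>\<^bsub>N\<^esub> y) = a \<odot>\<^bsub>N\<^esub> x \<oplus>\<^bsub>N\<^esub> a \<odot>\<^bsub>N\<^esub> y"
      using xy a by (simp add: add[symmetric] smult[symmetric] Q.smult_r_distr)
  next
    fix a b x assume a: "a \<in> carrier R" "b \<in> carrier R" and "x \<in> carrier N"
    then obtain x' where x: "x' \<in> carrier Q" "x = h x'" using pre by blast
    show "(a \<oplus>\<^bsub>R\<^esub> b) \<odot>\<^bsub>N\<^esub> x = a \<odot>\<^bsub>N\<^esub> x \<oplus>\<^bsub>N\<^esub> b \<odot>\<^bsub>N\<^esub> x"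
      using x a by (simp add: add[symmetric] smult[symmetric] Q.smult_l_distr)
    show "(a \<otimes>\<^bsub>R\<^esub> b) \<odot>\<^bsub>N\<^esub> x = a \<odot>\<^bsub>N\<^esub> (b \<odot>\<^bsub>N\<^esub> x)"
      using x a by (simp add: smult[symmetric] Q.smult_assoc1)
  next
    fix a x assume a: "a \<in> carrier R" and "x \<in> carrier N"
    then obtain x' where x: "x' \<in> carrier Q" "x = h x'" using pre by blast
    show "a \<odot>\<^bsub>N\<^esub> x \<in> carrier N" using x a hN by (simp add: smult[symmetric])
  next
    fix x assume "x \<in> carrier N"
    then obtain x' where x: "x' \<in> carrier Q" "x = h x'" using pre by blast
    show "\<one>\<^bsub>R\<^esub> \<odot>\<^bsub>N\<^esub> x = x" using x by (simp add: smult[symmetric])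
  qed
qed

lemma quotient_module_iso:
  fixes Q :: "('r, 'x) module" and N :: "('r, 'y) module"
  assumes Q: "Module.module R Q" and im: "h ` carrier Q = carrier N"
    and add: "\<And>x y. x \<in> carrier Q \<Longrightarrow> y \<in> carrier Q \<Longrightarrow> h (x \<oplus>\<^bsub>Q\<^esub> y) = h x \<oplus>\<^bsub>N\<^esub> h y"
    and smult: "\<And>a x. a \<in> carrier R \<Longrightarrow> x \<in> carrier Q \<Longrightarrow> h (a \<odot>\<^bsub>Q\<^esub> x) = a \<odot>\<^bsub>N\<^esub> h x"
    and zero: "h \<zero>\<^bsub>Q\<^esub> = \<zero>\<^bsub>N\<^esub>"
    and K: "K = {x \<in> carrier Q. h x = \<zero>\<^bsub>N\<^esub>}"
  shows "Module.module R (quotient_module Q K)" "Module.module R N"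
    "\<exists>\<Theta>\<in>module_iso R (quotient_module Q K) N. \<forall>x\<in>carrier Q. \<Theta> (K +>\<^bsub>Q\<^esub> x) = h x"
proof -
  interpret Q: Module.module R Q by (rule Q)
  show N: "Module.module R N" by (rule module_surjective_image[OF Q im add smult zero])
  interpret N: Module.module R N by (rule N)
  have hN: "h x \<in> carrier N" if "x \<in> carrier Q" for x using im that by blast
  have neg: "h (\<ominus>\<^bsub>Q\<^esub> x) = \<ominus>\<^bsub>N\<^esub> h x" if "x \<in> carrier Q" for x
    using add[of "\<ominus>\<^bsub>Q\<^esub> x" x] that hN zero by (intro N.M.minus_equality[symmetric]) (auto simp: Q.M.l_neg)
  have "additive_subgroup K Q"
  proof (intro additive_subgroup.intro subgroup.intro)
    show "K \<subseteq> carrier (add_monoid Q)" by (auto simp: K)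
    show "x \<otimes>\<^bsub>add_monoid Q\<^esub> y \<in> K" if "x \<in> K" "y \<in> K" for x y using that add by (auto simp: K)
    show "\<one>\<^bsub>add_monoid Q\<^esub> \<in> K" using zero by (auto simp: K)
    show "inv\<^bsub>add_monoid Q\<^esub> x \<in> K" if "x \<in> K" for x
    proof -
      have "\<ominus>\<^bsub>N\<^esub> \<zero>\<^bsub>N\<^esub> = \<zero>\<^bsub>N\<^esub>" by (rule N.M.minus_equality) auto
      then have "\<ominus>\<^bsub>Q\<^esub> x \<in> K" using that neg[of x] Q.M.a_inv_closed[of x] by (simp add: K)
      then show ?thesis by (simp add: a_inv_def)
    qed
  qed
  then have "abelian_subgroup K Q"
    by (rule abelian_subgroupI3) (rule Q.M.abelian_group_axioms)
  then interpret K: abelian_subgroup K Q .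
  have coset: "K +>\<^bsub>Q\<^esub> x = {y \<in> carrier Q. h y = h x}" if x: "x \<in> carrier Q" for x
  proof
    show "K +>\<^bsub>Q\<^esub> x \<subseteq> {y \<in> carrier Q. h y = h x}"
    proof
      fix y assume "y \<in> K +>\<^bsub>Q\<^esub> x"
      then obtain k where k: "k \<in> K" "y = k \<oplus>\<^bsub>Q\<^esub> x" unfolding a_r_coset_def' by blast
      then have "k \<in> carrier Q" "h k = \<zero>\<^bsub>N\<^esub>" unfolding K by blast+
      then show "y \<in> {y \<in> carrier Q. h y = h x}" using k x add[of k x] hN[OF x] by simp
    qed
    show "{y \<in> carrier Q. h y = h x} \<subseteq> K +>\<^bsub>Q\<^esub> x"
    proof
      fix y assume y: "y \<in> {y \<in> carrier Q. h y = h x}"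
      then have "y \<ominus>\<^bsub>Q\<^esub> x \<in> K"
        unfolding K using x hN[OF x] add[of y "\<ominus>\<^bsub>Q\<^esub> x"] neg[OF x] by (simp add: Q.M.minus_eq N.M.r_neg)
      moreover have "y = (y \<ominus>\<^bsub>Q\<^esub> x) \<oplus>\<^bsub>Q\<^esub> x"
        using x y by (simp add: Q.M.minus_eq Q.M.a_assoc Q.M.l_neg)
      ultimately show "y \<in> K +>\<^bsub>Q\<^esub> x" unfolding a_r_coset_def' by blast
    qed
  qed
  let ?q = "\<lambda>x. K +>\<^bsub>Q\<^esub> x"
  have q_im: "?q ` carrier Q = carrier (quotient_module Q K)"
    unfolding quotient_module_def A_RCOSETS_def' by auto
  have q_add: "?q (x \<oplus>\<^bsub>Q\<^esub> y) = ?q x \<oplus>\<^bsub>quotient_module Q K\<^esub> ?q y" if "x \<in> carrier Q" "y \<in> carrier Q" for x y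
    using that by (simp add: quotient_module_def K.a_rcos_sum)
  have q_smult: "?q (a \<odot>\<^bsub>Q\<^esub> x) = a \<odot>\<^bsub>quotient_module Q K\<^esub> ?q x" if a: "a \<in> carrier R" and x: "x \<in> carrier Q" for a x
  proof -
    have "?q (a \<odot>\<^bsub>Q\<^esub> y) = ?q (a \<odot>\<^bsub>Q\<^esub> x)" if "y \<in> ?q x" for y
      using that a x by (simp add: coset smult)
    moreover have "x \<in> ?q x" using x by (simp add: coset)
    ultimately have "(\<Union>y\<in>?q x. ?q (a \<odot>\<^bsub>Q\<^esub> y)) = ?q (a \<odot>\<^bsub>Q\<^esub> x)" by blast
    then show ?thesis by (simp add: quotient_module_def)
  qed
  have q_zero: "?q \<zero>\<^bsub>Q\<^esub> = \<zero>\<^bsub>quotient_module Q K\<^esub>"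
  proof -
    have "?q \<zero>\<^bsub>Q\<^esub> = {y \<in> carrier Q. h y = h \<zero>\<^bsub>Q\<^esub>}" by (rule coset) simp
    also have "\<dots> = K" unfolding zero by (rule K[symmetric])
    finally show ?thesis by (simp add: quotient_module_def)
  qed
  show M: "Module.module R (quotient_module Q K)"
    by (rule module_surjective_image[OF Q q_im q_add q_smult q_zero])
  define \<Theta> where "\<Theta> S = h (SOME x. x \<in> S)" for S
  have \<Theta>: "\<Theta> (?q x) = h x" if "x \<in> carrier Q" for x
  proof -
    have "x \<in> ?q x" using that by (simp add: coset)
    then have "(SOME y. y \<in> ?q x) \<in> ?q x" by (rule someI)
    then show ?thesis using that by (simp add: \<Theta>_def coset)
  qed
  have "\<Theta> \<in> module_iso R (quotient_module Q K) N"
    unfolding module_iso_def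
  proof (intro CollectI conjI ballI)
    show "bij_betw \<Theta> (carrier (quotient_module Q K)) (carrier N)"
      unfolding bij_betw_def
    proof
      show "inj_on \<Theta> (carrier (quotient_module Q K))"
      proof (rule inj_onI)
        fix S S' assume "S \<in> carrier (quotient_module Q K)" "S' \<in> carrier (quotient_module Q K)"
          and eq: "\<Theta> S = \<Theta> S'"
        then obtain x y where xy: "x \<in> carrier Q" "S = ?q x" "y \<in> carrier Q" "S' = ?q y"
          unfolding q_im[symmetric] by blast
        then have "h x = h y" using eq \<Theta> by (simp only:)
        then show "S = S'" using xy coset by (simp only:)
      qed
      show "\<Theta> ` carrier (quotient_module Q K) = carrier N"
        unfolding q_im[symmetric] im[symmetric] image_image by (rule image_cong) (auto simp: \<Theta>)
    qed
    fix S S' assume "S \<in> carrier (quotient_module Q K)" "S' \<in> carrier (quotient_module Q K)"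
    then obtain x y where "x \<in> carrier Q" "S = ?q x" "y \<in> carrier Q" "S' = ?q y"
      unfolding q_im[symmetric] by blast
    then show "\<Theta> (S \<oplus>\<^bsub>quotient_module Q K\<^esub> S') = \<Theta> S \<oplus>\<^bsub>N\<^esub> \<Theta> S'"
      using \<Theta> add by (simp add: q_add[symmetric])
  next
    fix a S assume a: "a \<in> carrier R" "S \<in> carrier (quotient_module Q K)"
    then obtain x where "x \<in> carrier Q" "S = ?q x" unfolding q_im[symmetric] by blast
    then show "\<Theta> (a \<odot>\<^bsub>quotient_module Q K\<^esub> S) = a \<odot>\<^bsub>N\<^esub> \<Theta> S"
      using \<Theta> smult a by (simp add: q_smult[symmetric])
  qed
  then show "\<exists>\<Theta>\<in>module_iso R (quotient_module Q K) N. \<forall>x\<in>carrier Q. \<Theta> (K +>\<^bsub>Q\<^esub> x) = h x"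
    using \<Theta> by blast
qed

section \<open>Symbols as families of derivations of the diolic algebra\<close>

context diolic_module
begin

text \<open>
  The pairs of a \<open>Der(P)\<close>-valued symmetric \<open>j\<close>-derivation \<open>\<Delta>\<close> and its symmetric symbol \<open>\<sigma>\<close>, encoded as
  \<open>T(f\<^sub>1, \<dots>, f\<^sub>j)(a, p) = (\<sigma>(f\<^sub>1, \<dots>, f\<^sub>j, a), \<Delta>(f\<^sub>1, \<dots>, f\<^sub>j)(p))\<close>. The Der-operator condition becomes the
  Leibniz rule on the diolic algebra. Because of the symmetry it is sufficient
  to require the derivation property in the first argument, and to exchange the first argument with the last one
  of \<open>\<sigma>\<close>.
\<close>

definition sym_der where
  "sym_der j T \<longleftrightarrow>
     (\<forall>fs\<in>tuples A j. T fs \<in> hom0) \<and>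
     (\<forall>fs\<in>tuples A j. \<forall>g\<in>carrier A. \<forall>x\<in>carrier B.
        T fs (emb0 g \<otimes> x) = emb0 g \<otimes> T fs x \<oplus> x \<otimes> T fs (emb0 g)) \<and>
     (\<forall>fs\<in>tuples A j. \<forall>gs\<in>tuples A j. mset fs = mset gs \<longrightarrow> T fs = T gs) \<and>
     (\<forall>gs. Suc (length gs) = j \<and> set gs \<subseteq> carrier A \<longrightarrow>
        (\<forall>f\<in>carrier A. \<forall>g\<in>carrier A. \<forall>x\<in>carrier B.
          T ((f \<oplus>\<^bsub>A\<^esub> g) # gs) x = T (f # gs) x \<oplus> T (g # gs) x \<and>
          T ((f \<otimes>\<^bsub>A\<^esub> g) # gs) x = emb0 f \<otimes> T (g # gs) x \<oplus> emb0 g \<otimes> T (f # gs) x \<and>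
          T (f # gs) (emb0 g) = T (g # gs) (emb0 f)) \<and>
        (\<forall>r. \<forall>f\<in>carrier A. \<forall>x\<in>carrier B. T ((r \<odot>\<^bsub>A\<^esub> f) # gs) x = scalar r \<otimes> T (f # gs) x))"

lemma sym_derD:
  assumes "sym_der j T"
  shows "fs \<in> tuples A j \<Longrightarrow> T fs \<in> hom0"
    "fs \<in> tuples A j \<Longrightarrow> g \<in> carrier A \<Longrightarrow> x \<in> carrier B \<Longrightarrow>
      T fs (emb0 g \<otimes> x) = emb0 g \<otimes> T fs x \<oplus> x \<otimes> T fs (emb0 g)"
    "fs \<in> tuples A j \<Longrightarrow> gs \<in> tuples A j \<Longrightarrow> mset fs = mset gs \<Longrightarrow> T fs = T gs"
  using assms unfolding sym_der_def by blast+

lemma sym_derD_slot: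
  assumes "sym_der (Suc j) T" "gs \<in> tuples A j" "f \<in> carrier A" "x \<in> carrier B"
  shows "g \<in> carrier A \<Longrightarrow> T ((f \<oplus>\<^bsub>A\<^esub> g) # gs) x = T (f # gs) x \<oplus> T (g # gs) x"
    "g \<in> carrier A \<Longrightarrow> T ((f \<otimes>\<^bsub>A\<^esub> g) # gs) x = emb0 f \<otimes> T (g # gs) x \<oplus> emb0 g \<otimes> T (f # gs) x"
    "g \<in> carrier A \<Longrightarrow> T (f # gs) (emb0 g) = T (g # gs) (emb0 f)"
    "T ((r \<odot>\<^bsub>A\<^esub> f) # gs) x = scalar r \<otimes> T (f # gs) x"
  using assms unfolding sym_der_def tuples_iff by (metis nat.inject)+

lemma smult_A_closed [simp]: "f \<in> carrier A \<Longrightarrow> r \<odot>\<^bsub>A\<^esub> f \<in> carrier A"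
  using scalar_smult[of f r] scalar_closed by simp

definition opid where "opid = (\<lambda>x\<in>carrier B. x)"

lemma opid_hom0 [simp]: "opid \<in> hom0"
  by (rule hom0I) (auto simp: opid_def)

lemma symb_eq:
  assumes "\<phi> \<in> hom0" "set fs \<subseteq> carrier A"
  shows "symb \<phi> fs = opadd (ads fs \<phi>) (opneg (opsmult (fst (ads fs \<phi> \<one>)) opid))"
proof (rule op_eqI)
  fix x assume x: "x \<in> carrier B"
  have h: "ads fs \<phi> \<in> hom0" using assms by simp
  have "ads fs \<phi> \<one> = emb0 (fst (ads fs \<phi> \<one>))"
    using hom0_emb0_eq[OF h, of "\<one>\<^bsub>A\<^esub>"] by (simp add: emb_one)
  then show "symb \<phi> fs x = opadd (ads fs \<phi>) (opneg (opsmult (fst (ads fs \<phi> \<one>)) opid)) x"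
    using x h by (simp add: symb_apply opid_def B.minus_eq B.m_comm)
qed (auto simp: symb_def)

lemma symb_hom0 [simp]: "\<phi> \<in> hom0 \<Longrightarrow> set fs \<subseteq> carrier A \<Longrightarrow> symb \<phi> fs \<in> hom0"
  by (simp add: symb_eq)

lemma symb_Cons: "symb \<phi> (f # fs) = symb (ad f \<phi>) fs"
  by (simp add: symb_def)

lemma symb_opadd:
  assumes "\<phi> \<in> hom0" "\<psi> \<in> hom0" "set fs \<subseteq> carrier A" "x \<in> carrier B"
  shows "symb (opadd \<phi> \<psi>) fs x = symb \<phi> fs x \<oplus> symb \<psi> fs x"
  using assms by (simp add: symb_apply ads_opadd) (simp add: B.cring_simprules)

lemma symb_opsmult:
  assumes "\<phi> \<in> hom0" "a \<in> carrier A" "set fs \<subseteq> carrier A" "x \<in> carrier B"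
  shows "symb (opsmult a \<phi>) fs x = emb0 a \<otimes> symb \<phi> fs x"
  using assms by (simp add: symb_apply ads_opsmult) (simp add: B.cring_simprules)

lemma symb_opneg:
  assumes "\<phi> \<in> hom0" "set fs \<subseteq> carrier A" "x \<in> carrier B"
  shows "symb (opneg \<phi>) fs x = \<ominus> symb \<phi> fs x"
  using assms by (simp add: symb_apply ads_opneg) (simp add: B.cring_simprules)

lemma symb_emb0:
  assumes "\<phi> \<in> hom0" "g \<in> carrier A" "set fs \<subseteq> carrier A"
  shows "symb \<phi> fs (emb0 g) = ads (fs @ [g]) \<phi> \<one>"
  using assms by (simp add: symb_apply ads_append ad_apply)

lemma symb_is_mult:
  assumes "\<phi> \<in> hom0" "is_mult (ads fs \<phi>)" "set fs \<subseteq> carrier A" "x \<in> carrier B"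
  shows "symb \<phi> fs x = \<zero>"
  using assms is_multD[OF assms(2,4)] by (simp add: symb_apply B.minus_eq B.r_neg)

text \<open>
  Splits \<open>\<psi>(g x)\<close> into \<open>g \<psi>(x)\<close> and a commutator with \<open>g\<close>, for the \<open>j\<close>-fold commutator \<open>\<psi>\<close>.
\<close>

lemma symb_derivation:
  assumes "order_le (Suc j) \<phi>" "fs \<in> tuples A j" "g \<in> carrier A" "x \<in> carrier B"
  shows "symb \<phi> fs (emb0 g \<otimes> x) = emb0 g \<otimes> symb \<phi> fs x \<oplus> x \<otimes> symb \<phi> fs (emb0 g)"
proof -
  note h = order_leD(1)[OF assms(1)]
  have fs: "set fs \<subseteq> carrier A" using assms by (simp add: tuples_iff)
  define \<psi> where "\<psi> = ads fs \<phi>"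
  have \<psi>: "\<psi> \<in> hom0" using h fs by (simp add: \<psi>_def)
  have "fs @ [g] \<in> tuples A (Suc j)" using assms by (simp add: tuples_iff)
  from order_leD(2)[OF assms(1) this assms(4)]
  \<comment> \<open>the commutator with \<open>g\<close> is a multiplication, namely by the symbol at \<open>g\<close>\<close>
  have "\<psi> (emb0 g \<otimes> x) \<ominus> emb0 g \<otimes> \<psi> x = x \<otimes> symb \<phi> fs (emb0 g)"
    using symb_emb0[OF h assms(3) fs] assms by (simp add: ads_append ad_apply \<psi>_def)
  have "symb \<phi> fs (emb0 g \<otimes> x) = \<psi> (emb0 g \<otimes> x) \<ominus> emb0 g \<otimes> x \<otimes> \<psi> \<one>"
    using assms by (simp add: symb_apply \<psi>_def)
  also have "\<dots> = (\<zero> \<oplus> (emb0 g \<otimes> \<psi> x \<ominus> emb0 g \<otimes> x \<otimes> \<psi> \<one>)) \<oplus> ((\<psi> (emb0 g \<otimes> x) \<ominus> emb0 g \<otimes> \<psi> x) \<ominus> \<zero>)"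
    using assms \<psi> by (intro telescope) auto
  also have "\<dots> = emb0 g \<otimes> symb \<phi> fs x \<oplus> (\<psi> (emb0 g \<otimes> x) \<ominus> emb0 g \<otimes> \<psi> x)"
    using assms \<psi> by (simp add: symb_apply \<psi>_def[symmetric]) (simp add: B.cring_simprules)
  finally show ?thesis using \<open>\<psi> (emb0 g \<otimes> x) \<ominus> emb0 g \<otimes> \<psi> x = x \<otimes> symb \<phi> fs (emb0 g)\<close> by simp
qed

theorem sym_der_symb:
  assumes "order_le (Suc j) \<phi>"
  shows "sym_der j (symb \<phi>)"
proof -
  note h = order_leD(1)[OF assms]
  have perm: "symb \<phi> fs = symb \<phi> gs" if "fs \<in> tuples A j" "gs \<in> tuples A j" "mset fs = mset gs" for fs gs
    using ads_perm[OF h that(3)] that by (simp add: symb_def tuples_iff)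
  have slots: "symb \<phi> ((f \<oplus>\<^bsub>A\<^esub> g) # gs) x = symb \<phi> (f # gs) x \<oplus> symb \<phi> (g # gs) x \<and>
      symb \<phi> ((f \<otimes>\<^bsub>A\<^esub> g) # gs) x = emb0 f \<otimes> symb \<phi> (g # gs) x \<oplus> emb0 g \<otimes> symb \<phi> (f # gs) x \<and>
      symb \<phi> (f # gs) (emb0 g) = symb \<phi> (g # gs) (emb0 f)"
    if gs: "Suc (length gs) = j" "set gs \<subseteq> carrier A" and f: "f \<in> carrier A" "g \<in> carrier A" and x: "x \<in> carrier B"
    for gs f g x
  proof (intro conjI)
    show "symb \<phi> ((f \<oplus>\<^bsub>A\<^esub> g) # gs) x = symb \<phi> (f # gs) x \<oplus> symb \<phi> (g # gs) x"
      using h gs f x by (simp add: symb_Cons ad_add symb_opadd)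
    \<comment> \<open>the quadratic term of \<open>ad (f g)\<close> becomes a multiplication, whose symbol vanishes\<close>
    have "g # f # gs \<in> tuples A (Suc j)" using gs f by (simp add: tuples_iff)
    then have "is_mult (ads gs (ad f (ad g \<phi>)))" using assms unfolding order_le_def by (metis ads.simps(2))
    then have "symb (ad f (ad g \<phi>)) gs x = \<zero>" using h gs f x by (intro symb_is_mult) auto
    then show "symb \<phi> ((f \<otimes>\<^bsub>A\<^esub> g) # gs) x = emb0 f \<otimes> symb \<phi> (g # gs) x \<oplus> emb0 g \<otimes> symb \<phi> (f # gs) x"
      using h gs f x by (simp add: symb_Cons ad_mult symb_opadd symb_opsmult)
    have "ads ((f # gs) @ [g]) \<phi> = ads ((g # gs) @ [f]) \<phi>"
      using h gs f by (intro ads_perm) auto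
    then show "symb \<phi> (f # gs) (emb0 g) = symb \<phi> (g # gs) (emb0 f)"
      using h gs f by (simp only: symb_emb0 list.set insert_subset)
  qed
  have sc: "symb \<phi> ((r \<odot>\<^bsub>A\<^esub> f) # gs) x = scalar r \<otimes> symb \<phi> (f # gs) x"
    if "set gs \<subseteq> carrier A" "f \<in> carrier A" "x \<in> carrier B" for r f gs x
    using h that scalar_closed by (simp add: symb_Cons ad_smult symb_opsmult scalar_def)
  show ?thesis
    unfolding sym_der_def
  proof (intro conjI[of "\<forall>fs\<in>tuples A j. symb \<phi> fs \<in> hom0"] conjI[of "\<forall>fs\<in>tuples A j. _ fs"] ballI)
    show "symb \<phi> fs \<in> hom0" if "fs \<in> tuples A j" for fs using h that by (simp add: tuples_iff)
    show "symb \<phi> fs (emb0 g \<otimes> x) = emb0 g \<otimes> symb \<phi> fs x \<oplus> x \<otimes> symb \<phi> fs (emb0 g)"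
      if "fs \<in> tuples A j" "g \<in> carrier A" "x \<in> carrier B" for fs g x
      by (rule symb_derivation[OF assms that])
    show "mset fs = mset gs \<longrightarrow> symb \<phi> fs = symb \<phi> gs" if "fs \<in> tuples A j" "gs \<in> tuples A j" for fs gs
      using perm[OF that] by (rule impI)
  qed ((intro allI impI conjI ballI; elim conjE),
      (rule slots[THEN conjunct1] slots[THEN conjunct2, THEN conjunct1] slots[THEN conjunct2, THEN conjunct2] sc;
       assumption)+)
qed

text \<open>
  If the symbol vanishes on \<open>P\<close>, then the Leibniz rule for \<open>g p\<close> leaves \<open>\<sigma>(f\<^sub>1, \<dots>, f\<^sub>j, g) p = 0\<close> for all \<open>p\<close>,
  hence \<open>\<sigma> = 0\<close> and the symbol vanishes on \<open>A\<close> as well.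
\<close>

lemma symb_kernel:
  assumes \<phi>: "order_le (Suc j) \<phi>"
    and faithful: "\<And>a. a \<in> carrier A \<Longrightarrow> (\<And>p. p \<in> carrier P \<Longrightarrow> a \<odot>\<^bsub>P\<^esub> p = \<zero>\<^bsub>P\<^esub>) \<Longrightarrow> a = \<zero>\<^bsub>A\<^esub>"
  shows "order_le j \<phi> \<longleftrightarrow> (\<forall>fs\<in>tuples A j. \<forall>p\<in>carrier P. snd (symb \<phi> fs (emb1 p)) = \<zero>\<^bsub>P\<^esub>)"
proof
  assume "order_le j \<phi>"
  then show "\<forall>fs\<in>tuples A j. \<forall>p\<in>carrier P. snd (symb \<phi> fs (emb1 p)) = \<zero>\<^bsub>P\<^esub>"
    by (auto simp: order_le_def symb_is_mult tuples_iff)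
next
  assume 0: "\<forall>fs\<in>tuples A j. \<forall>p\<in>carrier P. snd (symb \<phi> fs (emb1 p)) = \<zero>\<^bsub>P\<^esub>"
  note h = order_leD(1)[OF \<phi>]
  have "is_mult (ads fs \<phi>)" if fs: "fs \<in> tuples A j" for fs
  proof -
    define S where "S = symb \<phi> fs"
    have S: "S \<in> hom0" using h fs by (simp add: S_def tuples_iff)
    have S1: "S (emb1 p) = \<zero>" if "p \<in> carrier P" for p
      using hom0_emb1_eq[OF S that] 0 fs that by (simp add: S_def emb1_zero)
    have S0: "S (emb0 g) = \<zero>" if g: "g \<in> carrier A" for g
    proof -
      have "fst (S (emb0 g)) \<odot>\<^bsub>P\<^esub> p = \<zero>\<^bsub>P\<^esub>" if p: "p \<in> carrier P" for p
      proof -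
        have "S (emb0 g \<otimes> emb1 p) = emb0 g \<otimes> S (emb1 p) \<oplus> emb1 p \<otimes> S (emb0 g)"
          unfolding S_def using symb_derivation[OF \<phi> fs g] p by simp
        moreover have "S (emb0 g \<otimes> emb1 p) = \<zero>" using S1[of "g \<odot>\<^bsub>P\<^esub> p"] g p by (simp add: emb0_emb1)
        ultimately have "emb1 p \<otimes> S (emb0 g) = \<zero>" using S1[OF p] g p S by simp
        then have "snd (emb1 p \<otimes> S (emb0 g)) = \<zero>\<^bsub>P\<^esub>" by simp
        then show ?thesis using p g S hom0_emb0[OF S g] by simp
      qed
      then have "fst (S (emb0 g)) = \<zero>\<^bsub>A\<^esub>" using S g by (intro faithful) auto
      then show ?thesis using hom0_emb0_eq[OF S g] by (simp add: emb0_zero)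
    qed
    have "ads fs \<phi> x = x \<otimes> ads fs \<phi> \<one>" if x: "x \<in> carrier B" for x
    proof -
      have "S x = S (emb0 (fst x)) \<oplus> S (emb1 (snd x))"
        using hom0_add[OF S, of "emb0 (fst x)" "emb1 (snd x)"] x B_decomp[OF x] by auto
      then have "S x = \<zero>" using S0 S1 x by simp
      then have "ads fs \<phi> x \<ominus> x \<otimes> ads fs \<phi> \<one> = \<zero>" unfolding S_def symb_apply[OF x] .
      moreover have "ads fs \<phi> \<in> hom0" using h fs by (simp add: tuples_iff)
      then have "ads fs \<phi> x \<in> carrier B" "x \<otimes> ads fs \<phi> \<one> \<in> carrier B" using x by simp_all
      ultimately show ?thesis using minus_zero_imp_eq by blast
    qed
    then show ?thesis unfolding is_mult_def by blast
  qed
  then show "order_le j \<phi>" using h by (simp add: order_le_def)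
qed

definition Der_part where
  "Der_part j T = (\<lambda>fs\<in>tuples A j. \<lambda>p\<in>carrier P. snd (T fs (emb1 p)))"

lemma self_module_simps [simp]:
  "carrier (self_module A) = carrier A" "add (self_module A) = add A" "smult (self_module A) = mult A"
  by (simp_all add: self_module_def)

lemma fst_snd_scalar [simp]: "fst (scalar r) = r \<odot>\<^bsub>A\<^esub> \<one>\<^bsub>A\<^esub>" "snd (scalar r) = \<zero>\<^bsub>P\<^esub>"
  by (simp_all add: scalar_def)

lemma Der_op_of_sym_der:
  assumes T: "sym_der j T" and fs: "fs \<in> tuples A j"
  shows "is_der_op A P (\<lambda>g\<in>carrier A. fst (T fs (emb0 g))) (Der_part j T fs)"
proof -
  note h = sym_derD(1)[OF T fs]
  note d = sym_derD(2)[OF T fs]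
  have 1: "(\<lambda>g\<in>carrier A. fst (T fs (emb0 g))) \<in> derivations A (self_module A)"
    unfolding derivations_def self_module_simps
  proof (intro CollectI conjI ballI allI)
    show "(\<lambda>g\<in>carrier A. fst (T fs (emb0 g))) \<in> carrier A \<rightarrow>\<^sub>E carrier A"
      using h by auto
  next
    fix f g assume f: "f \<in> carrier A" "g \<in> carrier A"
    show "(\<lambda>g\<in>carrier A. fst (T fs (emb0 g))) (f \<oplus>\<^bsub>A\<^esub> g) =
       (\<lambda>g\<in>carrier A. fst (T fs (emb0 g))) f \<oplus>\<^bsub>A\<^esub> (\<lambda>g\<in>carrier A. fst (T fs (emb0 g))) g"
      using f hom0_add[OF h] by (simp add: emb0_add)
    show "(\<lambda>g\<in>carrier A. fst (T fs (emb0 g))) (f \<otimes>\<^bsub>A\<^esub> g) =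
        (f \<otimes>\<^bsub>A\<^esub> (\<lambda>g\<in>carrier A. fst (T fs (emb0 g))) g) \<oplus>\<^bsub>A\<^esub>
        (g \<otimes>\<^bsub>A\<^esub> (\<lambda>g\<in>carrier A. fst (T fs (emb0 g))) f)"
      using f d[of f "emb0 g"] by (simp add: emb0_mult)
  next
    fix r f assume f: "f \<in> carrier A"
    show "(\<lambda>g\<in>carrier A. fst (T fs (emb0 g))) (r \<odot>\<^bsub>A\<^esub> f)
        = (r \<odot>\<^bsub>A\<^esub> \<one>\<^bsub>A\<^esub>) \<otimes>\<^bsub>A\<^esub> (\<lambda>g\<in>carrier A. fst (T fs (emb0 g))) f"
      using f hom0_scalar[OF h, of "emb0 f" r] by (simp add: emb0_smult)
  qed
  show ?thesis
    unfolding is_der_op_def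
  proof (intro conjI ballI allI 1)
    show "Der_part j T fs \<in> carrier P \<rightarrow>\<^sub>E carrier P" using h fs by (auto simp: Der_part_def)
  next
    fix p q assume p: "p \<in> carrier P" "q \<in> carrier P"
    show "Der_part j T fs (p \<oplus>\<^bsub>P\<^esub> q) = Der_part j T fs p \<oplus>\<^bsub>P\<^esub> Der_part j T fs q"
      using p hom0_add[OF h] fs by (simp add: Der_part_def emb1_add)
  next
    fix r p assume p: "p \<in> carrier P"
    show "Der_part j T fs ((r \<odot>\<^bsub>A\<^esub> \<one>\<^bsub>A\<^esub>) \<odot>\<^bsub>P\<^esub> p) = (r \<odot>\<^bsub>A\<^esub> \<one>\<^bsub>A\<^esub>) \<odot>\<^bsub>P\<^esub> Der_part j T fs p"
      using p hom0_scalar[OF h, of "emb1 p" r] fs scalar_closed h hom0_emb1[OF h p]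
      by (simp add: Der_part_def emb1_smult)
  next
    fix a p assume p: "a \<in> carrier A" "p \<in> carrier P"
    show "Der_part j T fs (a \<odot>\<^bsub>P\<^esub> p)
        = ((\<lambda>g\<in>carrier A. fst (T fs (emb0 g))) a \<odot>\<^bsub>P\<^esub> p) \<oplus>\<^bsub>P\<^esub> (a \<odot>\<^bsub>P\<^esub> Der_part j T fs p)"
      using p d[of a "emb1 p"] fs h hom0_emb1[OF h p(2)] hom0_emb0[OF h p(1)]
      by (simp add: Der_part_def emb0_emb1 M.a_comm)
  qed
qed

lemma Der_simps [simp]:
  "T \<oplus>\<^bsub>Der A P\<^esub> T' = (\<lambda>p\<in>carrier P. T p \<oplus>\<^bsub>P\<^esub> T' p)"
  "a \<odot>\<^bsub>Der A P\<^esub> T = (\<lambda>p\<in>carrier P. a \<odot>\<^bsub>P\<^esub> T p)"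
  "\<zero>\<^bsub>Der A P\<^esub> = (\<lambda>p\<in>carrier P. \<zero>\<^bsub>P\<^esub>)"
  "T \<in> carrier (Der A P) \<longleftrightarrow> (\<exists>X. is_der_op A P X T)"
  by (simp_all add: Der_def)

text \<open>
  The symmetry of \<open>\<sigma>\<close> in all \<open>j + 1\<close> arguments is generated by the permutations of the first \<open>j\<close> of
  them and by the exchange of the first one with the last one.
\<close>

lemma Der_part_in_multiderivations:
  assumes T: "sym_der j T"
  shows "Der_part j T \<in> carrier (diolic_multiderivations A P (Suc j))"
proof -
  define \<sigma> where "\<sigma> gs = fst (T (butlast gs) (emb0 (last gs)))" for gs
  have sym: "\<sigma> gs = \<sigma> hs" if gh: "gs \<in> tuples A (Suc j)" "hs \<in> tuples A (Suc j)" "mset gs = mset hs" for gs hs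
  proof -
    obtain fs a where gs: "gs = fs @ [a]" using gh by (cases gs rule: rev_cases) (auto simp: tuples_iff)
    obtain fs' b where hs: "hs = fs' @ [b]" using gh by (cases hs rule: rev_cases) (auto simp: tuples_iff)
    have fs: "fs \<in> tuples A j" "fs' \<in> tuples A j" "a \<in> carrier A" "b \<in> carrier A"
      using gh by (auto simp: gs hs tuples_iff)
    have m: "add_mset a (mset fs) = add_mset b (mset fs')" using gh(3) by (simp add: gs hs)
    show ?thesis
    proof (cases "a = b")
      case True
      then have "T fs = T fs'" using m by (intro sym_derD(3)[OF T fs(1,2)]) simp
      then show ?thesis using True by (simp add: \<sigma>_def gs hs)
    next
      case False
      \<comment> \<open>the last arguments \<open>a\<close> and \<open>b\<close> of the two tuples differ, hence each occurs among the other arguments of the other tuple\<close>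
      then obtain K where K: "mset fs = add_mset b K" "mset fs' = add_mset a K"
        using m by (auto simp: add_eq_conv_ex)
      obtain cs where cs: "mset cs = K" using ex_mset by blast
      obtain i where i: "j = Suc i" using K fs(1) by (cases j) (auto simp: tuples_iff)
      have "set fs = insert b (set cs)" using K(1) cs by (metis set_mset_add_mset_insert set_mset_mset)
      moreover have "length fs = Suc (length cs)" using K(1) cs by (metis size_add_mset size_mset)
      ultimately have cs': "cs \<in> tuples A i" using fs i by (auto simp: tuples_iff)
      have "T fs = T (b # cs)" "T fs' = T (a # cs)"
        using fs cs' i K cs by (intro sym_derD(3)[OF T]; simp add: tuples_iff)+
      moreover have "T (b # cs) (emb0 a) = T (a # cs) (emb0 b)"
        using sym_derD_slot(3)[OF T[unfolded i] cs' fs(4) _ fs(3), of \<zero>] by simp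
      ultimately show ?thesis by (simp add: \<sigma>_def gs hs)
    qed
  qed
  have D: "is_der_op A P (\<lambda>g\<in>carrier A. \<sigma> (fs @ [g])) (Der_part j T fs)" if "fs \<in> tuples A j" for fs
    using Der_op_of_sym_der[OF T that] by (simp add: \<sigma>_def)
  have slot: "(\<lambda>f\<in>carrier A. Der_part j T (us @ f # vs)) \<in> derivations A (Der A P)"
    if uv: "set us \<subseteq> carrier A" "set vs \<subseteq> carrier A" "Suc (length us + length vs) = j" for us vs
  proof -
    define gs where "gs = us @ vs"
    obtain i where i: "j = Suc i" using uv by (cases j) auto
    have gs: "gs \<in> tuples A i" using uv i by (simp add: gs_def tuples_iff)
    have tup: "us @ f # vs \<in> tuples A j" "f # gs \<in> tuples A j" if "f \<in> carrier A" for f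
      using that uv by (auto simp: tuples_iff gs_def)
    have eq: "Der_part j T (us @ f # vs) = (\<lambda>p\<in>carrier P. snd (T (f # gs) (emb1 p)))" if "f \<in> carrier A" for f
      using sym_derD(3)[OF T tup(1)[OF that] tup(2)[OF that]] tup[OF that] by (simp add: Der_part_def gs_def)
    have fst0: "fst (T (f # gs) (emb1 p)) = \<zero>\<^bsub>A\<^esub>" and cl: "snd (T (f # gs) (emb1 p)) \<in> carrier P"
      if "f \<in> carrier A" "p \<in> carrier P" for f p
      using hom0_emb1[OF sym_derD(1)[OF T tup(2)]] hom0_closed[OF sym_derD(1)[OF T tup(2)]] that by auto
    note sl = sym_derD_slot[OF T[unfolded i] gs]
    show ?thesis
      unfolding derivations_def
    proof (intro CollectI conjI ballI allI)
      show "(\<lambda>f\<in>carrier A. Der_part j T (us @ f # vs)) \<in> carrier A \<rightarrow>\<^sub>E carrier (Der A P)"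
      proof -
        have "Der_part j T (us @ f # vs) \<in> carrier (Der A P)" if "f \<in> carrier A" for f
          unfolding Der_simps by (rule exI, rule D[OF tup(1)[OF that]])
        then show ?thesis by (auto simp del: Der_simps(4))
      qed
    next
      fix f g assume f: "f \<in> carrier A" "g \<in> carrier A"
      show "(\<lambda>f\<in>carrier A. Der_part j T (us @ f # vs)) (f \<oplus>\<^bsub>A\<^esub> g) =
        (\<lambda>f\<in>carrier A. Der_part j T (us @ f # vs)) f \<oplus>\<^bsub>Der A P\<^esub> (\<lambda>f\<in>carrier A. Der_part j T (us @ f # vs)) g"
        using f by (auto simp: eq sl(1) intro!: restrict_ext)
      show "(\<lambda>f\<in>carrier A. Der_part j T (us @ f # vs)) (f \<otimes>\<^bsub>A\<^esub> g) =
        (f \<odot>\<^bsub>Der A P\<^esub> (\<lambda>f\<in>carrier A. Der_part j T (us @ f # vs)) g) \<oplus>\<^bsub>Der A P\<^esub>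
        (g \<odot>\<^bsub>Der A P\<^esub> (\<lambda>f\<in>carrier A. Der_part j T (us @ f # vs)) f)"
        using f by (auto simp: eq sl(2) fst0 cl intro!: restrict_ext)
    next
      fix r f assume f: "f \<in> carrier A"
      show "(\<lambda>f\<in>carrier A. Der_part j T (us @ f # vs)) (r \<odot>\<^bsub>A\<^esub> f) =
        (r \<odot>\<^bsub>A\<^esub> \<one>\<^bsub>A\<^esub>) \<odot>\<^bsub>Der A P\<^esub> (\<lambda>f\<in>carrier A. Der_part j T (us @ f # vs)) f"
        using f scalar_closed by (auto simp: eq sl(4) fst0 cl intro!: restrict_ext)
    qed
  qed
  have "symmetric_map A j (Der_part j T)"
    unfolding symmetric_map_def
  proof (intro ballI impI)
    fix fs gs assume "fs \<in> tuples A j" "gs \<in> tuples A j" "mset fs = mset gs"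
    then show "Der_part j T fs = Der_part j T gs"
      using sym_derD(3)[OF T, of fs gs] by (simp add: Der_part_def)
  qed
  moreover have "Der_part j T \<in> tuples A j \<rightarrow>\<^sub>E carrier (Der A P)"
  proof -
    have "Der_part j T fs \<in> carrier (Der A P)" if "fs \<in> tuples A j" for fs
      unfolding Der_simps by (rule exI, rule D[OF that])
    moreover have "Der_part j T \<in> extensional (tuples A j)" by (simp add: Der_part_def)
    ultimately show ?thesis by (auto simp del: Der_simps(4) simp: PiE_iff)
  qed
  moreover have "symmetric_map A (Suc j) \<sigma>" unfolding symmetric_map_def using sym by blast
  ultimately show ?thesis
    unfolding diolic_multiderivations_def sym_multiderivations_def diff_Suc_1 partial_object.select_convs
    using slot D by blast
qed

lemma is_der_opD:
  assumes "is_der_op A P Y T"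
  shows "Y \<in> derivations A (self_module A)" "T \<in> carrier P \<rightarrow>\<^sub>E carrier P"
    "p \<in> carrier P \<Longrightarrow> q \<in> carrier P \<Longrightarrow> T (p \<oplus>\<^bsub>P\<^esub> q) = T p \<oplus>\<^bsub>P\<^esub> T q"
    "p \<in> carrier P \<Longrightarrow> T ((r \<odot>\<^bsub>A\<^esub> \<one>\<^bsub>A\<^esub>) \<odot>\<^bsub>P\<^esub> p) = (r \<odot>\<^bsub>A\<^esub> \<one>\<^bsub>A\<^esub>) \<odot>\<^bsub>P\<^esub> T p"
    "a \<in> carrier A \<Longrightarrow> p \<in> carrier P \<Longrightarrow> T (a \<odot>\<^bsub>P\<^esub> p) = (Y a \<odot>\<^bsub>P\<^esub> p) \<oplus>\<^bsub>P\<^esub> (a \<odot>\<^bsub>P\<^esub> T p)"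
  using assms unfolding is_der_op_def by blast+

lemma derivationsD:
  assumes "Y \<in> derivations A Q"
  shows "Y \<in> carrier A \<rightarrow>\<^sub>E carrier Q"
    "f \<in> carrier A \<Longrightarrow> g \<in> carrier A \<Longrightarrow> Y (f \<oplus>\<^bsub>A\<^esub> g) = Y f \<oplus>\<^bsub>Q\<^esub> Y g"
    "f \<in> carrier A \<Longrightarrow> Y (r \<odot>\<^bsub>A\<^esub> f) = (r \<odot>\<^bsub>A\<^esub> \<one>\<^bsub>A\<^esub>) \<odot>\<^bsub>Q\<^esub> Y f"
    "f \<in> carrier A \<Longrightarrow> g \<in> carrier A \<Longrightarrow> Y (f \<otimes>\<^bsub>A\<^esub> g) = (f \<odot>\<^bsub>Q\<^esub> Y g) \<oplus>\<^bsub>Q\<^esub> (g \<odot>\<^bsub>Q\<^esub> Y f)"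
  using assms unfolding derivations_def by blast+

lemma multiderivation_Der_part:
  assumes \<Delta>: "\<Delta> \<in> carrier (diolic_multiderivations A P (Suc j))"
  obtains T where "sym_der j T" "\<Delta> = Der_part j T"
proof -
  have S: "\<Delta> \<in> sym_multiderivations A j (Der A P)"
    and ex: "\<exists>\<sigma>. symmetric_map A (Suc j) \<sigma> \<and>
         (\<forall>fs\<in>tuples A j. is_der_op A P (\<lambda>g\<in>carrier A. \<sigma> (fs @ [g])) (\<Delta> fs))"
    using \<Delta> unfolding diolic_multiderivations_def diff_Suc_1 partial_object.select_convs mem_Collect_eq
    by (rule conjunct1, rule conjunct2)
  from ex obtain \<sigma> where \<sigma>D: "symmetric_map A (Suc j) \<sigma> \<and>
         (\<forall>fs\<in>tuples A j. is_der_op A P (\<lambda>g\<in>carrier A. \<sigma> (fs @ [g])) (\<Delta> fs))" by (rule exE)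
  note \<sigma> = conjunct1[OF \<sigma>D] and D = bspec[OF conjunct2[OF \<sigma>D]]
  note S' = S[unfolded sym_multiderivations_def mem_Collect_eq]
  note \<Delta>E = conjunct1[OF S'] and sym = conjunct1[OF conjunct2[OF S']]
  have slot: "(\<lambda>f\<in>carrier A. \<Delta> (us @ f # vs)) \<in> derivations A (Der A P)"
    if "set us \<subseteq> carrier A" "set vs \<subseteq> carrier A" "Suc (length us + length vs) = j" for us vs
    using conjunct2[OF conjunct2[OF S']] that by blast
  define T where "T fs = (\<lambda>x\<in>carrier B. (\<sigma> (fs @ [fst x]), \<Delta> fs (snd x)))" for fs
  have \<sigma>p: "\<sigma> fs = \<sigma> gs" if "fs \<in> tuples A (Suc j)" "mset fs = mset gs" for fs gs
  proof -
    have "gs \<in> tuples A (Suc j)"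
      using that mset_eq_length[OF that(2)] mset_eq_setD[OF that(2)] by (simp add: tuples_iff)
    from \<sigma>[unfolded symmetric_map_def, rule_format, OF that(1) this that(2)] show ?thesis .
  qed
  have X: "\<sigma> (fs @ [g]) \<in> carrier A" "\<sigma> (fs @ [g \<oplus>\<^bsub>A\<^esub> h]) = \<sigma> (fs @ [g]) \<oplus>\<^bsub>A\<^esub> \<sigma> (fs @ [h])"
    "\<sigma> (fs @ [r \<odot>\<^bsub>A\<^esub> g]) = (r \<odot>\<^bsub>A\<^esub> \<one>\<^bsub>A\<^esub>) \<otimes>\<^bsub>A\<^esub> \<sigma> (fs @ [g])"
    "\<sigma> (fs @ [g \<otimes>\<^bsub>A\<^esub> h]) = (g \<otimes>\<^bsub>A\<^esub> \<sigma> (fs @ [h])) \<oplus>\<^bsub>A\<^esub> (h \<otimes>\<^bsub>A\<^esub> \<sigma> (fs @ [g]))"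
    if "fs \<in> tuples A j" "g \<in> carrier A" "h \<in> carrier A" for fs g h r
  proof -
    note d = derivationsD[OF is_der_opD(1)[OF D[OF that(1)]], unfolded self_module_simps]
    show "\<sigma> (fs @ [g]) \<in> carrier A" using PiE_mem[OF d(1) that(2)] that(2) by simp
    show "\<sigma> (fs @ [g \<oplus>\<^bsub>A\<^esub> h]) = \<sigma> (fs @ [g]) \<oplus>\<^bsub>A\<^esub> \<sigma> (fs @ [h])"
      using d(2)[OF that(2,3)] that(2,3) by simp
    show "\<sigma> (fs @ [r \<odot>\<^bsub>A\<^esub> g]) = (r \<odot>\<^bsub>A\<^esub> \<one>\<^bsub>A\<^esub>) \<otimes>\<^bsub>A\<^esub> \<sigma> (fs @ [g])"
      using d(3)[OF that(2)] that(2) by simp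
    show "\<sigma> (fs @ [g \<otimes>\<^bsub>A\<^esub> h]) = (g \<otimes>\<^bsub>A\<^esub> \<sigma> (fs @ [h])) \<oplus>\<^bsub>A\<^esub> (h \<otimes>\<^bsub>A\<^esub> \<sigma> (fs @ [g]))"
      using d(4)[OF that(2,3)] that(2,3) by simp
  qed
  have Y: "\<Delta> fs p \<in> carrier P" "\<Delta> fs (p \<oplus>\<^bsub>P\<^esub> q) = \<Delta> fs p \<oplus>\<^bsub>P\<^esub> \<Delta> fs q"
    "\<Delta> fs ((r \<odot>\<^bsub>A\<^esub> \<one>\<^bsub>A\<^esub>) \<odot>\<^bsub>P\<^esub> p) = (r \<odot>\<^bsub>A\<^esub> \<one>\<^bsub>A\<^esub>) \<odot>\<^bsub>P\<^esub> \<Delta> fs p"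
    "a \<in> carrier A \<Longrightarrow> \<Delta> fs (a \<odot>\<^bsub>P\<^esub> p) = (\<sigma> (fs @ [a]) \<odot>\<^bsub>P\<^esub> p) \<oplus>\<^bsub>P\<^esub> (a \<odot>\<^bsub>P\<^esub> \<Delta> fs p)"
    if "fs \<in> tuples A j" "p \<in> carrier P" "q \<in> carrier P" for fs p q r a
  proof -
    note d = is_der_opD[OF D[OF that(1)]]
    show "\<Delta> fs p \<in> carrier P" by (rule PiE_mem[OF d(2) that(2)])
    show "\<Delta> fs (p \<oplus>\<^bsub>P\<^esub> q) = \<Delta> fs p \<oplus>\<^bsub>P\<^esub> \<Delta> fs q" by (rule d(3)[OF that(2,3)])
    show "\<Delta> fs ((r \<odot>\<^bsub>A\<^esub> \<one>\<^bsub>A\<^esub>) \<odot>\<^bsub>P\<^esub> p) = (r \<odot>\<^bsub>A\<^esub> \<one>\<^bsub>A\<^esub>) \<odot>\<^bsub>P\<^esub> \<Delta> fs p" by (rule d(4)[OF that(2)])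
    show "\<Delta> fs (a \<odot>\<^bsub>P\<^esub> p) = (\<sigma> (fs @ [a]) \<odot>\<^bsub>P\<^esub> p) \<oplus>\<^bsub>P\<^esub> (a \<odot>\<^bsub>P\<^esub> \<Delta> fs p)" if "a \<in> carrier A"
      using d(5)[OF that \<open>p \<in> carrier P\<close>] that by simp
  qed
  have X1: "\<sigma> (fs @ [g]) \<in> carrier A"
    and X3: "\<sigma> (fs @ [r \<odot>\<^bsub>A\<^esub> g]) = (r \<odot>\<^bsub>A\<^esub> \<one>\<^bsub>A\<^esub>) \<otimes>\<^bsub>A\<^esub> \<sigma> (fs @ [g])"
    if "fs \<in> tuples A j" "g \<in> carrier A" for fs g r
    by (rule X(1)[OF that that(2)], rule X(3)[OF that that(2)])
  have Y1: "\<Delta> fs p \<in> carrier P"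
    and Y3: "\<Delta> fs ((r \<odot>\<^bsub>A\<^esub> \<one>\<^bsub>A\<^esub>) \<odot>\<^bsub>P\<^esub> p) = (r \<odot>\<^bsub>A\<^esub> \<one>\<^bsub>A\<^esub>) \<odot>\<^bsub>P\<^esub> \<Delta> fs p"
    and Y4: "a \<in> carrier A \<Longrightarrow> \<Delta> fs (a \<odot>\<^bsub>P\<^esub> p) = (\<sigma> (fs @ [a]) \<odot>\<^bsub>P\<^esub> p) \<oplus>\<^bsub>P\<^esub> (a \<odot>\<^bsub>P\<^esub> \<Delta> fs p)"
    if "fs \<in> tuples A j" "p \<in> carrier P" for fs p r a
    by (rule Y(1)[OF that that(2)], rule Y(3)[OF that that(2)], rule Y(4)[OF that that(2)])
  have A0: "\<sigma> (fs @ [\<zero>\<^bsub>A\<^esub>]) = \<zero>\<^bsub>A\<^esub>" if "fs \<in> tuples A j" for fs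
  proof -
    have "\<sigma> (fs @ [\<zero>\<^bsub>A\<^esub>]) \<oplus>\<^bsub>A\<^esub> \<sigma> (fs @ [\<zero>\<^bsub>A\<^esub>]) = \<sigma> (fs @ [\<zero>\<^bsub>A\<^esub>])"
      using X(2)[OF that R.zero_closed R.zero_closed] by simp
    then show ?thesis using X1[OF that R.zero_closed] by (metis R.add.r_cancel_one')
  qed
  have P0: "\<Delta> fs \<zero>\<^bsub>P\<^esub> = \<zero>\<^bsub>P\<^esub>" if "fs \<in> tuples A j" for fs
  proof -
    have "\<Delta> fs \<zero>\<^bsub>P\<^esub> \<oplus>\<^bsub>P\<^esub> \<Delta> fs \<zero>\<^bsub>P\<^esub> = \<Delta> fs \<zero>\<^bsub>P\<^esub>"
      using Y(2)[OF that M.zero_closed M.zero_closed] by simp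
    then show ?thesis using Y1[OF that M.zero_closed] by (metis M.add.r_cancel_one')
  qed
  have T_apply: "x \<in> carrier B \<Longrightarrow> T fs x = (\<sigma> (fs @ [fst x]), \<Delta> fs (snd x))" for fs x by (simp add: T_def)
  have Th: "T fs \<in> hom0" if "fs \<in> tuples A j" for fs
  proof (rule hom0I)
    show "T fs (scalar r \<otimes> x) = scalar r \<otimes> T fs x" if "x \<in> carrier B" for r x
    proof -
      have "\<sigma> (fs @ [(r \<odot>\<^bsub>A\<^esub> \<one>\<^bsub>A\<^esub>) \<otimes>\<^bsub>A\<^esub> fst x]) = (r \<odot>\<^bsub>A\<^esub> \<one>\<^bsub>A\<^esub>) \<otimes>\<^bsub>A\<^esub> \<sigma> (fs @ [fst x])"
        using X3[OF \<open>fs \<in> tuples A j\<close>, of "fst x" r] scalar_smult[of "fst x" r] that by simp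
      then show ?thesis
        using that scalar_closed X1[OF \<open>fs \<in> tuples A j\<close>, of "fst x"]
          Y1[OF \<open>fs \<in> tuples A j\<close>, of "snd x"] Y3[OF \<open>fs \<in> tuples A j\<close>, of "snd x"]
        by (intro B_eqI) (simp_all add: T_apply)
    qed
    show "snd (T fs (emb0 a)) = \<zero>\<^bsub>P\<^esub>" if "a \<in> carrier A" for a
      using that P0[OF \<open>fs \<in> tuples A j\<close>] by (simp add: T_apply)
    show "fst (T fs (emb1 p)) = \<zero>\<^bsub>A\<^esub>" if "p \<in> carrier P" for p
      using that A0[OF \<open>fs \<in> tuples A j\<close>] by (simp add: T_apply)
    show "T fs x \<in> carrier B" if "x \<in> carrier B" for x
      using X1[OF \<open>fs \<in> tuples A j\<close> fst_snd_closed(1)[OF that]] Y1[OF \<open>fs \<in> tuples A j\<close> fst_snd_closed(2)[OF that]]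
      by (simp add: T_apply[OF that]) (simp add: carrier_B)
    show "T fs (x \<oplus> y) = T fs x \<oplus> T fs y" if "x \<in> carrier B" "y \<in> carrier B" for x y
      using that X(2)[OF \<open>fs \<in> tuples A j\<close>] Y(2)[OF \<open>fs \<in> tuples A j\<close>] by (simp add: T_apply B_simps)
  qed (simp add: T_def)
  have "sym_der j T"
    unfolding sym_der_def
  proof (intro conjI ballI allI impI)
    show "T fs \<in> hom0" if "fs \<in> tuples A j" for fs by (rule Th[OF that])
  next
    fix fs g x assume fs: "fs \<in> tuples A j" and g: "g \<in> carrier A" and x: "x \<in> carrier B"
    show "T fs (emb0 g \<otimes> x) = emb0 g \<otimes> T fs x \<oplus> x \<otimes> T fs (emb0 g)"
      using x g X1[OF fs g] X1[OF fs, of "fst x"] X(4)[OF fs g, of "fst x"] Y1[OF fs, of "snd x"]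
        Y4[OF fs _ g, of "snd x"] P0[OF fs]
      by (intro B_eqI) (simp_all add: T_apply M.a_comm)
  next
    fix fs gs assume fs: "fs \<in> tuples A j" "gs \<in> tuples A j" "mset fs = mset gs"
    have "\<Delta> fs = \<Delta> gs" by (rule sym[unfolded symmetric_map_def, rule_format, OF fs])
    moreover have "\<sigma> (fs @ [fst x]) = \<sigma> (gs @ [fst x])" if "x \<in> carrier B" for x
      using fs that by (intro \<sigma>p) (auto simp: tuples_iff)
    ultimately show "T fs = T gs" unfolding T_def by (intro restrict_ext) (simp only:)
  next
    fix gs assume gs: "Suc (length gs) = j \<and> set gs \<subseteq> carrier A"
    have tup: "f # gs \<in> tuples A j" if "f \<in> carrier A" for f using gs that by (simp add: tuples_iff)
    have rot: "\<sigma> ((f # gs) @ [h]) = \<sigma> ((h # gs) @ [f])" if "f \<in> carrier A" "h \<in> carrier A" for f h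
      using gs that by (intro \<sigma>p) (auto simp: tuples_iff)
    have d: "(\<lambda>f\<in>carrier A. \<Delta> (f # gs)) \<in> derivations A (Der A P)"
      using slot[of "[]" gs] gs by simp
    note d' = derivationsD(2-4)[OF d]
    have d1: "\<Delta> ((f \<oplus>\<^bsub>A\<^esub> g) # gs) p = \<Delta> (f # gs) p \<oplus>\<^bsub>P\<^esub> \<Delta> (g # gs) p"
      and d3: "\<Delta> ((f \<otimes>\<^bsub>A\<^esub> g) # gs) p = (f \<odot>\<^bsub>P\<^esub> \<Delta> (g # gs) p) \<oplus>\<^bsub>P\<^esub> (g \<odot>\<^bsub>P\<^esub> \<Delta> (f # gs) p)"
      and d2: "\<Delta> ((r \<odot>\<^bsub>A\<^esub> f) # gs) p = (r \<odot>\<^bsub>A\<^esub> \<one>\<^bsub>A\<^esub>) \<odot>\<^bsub>P\<^esub> \<Delta> (f # gs) p"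
      if "f \<in> carrier A" "g \<in> carrier A" "p \<in> carrier P" for f g p r
      using d'(1)[OF that(1,2)] d'(3)[OF that(1,2)] d'(2)[OF that(1), of r] that by simp_all
    {
      fix f g x assume f: "f \<in> carrier A" and g: "g \<in> carrier A" and x: "x \<in> carrier B"
      have fx: "fst x \<in> carrier A" "snd x \<in> carrier P" using x by auto
      note r = rot[OF _ fx(1), simplified]
      show "T ((f \<oplus>\<^bsub>A\<^esub> g) # gs) x = T (f # gs) x \<oplus> T (g # gs) x"
        using f g x d1[OF f g fx(2)] r X(2)[OF tup[OF fx(1)] f g] by (simp add: T_apply B_simps)
      show "T ((f \<otimes>\<^bsub>A\<^esub> g) # gs) x = emb0 f \<otimes> T (g # gs) x \<oplus> emb0 g \<otimes> T (f # gs) x"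
        using f g x d3[OF f g fx(2)] r X(4)[OF tup[OF fx(1)] f g] X1[OF tup[OF fx(1)]] Y1[OF tup[OF f]] Y1[OF tup[OF g]]
        by (intro B_eqI) (simp_all add: T_apply)
      show "T (f # gs) (emb0 g) = T (g # gs) (emb0 f)"
        using f g rot[OF f g] P0[OF tup] by (simp add: T_apply)
    }
    fix r f x assume f: "f \<in> carrier A" and x: "x \<in> carrier B"
    have fx: "fst x \<in> carrier A" "snd x \<in> carrier P" using x by auto
    note rr = rot[OF _ fx(1), simplified]
    show "T ((r \<odot>\<^bsub>A\<^esub> f) # gs) x = scalar r \<otimes> T (f # gs) x"
      using f x d2[OF f f fx(2), of r] rr X3[OF tup[OF fx(1)] f] X1[OF tup[OF fx(1)]] Y1[OF tup[OF f]] scalar_closed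
      by (intro B_eqI) (simp_all add: T_apply)
  qed
  moreover have "\<Delta> = Der_part j T"
  proof (rule extensionalityI)
    show "\<Delta> \<in> extensional (tuples A j)" using \<Delta>E by (simp add: PiE_iff)
    show "Der_part j T \<in> extensional (tuples A j)" by (simp add: Der_part_def)
    fix fs assume fs: "fs \<in> tuples A j"
    have "\<Delta> fs \<in> extensional (carrier P)" using D[OF fs] by (simp add: is_der_op_def PiE_iff)
    then show "\<Delta> fs = Der_part j T fs" using fs by (auto simp: Der_part_def T_apply extensional_def fun_eq_iff)
  qed
  ultimately show thesis by (rule that)
qed

lemma diolic_diff_simps:
  "carrier (diolic_diff A P k) = {\<phi>. order_le k \<phi>}" "add (diolic_diff A P k) = opadd"
  "smult (diolic_diff A P k) = opsmult" "zero (diolic_diff A P k) = opzero"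
  unfolding diolic_diff_def B_def[symmetric] by (auto simp: graded_diff_iff opadd_def opsmult_def opzero_def emb0_def fun_eq_iff)

lemma module_diolic_diff: "Module.module A (diolic_diff A P k)"
proof (rule moduleI[OF R.is_cring])
  have ext: "\<phi> \<in> extensional (carrier B)" if "order_le k \<phi>" for \<phi> using that order_leD hom0_ext by blast
  have cl [simp]: "\<phi> x \<in> carrier B" if "order_le k \<phi>" "x \<in> carrier B" for \<phi> x using that order_leD(1) by blast
  show "abelian_group (diolic_diff A P k)"
  proof (rule abelian_groupI, unfold diolic_diff_simps mem_Collect_eq)
    fix \<phi> assume \<phi>: "order_le k \<phi>"
    show "opadd opzero \<phi> = \<phi>" by (rule op_eqI) (use \<phi> ext in auto)
    have "opadd (opneg \<phi>) \<phi> = opzero" by (rule op_eqI) (use \<phi> in \<open>auto simp: B.l_neg\<close>)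
    then show "\<exists>\<psi>\<in>{\<phi>. order_le k \<phi>}. opadd \<psi> \<phi> = opzero" using order_le_closed(3)[OF \<phi>] by blast
    fix \<psi> assume \<psi>: "order_le k \<psi>"
    show "order_le k (opadd \<phi> \<psi>)" using \<phi> \<psi> order_le_closed by blast
    show "opadd \<phi> \<psi> = opadd \<psi> \<phi>" by (rule op_eqI) (use \<phi> \<psi> in \<open>auto simp: B.a_comm\<close>)
    fix \<theta> assume \<theta>: "order_le k \<theta>"
    show "opadd (opadd \<phi> \<psi>) \<theta> = opadd \<phi> (opadd \<psi> \<theta>)"
      by (rule op_eqI) (use \<phi> \<psi> \<theta> in \<open>auto simp: B.a_assoc\<close>)
  qed (rule order_le_opzero)
  fix a \<phi> assume a: "a \<in> carrier A" and "\<phi> \<in> carrier (diolic_diff A P k)"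
  then have \<phi>: "order_le k \<phi>" by (simp add: diolic_diff_simps)
  show "a \<odot>\<^bsub>diolic_diff A P k\<^esub> \<phi> \<in> carrier (diolic_diff A P k)"
    using order_le_closed(2)[OF \<phi> a] by (simp add: diolic_diff_simps)
  fix b assume b: "b \<in> carrier A"
  show "(a \<oplus>\<^bsub>A\<^esub> b) \<odot>\<^bsub>diolic_diff A P k\<^esub> \<phi> =
      (a \<odot>\<^bsub>diolic_diff A P k\<^esub> \<phi>) \<oplus>\<^bsub>diolic_diff A P k\<^esub> (b \<odot>\<^bsub>diolic_diff A P k\<^esub> \<phi>)"
    unfolding diolic_diff_simps by (rule op_eqI) (use \<phi> a b in \<open>auto simp: emb0_add B.l_distr\<close>)
  show "(a \<otimes>\<^bsub>A\<^esub> b) \<odot>\<^bsub>diolic_diff A P k\<^esub> \<phi> =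
      a \<odot>\<^bsub>diolic_diff A P k\<^esub> (b \<odot>\<^bsub>diolic_diff A P k\<^esub> \<phi>)"
    unfolding diolic_diff_simps by (rule op_eqI) (use \<phi> a b in \<open>auto simp: emb0_mult B.m_assoc\<close>)
next
  fix \<phi> assume "\<phi> \<in> carrier (diolic_diff A P k)"
  then have \<phi>: "order_le k \<phi>" by (simp add: diolic_diff_simps)
  show "\<one>\<^bsub>A\<^esub> \<odot>\<^bsub>diolic_diff A P k\<^esub> \<phi> = \<phi>"
    unfolding diolic_diff_simps by (rule op_eqI) (use hom0_ext[OF order_leD(1)[OF \<phi>]] hom0_closed[OF order_leD(1)[OF \<phi>]] in \<open>auto simp: emb_one\<close>)
next
  fix a \<phi> \<psi> assume a: "a \<in> carrier A" and "\<phi> \<in> carrier (diolic_diff A P k)" "\<psi> \<in> carrier (diolic_diff A P k)"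
  then have \<phi>: "order_le k \<phi>" "order_le k \<psi>" by (simp_all add: diolic_diff_simps)
  have cl: "\<phi> x \<in> carrier B" "\<psi> x \<in> carrier B" if "x \<in> carrier B" for x using that order_leD(1) \<phi> by blast+
  show "a \<odot>\<^bsub>diolic_diff A P k\<^esub> (\<phi> \<oplus>\<^bsub>diolic_diff A P k\<^esub> \<psi>) =
      (a \<odot>\<^bsub>diolic_diff A P k\<^esub> \<phi>) \<oplus>\<^bsub>diolic_diff A P k\<^esub> (a \<odot>\<^bsub>diolic_diff A P k\<^esub> \<psi>)"
    unfolding diolic_diff_simps by (rule op_eqI) (use cl a in \<open>auto simp: B.r_distr\<close>)
qed

text \<open>
  Given surjectivity, this is the isomorphism theorem for the linear map that sends an operator to its
  multi-symbol; faithfulness of \<open>P\<close> identifies the kernel.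
\<close>

theorem diolic_symbols_iso:
  assumes faithful: "\<And>a. a \<in> carrier A \<Longrightarrow> (\<And>p. p \<in> carrier P \<Longrightarrow> a \<odot>\<^bsub>P\<^esub> p = \<zero>\<^bsub>P\<^esub>) \<Longrightarrow> a = \<zero>\<^bsub>A\<^esub>"
    and surj: "\<And>T. sym_der j T \<Longrightarrow> \<exists>\<phi>. order_le (Suc j) \<phi> \<and> (\<forall>fs\<in>tuples A j. \<forall>x\<in>carrier B. symb \<phi> fs x = T fs x)"
  shows "Module.module A (diolic_smbl A P (Suc j))"
    "Module.module A (diolic_multiderivations A P (Suc j))"
    "\<exists>\<Theta>\<in>module_iso A (diolic_smbl A P (Suc j)) (diolic_multiderivations A P (Suc j)).
       \<forall>\<phi>\<in>carrier (diolic_diff A P (Suc j)).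
         \<Theta> (carrier (diolic_diff A P j) +>\<^bsub>diolic_diff A P (Suc j)\<^esub> \<phi>) = diolic_multisymbol A P (Suc j) \<phi>"
proof -
  let ?Q = "diolic_diff A P (Suc j)" and ?N = "diolic_multiderivations A P (Suc j)"
  let ?h = "diolic_multisymbol A P (Suc j)"
  have h: "?h \<phi> = Der_part j (symb \<phi>)" if "order_le (Suc j) \<phi>" for \<phi>
    using diolic_multisymbol_eq[OF order_leD(1)[OF that]] by (simp add: Der_part_def)
  have im: "?h ` carrier ?Q = carrier ?N"
  proof
    show "?h ` carrier ?Q \<subseteq> carrier ?N"
      using h Der_part_in_multiderivations sym_der_symb by (auto simp: diolic_diff_simps)
    show "carrier ?N \<subseteq> ?h ` carrier ?Q"
    proof
      fix \<Delta> assume "\<Delta> \<in> carrier ?N"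
      then obtain T where T: "sym_der j T" "\<Delta> = Der_part j T" using multiderivation_Der_part by blast
      obtain \<phi> where \<phi>: "order_le (Suc j) \<phi>" "\<And>fs x. fs \<in> tuples A j \<Longrightarrow> x \<in> carrier B \<Longrightarrow> symb \<phi> fs x = T fs x"
        using surj[OF T(1)] by blast
      have "Der_part j (symb \<phi>) = Der_part j T"
        unfolding Der_part_def by (intro restrict_ext) (simp only: \<phi>(2) emb_closed)
      then have eq: "\<Delta> = ?h \<phi>" using T(2) h[OF \<phi>(1)] by (simp only:)
      show "\<Delta> \<in> ?h ` carrier ?Q"
        by (rule image_eqI[where x = \<phi>], rule eq) (simp add: diolic_diff_simps \<phi>(1))
    qed
  qed
  have N_simps: "\<Delta> \<oplus>\<^bsub>?N\<^esub> \<Delta>' = (\<lambda>fs\<in>tuples A j. \<lambda>p\<in>carrier P. \<Delta> fs p \<oplus>\<^bsub>P\<^esub> \<Delta>' fs p)"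
    "a \<odot>\<^bsub>?N\<^esub> \<Delta> = (\<lambda>fs\<in>tuples A j. \<lambda>p\<in>carrier P. a \<odot>\<^bsub>P\<^esub> \<Delta> fs p)"
    "\<zero>\<^bsub>?N\<^esub> = (\<lambda>fs\<in>tuples A j. \<lambda>p\<in>carrier P. \<zero>\<^bsub>P\<^esub>)" for \<Delta> \<Delta>' a
    by (simp_all add: diolic_multiderivations_def)
  have add: "?h (\<phi> \<oplus>\<^bsub>?Q\<^esub> \<psi>) = ?h \<phi> \<oplus>\<^bsub>?N\<^esub> ?h \<psi>" if "\<phi> \<in> carrier ?Q" "\<psi> \<in> carrier ?Q" for \<phi> \<psi>
  proof -
    have o: "order_le (Suc j) \<phi>" "order_le (Suc j) \<psi>" using that by (auto simp: diolic_diff_simps)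
    note o' = order_leD(1)[OF o(1)] order_leD(1)[OF o(2)]
    show ?thesis
      unfolding diolic_diff_simps N_simps h[OF o(1)] h[OF o(2)] h[OF order_le_closed(1)[OF o]]
      unfolding Der_part_def by (intro restrict_ext) (simp add: symb_opadd[OF o'] tuples_iff)
  qed
  have smult: "?h (a \<odot>\<^bsub>?Q\<^esub> \<phi>) = a \<odot>\<^bsub>?N\<^esub> ?h \<phi>" if a: "a \<in> carrier A" and "\<phi> \<in> carrier ?Q" for a \<phi>
  proof -
    have o: "order_le (Suc j) \<phi>" using that by (auto simp: diolic_diff_simps)
    have "fst (symb \<phi> fs (emb1 p)) = \<zero>\<^bsub>A\<^esub>" "snd (symb \<phi> fs (emb1 p)) \<in> carrier P"
      if "fs \<in> tuples A j" "p \<in> carrier P" for fs p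
      using hom0_emb1[of "symb \<phi> fs" p] hom0_closed[of "symb \<phi> fs" "emb1 p"] that order_leD(1)[OF o] by (auto simp: tuples_iff)
    then have e: "snd (symb (opsmult a \<phi>) fs (emb1 p)) = a \<odot>\<^bsub>P\<^esub> snd (symb \<phi> fs (emb1 p))"
      if "fs \<in> tuples A j" "p \<in> carrier P" for fs p
      using that a symb_opsmult[OF order_leD(1)[OF o] a, of fs "emb1 p"] by (simp add: tuples_iff)
    show ?thesis
      unfolding diolic_diff_simps N_simps h[OF o] h[OF order_le_closed(2)[OF o a]]
      unfolding Der_part_def by (intro restrict_ext) (simp add: e)
  qed
  have ker: "\<phi> \<in> carrier (diolic_diff A P j) \<longleftrightarrow> \<phi> \<in> carrier ?Q \<and> ?h \<phi> = \<zero>\<^bsub>?N\<^esub>" for \<phi>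
  proof (cases "order_le (Suc j) \<phi>")
    case True
    have "?h \<phi> = \<zero>\<^bsub>?N\<^esub> \<longleftrightarrow> (\<forall>fs\<in>tuples A j. \<forall>p\<in>carrier P. snd (symb \<phi> fs (emb1 p)) = \<zero>\<^bsub>P\<^esub>)"
    proof
      assume eq: "?h \<phi> = \<zero>\<^bsub>?N\<^esub>"
      show "\<forall>fs\<in>tuples A j. \<forall>p\<in>carrier P. snd (symb \<phi> fs (emb1 p)) = \<zero>\<^bsub>P\<^esub>"
      proof (intro ballI)
        fix fs p assume "fs \<in> tuples A j" "p \<in> carrier P"
        then show "snd (symb \<phi> fs (emb1 p)) = \<zero>\<^bsub>P\<^esub>"
          using fun_cong[OF fun_cong[OF eq, of fs], of p] by (simp add: h[OF True] N_simps Der_part_def)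
      qed
    qed (auto simp: h[OF True] N_simps Der_part_def intro!: restrict_ext)
    then show ?thesis using symb_kernel[OF True faithful] True by (simp add: diolic_diff_simps)
  next
    case False
    then show ?thesis using order_le_Suc by (auto simp: diolic_diff_simps)
  qed
  have zero: "?h \<zero>\<^bsub>?Q\<^esub> = \<zero>\<^bsub>?N\<^esub>"
    using ker[of opzero] order_le_opzero by (simp add: diolic_diff_simps)
  have K: "carrier (diolic_diff A P j) = {\<phi> \<in> carrier ?Q. ?h \<phi> = \<zero>\<^bsub>?N\<^esub>}" using ker by blast
  note iso = quotient_module_iso[OF module_diolic_diff im add smult zero K]
  show "Module.module A (diolic_smbl A P (Suc j))" "Module.module A ?N"
    "\<exists>\<Theta>\<in>module_iso A (diolic_smbl A P (Suc j)) ?N. \<forall>\<phi>\<in>carrier ?Q.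
       \<Theta> (carrier (diolic_diff A P j) +>\<^bsub>?Q\<^esub> \<phi>) = ?h \<phi>"
    using iso by (simp_all add: diolic_smbl_def)
qed

section \<open>Operators with prescribed symbol\<close>

definition der_op where
  "der_op Y \<longleftrightarrow> Y \<in> hom0 \<and>
     (\<forall>g\<in>carrier A. \<forall>x\<in>carrier B. Y (emb0 g \<otimes> x) = emb0 g \<otimes> Y x \<oplus> x \<otimes> Y (emb0 g))"

lemma der_opD:
  assumes "der_op Y"
  shows "Y \<in> hom0" "g \<in> carrier A \<Longrightarrow> x \<in> carrier B \<Longrightarrow> Y (emb0 g \<otimes> x) = emb0 g \<otimes> Y x \<oplus> x \<otimes> Y (emb0 g)"
  using assms unfolding der_op_def by blast+

text \<open>
  Derivations of \<open>A\<close> with values in the \<open>A\<close>-module \<open>B\<close>. For \<open>T\<close> satisfying \<open>sym_der\<close> and fixed other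
  arguments, both \<open>f \<mapsto> T(f, \<dots>)(x)\<close> and \<open>g \<mapsto> T(\<dots>)(g)\<close> are of this kind.
\<close>

definition B_derivation where
  "B_derivation V \<longleftrightarrow> (\<forall>f\<in>carrier A. V f \<in> carrier B) \<and>
     (\<forall>f\<in>carrier A. \<forall>g\<in>carrier A. V (f \<oplus>\<^bsub>A\<^esub> g) = V f \<oplus> V g) \<and>
     (\<forall>r. \<forall>f\<in>carrier A. V (r \<odot>\<^bsub>A\<^esub> f) = scalar r \<otimes> V f) \<and>
     (\<forall>f\<in>carrier A. \<forall>g\<in>carrier A. V (f \<otimes>\<^bsub>A\<^esub> g) = emb0 f \<otimes> V g \<oplus> emb0 g \<otimes> V f)"

text \<open>
  Up to the factor \<open>w\<close>, every derivation \<open>V\<close> is the combination \<open>\<Sum>\<^sub>l V(y\<^sub>l) Y\<^sub>l\<close> of the symbols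
  of finitely many Der-operators \<open>Y\<^sub>l\<close>. Typically the \<open>y\<^sub>l\<close> are coordinates, cut off by a bump function, and
  the \<open>Y\<^sub>l\<close> lift the coordinate vector fields.
\<close>

definition frame where
  "frame w m y Y \<longleftrightarrow> w \<in> carrier A \<and> (\<forall>l\<le>m. y l \<in> carrier A \<and> der_op (Y l)) \<and>
     (\<forall>V. B_derivation V \<longrightarrow> (\<forall>f\<in>carrier A.
        emb0 w \<otimes> V f = (\<Oplus>l\<in>{..(m::nat)}. Y l (emb0 f) \<otimes> V (y l))))"

lemma frameD:
  assumes "frame w m y Y"
  shows "w \<in> carrier A" "l \<le> m \<Longrightarrow> y l \<in> carrier A" "l \<le> m \<Longrightarrow> der_op (Y l)" "l \<le> m \<Longrightarrow> Y l \<in> hom0"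
    "B_derivation V \<Longrightarrow> f \<in> carrier A \<Longrightarrow> emb0 w \<otimes> V f = (\<Oplus>l\<in>{..m}. Y l (emb0 f) \<otimes> V (y l))"
  using assms unfolding frame_def der_op_def by blast+

lemma hom0_sum:
  assumes "finite I" "\<And>l. l \<in> I \<Longrightarrow> \<phi> l \<in> hom0"
  shows "(\<lambda>x\<in>carrier B. \<Oplus>l\<in>I. \<phi> l x) \<in> hom0"
  using assms
proof (induction I rule: finite_induct)
  case empty
  have "(\<lambda>x\<in>carrier B. \<Oplus>l\<in>{}. \<phi> l x) = opzero" by (simp add: opzero_def)
  then show ?case by simp
next
  case (insert a I)
  have eq: "(\<lambda>x\<in>carrier B. \<Oplus>l\<in>insert a I. \<phi> l x) = opadd (\<phi> a) (\<lambda>x\<in>carrier B. \<Oplus>l\<in>I. \<phi> l x)"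
    unfolding opadd_def by (intro restrict_ext) (use insert in \<open>simp add: B.finsum_insert Pi_iff\<close>)
  show ?case unfolding eq by (intro opadd_hom0 insert.IH insert.prems) auto
qed

lemma symb_sum:
  assumes "finite I" "\<And>l. l \<in> I \<Longrightarrow> order_le (Suc j) (\<phi> l)"
  shows "\<exists>\<psi>. order_le (Suc j) \<psi> \<and>
    (\<forall>fs\<in>tuples A (Suc i). \<forall>x\<in>carrier B. symb \<psi> fs x = (\<Oplus>l\<in>I. symb (\<phi> l) fs x))"
  using assms
proof (induction I rule: finite_induct)
  case empty
  have "symb opzero fs x = \<zero>" if "fs \<in> tuples A (Suc i)" "x \<in> carrier B" for fs x
    using that by (simp add: symb_apply ads_opzero tuples_iff B.minus_eq)
  then show ?case using order_le_opzero by (intro exI[of _ opzero]) simp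
next
  case (insert a I)
  then obtain \<psi> where \<psi>: "order_le (Suc j) \<psi>"
    "\<And>fs x. fs \<in> tuples A (Suc i) \<Longrightarrow> x \<in> carrier B \<Longrightarrow> symb \<psi> fs x = (\<Oplus>l\<in>I. symb (\<phi> l) fs x)" by auto
  have a: "order_le (Suc j) (\<phi> a)" using insert.prems by simp
  have cl: "symb (\<phi> l) fs x \<in> carrier B" if "l \<in> insert a I" "fs \<in> tuples A (Suc i)" "x \<in> carrier B" for l fs x
    using that order_leD(1)[OF insert.prems[OF that(1)]] by (simp add: tuples_iff)
  show ?case
  proof (intro exI[of _ "opadd (\<phi> a) \<psi>"] conjI ballI)
    show "order_le (Suc j) (opadd (\<phi> a) \<psi>)" by (rule order_le_closed(1)[OF a \<psi>(1)])
    fix fs x assume fs: "fs \<in> tuples A (Suc i)" and x: "x \<in> carrier B"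
    show "symb (opadd (\<phi> a) \<psi>) fs x = (\<Oplus>l\<in>insert a I. symb (\<phi> l) fs x)"
      using symb_opadd[OF order_leD(1)[OF a] order_leD(1)[OF \<psi>(1)] _ x, of fs] fs x insert.hyps cl \<psi>(2)[OF fs x]
      by (simp add: tuples_iff B.finsum_insert Pi_iff)
  qed
qed

definition opcomp where "opcomp Y \<phi> = (\<lambda>x\<in>carrier B. Y (\<phi> x))"

lemma opcomp_hom0 [simp]:
  assumes "Y \<in> hom0" "\<phi> \<in> hom0"
  shows "opcomp Y \<phi> \<in> hom0"
proof (rule hom0I)
  show "snd (opcomp Y \<phi> (emb0 a)) = \<zero>\<^bsub>P\<^esub>" if "a \<in> carrier A" for a
    using that assms hom0_emb0[OF assms(1), of "fst (\<phi> (emb0 a))"] hom0_emb0_eq[OF assms(2) that]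
    by (simp add: opcomp_def)
  show "fst (opcomp Y \<phi> (emb1 p)) = \<zero>\<^bsub>A\<^esub>" if "p \<in> carrier P" for p
    using that assms hom0_emb1[OF assms(1), of "snd (\<phi> (emb1 p))"] hom0_emb1_eq[OF assms(2) that]
    by (simp add: opcomp_def)
qed (use assms in \<open>auto simp: opcomp_def hom0_add hom0_scalar\<close>)

lemma ad_opcomp:
  assumes Y: "der_op Y" and \<phi>: "\<phi> \<in> hom0" and f: "f \<in> carrier A"
  shows "ad f (opcomp Y \<phi>) = opadd (opcomp Y (ad f \<phi>)) (opsmult (fst (Y (emb0 f))) \<phi>)"
proof (rule op_eqI)
  note h = der_opD(1)[OF Y]
  fix x assume x: "x \<in> carrier B"
  define u v where "u = Y (\<phi> (emb0 f \<otimes> x))" and "v = emb0 f \<otimes> Y (\<phi> x)"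
  define c where "c = \<phi> x \<otimes> Y (emb0 f)"
  have cl: "u \<in> carrier B" "v \<in> carrier B" "c \<in> carrier B" using h \<phi> f x by (auto simp: u_def v_def c_def)
  have "Y (\<phi> (emb0 f \<otimes> x) \<ominus> emb0 f \<otimes> \<phi> x) = u \<ominus> Y (emb0 f \<otimes> \<phi> x)"
    using h \<phi> f x by (simp add: B.minus_eq hom0_add hom0_minus u_def)
  also have "\<dots> = u \<ominus> (v \<oplus> c)" using der_opD(2)[OF Y f] \<phi> x by (simp add: v_def c_def)
  finally have "opcomp Y (ad f \<phi>) x = u \<ominus> (v \<oplus> c)" using x by (simp add: opcomp_def ad_apply)
  moreover have "opsmult (fst (Y (emb0 f))) \<phi> x = c"
    using hom0_emb0_eq[OF h f] x h \<phi> f by (simp add: c_def B.m_comm)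
  moreover have "ad f (opcomp Y \<phi>) x = u \<ominus> v" using x f h \<phi> by (simp add: ad_apply opcomp_def u_def v_def)
  moreover have "u \<ominus> v = (u \<ominus> (v \<oplus> c)) \<oplus> c"
    using cl by (simp add: B.minus_eq B.minus_add B.a_assoc B.l_neg)
  ultimately show "ad f (opcomp Y \<phi>) x = opadd (opcomp Y (ad f \<phi>)) (opsmult (fst (Y (emb0 f))) \<phi>) x"
    using x by simp
qed (auto simp: opcomp_def)

lemma order_le_SucI:
  assumes "\<psi> \<in> hom0" "\<And>f. f \<in> carrier A \<Longrightarrow> order_le j (ad f \<psi>)"
  shows "order_le (Suc j) \<psi>"
  unfolding order_le_def
proof (intro conjI ballI)
  fix fs assume "fs \<in> tuples A (Suc j)"
  then obtain f gs where fs: "fs = f # gs" "f \<in> carrier A" "gs \<in> tuples A j"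
    by (cases fs) (auto simp: tuples_iff)
  then have "is_mult (ads gs (ad f \<psi>))" using assms(2) unfolding order_le_def by blast
  then show "is_mult (ads fs \<psi>)" using fs by simp
qed (rule assms)

text \<open>
  By \<open>ad f (Y \<circ> \<phi>) = Y \<circ> ad f \<phi> + Y(f) \<phi>\<close>, the commutator is composed of operators covered by
  the induction hypothesis.
\<close>

lemma order_le_opcomp:
  assumes Y: "der_op Y"
  shows "order_le j \<phi> \<Longrightarrow> order_le (Suc j) (opcomp Y \<phi>)"
proof (induction j arbitrary: \<phi>)
  case 0
  note h = order_leD(1)[OF 0] der_opD(1)[OF Y]
  have m: "is_mult \<phi>"
  proof -
    have "[] \<in> tuples A 0" by (simp add: tuples_iff)
    then show ?thesis using 0 unfolding order_le_def by (metis ads.simps(1))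
  qed
  show ?case
  proof (rule order_le_SucI)
    show "opcomp Y \<phi> \<in> hom0" using h by simp
    fix f assume f: "f \<in> carrier A"
    have "opcomp Y (ad f \<phi>) = opzero"
      unfolding is_mult_ad_zero[OF h(1) m f] opcomp_def opzero_def
      by (intro restrict_ext) (simp add: hom0_zero[OF h(2)])
    then show "order_le 0 (ad f (opcomp Y \<phi>))"
      unfolding ad_opcomp[OF Y h(1) f]
      using order_le_closed(1)[OF order_le_opzero order_le_closed(2)[OF 0, of "fst (Y (emb0 f))"]] f h by simp
  qed
next
  case (Suc j)
  note h = order_leD(1)[OF Suc.prems] der_opD(1)[OF Y]
  show ?case
  proof (rule order_le_SucI)
    show "opcomp Y \<phi> \<in> hom0" using h by simp
    fix f assume f: "f \<in> carrier A"
    show "order_le (Suc j) (ad f (opcomp Y \<phi>))"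
      unfolding ad_opcomp[OF Y h(1) f]
      by (rule order_le_closed(1)[OF Suc.IH[OF order_le_ad[OF Suc.prems f]] order_le_closed(2)[OF Suc.prems]])
        (use f h in simp)
  qed
qed

text \<open>The sum of \<open>Y(f\<^sub>i) F(f\<^sub>1, \<dots>, f\<^sub>i omitted, \<dots>, f\<^sub>n)\<close> over \<open>i\<close>.\<close>

fun omit_sum where
  "omit_sum Y [] F = \<zero>"
| "omit_sum Y (f # fs) F = Y (emb0 f) \<otimes> F fs \<oplus> omit_sum Y fs (\<lambda>gs. F (f # gs))"

lemma omit_sum_closed:
  assumes "Y \<in> hom0" "set fs \<subseteq> carrier A"
    "\<And>gs. set gs \<subseteq> carrier A \<Longrightarrow> Suc (length gs) = length fs \<Longrightarrow> F gs \<in> carrier B"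
  shows "omit_sum Y fs F \<in> carrier B"
  using assms by (induction fs arbitrary: F) auto

lemma omit_sum_cong:
  assumes "\<And>gs. set gs \<subseteq> carrier A \<Longrightarrow> Suc (length gs) = length fs \<Longrightarrow> F gs = G gs" "set fs \<subseteq> carrier A"
  shows "omit_sum Y fs F = omit_sum Y fs G"
  using assms
proof (induction fs arbitrary: F G)
  case (Cons f fs)
  have fs: "f \<in> carrier A" "set fs \<subseteq> carrier A" using Cons.prems(2) by simp_all
  have "F fs = G fs" by (rule Cons.prems(1)) (simp_all add: fs)
  moreover have "omit_sum Y fs (\<lambda>gs. F (f # gs)) = omit_sum Y fs (\<lambda>gs. G (f # gs))"
  proof (rule Cons.IH[OF _ fs(2)])
    show "F (f # gs) = G (f # gs)" if "set gs \<subseteq> carrier A" "Suc (length gs) = length fs" for gs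
      by (rule Cons.prems(1)) (simp_all add: fs that)
  qed
  ultimately show ?case by (simp only: omit_sum.simps)
qed simp

lemma omit_sum_scale:
  assumes "Y \<in> hom0" "set fs \<subseteq> carrier A" "c \<in> carrier B"
    "\<And>gs. set gs \<subseteq> carrier A \<Longrightarrow> Suc (length gs) = length fs \<Longrightarrow> F gs \<in> carrier B"
  shows "omit_sum Y fs (\<lambda>gs. c \<otimes> F gs) = c \<otimes> omit_sum Y fs F"
  using assms
proof (induction fs arbitrary: F)
  case (Cons f fs)
  have "omit_sum Y fs (\<lambda>gs. c \<otimes> F (f # gs)) = c \<otimes> omit_sum Y fs (\<lambda>gs. F (f # gs))"
    using Cons.prems by (intro Cons.IH) auto
  moreover have "omit_sum Y fs (\<lambda>gs. F (f # gs)) \<in> carrier B"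
    using Cons.prems by (intro omit_sum_closed) auto
  moreover have "F fs \<in> carrier B" using Cons.prems by auto
  ultimately show ?case using Cons.prems by (simp add: B.r_distr B.m_lcomm)
qed simp

text \<open>
  The Leibniz rule for iterated commutators: each function \<open>f\<^sub>i\<close> acts either on \<open>\<phi>\<close> or on \<open>Y\<close>. The terms in
  which two functions act on \<open>Y\<close> vanish, because \<open>ad f Y\<close> is the multiplication by \<open>Y(f)\<close>.
\<close>

lemma symb_opcomp:
  assumes Y: "der_op Y" and x: "x \<in> carrier B"
  shows "order_le (length fs) \<phi> \<Longrightarrow> set fs \<subseteq> carrier A \<Longrightarrow>
    symb (opcomp Y \<phi>) fs x = ads fs \<phi> \<one> \<otimes> Y x \<oplus> omit_sum Y fs (\<lambda>gs. symb \<phi> gs x)"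
proof (induction fs arbitrary: \<phi>)
  case Nil
  note h = order_leD(1)[OF Nil(1)] der_opD(1)[OF Y]
  define s where "s = fst (\<phi> \<one>)"
  have s: "s \<in> carrier A" "\<phi> \<one> = emb0 s"
    using h hom0_emb0_eq[OF h(1), of "\<one>\<^bsub>A\<^esub>"] by (auto simp: s_def emb_one)
  have "[] \<in> tuples A (length [])" by (simp add: tuples_iff)
  then have "\<phi> x = x \<otimes> \<phi> \<one>" using order_leD(2)[OF Nil(1) _ x, of "[]"] by (simp only: ads.simps)
  then have "\<phi> x = emb0 s \<otimes> x" using s x by (simp add: B.m_comm)
  then have "symb (opcomp Y \<phi>) [] x = (emb0 s \<otimes> Y x \<oplus> x \<otimes> Y (emb0 s)) \<ominus> x \<otimes> Y (emb0 s)"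
    using x s der_opD(2)[OF Y s(1) x] by (simp add: symb_apply opcomp_def)
  also have "\<dots> = emb0 s \<otimes> Y x" using s x h by (simp add: B.minus_eq B.a_assoc B.r_neg)
  finally show ?case using s x h by simp
next
  case (Cons f fs)
  note h = order_leD(1)[OF Cons.prems(1)] der_opD(1)[OF Y]
  have f: "f \<in> carrier A" "set fs \<subseteq> carrier A" using Cons.prems by auto
  have o: "order_le (length fs) (ad f \<phi>)" using order_le_ad Cons.prems f by simp
  have "symb (opcomp Y \<phi>) (f # fs) x
      = symb (opadd (opcomp Y (ad f \<phi>)) (opsmult (fst (Y (emb0 f))) \<phi>)) fs x"
    by (simp add: symb_Cons ad_opcomp[OF Y h(1) f(1)])
  also have "\<dots> = symb (opcomp Y (ad f \<phi>)) fs x \<oplus> emb0 (fst (Y (emb0 f))) \<otimes> symb \<phi> fs x"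
    using h f x by (simp add: symb_opadd symb_opsmult)
  also have "emb0 (fst (Y (emb0 f))) = Y (emb0 f)" by (rule hom0_emb0_eq[OF h(2) f(1), symmetric])
  also have "symb (opcomp Y (ad f \<phi>)) fs x = ads fs (ad f \<phi>) \<one> \<otimes> Y x \<oplus> omit_sum Y fs (\<lambda>gs. symb (ad f \<phi>) gs x)"
    by (rule Cons.IH[OF o f(2)])
  also have "(ads fs (ad f \<phi>) \<one> \<otimes> Y x \<oplus> omit_sum Y fs (\<lambda>gs. symb (ad f \<phi>) gs x)) \<oplus> Y (emb0 f) \<otimes> symb \<phi> fs x
      = ads fs (ad f \<phi>) \<one> \<otimes> Y x \<oplus> (Y (emb0 f) \<otimes> symb \<phi> fs x \<oplus> omit_sum Y fs (\<lambda>gs. symb (ad f \<phi>) gs x))"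
    using h f x by (simp add: B.a_ac omit_sum_closed)
  finally show ?case by (simp add: symb_Cons)
qed

context
  fixes w :: 'f and m :: nat and y :: "nat \<Rightarrow> 'f" and Y :: "nat \<Rightarrow> 'f \<times> 'p \<Rightarrow> 'f \<times> 'p"
  assumes fr: "frame w m y Y"
begin

lemma B_derivation_slot:
  assumes T: "sym_der (Suc j) T" and gs: "gs \<in> tuples A j" and x: "x \<in> carrier B"
  shows "B_derivation (\<lambda>f. T (f # gs) x)"
  unfolding B_derivation_def
proof (intro conjI ballI allI)
  show "T (f # gs) x \<in> carrier B" if "f \<in> carrier A" for f
    using sym_derD(1)[OF T, of "f # gs"] gs x that by (simp add: tuples_iff)
qed (rule sym_derD_slot[OF T gs _ x]; assumption)+

lemma B_derivation_last:
  assumes T: "sym_der j T" and fs: "fs \<in> tuples A j"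
  shows "B_derivation (\<lambda>g. T fs (emb0 g))"
  unfolding B_derivation_def
proof (intro conjI ballI allI)
  note h = sym_derD(1)[OF T fs]
  show "T fs (emb0 f) \<in> carrier B" if "f \<in> carrier A" for f using h that by simp
  show "T fs (emb0 (f \<oplus>\<^bsub>A\<^esub> g)) = T fs (emb0 f) \<oplus> T fs (emb0 g)" if "f \<in> carrier A" "g \<in> carrier A" for f g
    using h that by (simp add: emb0_add hom0_add)
  show "T fs (emb0 (r \<odot>\<^bsub>A\<^esub> f)) = scalar r \<otimes> T fs (emb0 f)" if "f \<in> carrier A" for r f
    using h that by (simp add: emb0_smult hom0_scalar)
  show "T fs (emb0 (f \<otimes>\<^bsub>A\<^esub> g)) = emb0 f \<otimes> T fs (emb0 g) \<oplus> emb0 g \<otimes> T fs (emb0 f)"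
    if "f \<in> carrier A" "g \<in> carrier A" for f g
    using that sym_derD(2)[OF T fs that(1), of "emb0 g"] by (simp add: emb0_mult)
qed

text \<open>
  For each of the arguments, the frame property restores the argument that was replaced
  by \<open>y\<^sub>l\<close>. By symmetry it may be put back in its original place, so all summands are equal.
\<close>

lemma sum_omit_sum:
  assumes T: "sym_der (Suc j) T" and x: "x \<in> carrier B"
  shows "length hs + length fs = Suc j \<Longrightarrow> set hs \<subseteq> carrier A \<Longrightarrow> set fs \<subseteq> carrier A \<Longrightarrow>
    (\<Oplus>l\<in>{..m}. omit_sum (Y l) fs (\<lambda>gs. T (y l # hs @ gs) x))
      = scalar (length fs) \<otimes> (emb0 w \<otimes> T (hs @ fs) x)"
proof (induction fs arbitrary: hs)
  case Nil
  have "scalar 0 = \<zero>" using scalar_hom(1)[of 0 0] by (metis B.add.r_cancel_one' add_0 emb_closed(3))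
  moreover have "T hs x \<in> carrier B" using sym_derD(1)[OF T, of hs] Nil x by (simp add: tuples_iff)
  ultimately show ?case using frameD(1)[OF fr] by (simp add: B.finsum_zero)
next
  case (Cons f fs)
  have f: "f \<in> carrier A" and hf: "hs @ fs \<in> tuples A j" using Cons.prems by (auto simp: tuples_iff)
  have cl: "T (g # gs) x \<in> carrier B" if "g \<in> carrier A" "gs \<in> tuples A j" for g gs
    using sym_derD(1)[OF T, of "g # gs"] that x by (simp add: tuples_iff)
  have "(\<Oplus>l\<in>{..m}. omit_sum (Y l) (f # fs) (\<lambda>gs. T (y l # hs @ gs) x))
    = (\<Oplus>l\<in>{..m}. Y l (emb0 f) \<otimes> T (y l # hs @ fs) x \<oplus> omit_sum (Y l) fs (\<lambda>gs. T (y l # (hs @ [f]) @ gs) x))"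
    by simp
  also have "\<dots> = (\<Oplus>l\<in>{..m}. Y l (emb0 f) \<otimes> T (y l # hs @ fs) x) \<oplus>
      (\<Oplus>l\<in>{..m}. omit_sum (Y l) fs (\<lambda>gs. T (y l # (hs @ [f]) @ gs) x))"
  proof (rule B.finsum_addf)
    show "(\<lambda>l. Y l (emb0 f) \<otimes> T (y l # hs @ fs) x) \<in> {..m} \<rightarrow> carrier B"
      using frameD(2,4)[OF fr] f cl hf by auto
    show "(\<lambda>l. omit_sum (Y l) fs (\<lambda>gs. T (y l # (hs @ [f]) @ gs) x)) \<in> {..m} \<rightarrow> carrier B"
      using frameD(2,4)[OF fr] f Cons.prems by (intro Pi_I omit_sum_closed cl) (auto simp: tuples_iff)
  qed
  also have "(\<Oplus>l\<in>{..m}. Y l (emb0 f) \<otimes> T (y l # hs @ fs) x) = emb0 w \<otimes> T (f # hs @ fs) x"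
    by (rule frameD(5)[OF fr B_derivation_slot[OF T hf x] f, symmetric])
  also have "T (f # hs @ fs) = T (hs @ f # fs)"
    by (rule sym_derD(3)[OF T]) (use Cons.prems in \<open>auto simp: tuples_iff\<close>)
  also have "(\<Oplus>l\<in>{..m}. omit_sum (Y l) fs (\<lambda>gs. T (y l # (hs @ [f]) @ gs) x))
      = scalar (length fs) \<otimes> (emb0 w \<otimes> T ((hs @ [f]) @ fs) x)"
    using Cons.prems by (intro Cons.IH) auto
  also have "emb0 w \<otimes> T (hs @ f # fs) x \<oplus> scalar (length fs) \<otimes> (emb0 w \<otimes> T ((hs @ [f]) @ fs) x)
      = (\<one> \<oplus> scalar (length fs)) \<otimes> (emb0 w \<otimes> T (hs @ f # fs) x)"
    using frameD(1)[OF fr] sym_derD(1)[OF T, of "hs @ f # fs"] Cons.prems x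
    by (simp add: tuples_iff B.l_distr)
  also have "\<one> \<oplus> scalar (length fs) = scalar (length (f # fs))"
    using scalar_hom(1)[of 1 "length fs"] by (simp add: scalar_hom(3))
  finally show ?case .
qed

text \<open>
  The family \<open>\<nabla>T = \<Sum>\<^sub>l \<sigma>(\<cdot>, y\<^sub>l) Y\<^sub>l\<close>. The Der-operators \<open>Y\<^sub>l\<close> define a connection, which lifts the vector field
  \<open>\<sigma>(f\<^sub>1, \<dots>, f\<^sub>j, \<cdot>)\<close> to a Der-operator with the same symbol, up to the factor \<open>w\<close>.
\<close>

definition connection where
  "connection T fs = (\<lambda>x\<in>carrier B. \<Oplus>l\<in>{..m}. T fs (emb0 (y l)) \<otimes> Y l x)"

lemma connection_emb0:
  assumes "sym_der j T" "fs \<in> tuples A j" "g \<in> carrier A"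
  shows "connection T fs (emb0 g) = emb0 w \<otimes> T fs (emb0 g)"
proof -
  have "(\<Oplus>l\<in>{..m}. T fs (emb0 (y l)) \<otimes> Y l (emb0 g)) = (\<Oplus>l\<in>{..m}. Y l (emb0 g) \<otimes> T fs (emb0 (y l)))"
    using sym_derD(1)[OF assms(1,2)] frameD(2,4)[OF fr] assms(3)
    by (intro B.finsum_cong') (auto simp: B.m_comm)
  then show ?thesis
    using frameD(5)[OF fr B_derivation_last[OF assms(1,2)] assms(3)] assms(3) by (simp add: connection_def)
qed

lemma sym_der_connection:
  assumes T: "sym_der (Suc j) T"
  shows "sym_der (Suc j) (connection T)"
proof -
  note F = frameD(2,4)[OF fr]
  have tc: "T fs (emb0 (y l)) \<in> carrier B" if "fs \<in> tuples A (Suc j)" "l \<le> m" for fs l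
    using sym_derD(1)[OF T that(1)] F that(2) by simp
  have h: "connection T fs \<in> hom0" if fs: "fs \<in> tuples A (Suc j)" for fs
  proof -
    have eq: "connection T fs = (\<lambda>x\<in>carrier B. \<Oplus>l\<in>{..m}. opsmult (fst (T fs (emb0 (y l)))) (Y l) x)"
      unfolding connection_def
      by (intro restrict_ext B.finsum_cong')
        (use F tc[OF fs] hom0_emb0_eq[OF sym_derD(1)[OF T fs]] in auto)
    show ?thesis unfolding eq by (rule hom0_sum) (use F tc[OF fs] in auto)
  qed
  have slots: "connection T ((f \<oplus>\<^bsub>A\<^esub> g) # gs) x = connection T (f # gs) x \<oplus> connection T (g # gs) x"
    "connection T ((f \<otimes>\<^bsub>A\<^esub> g) # gs) x = emb0 f \<otimes> connection T (g # gs) x \<oplus> emb0 g \<otimes> connection T (f # gs) x"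
    "connection T (f # gs) (emb0 g) = connection T (g # gs) (emb0 f)"
    "connection T ((r \<odot>\<^bsub>A\<^esub> f) # gs) x = scalar r \<otimes> connection T (f # gs) x"
    if gs: "gs \<in> tuples A j" and f: "f \<in> carrier A" "g \<in> carrier A" and x: "x \<in> carrier B" for gs f g x r
  proof -
    have tup: "h # gs \<in> tuples A (Suc j)" if "h \<in> carrier A" for h using gs that by (simp add: tuples_iff)
    note sl = sym_derD_slot[OF T gs]
    have Pi: "(\<lambda>l. T (h # gs) (emb0 (y l)) \<otimes> Y l x) \<in> {..m} \<rightarrow> carrier B" if "h \<in> carrier A" for h
      using tc[OF tup[OF that]] F x by auto
    have "(\<Oplus>l\<in>{..m}. T ((f \<oplus>\<^bsub>A\<^esub> g) # gs) (emb0 (y l)) \<otimes> Y l x)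
        = (\<Oplus>l\<in>{..m}. T (f # gs) (emb0 (y l)) \<otimes> Y l x \<oplus> T (g # gs) (emb0 (y l)) \<otimes> Y l x)"
      using F x f tc[OF tup] by (intro B.finsum_cong') (auto simp: sl(1) B.l_distr)
    then show "connection T ((f \<oplus>\<^bsub>A\<^esub> g) # gs) x = connection T (f # gs) x \<oplus> connection T (g # gs) x"
      using x B.finsum_addf[OF Pi[OF f(1)] Pi[OF f(2)]] by (simp add: connection_def)
    have "(\<Oplus>l\<in>{..m}. T ((f \<otimes>\<^bsub>A\<^esub> g) # gs) (emb0 (y l)) \<otimes> Y l x)
        = (\<Oplus>l\<in>{..m}. emb0 f \<otimes> (T (g # gs) (emb0 (y l)) \<otimes> Y l x) \<oplus> emb0 g \<otimes> (T (f # gs) (emb0 (y l)) \<otimes> Y l x))"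
      using F x f tc[OF tup] by (intro B.finsum_cong') (auto simp: sl(2) B.l_distr B.m_assoc)
    also have "\<dots> = (\<Oplus>l\<in>{..m}. emb0 f \<otimes> (T (g # gs) (emb0 (y l)) \<otimes> Y l x)) \<oplus>
        (\<Oplus>l\<in>{..m}. emb0 g \<otimes> (T (f # gs) (emb0 (y l)) \<otimes> Y l x))"
      using f Pi by (intro B.finsum_addf) (auto simp: Pi_iff)
    finally show "connection T ((f \<otimes>\<^bsub>A\<^esub> g) # gs) x = emb0 f \<otimes> connection T (g # gs) x \<oplus> emb0 g \<otimes> connection T (f # gs) x"
      using x f B.finsum_rdistr[OF finite_atMost _ Pi[OF f(2)], of "emb0 f"]
        B.finsum_rdistr[OF finite_atMost _ Pi[OF f(1)], of "emb0 g"] by (simp add: connection_def)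
    show "connection T (f # gs) (emb0 g) = connection T (g # gs) (emb0 f)"
      using connection_emb0[OF T tup[OF f(1)] f(2)] connection_emb0[OF T tup[OF f(2)] f(1)] sl(3)[OF f(1) x f(2)]
      by (simp only:)
    have "(\<Oplus>l\<in>{..m}. T ((r \<odot>\<^bsub>A\<^esub> f) # gs) (emb0 (y l)) \<otimes> Y l x)
        = (\<Oplus>l\<in>{..m}. scalar r \<otimes> (T (f # gs) (emb0 (y l)) \<otimes> Y l x))"
      using F x f tc[OF tup] by (intro B.finsum_cong') (auto simp: sl(4) B.m_assoc)
    then show "connection T ((r \<odot>\<^bsub>A\<^esub> f) # gs) x = scalar r \<otimes> connection T (f # gs) x"
      using x B.finsum_rdistr[OF finite_atMost _ Pi[OF f(1)], of "scalar r"] by (simp add: connection_def)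
  qed
  have der: "connection T fs (emb0 g \<otimes> x) = emb0 g \<otimes> connection T fs x \<oplus> x \<otimes> connection T fs (emb0 g)"
    if fs: "fs \<in> tuples A (Suc j)" and g: "g \<in> carrier A" and x: "x \<in> carrier B" for fs g x
  proof -
    have Pi: "(\<lambda>l. T fs (emb0 (y l)) \<otimes> Y l z) \<in> {..m} \<rightarrow> carrier B" if "z \<in> carrier B" for z
      using tc[OF fs] F that by auto
    have "(\<Oplus>l\<in>{..m}. T fs (emb0 (y l)) \<otimes> Y l (emb0 g \<otimes> x))
        = (\<Oplus>l\<in>{..m}. emb0 g \<otimes> (T fs (emb0 (y l)) \<otimes> Y l x) \<oplus> x \<otimes> (T fs (emb0 (y l)) \<otimes> Y l (emb0 g)))"
      using F x g tc[OF fs] der_opD(2)[OF frameD(3)[OF fr] g x]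
      by (intro B.finsum_cong') (auto simp: B.r_distr B.m_lcomm)
    also have "\<dots> = (\<Oplus>l\<in>{..m}. emb0 g \<otimes> (T fs (emb0 (y l)) \<otimes> Y l x)) \<oplus>
        (\<Oplus>l\<in>{..m}. x \<otimes> (T fs (emb0 (y l)) \<otimes> Y l (emb0 g)))"
      using g x Pi by (intro B.finsum_addf) (auto simp: Pi_iff)
    finally show ?thesis
      using x g B.finsum_rdistr[OF finite_atMost _ Pi[OF x], of "emb0 g"]
        B.finsum_rdistr[OF finite_atMost x Pi[of "emb0 g"]] by (simp add: connection_def)
  qed
  have sym: "connection T fs = connection T gs"
    if "fs \<in> tuples A (Suc j)" "gs \<in> tuples A (Suc j)" "mset fs = mset gs" for fs gs
    using sym_derD(3)[OF T that] by (simp add: connection_def)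
  show ?thesis
    unfolding sym_der_def
  proof (intro conjI[of "\<forall>fs\<in>tuples A (Suc j). connection T fs \<in> hom0"]
      conjI[of "\<forall>fs\<in>tuples A (Suc j). _ fs"] ballI)
    show "connection T fs \<in> hom0" if "fs \<in> tuples A (Suc j)" for fs by (rule h[OF that])
    show "connection T fs (emb0 g \<otimes> x) = emb0 g \<otimes> connection T fs x \<oplus> x \<otimes> connection T fs (emb0 g)"
      if "fs \<in> tuples A (Suc j)" "g \<in> carrier A" "x \<in> carrier B" for fs g x by (rule der[OF that])
    show "mset fs = mset gs \<longrightarrow> connection T fs = connection T gs"
      if "fs \<in> tuples A (Suc j)" "gs \<in> tuples A (Suc j)" for fs gs
      using sym[OF that] by (rule impI)
    show "\<forall>gs. Suc (length gs) = Suc j \<and> set gs \<subseteq> carrier A \<longrightarrow>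
        (\<forall>f\<in>carrier A. \<forall>g\<in>carrier A. \<forall>x\<in>carrier B.
          connection T ((f \<oplus>\<^bsub>A\<^esub> g) # gs) x = connection T (f # gs) x \<oplus> connection T (g # gs) x \<and>
          connection T ((f \<otimes>\<^bsub>A\<^esub> g) # gs) x = emb0 f \<otimes> connection T (g # gs) x \<oplus> emb0 g \<otimes> connection T (f # gs) x \<and>
          connection T (f # gs) (emb0 g) = connection T (g # gs) (emb0 f)) \<and>
        (\<forall>r. \<forall>f\<in>carrier A. \<forall>x\<in>carrier B. connection T ((r \<odot>\<^bsub>A\<^esub> f) # gs) x = scalar r \<otimes> connection T (f # gs) x)"
    proof (intro allI impI)
      fix gs assume "Suc (length gs) = Suc j \<and> set gs \<subseteq> carrier A"
      then have gs: "gs \<in> tuples A j" by (simp add: tuples_iff)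
      show "(\<forall>f\<in>carrier A. \<forall>g\<in>carrier A. \<forall>x\<in>carrier B.
          connection T ((f \<oplus>\<^bsub>A\<^esub> g) # gs) x = connection T (f # gs) x \<oplus> connection T (g # gs) x \<and>
          connection T ((f \<otimes>\<^bsub>A\<^esub> g) # gs) x = emb0 f \<otimes> connection T (g # gs) x \<oplus> emb0 g \<otimes> connection T (f # gs) x \<and>
          connection T (f # gs) (emb0 g) = connection T (g # gs) (emb0 f)) \<and>
        (\<forall>r. \<forall>f\<in>carrier A. \<forall>x\<in>carrier B. connection T ((r \<odot>\<^bsub>A\<^esub> f) # gs) x = scalar r \<otimes> connection T (f # gs) x)"
        by (intro conjI ballI allI; rule slots[OF gs]; assumption)
    qed
  qed
qed

text \<open>
  If \<open>\<phi>\<^sub>l\<close> has the symbol \<open>c T(y\<^sub>l, \<cdot>)\<close>, then the Leibniz rule gives the symbol of \<open>\<Sum>\<^sub>l Y\<^sub>l \<circ> \<phi>\<^sub>l\<close>. The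
  term \<open>c \<nabla>T\<close> arises when \<open>Y\<^sub>l\<close> acts on the element of \<open>B\<close>, the term \<open>c w T\<close> when it acts on one of the \<open>j + 1\<close>
  functions.
\<close>

lemma prolongation:
  assumes T: "sym_der (Suc j) T" and c: "c \<in> carrier B"
    and IH: "\<And>l. l \<le> m \<Longrightarrow> \<exists>\<phi>. order_le (Suc j) \<phi> \<and>
      (\<forall>gs\<in>tuples A j. \<forall>x\<in>carrier B. symb \<phi> gs x = c \<otimes> T (y l # gs) x)"
  shows "\<exists>\<phi>. order_le (Suc (Suc j)) \<phi> \<and> (\<forall>fs\<in>tuples A (Suc j). \<forall>x\<in>carrier B.
    symb \<phi> fs x = c \<otimes> (connection T fs x \<oplus> scalar (Suc j) \<otimes> (emb0 w \<otimes> T fs x)))"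
proof -
  note F = frameD(2,4)[OF fr]
  obtain \<phi> where \<phi>: "\<And>l. l \<le> m \<Longrightarrow> order_le (Suc j) (\<phi> l)"
    "\<And>l gs x. l \<le> m \<Longrightarrow> gs \<in> tuples A j \<Longrightarrow> x \<in> carrier B \<Longrightarrow> symb (\<phi> l) gs x = c \<otimes> T (y l # gs) x"
    using IH by metis
  have "\<exists>\<psi>. order_le (Suc (Suc j)) \<psi> \<and> (\<forall>fs\<in>tuples A (Suc j). \<forall>x\<in>carrier B.
      symb \<psi> fs x = (\<Oplus>l\<in>{..m}. symb (opcomp (Y l) (\<phi> l)) fs x))"
    by (rule symb_sum) (auto intro: order_le_opcomp[OF frameD(3)[OF fr]] \<phi>(1))
  then obtain \<psi> where \<psi>: "order_le (Suc (Suc j)) \<psi>"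
    "\<And>fs x. fs \<in> tuples A (Suc j) \<Longrightarrow> x \<in> carrier B \<Longrightarrow>
      symb \<psi> fs x = (\<Oplus>l\<in>{..m}. symb (opcomp (Y l) (\<phi> l)) fs x)" by blast
  have "symb \<psi> fs x = c \<otimes> (connection T fs x \<oplus> scalar (Suc j) \<otimes> (emb0 w \<otimes> T fs x))"
    if fs: "fs \<in> tuples A (Suc j)" and x: "x \<in> carrier B" for fs x
  proof -
    have fs': "length fs = Suc j" "set fs \<subseteq> carrier A" using fs by (auto simp: tuples_iff)
    have cl: "T (y l # gs) x \<in> carrier B" if "l \<le> m" "gs \<in> tuples A j" for l gs
      using sym_derD(1)[OF T, of "y l # gs"] F that x by (simp add: tuples_iff)
    have os: "omit_sum (Y l) fs (\<lambda>gs. T (y l # [] @ gs) x) \<in> carrier B" if "l \<le> m" for l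
      using F that fs' by (intro omit_sum_closed) (auto simp: tuples_iff intro!: cl)
    have tc: "T fs (emb0 (y l)) \<otimes> Y l x \<in> carrier B" if "l \<le> m" for l
      using sym_derD(1)[OF T fs] F that x by simp
    have each: "symb (opcomp (Y l) (\<phi> l)) fs x
        = c \<otimes> (T fs (emb0 (y l)) \<otimes> Y l x \<oplus> omit_sum (Y l) fs (\<lambda>gs. T (y l # [] @ gs) x))" if l: "l \<le> m" for l
    proof -
      \<comment> \<open>the coefficient of \<open>Y\<^sub>l\<close> is the symbol of \<open>\<phi>\<^sub>l\<close> with one of the functions in the last place\<close>
      obtain f gs where fg: "fs = f # gs" "f \<in> carrier A" "gs \<in> tuples A j"
        using fs by (cases fs) (auto simp: tuples_iff)
      note h = order_leD(1)[OF \<phi>(1)[OF l]]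
      have perm: "ads fs (\<phi> l) = ads (gs @ [f]) (\<phi> l)"
        by (rule ads_perm[OF h]) (use fg fs' in auto)
      have "ads fs (\<phi> l) \<one> = symb (\<phi> l) gs (emb0 f)"
        unfolding perm by (rule symb_emb0[OF h fg(2), symmetric]) (use fg(3) in \<open>simp add: tuples_iff\<close>)
      also have "\<dots> = c \<otimes> T (y l # gs) (emb0 f)" using \<phi>(2)[OF l fg(3)] fg(2) by simp
      also have "T (y l # gs) (emb0 f) = T fs (emb0 (y l))"
        using sym_derD_slot(3)[OF T fg(3) F(1)[OF l] x fg(2)] fg(1) by simp
      finally have 1: "ads fs (\<phi> l) \<one> = c \<otimes> T fs (emb0 (y l))" .
      have "omit_sum (Y l) fs (\<lambda>gs. symb (\<phi> l) gs x) = omit_sum (Y l) fs (\<lambda>gs. c \<otimes> T (y l # [] @ gs) x)"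
        using fs' \<phi>(2)[OF l _ x] by (intro omit_sum_cong) (auto simp: tuples_iff)
      also have "\<dots> = c \<otimes> omit_sum (Y l) fs (\<lambda>gs. T (y l # [] @ gs) x)"
        using F(2)[OF l] fs' c by (intro omit_sum_scale) (auto simp: tuples_iff intro!: cl[OF l])
      finally have 2: "omit_sum (Y l) fs (\<lambda>gs. symb (\<phi> l) gs x) = c \<otimes> omit_sum (Y l) fs (\<lambda>gs. T (y l # [] @ gs) x)" .
      have "order_le (length fs) (\<phi> l)" using \<phi>(1)[OF l] fs' by simp
      from symb_opcomp[OF frameD(3)[OF fr l] x this fs'(2)]
      show ?thesis unfolding 1 2
        using c os[OF l] sym_derD(1)[OF T fs] F l x by (simp only: B.r_distr B.m_assoc hom0_closed emb_closed B.m_closed)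
    qed
    have "symb \<psi> fs x = (\<Oplus>l\<in>{..m}. c \<otimes> (T fs (emb0 (y l)) \<otimes> Y l x \<oplus> omit_sum (Y l) fs (\<lambda>gs. T (y l # [] @ gs) x)))"
      unfolding \<psi>(2)[OF fs x] by (rule B.finsum_cong') (use each c tc os in auto)
    also have "\<dots> = c \<otimes> (\<Oplus>l\<in>{..m}. T fs (emb0 (y l)) \<otimes> Y l x \<oplus> omit_sum (Y l) fs (\<lambda>gs. T (y l # [] @ gs) x))"
      using c tc os by (intro B.finsum_rdistr[symmetric]) auto
    also have "(\<Oplus>l\<in>{..m}. T fs (emb0 (y l)) \<otimes> Y l x \<oplus> omit_sum (Y l) fs (\<lambda>gs. T (y l # [] @ gs) x))
      = connection T fs x \<oplus> (\<Oplus>l\<in>{..m}. omit_sum (Y l) fs (\<lambda>gs. T (y l # [] @ gs) x))"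
      unfolding connection_def restrict_apply'[OF x] using tc os by (intro B.finsum_addf) auto
    also have "(\<Oplus>l\<in>{..m}. omit_sum (Y l) fs (\<lambda>gs. T (y l # [] @ gs) x)) = scalar (Suc j) \<otimes> (emb0 w \<otimes> T fs x)"
      using sum_omit_sum[OF T x, of "[]" fs] fs' by simp
    finally show ?thesis .
  qed
  then show ?thesis using \<psi>(1) by blast
qed

lemma emb0_pow: "a \<in> carrier A \<Longrightarrow> emb0 (a [^]\<^bsub>A\<^esub> (Suc N)) = emb0 (a [^]\<^bsub>A\<^esub> N) \<otimes> emb0 a"
  by (simp add: emb0_mult R.nat_pow_closed)

text \<open>
  In the step from \<open>j\<close> to \<open>k = j + 1\<close>, with \<open>c = w\<^bsup>2j\<^esup>\<close>, the prolongations for \<open>T\<close> and \<open>\<nabla>T\<close> have the symbols \<open>c (\<nabla>T + k w T)\<close> and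
  \<open>c (\<nabla>\<nabla>T + k w \<nabla>T) = (k + 1) c w \<nabla>T\<close>. Multiplying the former by \<open>(k + 1) w\<close> and subtracting the latter
  leaves \<open>k (k + 1) c w\<^sup>2 T\<close>.
\<close>

theorem local_surjectivity:
  "sym_der j T \<Longrightarrow> \<exists>\<phi>. order_le (Suc j) \<phi> \<and>
     (\<forall>fs\<in>tuples A j. \<forall>x\<in>carrier B. symb \<phi> fs x = emb0 (w [^]\<^bsub>A\<^esub> (2 * j)) \<otimes> T fs x)"
proof (induction j arbitrary: T)
  case 0
  have nil: "[] \<in> tuples A 0" by (simp add: tuples_iff)
  note h = sym_derD(1)[OF 0 nil] and d = sym_derD(2)[OF 0 nil]
  have T1: "T [] \<one> = \<zero>"
  proof -
    have "T [] \<one> = T [] \<one> \<oplus> T [] \<one>" using d[of "\<one>\<^bsub>A\<^esub>" \<one>] h by (simp add: emb_one)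
    then show ?thesis using h by (metis B.add.r_cancel_one' B.one_closed hom0_closed)
  qed
  \<comment> \<open>without arguments, \<open>T\<close> itself is an operator of order one\<close>
  have "order_le (Suc 0) (T [])"
  proof (rule order_le_SucI[OF h])
    fix g assume g: "g \<in> carrier A"
    have a: "ad g (T []) x = x \<otimes> T [] (emb0 g)" if x: "x \<in> carrier B" for x
    proof -
      have "ad g (T []) x = (emb0 g \<otimes> T [] x \<oplus> x \<otimes> T [] (emb0 g)) \<ominus> emb0 g \<otimes> T [] x"
        using d[OF g x] x by (simp add: ad_apply)
      also have "\<dots> = (emb0 g \<otimes> T [] x \<oplus> \<ominus> (emb0 g \<otimes> T [] x)) \<oplus> x \<otimes> T [] (emb0 g)"
        using h g x by (simp add: B.minus_eq B.a_ac)
      finally show ?thesis using h g x by (simp add: B.r_neg)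
    qed
    have "is_mult (ad g (T []))" unfolding is_mult_def using a h g by (simp add: B.l_one)
    then show "order_le 0 (ad g (T []))" using h g by (simp add: order_le_def tuples_iff)
  qed
  moreover have "symb (T []) fs x = emb0 (w [^]\<^bsub>A\<^esub> (2 * 0 :: nat)) \<otimes> T fs x"
    if "fs \<in> tuples A 0" "x \<in> carrier B" for fs x
  proof -
    have "fs = []" using that by (simp add: tuples_iff)
    then show ?thesis using that h T1 by (simp add: symb_apply emb_one B.minus_eq)
  qed
  ultimately show ?case by blast
next
  case (Suc j)
  note F = frameD(2,4)[OF fr] and w = frameD(1)[OF fr]
  have contract: "sym_der j (\<lambda>gs. S (y l # gs))" if S: "sym_der (Suc j) S" and l: "l \<le> m" for S l
  proof -
    have tup: "y l # fs \<in> tuples A (Suc j)" if "fs \<in> tuples A j" for fs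
      using that F(1)[OF l] by (simp add: tuples_iff)
    have swap: "S (y l # f # gs) = S (f # y l # gs)" if "f # gs \<in> tuples A j" for f gs
      by (rule sym_derD(3)[OF S]) (use that F(1)[OF l] in \<open>auto simp: tuples_iff\<close>)
    have c: "y l # gs \<in> tuples A j" if "Suc (length gs) = j" "set gs \<subseteq> carrier A" for gs
      using that F(1)[OF l] by (simp add: tuples_iff)
    have A': "S (y l # (f \<oplus>\<^bsub>A\<^esub> g) # gs) x = S (y l # f # gs) x \<oplus> S (y l # g # gs) x"
      "S (y l # (f \<otimes>\<^bsub>A\<^esub> g) # gs) x = emb0 f \<otimes> S (y l # g # gs) x \<oplus> emb0 g \<otimes> S (y l # f # gs) x"
      "S (y l # f # gs) (emb0 g) = S (y l # g # gs) (emb0 f)"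
      "S (y l # (r \<odot>\<^bsub>A\<^esub> f) # gs) x = scalar r \<otimes> S (y l # f # gs) x"
      if gs: "Suc (length gs) = j" "set gs \<subseteq> carrier A" and f: "f \<in> carrier A" "g \<in> carrier A" and x: "x \<in> carrier B"
      for gs f g x r
    proof -
      have sw: "S (y l # h # gs) = S (h # y l # gs)" if "h \<in> carrier A" for h
        using gs that by (intro swap) (simp add: tuples_iff)
      note sl = sym_derD_slot[OF S c[OF gs] f(1) x]
      show "S (y l # (f \<oplus>\<^bsub>A\<^esub> g) # gs) x = S (y l # f # gs) x \<oplus> S (y l # g # gs) x"
        "S (y l # (f \<otimes>\<^bsub>A\<^esub> g) # gs) x = emb0 f \<otimes> S (y l # g # gs) x \<oplus> emb0 g \<otimes> S (y l # f # gs) x"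
        "S (y l # f # gs) (emb0 g) = S (y l # g # gs) (emb0 f)"
        "S (y l # (r \<odot>\<^bsub>A\<^esub> f) # gs) x = scalar r \<otimes> S (y l # f # gs) x"
        using sl f by (simp_all only: sw R.a_closed R.m_closed smult_A_closed)
    qed
    show ?thesis
      unfolding sym_der_def
    proof (intro conjI[of "\<forall>fs\<in>tuples A j. S (y l # fs) \<in> hom0"] conjI[of "\<forall>fs\<in>tuples A j. _ fs"] ballI)
      show "S (y l # fs) \<in> hom0" if "fs \<in> tuples A j" for fs by (rule sym_derD(1)[OF S tup[OF that]])
      show "S (y l # fs) (emb0 g \<otimes> x) = emb0 g \<otimes> S (y l # fs) x \<oplus> x \<otimes> S (y l # fs) (emb0 g)"
        if "fs \<in> tuples A j" "g \<in> carrier A" "x \<in> carrier B" for fs g x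
        by (rule sym_derD(2)[OF S tup[OF that(1)] that(2,3)])
      show "mset fs = mset gs \<longrightarrow> S (y l # fs) = S (y l # gs)" if "fs \<in> tuples A j" "gs \<in> tuples A j" for fs gs
        using sym_derD(3)[OF S tup[OF that(1)] tup[OF that(2)]] by simp
    qed ((intro allI impI conjI ballI; elim conjE), (rule A'; assumption)+)
  qed
  define c where "c = emb0 (w [^]\<^bsub>A\<^esub> (2 * j))"
  have c: "c \<in> carrier B" using w by (simp add: c_def)
  have IH: "\<exists>\<phi>. order_le (Suc j) \<phi> \<and> (\<forall>gs\<in>tuples A j. \<forall>x\<in>carrier B. symb \<phi> gs x = c \<otimes> S (y l # gs) x)"
    if "sym_der (Suc j) S" "l \<le> m" for S l
    unfolding c_def by (rule Suc.IH[OF contract[OF that]])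
  note T = Suc.prems and T' = sym_der_connection[OF Suc.prems]
  define k where "k = scalar (real (Suc j))"
  define k1 where "k1 = scalar (real (Suc (Suc j)))"
  define W where "W = emb0 w"
  have cl: "k \<in> carrier B" "k1 \<in> carrier B" "W \<in> carrier B" using w by (auto simp: k_def k1_def W_def)
  have k1: "k1 = \<one> \<oplus> k"
    using scalar_hom(1)[of 1 "real (Suc j)"] by (simp add: k_def k1_def scalar_hom(3))
  obtain \<phi>1 where \<phi>1: "order_le (Suc (Suc j)) \<phi>1" "\<And>fs x. fs \<in> tuples A (Suc j) \<Longrightarrow> x \<in> carrier B \<Longrightarrow>
      symb \<phi>1 fs x = c \<otimes> (connection T fs x \<oplus> k \<otimes> (W \<otimes> T fs x))"
    using prolongation[OF T c IH[OF T]] unfolding k_def W_def by blast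
  obtain \<phi>2 where \<phi>2: "order_le (Suc (Suc j)) \<phi>2" "\<And>fs x. fs \<in> tuples A (Suc j) \<Longrightarrow> x \<in> carrier B \<Longrightarrow>
      symb \<phi>2 fs x = c \<otimes> (connection (connection T) fs x \<oplus> k \<otimes> (W \<otimes> connection T fs x))"
    using prolongation[OF T' c IH[OF T']] unfolding k_def W_def by blast
  define q where "q = inverse (real (Suc j) * real (Suc (Suc j)))"
  define \<phi> where "\<phi> = opsmult (fst (scalar q)) (opadd (opsmult (fst (k1 \<otimes> W)) \<phi>1) (opneg \<phi>2))"
  have kW: "emb0 (fst (k1 \<otimes> W)) = k1 \<otimes> W" "emb0 (fst (scalar q)) = scalar q"
    using cl scalar_closed by (simp_all add: k1_def W_def scalar_def emb0_mult w)
  have "order_le (Suc (Suc j)) \<phi>"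
    unfolding \<phi>_def using cl by (intro order_le_closed \<phi>1(1) \<phi>2(1)) auto
  moreover have "symb \<phi> fs x = emb0 (w [^]\<^bsub>A\<^esub> (2 * Suc j)) \<otimes> T fs x"
    if fs: "fs \<in> tuples A (Suc j)" and x: "x \<in> carrier B" for fs x
  proof -
    define t u where "t = T fs x" and "u = connection T fs x"
    have tu: "t \<in> carrier B" "u \<in> carrier B"
      using sym_derD(1)[OF T fs] sym_derD(1)[OF T' fs] x by (auto simp: t_def u_def)
    have fs': "set fs \<subseteq> carrier A" using fs by (simp add: tuples_iff)
    have "connection (connection T) fs x = W \<otimes> u"
    proof -
      \<comment> \<open>the operator \<open>\<nabla>\<close> depends on the values of \<open>T\<close> on \<open>A\<close> only, and there \<open>\<nabla>T = w T\<close>\<close>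
      have "(\<Oplus>l\<in>{..m}. connection T fs (emb0 (y l)) \<otimes> Y l x) = (\<Oplus>l\<in>{..m}. W \<otimes> (T fs (emb0 (y l)) \<otimes> Y l x))"
        using F x cl sym_derD(1)[OF T fs] connection_emb0[OF T fs]
        by (intro B.finsum_cong') (auto simp: B.m_assoc W_def)
      also have "\<dots> = W \<otimes> (\<Oplus>l\<in>{..m}. T fs (emb0 (y l)) \<otimes> Y l x)"
        using F x cl sym_derD(1)[OF T fs] by (intro B.finsum_rdistr[symmetric]) auto
      finally show ?thesis using x by (simp add: connection_def[of "connection T"] connection_def[of T] u_def)
    qed
    then have s2: "symb \<phi>2 fs x = c \<otimes> (k1 \<otimes> (W \<otimes> u))"
      using \<phi>2(2)[OF fs x] cl tu by (simp add: k1 B.l_distr u_def[symmetric])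
    have s1: "symb \<phi>1 fs x = c \<otimes> (u \<oplus> k \<otimes> (W \<otimes> t))"
      using \<phi>1(2)[OF fs x] by (simp add: t_def u_def)
    note h = order_leD(1)[OF \<phi>1(1)] order_leD(1)[OF \<phi>2(1)]
    have "symb \<phi> fs x = scalar q \<otimes> (k1 \<otimes> W \<otimes> symb \<phi>1 fs x \<oplus> \<ominus> symb \<phi>2 fs x)"
      unfolding \<phi>_def using h fs' x cl kW by (simp add: symb_opsmult symb_opadd symb_opneg)
    also have "k1 \<otimes> W \<otimes> symb \<phi>1 fs x = c \<otimes> (k1 \<otimes> (W \<otimes> u)) \<oplus> k1 \<otimes> (k \<otimes> (c \<otimes> (W \<otimes> (W \<otimes> t))))"
      unfolding s1 using c cl tu by (simp add: B.r_distr B.m_ac)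
    also have "(c \<otimes> (k1 \<otimes> (W \<otimes> u)) \<oplus> k1 \<otimes> (k \<otimes> (c \<otimes> (W \<otimes> (W \<otimes> t))))) \<oplus> \<ominus> symb \<phi>2 fs x
        = (c \<otimes> (k1 \<otimes> (W \<otimes> u)) \<oplus> \<ominus> (c \<otimes> (k1 \<otimes> (W \<otimes> u)))) \<oplus> k1 \<otimes> (k \<otimes> (c \<otimes> (W \<otimes> (W \<otimes> t))))"
      unfolding s2 using c cl tu by (simp add: B.a_ac)
    also have "\<dots> = k1 \<otimes> (k \<otimes> (c \<otimes> (W \<otimes> (W \<otimes> t))))" using c cl tu by (simp add: B.r_neg)
    also have "scalar q \<otimes> \<dots> = (scalar q \<otimes> (k1 \<otimes> k)) \<otimes> (c \<otimes> (W \<otimes> (W \<otimes> t)))"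
      using c cl tu by (simp add: B.m_assoc)
    also have "scalar q \<otimes> (k1 \<otimes> k) = \<one>"
    proof -
      have "q * (real (Suc (Suc j)) * real (Suc j)) = 1"
      proof -
        have "real (Suc j) * real (Suc (Suc j)) \<noteq> 0" unfolding mult_eq_0_iff by simp
        then show ?thesis
          unfolding q_def mult.commute[of "real (Suc (Suc j))"] by (rule left_inverse)
      qed
      then show ?thesis unfolding k_def k1_def scalar_hom(2)[symmetric] by (simp only: scalar_hom(3))
    qed
    also have "\<one> \<otimes> (c \<otimes> (W \<otimes> (W \<otimes> t))) = emb0 (w [^]\<^bsub>A\<^esub> (2 * Suc j)) \<otimes> t"
      using c cl tu w by (simp add: emb0_pow[OF w] c_def W_def B.m_assoc emb0_mult)
    finally show ?thesis by (simp add: t_def)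
  qed
  ultimately show ?case by blast
qed

end

text \<open>
  An abstract form of \<open>g \<mapsto> \<Sum>\<^sub>i \<rho>\<^sub>i g\<^sub>i\<close> for a locally finite family of functions \<open>\<rho>\<^sub>i\<close>. Only linearity over
  \<open>B\<close> and compatibility with the grading matter for commutators.
\<close>

definition gluing where
  "gluing L \<longleftrightarrow>
     (\<forall>g. (\<forall>i::nat. g i \<in> carrier B) \<longrightarrow> L g \<in> carrier B \<and>
        (\<forall>h. (\<forall>i. h i \<in> carrier B) \<longrightarrow> L (\<lambda>i. g i \<oplus> h i) = L g \<oplus> L h) \<and>
        (\<forall>z\<in>carrier B. L (\<lambda>i. z \<otimes> g i) = z \<otimes> L g) \<and>
        ((\<forall>i. fst (g i) = \<zero>\<^bsub>A\<^esub>) \<longrightarrow> fst (L g) = \<zero>\<^bsub>A\<^esub>) \<and>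
        ((\<forall>i. snd (g i) = \<zero>\<^bsub>P\<^esub>) \<longrightarrow> snd (L g) = \<zero>\<^bsub>P\<^esub>))"

lemma gluingD:
  assumes "gluing L" "\<And>i. g i \<in> carrier B"
  shows "L g \<in> carrier B" "(\<And>i. h i \<in> carrier B) \<Longrightarrow> L (\<lambda>i. g i \<oplus> h i) = L g \<oplus> L h"
    "z \<in> carrier B \<Longrightarrow> L (\<lambda>i. z \<otimes> g i) = z \<otimes> L g"
    "(\<And>i. fst (g i) = \<zero>\<^bsub>A\<^esub>) \<Longrightarrow> fst (L g) = \<zero>\<^bsub>A\<^esub>" "(\<And>i. snd (g i) = \<zero>\<^bsub>P\<^esub>) \<Longrightarrow> snd (L g) = \<zero>\<^bsub>P\<^esub>"
  using assms unfolding gluing_def by blast+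

lemma gluing_minus:
  assumes "gluing L" "\<And>i. g i \<in> carrier B" "\<And>i. h i \<in> carrier B"
  shows "L (\<lambda>i. g i \<ominus> h i) = L g \<ominus> L h"
proof -
  have "g i \<ominus> h i = g i \<oplus> \<ominus> \<one> \<otimes> h i" for i
    using assms(2,3)[of i] by (simp add: B.minus_eq B.l_minus)
  then have 1: "(\<lambda>i. g i \<ominus> h i) = (\<lambda>i. g i \<oplus> \<ominus> \<one> \<otimes> h i)" by (rule ext)
  have 2: "L (\<lambda>i. g i \<oplus> \<ominus> \<one> \<otimes> h i) = L g \<oplus> L (\<lambda>i. \<ominus> \<one> \<otimes> h i)"
    by (rule gluingD(2)[OF assms(1,2)]) (use assms(3) in simp)
  have 3: "L (\<lambda>i. \<ominus> \<one> \<otimes> h i) = \<ominus> \<one> \<otimes> L h"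
    by (rule gluingD(3)[OF assms(1,3)]) simp
  have "L h \<in> carrier B" by (rule gluingD(1)[OF assms(1,3)])
  then show ?thesis unfolding 1 2 3 by (simp add: B.minus_eq B.l_minus)
qed

lemma hom0_gluing:
  assumes L: "gluing L" and \<phi>: "\<And>i. \<phi> i \<in> hom0"
  shows "(\<lambda>x\<in>carrier B. L (\<lambda>i. \<phi> i x)) \<in> hom0"
proof (rule hom0I)
  fix x assume x: "x \<in> carrier B"
  note G = gluingD[OF L, of "\<lambda>i. \<phi> i x"]
  show "(\<lambda>x\<in>carrier B. L (\<lambda>i. \<phi> i x)) x \<in> carrier B" using G(1) \<phi> x by simp
  show "(\<lambda>x\<in>carrier B. L (\<lambda>i. \<phi> i x)) (x \<oplus> z)
      = (\<lambda>x\<in>carrier B. L (\<lambda>i. \<phi> i x)) x \<oplus> (\<lambda>x\<in>carrier B. L (\<lambda>i. \<phi> i x)) z" if "z \<in> carrier B" for z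
    using G(2)[of "\<lambda>i. \<phi> i z"] \<phi> x that by (simp add: hom0_add)
  show "(\<lambda>x\<in>carrier B. L (\<lambda>i. \<phi> i x)) (scalar r \<otimes> x) = scalar r \<otimes> (\<lambda>x\<in>carrier B. L (\<lambda>i. \<phi> i x)) x" for r
    using G(3)[of "scalar r"] \<phi> x by (simp add: hom0_scalar)
next
  show "snd ((\<lambda>x\<in>carrier B. L (\<lambda>i. \<phi> i x)) (emb0 a)) = \<zero>\<^bsub>P\<^esub>" if "a \<in> carrier A" for a
    using gluingD(5)[OF L, of "\<lambda>i. \<phi> i (emb0 a)"] that \<phi> by (simp add: hom0_emb0)
  show "fst ((\<lambda>x\<in>carrier B. L (\<lambda>i. \<phi> i x)) (emb1 p)) = \<zero>\<^bsub>A\<^esub>" if "p \<in> carrier P" for p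
    using gluingD(4)[OF L, of "\<lambda>i. \<phi> i (emb1 p)"] that \<phi> by (simp add: hom0_emb1)
qed simp

lemma ads_gluing:
  assumes L: "gluing L"
  shows "(\<And>i. \<phi> i \<in> hom0) \<Longrightarrow> set fs \<subseteq> carrier A \<Longrightarrow>
    ads fs (\<lambda>x\<in>carrier B. L (\<lambda>i. \<phi> i x)) = (\<lambda>x\<in>carrier B. L (\<lambda>i. ads fs (\<phi> i) x))"
proof (induction fs arbitrary: \<phi>)
  case Nil then show ?case by simp
next
  case (Cons f fs)
  have f: "f \<in> carrier A" using Cons.prems by simp
  have ad: "ad f (\<lambda>x\<in>carrier B. L (\<lambda>i. \<phi> i x)) = (\<lambda>x\<in>carrier B. L (\<lambda>i. ad f (\<phi> i) x))"
  proof (rule op_eqI)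
    fix x assume x: "x \<in> carrier B"
    have "L (\<lambda>i. ad f (\<phi> i) x) = L (\<lambda>i. \<phi> i (emb0 f \<otimes> x) \<ominus> emb0 f \<otimes> \<phi> i x)"
      using x by (simp add: ad_apply)
    also have "\<dots> = L (\<lambda>i. \<phi> i (emb0 f \<otimes> x)) \<ominus> L (\<lambda>i. emb0 f \<otimes> \<phi> i x)"
      using Cons.prems x f by (intro gluing_minus[OF L]) auto
    also have "L (\<lambda>i. emb0 f \<otimes> \<phi> i x) = emb0 f \<otimes> L (\<lambda>i. \<phi> i x)"
      using Cons.prems x f by (intro gluingD(3)[OF L]) auto
    finally show "ad f (\<lambda>x\<in>carrier B. L (\<lambda>i. \<phi> i x)) x = (\<lambda>x\<in>carrier B. L (\<lambda>i. ad f (\<phi> i) x)) x"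
      using x f by (simp add: ad_apply)
  qed auto
  have "ads fs (\<lambda>x\<in>carrier B. L (\<lambda>i. ad f (\<phi> i) x)) = (\<lambda>x\<in>carrier B. L (\<lambda>i. ads fs (ad f (\<phi> i)) x))"
    by (rule Cons.IH) (use Cons.prems f in auto)
  then show ?case unfolding ads.simps ad .
qed

text \<open>
  Gluing is linear over \<open>B\<close>, so it commutes with commutators and with the passage to the symbol.
\<close>

theorem global_surjectivity:
  assumes frames: "\<And>i::nat. \<exists>m y Y. frame (w i) m y Y" and L: "gluing L"
    and unit: "\<And>z. z \<in> carrier B \<Longrightarrow> L (\<lambda>i. emb0 (w i [^]\<^bsub>A\<^esub> (2 * j)) \<otimes> z) = z"
    and T: "sym_der j T"
  shows "\<exists>\<phi>. order_le (Suc j) \<phi> \<and> (\<forall>fs\<in>tuples A j. \<forall>x\<in>carrier B. symb \<phi> fs x = T fs x)"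
proof -
  have "\<exists>\<phi>. order_le (Suc j) \<phi> \<and>
     (\<forall>fs\<in>tuples A j. \<forall>x\<in>carrier B. symb \<phi> fs x = emb0 (w i [^]\<^bsub>A\<^esub> (2 * j)) \<otimes> T fs x)" for i
    using frames[of i] local_surjectivity[OF _ T] by blast
  then obtain \<phi> where \<phi>: "\<And>i. order_le (Suc j) (\<phi> i)" "\<And>i fs x. fs \<in> tuples A j \<Longrightarrow> x \<in> carrier B \<Longrightarrow>
      symb (\<phi> i) fs x = emb0 (w i [^]\<^bsub>A\<^esub> (2 * j)) \<otimes> T fs x" by metis
  have h: "\<phi> i \<in> hom0" for i using order_leD(1)[OF \<phi>(1)] .
  define \<psi> where "\<psi> = (\<lambda>x\<in>carrier B. L (\<lambda>i. \<phi> i x))"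
  have ads: "ads fs \<psi> x = L (\<lambda>i. ads fs (\<phi> i) x)" if "set fs \<subseteq> carrier A" "x \<in> carrier B" for fs x
    using ads_gluing[OF L h that(1)] that(2) by (simp add: \<psi>_def)
  have "order_le (Suc j) \<psi>"
    unfolding order_le_def
  proof (intro conjI ballI)
    show "\<psi> \<in> hom0" unfolding \<psi>_def by (rule hom0_gluing[OF L h])
    fix fs assume fs: "fs \<in> tuples A (Suc j)"
    then have fs': "set fs \<subseteq> carrier A" by (simp add: tuples_iff)
    have "ads fs \<psi> x = x \<otimes> ads fs \<psi> \<one>" if x: "x \<in> carrier B" for x
    proof -
      have "ads fs \<psi> x = L (\<lambda>i. x \<otimes> ads fs (\<phi> i) \<one>)"
        unfolding ads[OF fs' x] using order_leD(2)[OF \<phi>(1) fs x] by presburger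
      also have "\<dots> = x \<otimes> L (\<lambda>i. ads fs (\<phi> i) \<one>)"
        using h fs' x by (intro gluingD(3)[OF L]) auto
      finally show ?thesis unfolding ads[OF fs' B.one_closed] .
    qed
    then show "is_mult (ads fs \<psi>)" unfolding is_mult_def by blast
  qed
  moreover have "symb \<psi> fs x = T fs x" if fs: "fs \<in> tuples A j" and x: "x \<in> carrier B" for fs x
  proof -
    have fs': "set fs \<subseteq> carrier A" using fs by (simp add: tuples_iff)
    have "symb \<psi> fs x = L (\<lambda>i. ads fs (\<phi> i) x) \<ominus> x \<otimes> L (\<lambda>i. ads fs (\<phi> i) \<one>)"
      using ads[OF fs' x] ads[OF fs' B.one_closed] x by (simp add: symb_apply)
    also have "x \<otimes> L (\<lambda>i. ads fs (\<phi> i) \<one>) = L (\<lambda>i. x \<otimes> ads fs (\<phi> i) \<one>)"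
      using h fs' x by (intro gluingD(3)[OF L, symmetric]) auto
    also have "L (\<lambda>i. ads fs (\<phi> i) x) \<ominus> L (\<lambda>i. x \<otimes> ads fs (\<phi> i) \<one>)
        = L (\<lambda>i. ads fs (\<phi> i) x \<ominus> x \<otimes> ads fs (\<phi> i) \<one>)"
      using h fs' x by (intro gluing_minus[OF L, symmetric]) auto
    also have "\<dots> = L (\<lambda>i. emb0 (w i [^]\<^bsub>A\<^esub> (2 * j)) \<otimes> T fs x)"
      using \<phi>(2)[OF fs x] x by (simp add: symb_apply)
    also have "\<dots> = T fs x" using sym_derD(1)[OF T fs] x by (intro unit) simp
    finally show ?thesis .
  qed
  ultimately show ?thesis by blast
qed

end

section \<open>Calculus of \<open>C\<^sup>k\<close> functions on open subsets of Euclidean space\<close>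

lemma Euclidean_space_eq_top_of_set:
  "Euclidean_space n = top_of_set (topspace (Euclidean_space n))"
  by (simp add: Euclidean_space_def euclidean_product_topology)

lemma continuous_map_Euclidean_iff:
  assumes "U \<subseteq> topspace (Euclidean_space n)"
  shows "continuous_map (subtopology (Euclidean_space n) U) euclideanreal f \<longleftrightarrow> continuous_on U f"
  by (metis Euclidean_space_eq_top_of_set assms continuous_map_iff_continuous inf.absorb_iff2 subtopology_subtopology)

lemma mem_Euclidean_space: "x \<in> topspace (Euclidean_space n) \<longleftrightarrow> (\<forall>i\<ge>n. x i = 0)"
  by (simp add: topspace_Euclidean_space)

lemma fun_upd_mem_Euclidean_space:
  assumes "x \<in> topspace (Euclidean_space n)" "i < n"
  shows "x(i := t) \<in> topspace (Euclidean_space n)"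
  using assms by (auto simp: mem_Euclidean_space)

lemma openin_Euclidean_iff:
  "openin (Euclidean_space n) U \<longleftrightarrow> (\<exists>T. open T \<and> U = topspace (Euclidean_space n) \<inter> T)"
  by (subst Euclidean_space_eq_top_of_set) (simp add: openin_open)

definition open_box :: "nat \<Rightarrow> (nat \<Rightarrow> real) \<Rightarrow> real \<Rightarrow> (nat \<Rightarrow> real) set" where
  "open_box n c r = {x \<in> topspace (Euclidean_space n). \<forall>i<n. \<bar>x i - c i\<bar> < r}"

lemma openin_open_box: "openin (Euclidean_space n) (open_box n c r)"
proof -
  have "open {x. \<bar>x i - c i\<bar> < r}" for i
    by (auto intro!: open_Collect_less continuous_intros)
  then have "open (\<Inter>i<n. {x. \<bar>x i - c i\<bar> < r})" by auto
  moreover have "open_box n c r = topspace (Euclidean_space n) \<inter> (\<Inter>i<n. {x. \<bar>x i - c i\<bar> < r})"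
    by (auto simp: open_box_def)
  ultimately show ?thesis by (auto simp: openin_Euclidean_iff)
qed

lemma open_contains_box:
  assumes "openin (Euclidean_space n) U" "c \<in> U"
  obtains r where "r > 0" "open_box n c r \<subseteq> U"
proof -
  obtain T where T: "open T" "U = topspace (Euclidean_space n) \<inter> T"
    using assms by (auto simp: openin_Euclidean_iff)
  then have c: "c \<in> topspace (Euclidean_space n)" "c \<in> T" using assms by auto
  have "openin (product_topology (\<lambda>i. euclidean) UNIV) T"
    using T(1) by (simp add: euclidean_product_topology)
  then obtain X where X: "c \<in> Pi\<^sub>E UNIV X" "\<And>i. openin euclidean (X i)"
      "finite {i. X i \<noteq> topspace euclidean}" "Pi\<^sub>E UNIV X \<subseteq> T"
    using product_topology_open_contains_basis[of "\<lambda>_. euclidean" UNIV T c] c by auto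
  have "\<exists>e>0. \<forall>y. \<bar>y - c i\<bar> < e \<longrightarrow> y \<in> X i" for i
  proof -
    have "open (X i)" "c i \<in> X i" using X(1,2) by (auto simp: PiE_iff)
    then show ?thesis by (auto simp: open_dist dist_real_def)
  qed
  then obtain e where e: "\<And>i. e i > 0" "\<And>i y. \<bar>y - c i\<bar> < e i \<Longrightarrow> y \<in> X i" by metis
  define r where "r = Min (insert 1 (e ` {..<n}))"
  have r0: "r > 0" unfolding r_def using e by (subst Min_gr_iff) auto
  have r1: "r \<le> e i" if "i < n" for i unfolding r_def using that by (intro Min_le) auto
  have "open_box n c r \<subseteq> U"
  proof
    fix x assume x: "x \<in> open_box n c r"
    have "x i \<in> X i" for i
    proof (cases "i < n")
      case True
      then show ?thesis using x r1[OF True] e(2)[of "x i" i] by (force simp: open_box_def)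
    next
      case False
      then have "x i = c i" using x c by (auto simp: open_box_def mem_Euclidean_space)
      then show ?thesis using e by simp
    qed
    then show "x \<in> U" using x T X(4) by (auto simp: open_box_def)
  qed
  then show thesis using r0 that by blast
qed

lemma eventually_fun_upd_in_open:
  assumes "openin (Euclidean_space n) U" "x \<in> U" "i < n"
  shows "\<forall>\<^sub>F t in nhds (x i). x(i := t) \<in> U"
proof -
  have x: "x \<in> topspace (Euclidean_space n)" using assms openin_subset by blast
  obtain r where r: "r > 0" "open_box n x r \<subseteq> U" using assms open_contains_box by blast
  have "x(i := t) \<in> U" if "dist t (x i) < r" for t
    using that r x \<open>i < n\<close> by (intro subsetD[OF r(2)]) (auto simp: open_box_def fun_upd_mem_Euclidean_space dist_real_def)
  then show ?thesis using r by (auto simp: eventually_nhds_metric)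
qed

lemma C_on_continuous:
  assumes "openin (Euclidean_space n) U" "C_on n k U f"
  shows "continuous_on U f"
  using assms continuous_map_Euclidean_iff[of U n f] openin_subset by (cases k) auto

lemma partial_derivI:
  "((\<lambda>t. f (x(i := t))) has_real_derivative d) (at (x i)) \<Longrightarrow> partial_deriv i f x = d"
  unfolding partial_deriv_def by (rule DERIV_imp_deriv)

lemma C_on_partial_deriv:
  assumes "C_on n (Suc k) U f" "i < n"
  shows "C_on n k U (partial_deriv i f)"
    and "x \<in> U \<Longrightarrow> ((\<lambda>t. f (x(i := t))) has_real_derivative partial_deriv i f x) (at (x i))"
  using assms by (auto simp: partial_deriv_def DERIV_deriv_iff_field_differentiable)

lemma partial_deriv_cong:
  assumes "openin (Euclidean_space n) U" "x \<in> U" "i < n" "\<And>y. y \<in> U \<Longrightarrow> f y = g y"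
  shows "partial_deriv i f x = partial_deriv i g x"
  unfolding partial_deriv_def
proof (rule deriv_cong_ev)
  show "\<forall>\<^sub>F t in nhds (x i). f (x(i := t)) = g (x(i := t))"
    using eventually_fun_upd_in_open[OF assms(1-3)] by eventually_elim (simp add: assms)
qed auto

lemma C_on_cong_imp:
  assumes "openin (Euclidean_space n) U" "\<And>y. y \<in> U \<Longrightarrow> f y = g y" "C_on n k U f"
  shows "C_on n k U g"
  using assms(2,3)
proof (induction k arbitrary: f g)
  case 0
  then show ?case using assms(1)
    by (simp add: continuous_map_Euclidean_iff openin_subset cong: continuous_on_cong)
next
  case (Suc k)
  have "C_on n 0 U f" using Suc.prems by simp
  then have cont: "continuous_map (subtopology (Euclidean_space n) U) euclideanreal g"
    using Suc.prems assms(1)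
    by (simp add: continuous_map_Euclidean_iff openin_subset cong: continuous_on_cong)
  have "(\<lambda>t. g (x(i := t))) field_differentiable at (x i)" if "i < n" "x \<in> U" for i x
  proof -
    have "((\<lambda>t. f (x(i := t))) has_real_derivative partial_deriv i f x) (at (x i))"
      using C_on_partial_deriv Suc.prems that by blast
    moreover have "\<forall>\<^sub>F t in nhds (x i). f (x(i := t)) = g (x(i := t))"
      using eventually_fun_upd_in_open[OF assms(1) that(2,1)]
      by eventually_elim (rule Suc.prems)
    ultimately have "((\<lambda>t. g (x(i := t))) has_real_derivative partial_deriv i f x) (at (x i))"
      using DERIV_cong_ev[OF refl _ refl, of "\<lambda>t. f (x(i := t))" "\<lambda>t. g (x(i := t))" "x i"] by simp
    then show ?thesis unfolding field_differentiable_def by blast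
  qed
  moreover have "C_on n k U (partial_deriv i g)" if "i < n" for i
    by (rule Suc.IH[OF _ C_on_partial_deriv(1)[OF Suc.prems(2) that]])
      (rule partial_deriv_cong[OF assms(1) _ that Suc.prems(1)])
  ultimately show ?case using cont by simp
qed

text \<open>
  Avoids the choice of \<open>deriv\<close>: partial derivatives may be given by any functions \<open>d\<^sub>i\<close>.
\<close>

lemma C_on_SucI:
  assumes U: "openin (Euclidean_space n) U" and "continuous_on U f"
    and d: "\<And>i. i < n \<Longrightarrow> C_on n k U (d i)"
    and deriv: "\<And>i x. i < n \<Longrightarrow> x \<in> U \<Longrightarrow> ((\<lambda>t. f (x(i := t))) has_real_derivative d i x) (at (x i))"
  shows "C_on n (Suc k) U f"
proof -
  have "C_on n k U (partial_deriv i f)" if "i < n" for i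
    by (rule C_on_cong_imp[OF U _ d[OF that]]) (metis partial_derivI deriv that)
  moreover have "(\<lambda>t. f (x(i := t))) field_differentiable at (x i)" if "i < n" "x \<in> U" for i x
    unfolding field_differentiable_def using deriv[OF that] by (rule exI)
  ultimately show ?thesis using assms(1,2) by (simp add: continuous_map_Euclidean_iff openin_subset)
qed

lemma C_on_0I: "openin (Euclidean_space n) U \<Longrightarrow> continuous_on U f \<Longrightarrow> C_on n 0 U f"
  by (simp add: continuous_map_Euclidean_iff openin_subset)

lemma C_on_Suc_imp: "C_on n (Suc k) U f \<Longrightarrow> C_on n k U f"
proof (induction k arbitrary: f)
  case (Suc k)
  then have "\<forall>i<n. C_on n k U (partial_deriv i f)" by simp
  then show ?case using Suc.prems by simp
qed simp

lemma C_on_subset: "C_on n k U f \<Longrightarrow> V \<subseteq> U \<Longrightarrow> C_on n k V f"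
  by (induction k arbitrary: f) (auto intro: continuous_map_from_subtopology_mono)

lemma C_on_local:
  assumes "openin (Euclidean_space n) U"
    and "\<And>x. x \<in> U \<Longrightarrow> \<exists>V. openin (Euclidean_space n) V \<and> x \<in> V \<and> C_on n k V f"
  shows "C_on n k U f"
proof -
  have cont: "continuous_on U g" if *: "\<And>x. x \<in> U \<Longrightarrow> \<exists>V. openin (Euclidean_space n) V \<and> x \<in> V \<and> continuous_on V g"
    for g :: "(nat \<Rightarrow> real) \<Rightarrow> real"
  proof -
    have "\<exists>T. open T \<and> x \<in> T \<and> continuous_on (U \<inter> T) g" if "x \<in> U" for x
    proof -
      obtain V where "openin (Euclidean_space n) V" "x \<in> V" "continuous_on V g"
        using *[OF \<open>x \<in> U\<close>] by blast
      moreover then obtain T where "open T" "V = topspace (Euclidean_space n) \<inter> T"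
        by (auto simp: openin_Euclidean_iff)
      moreover have "U \<inter> T \<subseteq> topspace (Euclidean_space n) \<inter> T"
        using assms(1) openin_subset by fast
      ultimately show ?thesis by (metis IntD2 continuous_on_subset)
    qed
    moreover have "continuous (at x within U) g"
      if "x \<in> U" "open T" "x \<in> T" "continuous_on (U \<inter> T) g" for x T
    proof -
      have "at x within U = at x within (U \<inter> T)"
        using that by (intro at_within_nhd[of x T]) auto
      then show ?thesis using that by (simp add: continuous_on_eq_continuous_within)
    qed
    ultimately have "\<forall>x\<in>U. continuous (at x within U) g" by blast
    then show ?thesis by (simp add: continuous_on_eq_continuous_within)
  qed
  have cont': "continuous_on U f"
    if *: "\<And>x. x \<in> U \<Longrightarrow> \<exists>V. openin (Euclidean_space n) V \<and> x \<in> V \<and> C_on n k V f" for f k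
  proof (rule cont)
    fix x assume "x \<in> U"
    then obtain V where "openin (Euclidean_space n) V" "x \<in> V" "C_on n k V f" using * by metis
    then show "\<exists>V. openin (Euclidean_space n) V \<and> x \<in> V \<and> continuous_on V f"
      using C_on_continuous by metis
  qed
  show ?thesis using assms(2)
  proof (induction k arbitrary: f)
    case 0
    then show ?case by (intro C_on_0I[OF assms(1)] cont')
  next
    case (Suc k)
    show ?case
    proof (rule C_on_SucI[OF assms(1), where d = "\<lambda>i. partial_deriv i f"])
      show "continuous_on U f" using Suc.prems by (rule cont')
      show "C_on n k U (partial_deriv i f)" if "i < n" for i
      proof (rule Suc.IH)
        fix x assume "x \<in> U"
        then obtain V where "openin (Euclidean_space n) V" "x \<in> V" "C_on n (Suc k) V f"
          using Suc.prems by metis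
        then show "\<exists>V. openin (Euclidean_space n) V \<and> x \<in> V \<and> C_on n k V (partial_deriv i f)"
          using C_on_partial_deriv(1) that by metis
      qed
      show "((\<lambda>t. f (x(i := t))) has_real_derivative partial_deriv i f x) (at (x i))"
        if "i < n" "x \<in> U" for i x
      proof -
        obtain V where "x \<in> V" "C_on n (Suc k) V f" using Suc.prems \<open>x \<in> U\<close> by metis
        then show ?thesis using C_on_partial_deriv(2) that by metis
      qed
    qed
  qed
qed

declare C_on.simps(2) [simp del]

lemma C_on_const: "openin (Euclidean_space n) U \<Longrightarrow> C_on n k U (\<lambda>x. c)"
proof (induction k arbitrary: c)
  case 0 then show ?case by (intro C_on_0I) auto
next
  case (Suc k)
  then show ?case by (intro C_on_SucI[where d = "\<lambda>i x. 0"]) auto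
qed

lemma C_on_coordinate: "openin (Euclidean_space n) U \<Longrightarrow> C_on n k U (\<lambda>x. x j)"
proof (induction k)
  case 0 then show ?case
    by (intro C_on_0I continuous_on_subset[OF continuous_on_product_coordinates]) auto
next
  case (Suc k)
  show ?case
  proof (rule C_on_SucI[where d = "\<lambda>i x. if i = j then 1 else 0"])
    show "C_on n k U (\<lambda>x. if i = j then 1 else 0)" for i
      using C_on_const[OF Suc.prems, of k 1] C_on_const[OF Suc.prems, of k 0] by simp
    show "((\<lambda>t. (x(i := t)) j) has_real_derivative (if i = j then 1 else 0)) (at (x i))" for i x
      by auto
    show "continuous_on U (\<lambda>x. x j)"
      by (rule continuous_on_subset[OF continuous_on_product_coordinates]) auto
  qed (use Suc.prems in auto)
qed

lemma C_on_add:
  assumes U: "openin (Euclidean_space n) U" and "C_on n k U f" "C_on n k U g"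
  shows "C_on n k U (\<lambda>x. f x + g x)"
  using assms(2,3)
proof (induction k arbitrary: f g)
  case 0
  show ?case
    by (intro C_on_0I continuous_intros C_on_continuous[OF U "0.prems"(1)] C_on_continuous[OF U "0.prems"(2)] U)
next
  case (Suc k)
  show ?case
  proof (rule C_on_SucI[OF U, where d = "\<lambda>i x. partial_deriv i f x + partial_deriv i g x"])
    show "continuous_on U (\<lambda>x. f x + g x)"
      by (intro continuous_intros C_on_continuous[OF U Suc.prems(1)] C_on_continuous[OF U Suc.prems(2)])
    show "C_on n k U (\<lambda>x. partial_deriv i f x + partial_deriv i g x)" if "i < n" for i
      using Suc.prems that by (intro Suc.IH C_on_partial_deriv[of n k])
    show "((\<lambda>t. f (x(i := t)) + g (x(i := t))) has_real_derivative
        partial_deriv i f x + partial_deriv i g x) (at (x i))" if "i < n" "x \<in> U" for i x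
      by (rule DERIV_add[OF C_on_partial_deriv(2)[OF Suc.prems(1) that] C_on_partial_deriv(2)[OF Suc.prems(2) that]])
  qed
qed

lemma C_on_mult:
  assumes U: "openin (Euclidean_space n) U" and "C_on n k U f" "C_on n k U g"
  shows "C_on n k U (\<lambda>x. f x * g x)"
  using assms(2,3)
proof (induction k arbitrary: f g)
  case 0
  show ?case
    by (intro C_on_0I continuous_intros C_on_continuous[OF U "0.prems"(1)] C_on_continuous[OF U "0.prems"(2)] U)
next
  case (Suc k)
  show ?case
  proof (rule C_on_SucI[OF U, where d = "\<lambda>i x. partial_deriv i f x * g x + partial_deriv i g x * f x"])
    show "continuous_on U (\<lambda>x. f x * g x)"
      by (intro continuous_intros C_on_continuous[OF U Suc.prems(1)] C_on_continuous[OF U Suc.prems(2)])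
    show "C_on n k U (\<lambda>x. partial_deriv i f x * g x + partial_deriv i g x * f x)" if "i < n" for i
      using Suc.prems that by (intro C_on_add[OF U] Suc.IH C_on_partial_deriv[of n k] C_on_Suc_imp[of n k])
    show "((\<lambda>t. f (x(i := t)) * g (x(i := t))) has_real_derivative
        partial_deriv i f x * g x + partial_deriv i g x * f x) (at (x i))" if "i < n" "x \<in> U" for i x
      by (rule DERIV_cong[OF DERIV_mult[OF C_on_partial_deriv(2)[OF Suc.prems(1) that]
            C_on_partial_deriv(2)[OF Suc.prems(2) that]]]) simp
  qed
qed

lemma C_on_sum:
  assumes "openin (Euclidean_space n) U" "\<And>j. j \<in> J \<Longrightarrow> C_on n k U (f j)"
  shows "C_on n k U (\<lambda>x. \<Sum>j\<in>J. f j x)"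
  using assms by (induction J rule: infinite_finite_induct) (auto intro: C_on_const C_on_add)

text \<open>The digit stands for functions of one variable; \<open>k\<close> is the order of differentiability.\<close>

fun C1_on :: "nat \<Rightarrow> real set \<Rightarrow> (real \<Rightarrow> real) \<Rightarrow> bool" where
  "C1_on 0 S g \<longleftrightarrow> continuous_on S g"
| "C1_on (Suc k) S g \<longleftrightarrow> (\<exists>g'. (\<forall>t\<in>S. (g has_real_derivative g' t) (at t)) \<and> C1_on k S g')"

lemma C1_on_continuous: "C1_on k S g \<Longrightarrow> continuous_on S g"
  by (cases k) (auto intro: DERIV_isCont continuous_at_imp_continuous_on)

lemma C_on_compose_real:
  assumes U: "openin (Euclidean_space n) U"
    and "C_on n k U f" "C1_on k S g" and S: "\<And>x. x \<in> U \<Longrightarrow> f x \<in> S"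
  shows "C_on n k U (\<lambda>x. g (f x))"
  using assms(2,3)
proof (induction k arbitrary: g)
  case 0
  then show ?case using S U C_on_continuous[OF U "0.prems"(1)]
    by (intro C_on_0I continuous_on_compose2[of S g U f]) auto
next
  case (Suc k)
  obtain g' where g': "\<And>t. t \<in> S \<Longrightarrow> (g has_real_derivative g' t) (at t)" "C1_on k S g'"
    using Suc.prems(2) by auto
  show ?case
  proof (rule C_on_SucI[OF U, where d = "\<lambda>i x. g' (f x) * partial_deriv i f x"])
    show "continuous_on U (\<lambda>x. g (f x))"
      using S C1_on_continuous[OF Suc.prems(2)] C_on_continuous[OF U Suc.prems(1)]
      by (intro continuous_on_compose2[of S g U f]) auto
    show "C_on n k U (\<lambda>x. g' (f x) * partial_deriv i f x)" if "i < n" for i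
      by (rule C_on_mult[OF U Suc.IH[OF C_on_Suc_imp[OF Suc.prems(1)] g'(2)] C_on_partial_deriv(1)[OF Suc.prems(1) that]])
    show "((\<lambda>t. g (f (x(i := t)))) has_real_derivative g' (f x) * partial_deriv i f x) (at (x i))"
      if "i < n" "x \<in> U" for i x
    proof -
      have "(g has_real_derivative g' (f x)) (at (f (x(i := x i))))"
        using g'(1)[OF S[OF that(2)]] by simp
      from DERIV_chain2[OF this C_on_partial_deriv(2)[OF Suc.prems(1) that]] show ?thesis .
    qed
  qed
qed

lemma C1_on_power_inverse: "C1_on k {0<..} (\<lambda>t. c / t ^ m)"
proof (induction k arbitrary: c m)
  case 0 show ?case by (auto intro!: continuous_intros)
next
  case (Suc k)
  have "((\<lambda>t. c / t ^ m) has_real_derivative (- real m * c) / t ^ Suc m) (at t)" if "t > 0" for t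
  proof (cases m)
    case (Suc l)
    show ?thesis unfolding Suc using that
      by (auto intro!: derivative_eq_intros simp del: power_Suc) (simp add: field_simps)
  qed (use that in \<open>auto intro!: derivative_eq_intros\<close>)
  then show ?case unfolding C1_on.simps
    by (intro exI[of _ "\<lambda>t. (- real m * c) / t ^ Suc m"] conjI ballI Suc) (simp only: greaterThan_iff)
qed

text \<open>
  The smooth function \<open>exp(-1/t)\<close>, continued by zero, is \<open>flat 0\<close>. Division by the powers of \<open>t\<close> gives a class of
  functions that contains the linear combinations needed for all derivatives.
\<close>

definition flat :: "nat \<Rightarrow> real \<Rightarrow> real" where
  "flat m t = (if t > 0 then exp (- 1 / t) / t ^ m else 0)"

lemma flat_0_nonneg: "flat 0 t \<ge> 0" and flat_0_pos_iff: "flat 0 t > 0 \<longleftrightarrow> t > 0"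
  by (auto simp: flat_def)

lemma DERIV_flat: "(flat m has_real_derivative flat (m + 2) t - real m * flat (m + 1) t) (at t)"
proof (cases t "0 :: real" rule: linorder_cases)
  case less
  have "((\<lambda>t. 0) has_real_derivative 0) (at t)" by simp
  then have "(flat m has_real_derivative 0) (at t)"
    by (rule has_field_derivative_transform_within_open[of _ _ _ "{..<0}"]) (use less in \<open>auto simp: flat_def\<close>)
  then show ?thesis using less by (simp add: flat_def)
next
  case greater
  have "((\<lambda>t. exp (- 1 / t) / t ^ m) has_real_derivative flat (m + 2) t - real m * flat (m + 1) t) (at t)"
  proof (cases m)
    case (Suc l)
    show ?thesis unfolding Suc using greater
      by (auto intro!: derivative_eq_intros simp: flat_def simp del: power_Suc) (simp add: field_simps power2_eq_square)
  qed (use greater in \<open>auto intro!: derivative_eq_intros simp: flat_def power2_eq_square\<close>)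
  then show ?thesis
    by (rule has_field_derivative_transform_within_open[of _ _ _ "{0<..}"]) (use greater in \<open>auto simp: flat_def\<close>)
next
  case equal
  have "((\<lambda>s. flat m s / s) \<longlongrightarrow> 0) (at_left 0)"
    by (rule tendsto_eventually) (auto simp: flat_def eventually_at_filter)
  moreover have "((\<lambda>s. flat m s / s) \<longlongrightarrow> 0) (at_right 0)"
  proof -
    have "((\<lambda>s. exp (- 1 / s) / s ^ m / s) \<longlongrightarrow> 0) (at_right (0::real))" by real_asymp
    moreover have "\<forall>\<^sub>F s in at_right 0. exp (- 1 / s) / s ^ m / s = flat m s / s"
      by (auto simp: flat_def eventually_at_filter)
    ultimately show ?thesis by (rule Lim_transform_eventually)
  qed
  ultimately have "((\<lambda>s. flat m s / s) \<longlongrightarrow> 0) (at 0)" by (simp add: filterlim_split_at)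
  then show ?thesis using equal by (simp add: has_field_derivative_iff flat_def)
qed

lemma C1_on_add: "C1_on k S f \<Longrightarrow> C1_on k S g \<Longrightarrow> C1_on k S (\<lambda>t. f t + g t)"
proof (induction k arbitrary: f g)
  case (Suc k)
  then obtain f' g' where "\<forall>t\<in>S. (f has_real_derivative f' t) (at t)" "C1_on k S f'"
     "\<forall>t\<in>S. (g has_real_derivative g' t) (at t)" "C1_on k S g'" by auto
  then show ?case using Suc.IH[of f' g'] by (auto intro!: exI[of _ "\<lambda>t. f' t + g' t"] derivative_intros)
qed (auto intro: continuous_intros)

lemma C1_on_cmult: "C1_on k S f \<Longrightarrow> C1_on k S (\<lambda>t. c * f t)"
proof (induction k arbitrary: f)
  case (Suc k)
  then obtain f' where "\<forall>t\<in>S. (f has_real_derivative f' t) (at t)" "C1_on k S f'" by auto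
  then show ?case using Suc.IH[of f'] by (auto intro!: exI[of _ "\<lambda>t. c * f' t"] DERIV_cmult)
qed (auto intro: continuous_intros)

lemma C1_on_flat: "C1_on k UNIV (flat m)"
proof (induction k arbitrary: m)
  case 0 show ?case using DERIV_flat by (auto intro: DERIV_isCont continuous_at_imp_continuous_on)
next
  case (Suc k)
  have "C1_on k UNIV (\<lambda>t. flat (m + 2) t + (- real m) * flat (m + 1) t)"
    by (intro C1_on_add C1_on_cmult Suc)
  then show ?case unfolding C1_on.simps
    by (intro exI[of _ "\<lambda>t. flat (m + 2) t + (- real m) * flat (m + 1) t"] conjI ballI) (use DERIV_flat[of m] in simp)
qed

section \<open>The chain rule and Hadamard's lemma\<close>

lemma continuous_on_open_box_bound:
  fixes e :: real and m :: nat
  assumes U: "openin (Euclidean_space n) U" and "c \<in> U" and g: "\<And>j. j < m \<Longrightarrow> continuous_on U (g j)" and "e > 0"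
  obtains d where "d > 0" "open_box n c d \<subseteq> U"
    "\<And>z j. z \<in> open_box n c d \<Longrightarrow> j < m \<Longrightarrow> \<bar>g j z - g j c\<bar> < e"
proof -
  have o: "openin (Euclidean_space n) {z \<in> U. \<bar>g j z - g j c\<bar> < e}" if "j < m" for j
  proof -
    have "continuous_on U (\<lambda>z. \<bar>g j z - g j c\<bar>)"
      by (rule continuous_on_rabs[OF continuous_on_diff[OF g[OF that] continuous_on_const]])
    then have "openin (top_of_set U) (U \<inter> (\<lambda>z. \<bar>g j z - g j c\<bar>) -` {..<e})"
      by (rule continuous_openin_preimage_gen) auto
    moreover have "U \<inter> (\<lambda>z. \<bar>g j z - g j c\<bar>) -` {..<e} = {z \<in> U. \<bar>g j z - g j c\<bar> < e}" by auto
    ultimately show ?thesis using U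
      by (subst Euclidean_space_eq_top_of_set, subst (asm) Euclidean_space_eq_top_of_set)
        (auto intro: openin_trans)
  qed
  define W where "W = U \<inter> (\<Inter>j\<in>{..<m}. {z \<in> U. \<bar>g j z - g j c\<bar> < e})"
  have "openin (Euclidean_space n) W"
  proof (cases "m = 0")
    case False
    then show ?thesis unfolding W_def using U o by (intro openin_Int openin_INT2) auto
  qed (use U in \<open>simp add: W_def\<close>)
  moreover have "c \<in> W" using assms by (auto simp: W_def)
  ultimately obtain d where "d > 0" "open_box n c d \<subseteq> W" using open_contains_box by blast
  then show thesis using that[of d] by (force simp: W_def)
qed

text \<open>
  A function with continuous partial derivatives is differentiable: the coordinates are moved one
  after the other, and each move is estimated by the mean value theorem.
\<close>

lemma C_on_differentiable:
  assumes U: "openin (Euclidean_space n) U" and f: "C_on n (Suc k) U f" and c: "c \<in> U" and "e > 0"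
  obtains d where "d > 0" "open_box n c d \<subseteq> U"
    "\<And>z. z \<in> open_box n c d \<Longrightarrow>
      \<bar>f z - f c - (\<Sum>j<n. partial_deriv j f c * (z j - c j))\<bar> \<le> e * (\<Sum>j<n. \<bar>z j - c j\<bar>)"
proof -
  have "continuous_on U (partial_deriv j f)" if "j < n" for j
    using C_on_continuous[OF U C_on_partial_deriv(1)[OF f that]] .
  then obtain d where d: "d > 0" "open_box n c d \<subseteq> U"
    and pd: "\<And>z j. z \<in> open_box n c d \<Longrightarrow> j < n \<Longrightarrow> \<bar>partial_deriv j f z - partial_deriv j f c\<bar> < e"
    using continuous_on_open_box_bound[OF U c _ \<open>e > 0\<close>, of n "\<lambda>j. partial_deriv j f"] by blast
  have cE: "c \<in> topspace (Euclidean_space n)" using U c openin_subset by blast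
  have "\<bar>f z - f c - (\<Sum>j<n. partial_deriv j f c * (z j - c j))\<bar> \<le> e * (\<Sum>j<n. \<bar>z j - c j\<bar>)"
    if z: "z \<in> open_box n c d" for z
  proof -
    define w where "w j = (\<lambda>l. if l < j then z l else c l)" for j
    have w: "(w j)(j := s) \<in> open_box n c d" if "j < n" "s \<in> closed_segment (c j) (z j)" for j s
    proof -
      have "\<bar>s - c j\<bar> \<le> \<bar>z j - c j\<bar>"
        using that(2) by (auto simp: closed_segment_eq_real_ivl split: if_splits)
      also have "\<bar>z j - c j\<bar> < d" using z that by (auto simp: open_box_def)
      finally show ?thesis
        using z cE d that(1) by (auto simp: open_box_def w_def mem_Euclidean_space)
    qed
    have step: "\<bar>f (w (Suc j)) - f (w j) - partial_deriv j f c * (z j - c j)\<bar> \<le> e * \<bar>z j - c j\<bar>"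
      if j: "j < n" for j
    proof -
      define g where "g s = f ((w j)(j := s)) - partial_deriv j f c * s" for s
      have der: "(g has_field_derivative (partial_deriv j f ((w j)(j := s)) - partial_deriv j f c))
            (at s within closed_segment (c j) (z j))"
        if "s \<in> closed_segment (c j) (z j)" for s
      proof -
        have "(w j)(j := s) \<in> U" using w[OF j that] d by auto
        from C_on_partial_deriv(2)[OF f j this]
        have "((\<lambda>s. f ((w j)(j := s))) has_real_derivative partial_deriv j f ((w j)(j := s))) (at s)"
          by simp
        then have "(g has_field_derivative (partial_deriv j f ((w j)(j := s)) - partial_deriv j f c)) (at s)"
          unfolding g_def by (auto intro!: derivative_eq_intros)
        then show ?thesis by (rule has_field_derivative_at_within)
      qed
      have "norm (g (z j) - g (c j)) \<le> e * norm (z j - c j)"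
      proof (rule field_differentiable_bound[OF convex_closed_segment der])
        show "norm (partial_deriv j f ((w j)(j := s)) - partial_deriv j f c) \<le> e"
          if "s \<in> closed_segment (c j) (z j)" for s
          using pd[OF w[OF j that] j] by simp
      qed auto
      moreover have "(w j)(j := z j) = w (Suc j)" "(w j)(j := c j) = w j"
        by (auto simp: w_def)
      ultimately show ?thesis by (simp add: g_def algebra_simps)
    qed
    have "\<bar>f (w m) - f c - (\<Sum>j<m. partial_deriv j f c * (z j - c j))\<bar> \<le> e * (\<Sum>j<m. \<bar>z j - c j\<bar>)"
      if "m \<le> n" for m
      using that
    proof (induction m)
      case 0 show ?case by (simp add: w_def)
    next
      case (Suc m)
      then show ?case using step[of m] by (simp add: algebra_simps)
    qed
    moreover have "w n = z" using z cE by (auto simp: w_def fun_eq_iff open_box_def mem_Euclidean_space)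
    ultimately show ?thesis by force
  qed
  then show thesis using d that by blast
qed

text \<open>
  The chain rule along a curve. The remainder of the linear approximation of \<open>f\<close> is small compared with the
  increments of the coordinates of \<open>\<gamma>\<close>, which are bounded by a multiple of \<open>t - t\<^sub>0\<close>.
\<close>

lemma C_on_chain_rule:
  assumes U: "openin (Euclidean_space n) U" and f: "C_on n (Suc k) U f" and c: "\<gamma> t0 \<in> U"
    and \<gamma>E: "\<forall>\<^sub>F t in at t0. \<gamma> t \<in> topspace (Euclidean_space n)"
    and \<gamma>: "\<And>j. j < n \<Longrightarrow> ((\<lambda>t. \<gamma> t j) has_real_derivative \<gamma>' j) (at t0)"
  shows "((\<lambda>t. f (\<gamma> t)) has_real_derivative (\<Sum>j<n. partial_deriv j f (\<gamma> t0) * \<gamma>' j)) (at t0)"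
proof -
  define R where "R t = f (\<gamma> t) - f (\<gamma> t0) - (\<Sum>j<n. partial_deriv j f (\<gamma> t0) * (\<gamma> t j - \<gamma> t0 j))" for t
  define K where "K = (\<Sum>j<n. \<bar>\<gamma>' j\<bar> + 1) + 1"
  have K: "K > 0" unfolding K_def by (intro add_nonneg_pos sum_nonneg) auto
  have "((\<lambda>t. R t / (t - t0)) \<longlongrightarrow> 0) (at t0)"
  proof (rule tendstoI)
    fix e :: real assume "e > 0"
    then have e: "e / K > 0" using K by simp
    obtain d where d: "d > 0" "open_box n (\<gamma> t0) d \<subseteq> U"
      and est: "\<And>z. z \<in> open_box n (\<gamma> t0) d \<Longrightarrow>
        \<bar>f z - f (\<gamma> t0) - (\<Sum>j<n. partial_deriv j f (\<gamma> t0) * (z j - \<gamma> t0 j))\<bar> \<le> e / K * (\<Sum>j<n. \<bar>z j - \<gamma> t0 j\<bar>)"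
      using C_on_differentiable[OF U f c e] by blast
    have "\<forall>\<^sub>F t in at t0. \<forall>j\<in>{..<n}. \<bar>\<gamma> t j - \<gamma> t0 j\<bar> < d"
    proof (intro eventually_ball_finite ballI finite_lessThan)
      fix j assume "j \<in> {..<n}"
      then have "isCont (\<lambda>t. \<gamma> t j) t0" using \<gamma> DERIV_isCont by blast
      then have "\<forall>\<^sub>F t in at t0. dist (\<gamma> t j) (\<gamma> t0 j) < d"
        using d(1) unfolding isCont_def tendsto_iff by blast
      then show "\<forall>\<^sub>F t in at t0. \<bar>\<gamma> t j - \<gamma> t0 j\<bar> < d" by (simp add: dist_real_def)
    qed
    moreover have "\<forall>\<^sub>F t in at t0. \<forall>j\<in>{..<n}. \<bar>(\<gamma> t j - \<gamma> t0 j) / (t - t0) - \<gamma>' j\<bar> < 1"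
    proof (intro eventually_ball_finite ballI finite_lessThan)
      fix j assume "j \<in> {..<n}"
      then have "((\<lambda>t. (\<gamma> t j - \<gamma> t0 j) / (t - t0)) \<longlongrightarrow> \<gamma>' j) (at t0)"
        using \<gamma> by (simp add: has_field_derivative_iff)
      then have "\<forall>\<^sub>F t in at t0. dist ((\<gamma> t j - \<gamma> t0 j) / (t - t0)) (\<gamma>' j) < 1"
        unfolding tendsto_iff by (metis zero_less_one)
      then show "\<forall>\<^sub>F t in at t0. \<bar>(\<gamma> t j - \<gamma> t0 j) / (t - t0) - \<gamma>' j\<bar> < 1"
        by (simp add: dist_real_def)
    qed
    moreover have "\<forall>\<^sub>F t in at t0. t \<noteq> t0" by (simp add: eventually_at_filter)
    ultimately show "\<forall>\<^sub>F t in at t0. dist (R t / (t - t0)) 0 < e"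
      using \<gamma>E
    proof eventually_elim
      case (elim t)
      then have "\<gamma> t \<in> open_box n (\<gamma> t0) d" by (auto simp: open_box_def)
      then have "\<bar>R t\<bar> \<le> e / K * (\<Sum>j<n. \<bar>\<gamma> t j - \<gamma> t0 j\<bar>)" unfolding R_def by (rule est)
      also have "\<dots> \<le> e / K * (\<Sum>j<n. (\<bar>\<gamma>' j\<bar> + 1) * \<bar>t - t0\<bar>)"
      proof (intro mult_left_mono sum_mono)
        fix j assume "j \<in> {..<n}"
        then have "\<bar>(\<gamma> t j - \<gamma> t0 j) / (t - t0)\<bar> \<le> \<bar>\<gamma>' j\<bar> + 1" using elim(2) by (smt (verit))
        then show "\<bar>\<gamma> t j - \<gamma> t0 j\<bar> \<le> (\<bar>\<gamma>' j\<bar> + 1) * \<bar>t - t0\<bar>"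
          using elim(3) by (simp add: field_simps)
      qed (use e in auto)
      also have "\<dots> = e / K * ((K - 1) * \<bar>t - t0\<bar>)"
        by (simp add: K_def sum_distrib_right)
      also have "\<dots> = e * ((K - 1) / K) * \<bar>t - t0\<bar>" by simp
      also have "\<dots> < e * 1 * \<bar>t - t0\<bar>"
        using \<open>e > 0\<close> elim(3) K by (intro mult_strict_right_mono mult_strict_left_mono) (auto simp: field_simps)
      finally show ?case using elim(3) by (simp add: field_simps)
    qed
  qed
  moreover have "((\<lambda>t. \<Sum>j<n. partial_deriv j f (\<gamma> t0) * ((\<gamma> t j - \<gamma> t0 j) / (t - t0)))
      \<longlongrightarrow> (\<Sum>j<n. partial_deriv j f (\<gamma> t0) * \<gamma>' j)) (at t0)"
    by (intro tendsto_sum tendsto_mult tendsto_const) (use \<gamma> in \<open>auto simp: has_field_derivative_iff\<close>)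
  ultimately have "((\<lambda>t. R t / (t - t0) + (\<Sum>j<n. partial_deriv j f (\<gamma> t0) * ((\<gamma> t j - \<gamma> t0 j) / (t - t0))))
      \<longlongrightarrow> 0 + (\<Sum>j<n. partial_deriv j f (\<gamma> t0) * \<gamma>' j)) (at t0)"
    by (rule tendsto_add)
  moreover have "R t / (t - t0) + (\<Sum>j<n. partial_deriv j f (\<gamma> t0) * ((\<gamma> t j - \<gamma> t0 j) / (t - t0)))
      = (f (\<gamma> t) - f (\<gamma> t0)) / (t - t0)" for t
  proof -
    have "(\<Sum>j<n. partial_deriv j f (\<gamma> t0) * ((\<gamma> t j - \<gamma> t0 j) / (t - t0)))
        = (\<Sum>j<n. partial_deriv j f (\<gamma> t0) * (\<gamma> t j - \<gamma> t0 j)) / (t - t0)"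
      by (simp add: sum_divide_distrib)
    then show ?thesis by (simp add: R_def add_divide_distrib[symmetric])
  qed
  ultimately show ?thesis by (simp add: has_field_derivative_iff)
qed

lemma C_on_compose:
  assumes U: "openin (Euclidean_space n) U" and V: "openin (Euclidean_space p) V"
    and gU: "\<And>x. x \<in> V \<Longrightarrow> g x \<in> U"
    and g: "\<And>j. j < n \<Longrightarrow> C_on p k V (\<lambda>x. g x j)"
    and f: "C_on n k U f"
  shows "C_on p k V (\<lambda>x. f (g x))"
proof -
  have cont: "continuous_on V (\<lambda>x. f (g x))" if "C_on n k U f" "\<And>j. j < n \<Longrightarrow> C_on p k V (\<lambda>x. g x j)" for f k
  proof (rule continuous_on_compose2[OF C_on_continuous[OF U that(1)]])
    have "g x j = 0" if "x \<in> V" "\<not> j < n" for x j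
      using that gU openin_subset[OF U] by (force simp: mem_Euclidean_space)
    then have "continuous_on V (\<lambda>x. g x j)" for j
      using C_on_continuous[OF V that(2)] by (cases "j < n") (auto cong: continuous_on_cong)
    then show "continuous_on V g" by (rule continuous_on_coordinatewise_then_product)
  qed (use gU in auto)
  show ?thesis using f g
  proof (induction k arbitrary: f)
    case 0
    show ?case by (rule C_on_0I[OF V cont[OF "0.prems"]])
  next
    case (Suc k)
    show ?case
    proof (rule C_on_SucI[OF V, where d = "\<lambda>i x. \<Sum>j<n. partial_deriv j f (g x) * partial_deriv i (\<lambda>x. g x j) x"])
      show "continuous_on V (\<lambda>x. f (g x))" using Suc.prems by (rule cont)
      show "C_on p k V (\<lambda>x. \<Sum>j<n. partial_deriv j f (g x) * partial_deriv i (\<lambda>x. g x j) x)" if "i < p" for i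
      proof (intro C_on_sum[OF V] C_on_mult[OF V])
        fix j assume "j \<in> {..<n}"
        then have j: "j < n" by simp
        show "C_on p k V (\<lambda>x. partial_deriv j f (g x))"
          by (rule Suc.IH[OF C_on_partial_deriv(1)[OF Suc.prems(1) j]])
            (rule C_on_Suc_imp[OF Suc.prems(2)])
        show "C_on p k V (partial_deriv i (\<lambda>x. g x j))"
          by (rule C_on_partial_deriv(1)[OF Suc.prems(2)[OF j] that])
      qed
      fix i x assume i: "i < p" and x: "x \<in> V"
      have "((\<lambda>t. f (g (x(i := t)))) has_real_derivative
          (\<Sum>j<n. partial_deriv j f (g (x(i := x i))) * partial_deriv i (\<lambda>x. g x j) x)) (at (x i))"
      proof (rule C_on_chain_rule[OF U Suc.prems(1)])
        show "g (x(i := x i)) \<in> U" using gU x by simp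
        have "\<forall>\<^sub>F t in nhds (x i). g (x(i := t)) \<in> topspace (Euclidean_space n)"
          using eventually_fun_upd_in_open[OF V x i]
          by eventually_elim (use gU openin_subset[OF U] in blast)
        then show "\<forall>\<^sub>F t in at (x i). g (x(i := t)) \<in> topspace (Euclidean_space n)"
          by (simp add: eventually_at_filter eventually_mono)
        show "((\<lambda>t. g (x(i := t)) j) has_real_derivative partial_deriv i (\<lambda>x. g x j) x) (at (x i))"
          if "j < n" for j
          by (rule C_on_partial_deriv(2)[OF Suc.prems(2)[OF that] i x])
      qed
      then show "((\<lambda>t. f (g (x(i := t)))) has_real_derivative
          (\<Sum>j<n. partial_deriv j f (g x) * partial_deriv i (\<lambda>x. g x j) x)) (at (x i))" by simp
    qed
  qed
qed

text \<open>
  The weights \<open>t\<^sup>m\<close> make the class of these integrals closed under partial derivatives.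
\<close>

definition ray_integral :: "(nat \<Rightarrow> real) \<Rightarrow> nat \<Rightarrow> ((nat \<Rightarrow> real) \<Rightarrow> real) \<Rightarrow> (nat \<Rightarrow> real) \<Rightarrow> real" where
  "ray_integral c m F x = integral (cbox 0 1) (\<lambda>t. t ^ m * F (\<lambda>l. c l + t * (x l - c l)))"

lemma ray_in_open_box:
  assumes "c \<in> topspace (Euclidean_space n)" "x \<in> open_box n c r" "t \<in> {0..1}"
  shows "(\<lambda>l. c l + t * (x l - c l)) \<in> open_box n c r"
proof -
  have "\<bar>t * (x i - c i)\<bar> < r" if "i < n" for i
  proof -
    have "\<bar>t * (x i - c i)\<bar> \<le> 1 * \<bar>x i - c i\<bar>"
      using assms(3) unfolding abs_mult by (intro mult_right_mono) auto
    also have "\<dots> < r" using assms(2) that by (auto simp: open_box_def)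
    finally show ?thesis .
  qed
  then show ?thesis using assms by (auto simp: open_box_def mem_Euclidean_space)
qed

lemma continuous_on_ray:
  assumes F: "continuous_on (open_box n c r) F" and c: "c \<in> topspace (Euclidean_space n)"
    and g: "\<And>l. continuous_on S (\<lambda>p. fst (g p) l)" "continuous_on S (\<lambda>p. snd (g p))"
    and gS: "\<And>p. p \<in> S \<Longrightarrow> fst (g p) \<in> open_box n c r \<and> snd (g p) \<in> {0..1}"
  shows "continuous_on S (\<lambda>p. F (\<lambda>l. c l + snd (g p) * (fst (g p) l - c l)))"
proof (rule continuous_on_compose2[OF F])
  show "continuous_on S (\<lambda>p l. c l + snd (g p) * (fst (g p) l - c l))"
    by (intro continuous_on_coordinatewise_then_product continuous_intros g)
  show "(\<lambda>p l. c l + snd (g p) * (fst (g p) l - c l)) ` S \<subseteq> open_box n c r"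
    using ray_in_open_box[OF c] gS by blast
qed

lemma continuous_on_ray_integral:
  assumes F: "continuous_on (open_box n c r) F" and c: "c \<in> topspace (Euclidean_space n)"
  shows "continuous_on (open_box n c r) (ray_integral c m F)"
  unfolding ray_integral_def
proof (rule integral_continuous_on_param)
  show "continuous_on (open_box n c r \<times> cbox 0 1) (\<lambda>(x, t). t ^ m * F (\<lambda>l. c l + t * (x l - c l)))"
    unfolding case_prod_beta
  proof (intro continuous_intros continuous_on_ray[OF F c])
    show "continuous_on (open_box n c r \<times> cbox 0 1) (\<lambda>p. fst p l)" for l
      by (rule continuous_on_product_then_coordinatewise[OF continuous_on_fst[OF continuous_on_id]])
  qed auto
qed

lemma C_on_ray_integral:
  assumes c: "c \<in> topspace (Euclidean_space n)"
  shows "C_on n k (open_box n c r) F \<Longrightarrow> C_on n k (open_box n c r) (ray_integral c m F)"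
proof (induction k arbitrary: F m)
  case 0
  then show ?case
    by (intro C_on_0I openin_open_box continuous_on_ray_integral[OF _ c] C_on_continuous[OF openin_open_box])
next
  case (Suc k)
  note cF = C_on_continuous[OF openin_open_box Suc.prems]
  show ?case
  proof (rule C_on_SucI[OF openin_open_box, where d = "\<lambda>i. ray_integral c (Suc m) (partial_deriv i F)"])
    show "continuous_on (open_box n c r) (ray_integral c m F)"
      by (rule continuous_on_ray_integral[OF cF c])
    show "C_on n k (open_box n c r) (ray_integral c (Suc m) (partial_deriv i F))" if "i < n" for i
      by (rule Suc.IH[OF C_on_partial_deriv(1)[OF Suc.prems that]])
    fix i x assume i: "i < n" and x: "x \<in> open_box n c r"
    define S where "S = {c i - r<..<c i + r}"
    have xS: "x(i := s) \<in> open_box n c r" if "s \<in> S" for s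
      using that x i by (auto simp: S_def open_box_def fun_upd_mem_Euclidean_space)
    have xi: "x i \<in> S" using x i by (auto simp: S_def open_box_def abs_less_iff)
    note cpF = C_on_continuous[OF openin_open_box C_on_partial_deriv(1)[OF Suc.prems i]]
    define G where "G s t = t ^ m * F (\<lambda>l. c l + t * ((x(i := s)) l - c l))" for s t
    define G' where "G' s t = t ^ Suc m * partial_deriv i F (\<lambda>l. c l + t * ((x(i := s)) l - c l))" for s t
    have "((\<lambda>s. integral (cbox 0 1) (G s)) has_field_derivative integral (cbox 0 1) (G' (x i)))
      (at (x i) within S)"
    proof (rule leibniz_rule_field_derivative)
      fix s t :: real assume s: "s \<in> S" and t: "t \<in> cbox 0 1"
      define y where "y = (\<lambda>l. c l + t * ((x(i := s)) l - c l))"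
      have y: "y \<in> open_box n c r" unfolding y_def using ray_in_open_box[OF c xS[OF s]] t by simp
      have eq: "(\<lambda>l. c l + t * ((x(i := s')) l - c l)) = y(i := c i + t * (s' - c i))" for s'
        by (auto simp: y_def)
      have "((\<lambda>v. F (y(i := v))) has_real_derivative partial_deriv i F y) (at (c i + t * (s - c i)))"
      proof -
        have "y i = c i + t * (s - c i)" by (simp add: y_def)
        then show ?thesis using C_on_partial_deriv(2)[OF Suc.prems i y] by (simp only:)
      qed
      moreover have "((\<lambda>s'. c i + t * (s' - c i)) has_real_derivative t) (at s)"
        by (auto intro!: derivative_eq_intros)
      ultimately have "((\<lambda>s'. F (y(i := c i + t * (s' - c i)))) has_real_derivative partial_deriv i F y * t) (at s)"
        by (rule DERIV_chain2)
      from DERIV_cmult[OF this, of "t ^ m"]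
      have "((\<lambda>s'. G s' t) has_real_derivative G' s t) (at s)"
        unfolding G_def G'_def eq by (simp add: y_def fun_upd_idem mult_ac)
      then show "((\<lambda>s'. G s' t) has_real_derivative G' s t) (at s within S)"
        by (rule has_field_derivative_at_within)
    next
      fix s assume s: "s \<in> S"
      show "G s integrable_on cbox 0 1"
        unfolding G_def
      proof (rule integrable_continuous)
        show "continuous_on (cbox 0 1) (\<lambda>t. t ^ m * F (\<lambda>l. c l + t * ((x(i := s)) l - c l)))"
          using continuous_on_ray[OF cF c, of "cbox 0 1" "\<lambda>t. (x(i := s), t)"] xS[OF s]
          by (auto intro!: continuous_intros)
      qed
    next
      have "continuous_on (S \<times> cbox 0 1) (\<lambda>p. (x(i := fst p)) l)" for l
        by (cases "l = i") (auto intro!: continuous_intros)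
      then have "continuous_on (S \<times> cbox 0 1) (\<lambda>p. partial_deriv i F (\<lambda>l. c l + snd p * ((x(i := fst p)) l - c l)))"
        by (rule continuous_on_ray[OF cpF c, of "S \<times> cbox 0 1" "\<lambda>p. (x(i := fst p), snd p)",
              unfolded fst_conv snd_conv, OF _ continuous_on_snd[OF continuous_on_id]])
          (use xS in auto)
      then show "continuous_on (S \<times> cbox 0 1) (\<lambda>(s, t). G' s t)"
        unfolding G'_def case_prod_beta by (intro continuous_intros)
    qed (use xi in \<open>auto simp: S_def\<close>)
    moreover have "at (x i) within S = at (x i)" using xi by (intro at_within_open) (auto simp: S_def)
    ultimately show "((\<lambda>t. ray_integral c m F (x(i := t))) has_real_derivative
        ray_integral c (Suc m) (partial_deriv i F) x) (at (x i))"
    proof -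
      have "ray_integral c m F (x(i := s)) = integral (cbox 0 1) (G s)" for s
        unfolding ray_integral_def by (rule arg_cong[of _ _ "integral _"]) (rule ext, simp only: G_def)
      moreover have "ray_integral c (Suc m) (partial_deriv i F) x = integral (cbox 0 1) (G' (x i))"
        unfolding ray_integral_def
        by (rule arg_cong[of _ _ "integral _"]) (rule ext, simp only: G'_def fun_upd_triv)
      ultimately show ?thesis
        using \<open>((\<lambda>s. integral (cbox 0 1) (G s)) has_field_derivative _) _\<close> \<open>at (x i) within S = at (x i)\<close>
        by (simp only:)
    qed
  qed
qed

text \<open>
  The fundamental theorem of calculus on the segment from \<open>c\<close> to \<open>x\<close>.
\<close>

lemma hadamard:
  assumes c: "c \<in> topspace (Euclidean_space n)" and F: "C_on n (Suc k) (open_box n c r) F"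
    and x: "x \<in> open_box n c r"
  shows "F x = F c + (\<Sum>j<n. (x j - c j) * ray_integral c 0 (partial_deriv j F) x)"
proof -
  define l where "l t = (\<lambda>i. c i + t * (x i - c i))" for t
  have l: "l t \<in> open_box n c r" if "t \<in> {0..1}" for t
    unfolding l_def using ray_in_open_box[OF c x that] .
  have lE: "l t \<in> topspace (Euclidean_space n)" for t
    using c x by (auto simp: l_def mem_Euclidean_space open_box_def)
  have "((\<lambda>t. F (l t)) has_real_derivative (\<Sum>j<n. partial_deriv j F (l t) * (x j - c j))) (at t)"
    if "t \<in> {0..1}" for t
  proof (rule C_on_chain_rule[OF openin_open_box F])
    show "l t \<in> open_box n c r" by (rule l[OF that])
    show "\<forall>\<^sub>F t in at t. l t \<in> topspace (Euclidean_space n)" using lE by simp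
    show "((\<lambda>t. l t j) has_real_derivative x j - c j) (at t)" for j
      unfolding l_def by (auto intro!: derivative_eq_intros)
  qed
  then have "((\<lambda>t. \<Sum>j<n. partial_deriv j F (l t) * (x j - c j)) has_integral F (l 1) - F (l 0)) {0..1}"
    by (intro fundamental_theorem_of_calculus)
      (auto simp: has_real_derivative_iff_has_vector_derivative[symmetric] intro: has_field_derivative_at_within)
  then have "F x - F c = integral {0..1} (\<lambda>t. \<Sum>j<n. partial_deriv j F (l t) * (x j - c j))"
    by (simp add: integral_unique l_def)
  also have "\<dots> = (\<Sum>j<n. integral {0..1} (\<lambda>t. partial_deriv j F (l t) * (x j - c j)))"
  proof (rule integral_sum)
    fix j assume "j \<in> {..<n}"
    then have "continuous_on (open_box n c r) (partial_deriv j F)"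
      using C_on_continuous[OF openin_open_box C_on_partial_deriv(1)[OF F]] by blast
    from continuous_on_ray[OF this c, of "{0..1}" "\<lambda>t. (x, t)"] x
    have "continuous_on {0..1} (\<lambda>t. partial_deriv j F (l t))" by (auto simp: l_def)
    then show "(\<lambda>t. partial_deriv j F (l t) * (x j - c j)) integrable_on {0..1}"
      by (intro integrable_continuous_real continuous_intros)
  qed simp
  also have "\<dots> = (\<Sum>j<n. (x j - c j) * ray_integral c 0 (partial_deriv j F) x)"
    by (simp add: ray_integral_def l_def mult.commute)
  finally show ?thesis by simp
qed

section \<open>Smooth functions on a manifold\<close>

locale smooth_mfd =
  fixes M :: "'a manifold"
  assumes smooth_manifold: "smooth_manifold M"
begin

abbreviation X where "X \<equiv> topspace (mtop M)"
abbreviation n where "n \<equiv> mdim M"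

lemma chartD:
  assumes "(U, \<phi>) \<in> atlas M"
  shows "openin (mtop M) U" "openin (Euclidean_space n) (\<phi> ` U)"
    "homeomorphic_map (subtopology (mtop M) U) (subtopology (Euclidean_space n) (\<phi> ` U)) \<phi>"
  using assms smooth_manifold by (auto simp: smooth_manifold_def)

lemma chart_transition:
  assumes "(U, \<phi>) \<in> atlas M" "(V, \<psi>) \<in> atlas M" "i < n"
  shows "Cinf_on n (\<phi> ` (U \<inter> V)) (\<lambda>y. \<psi> (inv_into U \<phi> y) i)"
proof -
  have "\<forall>(U, \<phi>)\<in>atlas M. \<forall>(V, \<psi>)\<in>atlas M. \<forall>i<n.
      Cinf_on n (\<phi> ` (U \<inter> V)) (\<lambda>y. \<psi> (inv_into U \<phi> y) i)"
    using smooth_manifold unfolding smooth_manifold_def by blast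
  from bspec[OF bspec[OF this assms(1), unfolded prod.case] assms(2), unfolded prod.case] assms(3)
  show ?thesis by blast
qed

lemma chart_subset: "(U, \<phi>) \<in> atlas M \<Longrightarrow> U \<subseteq> X"
  using chartD(1) openin_subset by blast

lemma chart_inj: "(U, \<phi>) \<in> atlas M \<Longrightarrow> inj_on \<phi> U"
  using chartD(3) chart_subset homeomorphic_imp_injective_map
  by (metis topspace_subtopology inf.absorb2)

lemma chart_inv [simp]: "(U, \<phi>) \<in> atlas M \<Longrightarrow> x \<in> U \<Longrightarrow> inv_into U \<phi> (\<phi> x) = x"
  using chart_inj inv_into_f_f by fast

lemma chart_ex: "x \<in> X \<Longrightarrow> \<exists>U \<phi>. (U, \<phi>) \<in> atlas M \<and> x \<in> U"
  using smooth_manifold by (force simp: smooth_manifold_def)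

lemma chart_Euclidean: "(U, \<phi>) \<in> atlas M \<Longrightarrow> x \<in> U \<Longrightarrow> \<phi> x \<in> topspace (Euclidean_space n)"
  using chartD(2) openin_subset by fast

lemma chart_image_open:
  assumes c: "(U, \<phi>) \<in> atlas M" and "openin (mtop M) N" "N \<subseteq> U"
  shows "openin (Euclidean_space n) (\<phi> ` N)"
proof -
  have "openin (subtopology (mtop M) U) N"
    using assms chartD(1)[OF c] by (simp add: openin_open_subtopology)
  then have "openin (subtopology (Euclidean_space n) (\<phi> ` U)) (\<phi> ` N)"
    using homeomorphic_imp_open_map[OF chartD(3)[OF c]] by (auto simp: open_map_def)
  then show ?thesis using chartD(2)[OF c] by (simp add: openin_open_subtopology)
qed

lemma chart_image_open':
  assumes c: "(U, \<phi>) \<in> atlas M" and "openin (mtop M) W"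
  shows "openin (Euclidean_space n) (\<phi> ` (U \<inter> W))"
  using assms chartD(1) by (intro chart_image_open[OF c]) auto

lemma chart_preimage_open:
  assumes c: "(U, \<phi>) \<in> atlas M" and "openin (Euclidean_space n) T"
  shows "openin (mtop M) {x \<in> U. \<phi> x \<in> T}"
proof -
  have "openin (subtopology (mtop M) U) {x \<in> topspace (subtopology (mtop M) U). \<phi> x \<in> T \<inter> \<phi> ` U}"
    using homeomorphic_imp_continuous_map[OF chartD(3)[OF c]] assms(2)
    by (intro openin_continuous_map_preimage[where Y = "subtopology (Euclidean_space n) (\<phi> ` U)"] openin_subtopology_Int)
      auto
  moreover have "{x \<in> topspace (subtopology (mtop M) U). \<phi> x \<in> T \<inter> \<phi> ` U} = {x \<in> U. \<phi> x \<in> T}"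
    using chart_subset[OF c] by auto
  ultimately show ?thesis using chartD(1)[OF c] by (simp add: openin_open_subtopology)
qed

lemma smooth_on_iff:
  "smooth_on M W f \<longleftrightarrow> (\<forall>(U, \<phi>)\<in>atlas M. \<forall>k. C_on n k (\<phi> ` (U \<inter> W)) (\<lambda>y. f (inv_into U \<phi> y)))"
  by (simp add: smooth_on_def Cinf_on_def o_def)

lemma smooth_onD:
  "smooth_on M W f \<Longrightarrow> (U, \<phi>) \<in> atlas M \<Longrightarrow> C_on n k (\<phi> ` (U \<inter> W)) (\<lambda>y. f (inv_into U \<phi> y))"
  by (auto simp: smooth_on_iff)

lemma smooth_onI:
  "(\<And>U \<phi> k. (U, \<phi>) \<in> atlas M \<Longrightarrow> C_on n k (\<phi> ` (U \<inter> W)) (\<lambda>y. f (inv_into U \<phi> y))) \<Longrightarrow> smooth_on M W f"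
  by (auto simp: smooth_on_iff)

lemma smooth_on_subset: "smooth_on M W f \<Longrightarrow> V \<subseteq> W \<Longrightarrow> smooth_on M V f"
  by (rule smooth_onI, rule C_on_subset[OF smooth_onD]) auto

lemma smooth_on_cong:
  assumes "openin (mtop M) W" "smooth_on M W f" "\<And>x. x \<in> W \<Longrightarrow> f x = g x"
  shows "smooth_on M W g"
proof (rule smooth_onI)
  fix U \<phi> k assume c: "(U, \<phi>) \<in> atlas M"
  show "C_on n k (\<phi> ` (U \<inter> W)) (\<lambda>y. g (inv_into U \<phi> y))"
    by (rule C_on_cong_imp[OF chart_image_open'[OF c assms(1)] _ smooth_onD[OF assms(2) c]])
      (use c assms(3) in auto)
qed

lemma smooth_on_local:
  assumes "openin (mtop M) W"
    and "\<And>x. x \<in> W \<Longrightarrow> \<exists>N. openin (mtop M) N \<and> x \<in> N \<and> smooth_on M N f"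
  shows "smooth_on M W f"
proof (rule smooth_onI)
  fix U \<phi> k assume c: "(U, \<phi>) \<in> atlas M"
  show "C_on n k (\<phi> ` (U \<inter> W)) (\<lambda>y. f (inv_into U \<phi> y))"
  proof (rule C_on_local[OF chart_image_open'[OF c assms(1)]])
    fix y assume "y \<in> \<phi> ` (U \<inter> W)"
    then obtain x where x: "x \<in> U" "x \<in> W" "y = \<phi> x" by auto
    obtain N where N: "openin (mtop M) N" "x \<in> N" "smooth_on M N f" using assms(2) x by blast
    show "\<exists>V. openin (Euclidean_space n) V \<and> y \<in> V \<and> C_on n k V (\<lambda>y. f (inv_into U \<phi> y))"
      using chart_image_open'[OF c N(1)] smooth_onD[OF N(3) c] x N(2) by blast
  qed
qed

text \<open>Smoothness can be tested in one chart around each point, since the transition maps are smooth.\<close>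

lemma smooth_onI_chart:
  assumes W: "openin (mtop M) W"
    and f: "\<And>x. x \<in> W \<Longrightarrow> \<exists>U \<phi> N. (U, \<phi>) \<in> atlas M \<and> openin (mtop M) N \<and> x \<in> N \<and> N \<subseteq> U \<and>
      (\<forall>k. C_on n k (\<phi> ` N) (\<lambda>y. f (inv_into U \<phi> y)))"
  shows "smooth_on M W f"
proof (rule smooth_on_local[OF W])
  fix x assume "x \<in> W"
  then obtain U \<phi> N where c: "(U, \<phi>) \<in> atlas M" and N: "openin (mtop M) N" "x \<in> N" "N \<subseteq> U"
    and fN: "\<And>k. C_on n k (\<phi> ` N) (\<lambda>y. f (inv_into U \<phi> y))" using f by metis
  have "smooth_on M N f"
  proof (rule smooth_onI)
    fix V \<psi> k assume d: "(V, \<psi>) \<in> atlas M"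
    note o = chart_image_open'[OF d N(1)]
    have "C_on n k (\<psi> ` (V \<inter> N)) (\<lambda>y. f (inv_into U \<phi> (\<phi> (inv_into V \<psi> y))))"
    proof (rule C_on_compose[OF chart_image_open[OF c N(1) N(3)] o _ _ fN])
      show "\<phi> (inv_into V \<psi> y) \<in> \<phi> ` N" if "y \<in> \<psi> ` (V \<inter> N)" for y
        using that d by auto
      fix j assume "j < n"
      then have "Cinf_on n (\<psi> ` (V \<inter> U)) (\<lambda>y. \<phi> (inv_into V \<psi> y) j)"
        using chart_transition[OF d c] by blast
      then show "C_on n k (\<psi> ` (V \<inter> N)) (\<lambda>y. \<phi> (inv_into V \<psi> y) j)"
        using N(3) by (auto simp: Cinf_on_def intro: C_on_subset)
    qed
    then show "C_on n k (\<psi> ` (V \<inter> N)) (\<lambda>y. f (inv_into V \<psi> y))"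
      by (rule C_on_cong_imp[OF o, rotated]) (use N(3) c d in auto)
  qed
  then show "\<exists>N. openin (mtop M) N \<and> x \<in> N \<and> smooth_on M N f" using N by blast
qed

lemma smooth_on_const: "openin (mtop M) W \<Longrightarrow> smooth_on M W (\<lambda>x. c)"
  by (rule smooth_onI, rule C_on_const[OF chart_image_open'])

lemma smooth_on_add:
  "openin (mtop M) W \<Longrightarrow> smooth_on M W f \<Longrightarrow> smooth_on M W g \<Longrightarrow> smooth_on M W (\<lambda>x. f x + g x)"
  by (rule smooth_onI, rule C_on_add[OF chart_image_open']) (auto intro: smooth_onD)

lemma smooth_on_mult:
  "openin (mtop M) W \<Longrightarrow> smooth_on M W f \<Longrightarrow> smooth_on M W g \<Longrightarrow> smooth_on M W (\<lambda>x. f x * g x)"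
  by (rule smooth_onI, rule C_on_mult[OF chart_image_open']) (auto intro: smooth_onD)

lemma smooth_on_sum:
  "openin (mtop M) W \<Longrightarrow> (\<And>j. j \<in> J \<Longrightarrow> smooth_on M W (f j)) \<Longrightarrow> smooth_on M W (\<lambda>x. \<Sum>j\<in>J. f j x)"
  by (rule smooth_onI, rule C_on_sum[OF chart_image_open']) (auto intro: smooth_onD)

lemma smooth_on_prod:
  "openin (mtop M) W \<Longrightarrow> (\<And>j. j \<in> J \<Longrightarrow> smooth_on M W (f j)) \<Longrightarrow> smooth_on M W (\<lambda>x. \<Prod>j\<in>J. f j x)"
  by (induction J rule: infinite_finite_induct) (auto intro: smooth_on_const smooth_on_mult)

lemma smooth_on_power:
  "openin (mtop M) W \<Longrightarrow> smooth_on M W f \<Longrightarrow> smooth_on M W (\<lambda>x. f x ^ k)"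
  by (induction k) (auto intro: smooth_on_const smooth_on_mult)

lemma smooth_on_diff:
  assumes "openin (mtop M) W" "smooth_on M W f" "smooth_on M W g"
  shows "smooth_on M W (\<lambda>x. f x - g x)"
  using smooth_on_add[OF assms(1,2) smooth_on_mult[OF assms(1) smooth_on_const[OF assms(1), of "-1"] assms(3)]]
  by simp

lemma smooth_on_compose_real:
  assumes "openin (mtop M) W" "smooth_on M W f" "\<And>k. C1_on k S g" "\<And>x. x \<in> W \<Longrightarrow> f x \<in> S"
  shows "smooth_on M W (\<lambda>x. g (f x))"
proof (rule smooth_onI)
  fix U \<phi> k assume c: "(U, \<phi>) \<in> atlas M"
  show "C_on n k (\<phi> ` (U \<inter> W)) (\<lambda>y. g (f (inv_into U \<phi> y)))"
    by (rule C_on_compose_real[OF chart_image_open'[OF c assms(1)] smooth_onD[OF assms(2) c] assms(3)])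
      (use c assms(4) in auto)
qed

lemma smooth_on_coordinate:
  assumes c: "(U, \<phi>) \<in> atlas M"
  shows "smooth_on M U (\<lambda>x. \<phi> x j)"
proof (rule smooth_onI_chart[OF chartD(1)[OF c]])
  fix x assume "x \<in> U"
  moreover have "C_on n k (\<phi> ` U) (\<lambda>y. \<phi> (inv_into U \<phi> y) j)" for k
    by (rule C_on_cong_imp[OF chartD(2)[OF c] _ C_on_coordinate[OF chartD(2)[OF c]]])
      (simp add: f_inv_into_f)
  ultimately show "\<exists>V \<psi> N. (V, \<psi>) \<in> atlas M \<and> openin (mtop M) N \<and> x \<in> N \<and> N \<subseteq> V \<and>
      (\<forall>k. C_on n k (\<psi> ` N) (\<lambda>y. \<phi> (inv_into V \<psi> y) j))"
    using c chartD(1)[OF c] by blast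
qed

text \<open>The open sets \<open>N\<close> and \<open>X - K\<close> cover \<open>M\<close>, and the extended function is smooth on each of them.\<close>

lemma smooth_on_extend_zero:
  assumes N: "openin (mtop M) N" and K: "closedin (mtop M) K" "K \<subseteq> N"
    and W: "openin (mtop M) W"
    and g: "smooth_on M (W \<inter> N) g" and z: "\<And>x. x \<in> W \<inter> N \<Longrightarrow> x \<notin> K \<Longrightarrow> g x = 0"
  shows "smooth_on M W (\<lambda>x. if x \<in> N then g x else 0)"
proof (rule smooth_on_local[OF W])
  fix x assume x: "x \<in> W"
  show "\<exists>V. openin (mtop M) V \<and> x \<in> V \<and> smooth_on M V (\<lambda>x. if x \<in> N then g x else 0)"
  proof (cases "x \<in> N")
    case True
    have "smooth_on M (W \<inter> N) (\<lambda>x. if x \<in> N then g x else 0)"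
      by (rule smooth_on_cong[OF _ g]) (use N W in auto)
    then show ?thesis using x True N W by (metis IntI openin_Int)
  next
    case False
    have o: "openin (mtop M) (W - K)" using K(1) W by auto
    have "smooth_on M (W - K) (\<lambda>x. if x \<in> N then g x else 0)"
      by (rule smooth_on_cong[OF o smooth_on_const[OF o, of 0]]) (use z in auto)
    then show ?thesis using o False K x by blast
  qed
qed

text \<open>The vector field \<open>\<partial>/\<partial>\<phi>\<^sub>j\<close> of a chart.\<close>

definition chart_deriv :: "'a set \<Rightarrow> ('a \<Rightarrow> nat \<Rightarrow> real) \<Rightarrow> nat \<Rightarrow> ('a \<Rightarrow> real) \<Rightarrow> 'a \<Rightarrow> real" where
  "chart_deriv U \<phi> j g x = partial_deriv j (\<lambda>y. g (inv_into U \<phi> y)) (\<phi> x)"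

lemma chart_deriv_cong:
  assumes c: "(U, \<phi>) \<in> atlas M" and N: "openin (mtop M) N" "N \<subseteq> U" and x: "x \<in> N" and j: "j < n"
    and "\<And>x. x \<in> N \<Longrightarrow> f x = g x"
  shows "chart_deriv U \<phi> j f x = chart_deriv U \<phi> j g x"
  unfolding chart_deriv_def
  by (rule partial_deriv_cong[OF chart_image_open[OF c N] _ j]) (use assms in auto)

lemma smooth_on_local_rep:
  assumes c: "(U, \<phi>) \<in> atlas M" and "N \<subseteq> U" and "smooth_on M N g"
  shows "C_on n k (\<phi> ` N) (\<lambda>y. g (inv_into U \<phi> y))"
  using smooth_onD[OF assms(3) c] assms(2) by (simp add: inf.absorb2)

context
  fixes U \<phi> N and j :: nat
  assumes c: "(U, \<phi>) \<in> atlas M" and N: "openin (mtop M) N" "N \<subseteq> U" and j: "j < n"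
begin

lemma chart_deriv_has_deriv:
  assumes "smooth_on M N g" "x \<in> N"
  shows "((\<lambda>t. g (inv_into U \<phi> ((\<phi> x)(j := t)))) has_real_derivative chart_deriv U \<phi> j g x) (at (\<phi> x j))"
  unfolding chart_deriv_def
  using C_on_partial_deriv(2)[OF smooth_on_local_rep[OF c N(2) assms(1)] j] assms(2) by blast

lemma smooth_on_chart_deriv:
  assumes "smooth_on M N g"
  shows "smooth_on M N (chart_deriv U \<phi> j g)"
proof (rule smooth_onI_chart[OF N(1)])
  fix x assume "x \<in> N"
  have "C_on n k (\<phi> ` N) (\<lambda>y. chart_deriv U \<phi> j g (inv_into U \<phi> y))" for k
    by (rule C_on_cong_imp[OF chart_image_open[OF c N] _
          C_on_partial_deriv(1)[OF smooth_on_local_rep[OF c N(2) assms] j]])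
      (use c N in \<open>auto simp: chart_deriv_def subset_eq\<close>)
  then show "\<exists>V \<psi> N. (V, \<psi>) \<in> atlas M \<and> openin (mtop M) N \<and> x \<in> N \<and> N \<subseteq> V \<and>
      (\<forall>k. C_on n k (\<psi> ` N) (\<lambda>y. chart_deriv U \<phi> j g (inv_into V \<psi> y)))"
    using c N \<open>x \<in> N\<close> by blast
qed

lemma chart_deriv_add:
  assumes "smooth_on M N f" "smooth_on M N g" "x \<in> N"
  shows "chart_deriv U \<phi> j (\<lambda>x. f x + g x) x = chart_deriv U \<phi> j f x + chart_deriv U \<phi> j g x"
  unfolding chart_deriv_def[of _ _ _ "\<lambda>x. f x + g x"]
  by (rule partial_derivI DERIV_add chart_deriv_has_deriv assms)+

lemma chart_deriv_mult:
  assumes "smooth_on M N f" "smooth_on M N g" "x \<in> N"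
  shows "chart_deriv U \<phi> j (\<lambda>x. f x * g x) x = f x * chart_deriv U \<phi> j g x + g x * chart_deriv U \<phi> j f x"
proof -
  have "inv_into U \<phi> (\<phi> x) = x" using assms(3) N(2) c by auto
  with DERIV_mult[OF chart_deriv_has_deriv[OF assms(1,3)] chart_deriv_has_deriv[OF assms(2,3)]]
  show ?thesis unfolding chart_deriv_def[of _ _ _ "\<lambda>x. f x * g x"]
    by (intro partial_derivI) (simp add: fun_upd_triv mult.commute add.commute)
qed

lemma chart_deriv_coordinate:
  assumes "x \<in> N"
  shows "chart_deriv U \<phi> j (\<lambda>x. \<phi> x i) x = (if i = j then 1 else 0)"
proof -
  have "chart_deriv U \<phi> j (\<lambda>x. \<phi> x i) x = partial_deriv j (\<lambda>y. y i) (\<phi> x)"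
    unfolding chart_deriv_def
    by (rule partial_deriv_cong[OF chart_image_open[OF c N] _ j]) (use assms N c in \<open>auto simp: subset_eq\<close>)
  also have "\<dots> = (if i = j then 1 else 0)"
    by (rule partial_derivI) auto
  finally show ?thesis .
qed

end

lemma chart_deriv_const:
  assumes "(U, \<phi>) \<in> atlas M"
  shows "chart_deriv U \<phi> j (\<lambda>x. r) x = 0"
  unfolding chart_deriv_def by (rule partial_derivI) simp

text \<open>
  A product of one-variable bump functions of the coordinates. Its support lies in a closed cube, which
  is compact, so that its preimage \<open>K\<close> is closed in the Hausdorff space \<open>M\<close>.
\<close>

lemma bump_function:
  assumes c: "(U, \<phi>) \<in> atlas M" and N: "openin (mtop M) N" "N \<subseteq> U" and x0: "x0 \<in> N"
  obtains \<eta> K r where "r > 0" "closedin (mtop M) K" "K \<subseteq> N" "smooth_on M X \<eta>"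
    "\<And>x. \<eta> x \<ge> 0" "\<eta> x0 > 0" "\<And>x. x \<notin> K \<Longrightarrow> \<eta> x = 0"
    "\<And>x. x \<in> K \<Longrightarrow> \<phi> x \<in> open_box n (\<phi> x0) r" "open_box n (\<phi> x0) r \<subseteq> \<phi> ` N"
proof -
  define c0 where "c0 = \<phi> x0"
  have c0E: "c0 \<in> topspace (Euclidean_space n)" unfolding c0_def using chart_Euclidean c x0 N by blast
  have "c0 \<in> \<phi> ` N" using x0 by (simp add: c0_def)
  then obtain r where r: "r > 0" "open_box n c0 r \<subseteq> \<phi> ` N"
    using open_contains_box[OF chart_image_open[OF c N]] by blast
  define B where "B = {z \<in> topspace (Euclidean_space n). \<forall>i<n. \<bar>z i - c0 i\<bar> \<le> r / 2}"
  have Bsub: "B \<subseteq> open_box n c0 r" using r(1) by (force simp: B_def open_box_def)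
  have Bcomp: "compactin (Euclidean_space n) B"
  proof -
    have "B = Pi\<^sub>E UNIV (\<lambda>i. if i < n then {c0 i - r / 2 .. c0 i + r / 2} else {0})"
    proof (rule Set.set_eqI)
      fix x :: "nat \<Rightarrow> real"
      have "\<bar>x i - c0 i\<bar> \<le> r / 2 \<longleftrightarrow> x i \<in> {c0 i - r / 2 .. c0 i + r / 2}" for i
        by (simp only: atLeastAtMost_iff) arith
      then have "x \<in> B \<longleftrightarrow> (\<forall>i. x i \<in> (if i < n then {c0 i - r / 2 .. c0 i + r / 2} else {0}))"
        unfolding B_def by (simp add: mem_Euclidean_space) (metis not_le)
      then show "x \<in> B \<longleftrightarrow> x \<in> Pi\<^sub>E UNIV (\<lambda>i. if i < n then {c0 i - r / 2 .. c0 i + r / 2} else {0})"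
        by (simp add: PiE_iff)
    qed
    then have "compactin (powertop_real UNIV) B"
      by (simp add: compactin_PiE)
    then show ?thesis
      unfolding Euclidean_space_def compactin_subtopology
      by (auto simp: B_def topspace_Euclidean_space)
  qed
  define K where "K = inv_into U \<phi> ` B"
  have BU: "B \<subseteq> \<phi> ` U" "B \<subseteq> \<phi> ` N" using Bsub r(2) N(2) by blast+
  have KN: "K \<subseteq> N"
  proof
    fix x assume "x \<in> K"
    then obtain y where "y \<in> N" "x = inv_into U \<phi> (\<phi> y)" using BU(2) by (auto simp: K_def)
    then show "x \<in> N" using c N by auto
  qed
  have memK: "x \<in> K \<longleftrightarrow> \<phi> x \<in> B" if "x \<in> U" for x
    using that c BU by (auto simp: K_def image_iff f_inv_into_f intro!: bexI[of _ "\<phi> x"])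
  have "compactin (mtop M) K"
  proof -
    obtain g where g: "homeomorphic_maps (subtopology (mtop M) U) (subtopology (Euclidean_space n) (\<phi> ` U)) \<phi> g"
      using chartD(3)[OF c] homeomorphic_map_maps by blast
    have "g y = inv_into U \<phi> y" if yB: "y \<in> B" for y
    proof -
      obtain x where "x \<in> U" "y = \<phi> x" using BU(1) yB by auto
      then show ?thesis using g c chart_subset[OF c] by (auto simp: homeomorphic_maps_def)
    qed
    then have "K = g ` B" by (simp add: K_def)
    moreover have "compactin (subtopology (Euclidean_space n) (\<phi> ` U)) B"
      using Bcomp BU by (simp add: compactin_subtopology)
    ultimately have "compactin (subtopology (mtop M) U) K"
      using g by (metis homeomorphic_maps_def image_compactin)
    then show ?thesis by (simp add: compactin_subtopology)
  qed
  then have Kcl: "closedin (mtop M) K"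
    using smooth_manifold compactin_imp_closedin by (auto simp: smooth_manifold_def)
  define \<beta> where "\<beta> x = (\<Prod>i<n. flat 0 ((r / 2)\<^sup>2 - (\<phi> x i - c0 i)\<^sup>2))" for x
  have zero: "\<beta> x = 0" if xK: "x \<in> U" "x \<notin> K" for x
  proof -
    obtain i where i: "i < n" "\<not> \<bar>\<phi> x i - c0 i\<bar> \<le> r / 2"
      using memK[OF xK(1)] xK chart_Euclidean[OF c] by (auto simp: B_def)
    then have "(r / 2)\<^sup>2 \<le> (\<phi> x i - c0 i)\<^sup>2" using r(1) by (intro abs_le_square_iff[THEN iffD1]) auto
    then have "flat 0 ((r / 2)\<^sup>2 - (\<phi> x i - c0 i)\<^sup>2) = 0" by (simp add: flat_def)
    then show ?thesis unfolding \<beta>_def using i(1) by (intro prod_zero) auto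
  qed
  have sm: "smooth_on M U \<beta>"
    unfolding \<beta>_def
    by (intro smooth_on_prod smooth_on_compose_real[OF _ _ C1_on_flat] smooth_on_diff smooth_on_const
        smooth_on_power smooth_on_coordinate[OF c] chartD(1)[OF c]) auto
  define \<eta> where "\<eta> x = (if x \<in> U then \<beta> x else 0)" for x
  have "smooth_on M X \<eta>"
    unfolding \<eta>_def
    by (rule smooth_on_extend_zero[OF chartD(1)[OF c] Kcl])
      (use KN N zero sm chart_subset[OF c] in \<open>auto simp: inf.absorb2\<close>)
  moreover have "\<eta> x \<ge> 0" for x by (auto simp: \<eta>_def \<beta>_def flat_0_nonneg intro!: prod_nonneg)
  moreover have "\<eta> x0 > 0"
    using x0 N r by (auto simp: \<eta>_def \<beta>_def flat_0_pos_iff c0_def intro!: prod_pos)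
  moreover have "\<eta> x = 0" if "x \<notin> K" for x using zero that by (auto simp: \<eta>_def)
  moreover have "\<phi> x \<in> open_box n (\<phi> x0) r" if "x \<in> K" for x
    using that memK KN N Bsub by (auto simp: c0_def)
  ultimately show thesis using that r Kcl KN by (simp add: c0_def)
qed

abbreviation A where "A \<equiv> smooth_functions M"

lemma carrier_A: "f \<in> carrier A \<longleftrightarrow> f \<in> extensional X \<and> smooth_on M X f"
  by (simp add: smooth_functions_def)

lemma A_simps:
  "f \<otimes>\<^bsub>A\<^esub> g = (\<lambda>x\<in>X. f x * g x)" "f \<oplus>\<^bsub>A\<^esub> g = (\<lambda>x\<in>X. f x + g x)"
  "r \<odot>\<^bsub>A\<^esub> f = (\<lambda>x\<in>X. r * f x)" "\<one>\<^bsub>A\<^esub> = (\<lambda>x\<in>X. 1)" "\<zero>\<^bsub>A\<^esub> = (\<lambda>x\<in>X. 0)"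
  by (simp_all add: smooth_functions_def)

lemma restrict_in_A: "smooth_on M X f \<Longrightarrow> restrict f X \<in> carrier A"
  by (auto simp: carrier_A intro: smooth_on_cong[OF openin_topspace])

lemma A_smooth: "f \<in> carrier A \<Longrightarrow> W \<subseteq> X \<Longrightarrow> smooth_on M W f"
  by (auto simp: carrier_A intro: smooth_on_subset)

text \<open>
  A tangent vector at \<open>x\<close>.
\<close>

definition point_derivation :: "'a \<Rightarrow> (('a \<Rightarrow> real) \<Rightarrow> real) \<Rightarrow> bool" where
  "point_derivation x v \<longleftrightarrow>
     (\<forall>f\<in>carrier A. \<forall>g\<in>carrier A. v (f \<oplus>\<^bsub>A\<^esub> g) = v f + v g) \<and>
     (\<forall>r. \<forall>f\<in>carrier A. v (r \<odot>\<^bsub>A\<^esub> f) = r * v f) \<and>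
     (\<forall>f\<in>carrier A. \<forall>g\<in>carrier A. v (f \<otimes>\<^bsub>A\<^esub> g) = f x * v g + g x * v f)"

lemma point_derivationD:
  assumes "point_derivation x v" "f \<in> carrier A" "g \<in> carrier A"
  shows "v (f \<oplus>\<^bsub>A\<^esub> g) = v f + v g" "v (r \<odot>\<^bsub>A\<^esub> f) = r * v f" "v (f \<otimes>\<^bsub>A\<^esub> g) = f x * v g + g x * v f"
  using assms by (auto simp: point_derivation_def)

lemma point_derivation_sum:
  assumes "point_derivation x v" "finite J" "\<And>j. j \<in> J \<Longrightarrow> f j \<in> carrier A"
  shows "v (\<lambda>x\<in>X. \<Sum>j\<in>J. f j x) = (\<Sum>j\<in>J. v (f j))"
  using assms(2,3)
proof (induction J rule: finite_induct)
  case empty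
  have "(\<lambda>x\<in>X. 0) = 0 \<odot>\<^bsub>A\<^esub> (\<lambda>x\<in>X. 1)" by (auto simp: A_simps)
  moreover have "(\<lambda>x\<in>X. 1) \<in> carrier A" by (intro restrict_in_A smooth_on_const) auto
  ultimately show ?case using point_derivationD(2)[OF assms(1), of "\<lambda>x\<in>X. 1" "\<lambda>x\<in>X. 1" 0] by simp
next
  case (insert j J)
  have *: "(\<lambda>x\<in>X. \<Sum>j\<in>insert j J. f j x) = f j \<oplus>\<^bsub>A\<^esub> (\<lambda>x\<in>X. \<Sum>j\<in>J. f j x)"
    using insert.hyps by (auto simp: A_simps)
  moreover have "(\<lambda>x\<in>X. \<Sum>j\<in>J. f j x) \<in> carrier A"
    using insert.prems by (intro restrict_in_A smooth_on_sum) (auto simp: carrier_A)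
  ultimately have "v (\<lambda>x\<in>X. \<Sum>j\<in>insert j J. f j x) = v (f j) + v (\<lambda>x\<in>X. \<Sum>j\<in>J. f j x)"
    using point_derivationD(1)[OF assms(1)] insert.prems by (simp only: insertI1)
  moreover have "v (\<lambda>x\<in>X. \<Sum>j\<in>J. f j x) = (\<Sum>j\<in>J. v (f j))"
    using insert.prems by (intro insert.IH) auto
  ultimately show ?case by (simp only: sum.insert[OF insert.hyps(1,2)])
qed

text \<open>
  Hadamard's lemma writes \<open>f - f(x\<^sub>0)\<close> as \<open>\<Sum>\<^sub>j (\<phi>\<^sub>j - \<phi>\<^sub>j(x\<^sub>0)) g\<^sub>j\<close> near \<open>x\<^sub>0\<close>. Multiplied by the square of a bump
  function \<open>\<theta>\<close> with \<open>\<theta>(x\<^sub>0) = 1\<close>, the factors \<open>u\<^sub>j = \<theta> (\<phi>\<^sub>j - \<phi>\<^sub>j(x\<^sub>0))\<close> and \<open>\<theta> g\<^sub>j\<close> are globally defined. A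
  derivation at \<open>x\<^sub>0\<close> applied to both sides leaves \<open>v(u\<^sub>j) g\<^sub>j(x\<^sub>0)\<close>, as the \<open>u\<^sub>j\<close> vanish at \<open>x\<^sub>0\<close>.
\<close>

lemma point_derivation_coordinates:
  assumes c: "(U, \<phi>) \<in> atlas M" and x0: "x0 \<in> U"
  obtains u where "\<And>j. u j \<in> carrier A"
    "\<And>v f. point_derivation x0 v \<Longrightarrow> f \<in> carrier A \<Longrightarrow> v f = (\<Sum>j<n. v (u j) * chart_deriv U \<phi> j f x0)"
proof -
  obtain \<eta> K r where r: "r > 0" and K: "closedin (mtop M) K" "K \<subseteq> U" and \<eta>: "smooth_on M X \<eta>"
    "\<eta> x0 > 0" "\<And>x. x \<notin> K \<Longrightarrow> \<eta> x = 0"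
    and Kbox: "\<And>x. x \<in> K \<Longrightarrow> \<phi> x \<in> open_box n (\<phi> x0) r" and box: "open_box n (\<phi> x0) r \<subseteq> \<phi> ` U"
    by (rule bump_function[OF c chartD(1)[OF c] _ x0]) auto
  define c0 where "c0 = \<phi> x0"
  define N where "N = {x \<in> U. \<phi> x \<in> open_box n c0 r}"
  have N: "openin (mtop M) N" "N \<subseteq> U" "N \<subseteq> X" and KN: "K \<subseteq> N"
    using chart_preimage_open[OF c openin_open_box] K Kbox chart_subset[OF c] by (auto simp: N_def c0_def)
  have c0E: "c0 \<in> topspace (Euclidean_space n)" unfolding c0_def by (rule chart_Euclidean[OF c x0])
  have x0N: "x0 \<in> N" using x0 c0E r by (auto simp: N_def c0_def open_box_def)
  have \<phi>N: "\<phi> ` N = open_box n c0 r"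
    using box by (auto simp: N_def c0_def)
  define \<theta> where "\<theta> x = \<eta> x / \<eta> x0" for x
  have \<theta>: "smooth_on M X \<theta>" "\<theta> x0 = 1" "\<And>x. x \<notin> K \<Longrightarrow> \<theta> x = 0"
    using smooth_on_mult[OF openin_topspace smooth_on_const[OF openin_topspace, of "1 / \<eta> x0"] \<eta>(1)] \<eta>(2,3)
    by (auto simp: \<theta>_def[abs_def])
  have ext: "(\<lambda>x\<in>X. if x \<in> N then \<theta> x * g x else 0) \<in> carrier A" if "smooth_on M N g" for g
    by (intro restrict_in_A smooth_on_extend_zero[OF N(1) K(1) KN] smooth_on_mult)
      (use N that \<theta> in \<open>auto simp: inf.absorb2 intro: smooth_on_subset\<close>)
  have \<theta>A: "restrict \<theta> X \<in> carrier A" by (rule restrict_in_A[OF \<theta>(1)])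
  define u where "u j = (\<lambda>x\<in>X. if x \<in> N then \<theta> x * (\<phi> x j - c0 j) else 0)" for j
  have uA: "u j \<in> carrier A" for j
    unfolding u_def by (intro ext smooth_on_diff smooth_on_const N smooth_on_subset[OF smooth_on_coordinate[OF c]])
  have u0: "u j x0 = 0" for j using x0N N by (auto simp: u_def c0_def)
  have "v f = (\<Sum>j<n. v (u j) * chart_deriv U \<phi> j f x0)" if v: "point_derivation x0 v" and f: "f \<in> carrier A" for v f
  proof -
    note D = point_derivationD[OF v]
    define F where "F y = f (inv_into U \<phi> y)" for y
    have F: "C_on n k (open_box n c0 r) F" for k
      unfolding F_def \<phi>N[symmetric] by (rule smooth_on_local_rep[OF c N(2) A_smooth[OF f N(3)]])
    define g where "g j x = ray_integral c0 0 (partial_deriv j F) (\<phi> x)" for j x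
    have g: "smooth_on M N (g j)" if "j < n" for j
    proof (rule smooth_onI_chart[OF N(1)])
      fix x assume "x \<in> N"
      have "C_on n k (\<phi> ` N) (\<lambda>y. g j (inv_into U \<phi> y))" for k
        by (rule C_on_cong_imp[OF _ _ C_on_ray_integral[OF c0E C_on_partial_deriv(1)[OF F \<open>j < n\<close>]], folded \<phi>N])
          (use chart_image_open[OF c N(1,2)] N c in \<open>auto simp: g_def subset_eq\<close>)
      then show "\<exists>V \<psi> N. (V, \<psi>) \<in> atlas M \<and> openin (mtop M) N \<and> x \<in> N \<and> N \<subseteq> V \<and>
          (\<forall>k. C_on n k (\<psi> ` N) (\<lambda>y. g j (inv_into V \<psi> y)))"
        using c N \<open>x \<in> N\<close> by blast
    qed
    define w where "w j = (\<lambda>x\<in>X. if x \<in> N then \<theta> x * g j x else 0)" for j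
    have wA: "w j \<in> carrier A" if "j < n" for j unfolding w_def by (rule ext[OF g[OF that]])
    have w0: "w j x0 = chart_deriv U \<phi> j f x0" if "j < n" for j
    proof -
      have "ray_integral c0 0 (partial_deriv j F) c0 = partial_deriv j F c0"
        by (simp add: ray_integral_def)
      then show ?thesis using x0N N \<theta>(2) by (auto simp: w_def g_def c0_def chart_deriv_def F_def[abs_def])
    qed
    let ?\<theta> = "restrict \<theta> X"
    let ?\<theta>2 = "?\<theta> \<otimes>\<^bsub>A\<^esub> ?\<theta>"
    have \<theta>2: "?\<theta>2 \<in> carrier A" "?\<theta>2 x0 = 1"
      using \<theta>(2) x0N N \<theta>A by (auto simp: A_simps carrier_A intro!: smooth_on_cong[OF _ smooth_on_mult[OF _ \<theta>(1) \<theta>(1)]])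
    have uw: "u j \<otimes>\<^bsub>A\<^esub> w j \<in> carrier A" if "j < n" for j
      using uA[of j] wA[OF that] unfolding A_simps by (intro restrict_in_A smooth_on_mult) (auto simp: carrier_A)
    have "?\<theta>2 \<otimes>\<^bsub>A\<^esub> f = (f x0 \<odot>\<^bsub>A\<^esub> ?\<theta>2) \<oplus>\<^bsub>A\<^esub> (\<lambda>x\<in>X. \<Sum>j<n. (u j \<otimes>\<^bsub>A\<^esub> w j) x)" (is "?L = ?R")
    proof
      fix x
      show "?L x = ?R x"
      proof (cases "x \<in> N")
        case True
        then have xX: "x \<in> X" using N by auto
        have "F (\<phi> x) = F c0 + (\<Sum>j<n. (\<phi> x j - c0 j) * g j x)"
          unfolding g_def by (rule hadamard[OF c0E F]) (use True in \<open>auto simp: N_def\<close>)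
        moreover have "F (\<phi> x) = f x" "F c0 = f x0" using True x0 N c by (auto simp: F_def c0_def)
        ultimately have "f x = f x0 + (\<Sum>j<n. (\<phi> x j - c0 j) * g j x)" by simp
        then have "\<theta> x * \<theta> x * f x = \<theta> x * \<theta> x * (f x0 + (\<Sum>j<n. (\<phi> x j - c0 j) * g j x))" by simp
        also have "\<dots> = f x0 * (\<theta> x * \<theta> x) + (\<Sum>j<n. \<theta> x * (\<phi> x j - c0 j) * (\<theta> x * g j x))"
          by (simp add: algebra_simps sum_distrib_left)
        finally show ?thesis using True xX by (simp add: A_simps u_def w_def)
      next
        case False
        then have "\<theta> x = 0" using \<theta>(3) KN by blast
        then show ?thesis using False by (auto simp: A_simps u_def restrict_def)
      qed
    qed
    then have "v ?L = v ?R" by simp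
    moreover have "v ?L = v f + f x0 * v ?\<theta>2" using D(3)[OF \<theta>2(1) f] \<theta>2(2) by simp
    moreover have "v ?R = f x0 * v ?\<theta>2 + (\<Sum>j<n. v (u j \<otimes>\<^bsub>A\<^esub> w j))"
    proof -
      have "f x0 \<odot>\<^bsub>A\<^esub> ?\<theta>2 \<in> carrier A"
        unfolding A_simps(3) by (intro restrict_in_A smooth_on_mult smooth_on_const A_smooth \<theta>2) auto
      moreover have "(\<lambda>x\<in>X. \<Sum>j<n. (u j \<otimes>\<^bsub>A\<^esub> w j) x) \<in> carrier A"
        by (intro restrict_in_A smooth_on_sum A_smooth uw) auto
      ultimately show ?thesis
        using D(1) D(2)[OF \<theta>2(1) \<theta>2(1)] point_derivation_sum[OF v, of "{..<n}" "\<lambda>j. u j \<otimes>\<^bsub>A\<^esub> w j"] uw by simp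
    qed
    moreover have "v (u j \<otimes>\<^bsub>A\<^esub> w j) = v (u j) * chart_deriv U \<phi> j f x0" if "j < n" for j
      using D(3)[OF uA wA[OF that]] u0 w0[OF that] by simp
    ultimately show ?thesis by simp
  qed
  then show thesis using that uA by blast
qed

text \<open>
  Vector fields that are cut off so as to extend to \<open>M\<close> by zero: the argument of \<open>D\<close> needs to be smooth on \<open>N\<close>
  only, the result is smooth on \<open>M\<close>. The coordinates of a section in a trivialisation are such arguments.
\<close>

definition vector_field_on :: "'a set \<Rightarrow> (('a \<Rightarrow> real) \<Rightarrow> 'a \<Rightarrow> real) \<Rightarrow> bool" where
  "vector_field_on N D \<longleftrightarrow>
     (\<forall>g. smooth_on M N g \<longrightarrow> smooth_on M X (D g)) \<and>
     (\<forall>f g x. smooth_on M N f \<longrightarrow> smooth_on M N g \<longrightarrow> x \<in> N \<longrightarrow> D (\<lambda>x. f x + g x) x = D f x + D g x) \<and>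
     (\<forall>f g x. smooth_on M N f \<longrightarrow> smooth_on M N g \<longrightarrow> x \<in> N \<longrightarrow>
        D (\<lambda>x. f x * g x) x = f x * D g x + g x * D f x) \<and>
     (\<forall>f g x. (\<forall>x\<in>N. f x = g x) \<longrightarrow> D f x = D g x) \<and>
     (\<forall>r x. D (\<lambda>x. r) x = 0)"

text \<open>
  The functions \<open>y\<^sub>j\<close> are the cut-off coordinates \<open>z\<^sub>j = \<eta> \<phi>\<^sub>j\<close> and, for \<open>j = n\<close>, the bump function \<open>\<eta>\<close> itself.
  A derivation \<open>v\<close> has the components \<open>v\<^sub>j\<close> with \<open>\<eta> v\<^sub>j = v(z\<^sub>j) - \<phi>\<^sub>j v(\<eta>)\<close>, where the second term accounts for the
  derivative of the cut-off and leads to the vector field \<open>D\<^sub>n\<close>. One factor \<open>\<eta>\<close> of \<open>\<eta>\<^sup>3\<close> occurs in this equation,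
  the other two make the products with \<open>\<phi>\<^sub>j\<close> and \<open>\<partial>/\<partial>\<phi>\<^sub>j\<close> globally defined.
\<close>

lemma local_vector_fields:
  assumes V: "openin (mtop M) V" and x0: "x0 \<in> V"
  obtains N K \<eta> y D where "openin (mtop M) N" "N \<subseteq> V" "closedin (mtop M) K" "K \<subseteq> N"
    "\<eta> \<in> carrier A" "\<And>x. x \<in> X \<Longrightarrow> \<eta> x \<ge> 0" "\<eta> x0 > 0"  "\<And>x. x \<in> X - K \<Longrightarrow> \<eta> x = 0"
    "\<And>j. j \<le> n \<Longrightarrow> y j \<in> carrier A" "\<And>j. j \<le> n \<Longrightarrow> vector_field_on N (D j)"
    "\<And>j g x. j \<le> n \<Longrightarrow> x \<notin> K \<Longrightarrow> D j g x = 0"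
    "\<And>x v f. x \<in> X \<Longrightarrow> point_derivation x v \<Longrightarrow> f \<in> carrier A \<Longrightarrow>
        \<eta> x ^ 3 * v f = (\<Sum>j\<le>n. v (y j) * D j f x)"
proof -
  have "x0 \<in> X" using V x0 openin_subset by blast
  then obtain U \<phi> where c: "(U, \<phi>) \<in> atlas M" and "x0 \<in> U" using chart_ex by blast
  define N where "N = U \<inter> V"
  have N: "openin (mtop M) N" "N \<subseteq> U" "N \<subseteq> V" "x0 \<in> N" "N \<subseteq> X"
    using V x0 \<open>x0 \<in> U\<close> chartD(1)[OF c] openin_subset by (auto simp: N_def)
  obtain \<beta> K where K: "closedin (mtop M) K" "K \<subseteq> N" and \<beta>: "smooth_on M X \<beta>"
    "\<And>x. \<beta> x \<ge> 0" "\<beta> x0 > 0" "\<And>x. x \<notin> K \<Longrightarrow> \<beta> x = 0"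
    using bump_function[OF c N(1,2,4)] by metis
  have \<beta>N: "smooth_on M N \<beta>" by (rule smooth_on_subset[OF \<beta>(1) N(5)])
  have \<phi>N: "smooth_on M N (\<lambda>x. \<phi> x j)" for j by (rule smooth_on_subset[OF smooth_on_coordinate[OF c] N(2)])
  note sms = smooth_on_mult[OF N(1)] smooth_on_add[OF N(1)] smooth_on_sum[OF N(1)]
    smooth_on_diff[OF N(1)] smooth_on_const[OF N(1)] smooth_on_power[OF N(1)]
  note cd = smooth_on_chart_deriv[OF c N(1,2)]
  define \<eta> where "\<eta> = restrict \<beta> X"
  have \<eta>: "\<eta> \<in> carrier A" "\<And>x. x \<in> X \<Longrightarrow> \<eta> x = \<beta> x" unfolding \<eta>_def by (auto intro: restrict_in_A \<beta>)
  define z where "z j = (\<lambda>x\<in>X. if x \<in> N then \<beta> x * \<phi> x j else 0)" for j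
  have zA: "z j \<in> carrier A" for j
    unfolding z_def
    by (rule restrict_in_A[OF smooth_on_extend_zero[OF N(1) K openin_topspace]])
      (use N \<beta>N \<phi>N \<beta>(4) in \<open>auto simp: inf.absorb2 intro: sms\<close>)
  define y where "y j = (if j = n then \<eta> else z j)" for j
  define D where "D j g x = (if x \<in> N then
      if j = n then - (\<Sum>i<n. \<beta> x * \<phi> x i * (\<beta> x * chart_deriv U \<phi> i g x))
      else \<beta> x * (\<beta> x * chart_deriv U \<phi> j g x) else 0)" for j g x
  have yA: "y j \<in> carrier A" if "j \<le> n" for j using zA \<eta> by (simp add: y_def)
  have D0: "D j g x = 0" if "x \<notin> K" for j g x using \<beta>(4)[OF that] by (simp add: D_def)
  have DX: "smooth_on M X (D j g)" if "j \<le> n" "smooth_on M N g" for j g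
  proof (cases "j = n")
    case True
    have "smooth_on M N (\<lambda>x. -1 * (\<Sum>i<n. \<beta> x * \<phi> x i * (\<beta> x * chart_deriv U \<phi> i g x)))"
      by (intro sms \<beta>N \<phi>N cd that(2)) auto
    then show ?thesis using True unfolding D_def
      by (intro smooth_on_extend_zero[OF N(1) K openin_topspace]) (use N \<beta>(4) in \<open>auto simp: inf.absorb2\<close>)
  next
    case False
    have "smooth_on M N (\<lambda>x. \<beta> x * (\<beta> x * chart_deriv U \<phi> j g x))"
      by (intro sms \<beta>N \<phi>N cd that(2)) (use False that in auto)
    then show ?thesis using False unfolding D_def
      by (intro smooth_on_extend_zero[OF N(1) K openin_topspace]) (use N \<beta>(4) in \<open>auto simp: inf.absorb2\<close>)
  qed
  have vf: "vector_field_on N (D j)" if "j \<le> n" for j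
    unfolding vector_field_on_def
  proof (intro conjI allI impI)
    show "smooth_on M X (D j g)" if "smooth_on M N g" for g by (rule DX[OF \<open>j \<le> n\<close> that])
    fix f g x assume fg: "smooth_on M N f" "smooth_on M N g" "x \<in> N"
    have a: "chart_deriv U \<phi> i (\<lambda>x. f x + g x) x = chart_deriv U \<phi> i f x + chart_deriv U \<phi> i g x" if "i < n" for i
      using chart_deriv_add[OF c N(1,2) that fg] .
    have m: "chart_deriv U \<phi> i (\<lambda>x. f x * g x) x = f x * chart_deriv U \<phi> i g x + g x * chart_deriv U \<phi> i f x" if "i < n" for i
      using chart_deriv_mult[OF c N(1,2) that fg] .
    show "D j (\<lambda>x. f x + g x) x = D j f x + D j g x"
      using \<open>j \<le> n\<close> by (auto simp: D_def a algebra_simps sum.distrib)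
    show "D j (\<lambda>x. f x * g x) x = f x * D j g x + g x * D j f x"
      using \<open>j \<le> n\<close> by (auto simp: D_def m algebra_simps sum.distrib sum_distrib_left)
  next
    fix f g :: "'a \<Rightarrow> real" and x assume fg: "\<forall>x\<in>N. f x = g x"
    have "chart_deriv U \<phi> i f x = chart_deriv U \<phi> i g x" if "i < n" "x \<in> N" for i
      using chart_deriv_cong[OF c N(1,2) that(2,1)] fg by blast
    then show "D j f x = D j g x" using \<open>j \<le> n\<close> by (auto simp: D_def)
  next
    show "D j (\<lambda>x. r) x = 0" for r x by (simp add: D_def chart_deriv_const[OF c])
  qed
  have main: "\<eta> x ^ 3 * v f = (\<Sum>j\<le>n. v (y j) * D j f x)"
    if x: "x \<in> X" and v: "point_derivation x v" and f: "f \<in> carrier A" for x v f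
  proof (cases "x \<in> K")
    case False
    then show ?thesis using D0 \<eta> \<beta>(4) x by simp
  next
    case True
    then have xN: "x \<in> N" "x \<in> U" using K N by auto
    obtain u where u0: "\<And>j. u j \<in> carrier A" "\<And>v f. point_derivation x v \<Longrightarrow> f \<in> carrier A \<Longrightarrow>
        v f = (\<Sum>j<n. v (u j) * chart_deriv U \<phi> j f x)"
      using point_derivation_coordinates[OF c xN(2)] by blast
    note u = u0(1) u0(2)[OF v]
    have "v (z i) = \<phi> x i * v \<eta> + \<beta> x * v (u i)" if i: "i < n" for i
    proof -
      have *: "chart_deriv U \<phi> j (z i) x = \<beta> x * (if i = j then 1 else 0) + \<phi> x i * chart_deriv U \<phi> j \<eta> x"
        if j: "j < n" for j
      proof -
        have "chart_deriv U \<phi> j (z i) x = chart_deriv U \<phi> j (\<lambda>x. \<beta> x * \<phi> x i) x"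
          by (rule chart_deriv_cong[OF c N(1,2) xN(1) j]) (use N in \<open>auto simp: z_def\<close>)
        moreover have "chart_deriv U \<phi> j \<eta> x = chart_deriv U \<phi> j \<beta> x"
          by (rule chart_deriv_cong[OF c N(1,2) xN(1) j]) (use N in \<open>auto simp: \<eta>_def\<close>)
        ultimately show ?thesis
          using chart_deriv_mult[OF c N(1,2) j \<beta>N \<phi>N xN(1)] chart_deriv_coordinate[OF c N(1,2) j xN(1)] by simp
      qed
      have "v (z i) = (\<Sum>j<n. v (u j) * (\<beta> x * (if i = j then 1 else 0) + \<phi> x i * chart_deriv U \<phi> j \<eta> x))"
        using u(2)[OF zA[of i]] * by simp
      also have "\<dots> = (\<Sum>j<n. if i = j then \<beta> x * v (u j) else 0) + \<phi> x i * (\<Sum>j<n. v (u j) * chart_deriv U \<phi> j \<eta> x)"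
        unfolding sum_distrib_left sum.distrib[symmetric]
        by (rule sum.cong) (auto simp: algebra_simps)
      also have "\<dots> = \<beta> x * v (u i) + \<phi> x i * v \<eta>" using i u(2)[OF \<eta>(1)] by simp
      finally show ?thesis by simp
    qed
    then have z: "\<beta> x * v (u i) = v (z i) - \<phi> x i * v \<eta>" if "i < n" for i using that by simp
    have "\<eta> x ^ 3 * v f = (\<Sum>j<n. (\<beta> x * v (u j)) * (\<beta> x * (\<beta> x * chart_deriv U \<phi> j f x)))"
      using u(2)[OF f] \<eta>(2)[OF x] by (simp add: sum_distrib_left power3_eq_cube algebra_simps)
    also have "\<dots> = (\<Sum>j<n. (v (z j) - \<phi> x j * v \<eta>) * (\<beta> x * (\<beta> x * chart_deriv U \<phi> j f x)))"
      using z by simp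
    also have "\<dots> = (\<Sum>j<n. v (z j) * (\<beta> x * (\<beta> x * chart_deriv U \<phi> j f x)))
        + v \<eta> * - (\<Sum>j<n. \<beta> x * \<phi> x j * (\<beta> x * chart_deriv U \<phi> j f x))"
      by (simp add: sum_distrib_left sum_subtractf algebra_simps)
    also have "\<dots> = (\<Sum>j\<le>n. v (y j) * D j f x)"
      using xN(1) by (simp add: lessThan_Suc_atMost[symmetric] y_def D_def)
    finally show ?thesis .
  qed
  show thesis
    by (rule that[OF N(1,3) K \<eta>(1) _ _ _ yA vf D0 main]) (use \<eta>(2) \<beta> \<open>x0 \<in> X\<close> in auto)
qed

end

section \<open>Sections of a vector bundle\<close>

locale smooth_vbundle = smooth_mfd M for M :: "'a manifold" +
  fixes E :: "('a, 'e) vbundle"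
  assumes vector_bundle: "vector_bundle M E"
begin

abbreviation P where "P \<equiv> smooth_sections M E"
abbreviation rk where "rk \<equiv> bundle_rank E"
abbreviation BA where "BA \<equiv> bundle_atlas E"

lemma zero_fibre: "x \<in> X \<Longrightarrow> fibre_zero E x \<in> fibre E x"
  and add_fibre: "x \<in> X \<Longrightarrow> u \<in> fibre E x \<Longrightarrow> v \<in> fibre E x \<Longrightarrow> fibre_add E u v \<in> fibre E x"
  and scale_fibre: "x \<in> X \<Longrightarrow> u \<in> fibre E x \<Longrightarrow> fibre_scale E r u \<in> fibre E x"
  using bspec[OF conjunct1[OF conjunct2[OF vector_bundle[unfolded vector_bundle_def]]]] by simp_all

lemma triv_all:
  "\<forall>(U, \<Phi>)\<in>BA. openin (mtop M) U \<and>
        (\<forall>x\<in>U. bij_betw \<Phi> (fibre E x) (topspace (Euclidean_space rk)) \<and>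
           (\<forall>i. \<Phi> (fibre_zero E x) i = 0) \<and>
           (\<forall>u\<in>fibre E x. \<forall>v\<in>fibre E x. \<forall>i. \<Phi> (fibre_add E u v) i = \<Phi> u i + \<Phi> v i) \<and>
           (\<forall>r. \<forall>u\<in>fibre E x. \<forall>i. \<Phi> (fibre_scale E r u) i = r * \<Phi> u i))"
  by (rule conjunct1[OF conjunct2[OF conjunct2[OF conjunct2[OF vector_bundle[unfolded vector_bundle_def]]]]])

lemma triv_open: "(U, \<Phi>) \<in> BA \<Longrightarrow> openin (mtop M) U"
  using bspec[OF triv_all, of "(U, \<Phi>)"] by simp

lemma triv_subset: "(U, \<Phi>) \<in> BA \<Longrightarrow> U \<subseteq> X"
  using triv_open openin_subset by blast

lemma triv:
  assumes "(U, \<Phi>) \<in> BA" "x \<in> U"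
  shows triv_bij: "bij_betw \<Phi> (fibre E x) (topspace (Euclidean_space rk))"
    and triv_zero: "\<Phi> (fibre_zero E x) i = 0"
    and triv_add: "u \<in> fibre E x \<Longrightarrow> v \<in> fibre E x \<Longrightarrow> \<Phi> (fibre_add E u v) i = \<Phi> u i + \<Phi> v i"
    and triv_scale: "u \<in> fibre E x \<Longrightarrow> \<Phi> (fibre_scale E r u) i = r * \<Phi> u i"
proof -
  have *: "bij_betw \<Phi> (fibre E x) (topspace (Euclidean_space rk)) \<and>
           (\<forall>i. \<Phi> (fibre_zero E x) i = 0) \<and>
           (\<forall>u\<in>fibre E x. \<forall>v\<in>fibre E x. \<forall>i. \<Phi> (fibre_add E u v) i = \<Phi> u i + \<Phi> v i) \<and>
           (\<forall>r. \<forall>u\<in>fibre E x. \<forall>i. \<Phi> (fibre_scale E r u) i = r * \<Phi> u i)"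
    using bspec[OF triv_all assms(1)] assms(2) by simp
  show "bij_betw \<Phi> (fibre E x) (topspace (Euclidean_space rk))" "\<Phi> (fibre_zero E x) i = 0"
    "u \<in> fibre E x \<Longrightarrow> v \<in> fibre E x \<Longrightarrow> \<Phi> (fibre_add E u v) i = \<Phi> u i + \<Phi> v i"
    "u \<in> fibre E x \<Longrightarrow> \<Phi> (fibre_scale E r u) i = r * \<Phi> u i"
    using * by blast+
qed

lemma triv_ex:
  assumes "x \<in> X"
  obtains U \<Phi> where "(U, \<Phi>) \<in> BA" "x \<in> U"
proof -
  have "(\<Union>(U, \<Phi>)\<in>BA. U) = X"
    by (rule conjunct1[OF conjunct2[OF conjunct2[OF vector_bundle[unfolded vector_bundle_def]]]])
  then show thesis using that assms by blast
qed

lemma triv_transition: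
  assumes "(U, \<Phi>) \<in> BA" "(V, \<Psi>) \<in> BA" "i < rk" "j < rk"
  shows "smooth_on M (U \<inter> V) (\<lambda>x. \<Psi> (inv_into (fibre E x) \<Phi> (\<lambda>l. if l = j then 1 else 0)) i)"
proof -
  have "\<forall>(U, \<Phi>)\<in>BA. \<forall>(V, \<Psi>)\<in>BA. \<forall>i<rk. \<forall>j<rk.
        smooth_on M (U \<inter> V) (\<lambda>x. \<Psi> (inv_into (fibre E x) \<Phi> (\<lambda>l. if l = j then 1 else 0)) i)"
    by (rule conjunct2[OF conjunct2[OF conjunct2[OF conjunct2[OF vector_bundle[unfolded vector_bundle_def]]]]])
  from bspec[OF bspec[OF this assms(1), unfolded prod.case] assms(2), unfolded prod.case] assms(3,4)
  show ?thesis by blast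
qed

lemma triv_beyond: "(U, \<Phi>) \<in> BA \<Longrightarrow> x \<in> U \<Longrightarrow> u \<in> fibre E x \<Longrightarrow> rk \<le> i \<Longrightarrow> \<Phi> u i = 0"
  using bij_betwE[OF triv_bij] by (force simp: mem_Euclidean_space)

lemma triv_eqI:
  assumes "(U, \<Phi>) \<in> BA" "x \<in> U" "u \<in> fibre E x" "v \<in> fibre E x" "\<And>i. i < rk \<Longrightarrow> \<Phi> u i = \<Phi> v i"
  shows "u = v"
proof -
  have "\<Phi> u = \<Phi> v"
  proof
    fix i show "\<Phi> u i = \<Phi> v i" using assms triv_beyond[OF assms(1,2)] by (cases "i < rk") auto
  qed
  then show ?thesis using bij_betw_imp_inj_on[OF triv_bij[OF assms(1,2)]] assms(3,4) by (meson inj_onD)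
qed

definition point where
  "point \<Phi> x c = inv_into (fibre E x) \<Phi> (\<lambda>i. if i < rk then c i else 0)"

lemma point:
  assumes "(U, \<Phi>) \<in> BA" "x \<in> U"
  shows "point \<Phi> x c \<in> fibre E x" "\<Phi> (point \<Phi> x c) = (\<lambda>i. if i < rk then c i else 0)"
proof -
  have "(\<lambda>i. if i < rk then c i else 0) \<in> \<Phi> ` fibre E x"
    using bij_betw_imp_surj_on[OF triv_bij[OF assms]] by (simp add: mem_Euclidean_space)
  then show "point \<Phi> x c \<in> fibre E x" "\<Phi> (point \<Phi> x c) = (\<lambda>i. if i < rk then c i else 0)"
    unfolding point_def by (auto intro: inv_into_into f_inv_into_f)
qed

definition transition where
  "transition \<Phi> \<Psi> x i j = \<Psi> (inv_into (fibre E x) \<Phi> (\<lambda>l. if l = j then 1 else 0)) i"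

text \<open>
  A vector is the sum of its components, which are added one by one.
\<close>

lemma transition_formula:
  assumes U: "(U, \<Phi>) \<in> BA" "x \<in> U" and V: "(V, \<Psi>) \<in> BA" "x \<in> V" and u: "u \<in> fibre E x"
  shows "\<Psi> u i = (\<Sum>j<rk. \<Phi> u j * transition \<Phi> \<Psi> x i j)"
proof -
  have xX: "x \<in> X" using U triv_subset by blast
  define e where "e j = inv_into (fibre E x) \<Phi> (\<lambda>l. if l = j then 1 else 0)" for j
  have e: "e j \<in> fibre E x" "\<Phi> (e j) = (\<lambda>l. if l = j then 1 else 0)" if "j < rk" for j
  proof -
    have "(\<lambda>l. if l = j then 1 else 0) \<in> \<Phi> ` fibre E x"
      using bij_betw_imp_surj_on[OF triv_bij[OF U]] that by (simp add: mem_Euclidean_space)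
    then show "e j \<in> fibre E x" "\<Phi> (e j) = (\<lambda>l. if l = j then 1 else 0)"
      unfolding e_def by (auto intro: inv_into_into f_inv_into_f)
  qed
  have "\<exists>v\<in>fibre E x. (\<forall>l. \<Phi> v l = (if l < k then \<Phi> u l else 0)) \<and> (\<forall>i. \<Psi> v i = (\<Sum>j<k. \<Phi> u j * \<Psi> (e j) i))"
    if "k \<le> rk" for k
    using that
  proof (induction k)
    case 0
    then show ?case using zero_fibre[OF xX] triv_zero[OF U] triv_zero[OF V]
      by (intro bexI[of _ "fibre_zero E x"]) auto
  next
    case (Suc k)
    then obtain v where v: "v \<in> fibre E x" "\<And>l. \<Phi> v l = (if l < k then \<Phi> u l else 0)"
      "\<And>i. \<Psi> v i = (\<Sum>j<k. \<Phi> u j * \<Psi> (e j) i)" by auto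
    have ek: "e k \<in> fibre E x" "\<Phi> (e k) = (\<lambda>l. if l = k then 1 else 0)" using e[of k] Suc.prems by auto
    define s where "s = fibre_scale E (\<Phi> u k) (e k)"
    have s: "s \<in> fibre E x" unfolding s_def by (rule scale_fibre[OF xX ek(1)])
    show ?case
    proof (intro bexI[of _ "fibre_add E v s"] conjI allI)
      show "fibre_add E v s \<in> fibre E x" by (rule add_fibre[OF xX v(1) s])
      show "\<Phi> (fibre_add E v s) l = (if l < Suc k then \<Phi> u l else 0)" for l
        using triv_add[OF U v(1) s] triv_scale[OF U ek(1)] by (auto simp: v(2) ek(2) s_def less_Suc_eq)
      show "\<Psi> (fibre_add E v s) i = (\<Sum>j<Suc k. \<Phi> u j * \<Psi> (e j) i)" for i
        using triv_add[OF V v(1) s] triv_scale[OF V ek(1)] by (simp add: v(3) s_def)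
    qed
  qed
  then obtain v where v: "v \<in> fibre E x" "\<And>l. \<Phi> v l = (if l < rk then \<Phi> u l else 0)"
    "\<And>i. \<Psi> v i = (\<Sum>j<rk. \<Phi> u j * \<Psi> (e j) i)" by blast
  have "v = u" by (rule triv_eqI[OF U v(1) u]) (simp add: v(2))
  then show ?thesis using v(3) by (simp add: transition_def e_def)
qed

lemma carrier_P:
  "s \<in> carrier P \<longleftrightarrow> s \<in> (\<Pi>\<^sub>E x\<in>X. fibre E x) \<and> (\<forall>(U, \<Phi>)\<in>BA. \<forall>i<rk. smooth_on M U (\<lambda>x. \<Phi> (s x) i))"
  by (simp add: smooth_sections_def)

lemma P_fibre: "p \<in> carrier P \<Longrightarrow> x \<in> X \<Longrightarrow> p x \<in> fibre E x"
  by (auto simp: carrier_P)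

lemma P_smooth:
  assumes "p \<in> carrier P" "(U, \<Phi>) \<in> BA"
  shows "smooth_on M U (\<lambda>x. \<Phi> (p x) i)"
proof (cases "i < rk")
  case True
  then show ?thesis using assms by (auto simp: carrier_P)
next
  case False
  then show ?thesis
    using triv_beyond[OF assms(2)] P_fibre[OF assms(1)] triv_subset[OF assms(2)]
    by (intro smooth_on_cong[OF triv_open[OF assms(2)] smooth_on_const[OF triv_open[OF assms(2)], of 0]])
      (metis not_less subsetD)
qed

lemma P_I:
  assumes "s \<in> extensional X" "\<And>x. x \<in> X \<Longrightarrow> s x \<in> fibre E x"
    "\<And>U \<Phi> i. (U, \<Phi>) \<in> BA \<Longrightarrow> i < rk \<Longrightarrow> smooth_on M U (\<lambda>x. \<Phi> (s x) i)"
  shows "s \<in> carrier P"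
  unfolding carrier_P using assms by (auto simp: PiE_iff)

lemma P_simps:
  "p \<oplus>\<^bsub>P\<^esub> q = (\<lambda>x\<in>X. fibre_add E (p x) (q x))" "\<zero>\<^bsub>P\<^esub> = (\<lambda>x\<in>X. fibre_zero E x)"
  "a \<odot>\<^bsub>P\<^esub> p = (\<lambda>x\<in>X. fibre_scale E (a x) (p x))"
  by (simp_all add: smooth_sections_def)

lemma P_coords:
  assumes U: "(U, \<Phi>) \<in> BA" "x \<in> U"
  shows "p \<in> carrier P \<Longrightarrow> q \<in> carrier P \<Longrightarrow> \<Phi> ((p \<oplus>\<^bsub>P\<^esub> q) x) i = \<Phi> (p x) i + \<Phi> (q x) i"
    "p \<in> carrier P \<Longrightarrow> \<Phi> ((a \<odot>\<^bsub>P\<^esub> p) x) i = a x * \<Phi> (p x) i"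
    "\<Phi> (\<zero>\<^bsub>P\<^esub> x) i = 0"
proof -
  have "x \<in> X" using U triv_subset by blast
  then show "p \<in> carrier P \<Longrightarrow> q \<in> carrier P \<Longrightarrow> \<Phi> ((p \<oplus>\<^bsub>P\<^esub> q) x) i = \<Phi> (p x) i + \<Phi> (q x) i"
    "p \<in> carrier P \<Longrightarrow> \<Phi> ((a \<odot>\<^bsub>P\<^esub> p) x) i = a x * \<Phi> (p x) i" "\<Phi> (\<zero>\<^bsub>P\<^esub> x) i = 0"
    using triv_add[OF U] triv_scale[OF U] triv_zero[OF U] P_fibre by (simp_all add: P_simps)
qed

lemma P_eqI:
  assumes "p \<in> carrier P" "q \<in> carrier P"
    "\<And>x. x \<in> X \<Longrightarrow> \<exists>U \<Phi>. (U, \<Phi>) \<in> BA \<and> x \<in> U \<and> (\<forall>i<rk. \<Phi> (p x) i = \<Phi> (q x) i)"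
  shows "p = q"
proof (rule extensionalityI)
  show "p \<in> extensional X" "q \<in> extensional X" using assms(1,2) by (auto simp: carrier_P PiE_iff)
  fix x assume x: "x \<in> X"
  then obtain U \<Phi> where "(U, \<Phi>) \<in> BA" "x \<in> U" "\<forall>i<rk. \<Phi> (p x) i = \<Phi> (q x) i" using assms(3) by blast
  then show "p x = q x" using P_fibre[OF assms(1) x] P_fibre[OF assms(2) x] triv_eqI by blast
qed

lemma P_eqI_all:
  assumes "p \<in> carrier P" "q \<in> carrier P"
    "\<And>U \<Phi> x i. (U, \<Phi>) \<in> BA \<Longrightarrow> x \<in> U \<Longrightarrow> \<Phi> (p x) i = \<Phi> (q x) i"
  shows "p = q"
proof (rule P_eqI[OF assms(1,2)])
  fix x assume "x \<in> X"
  then obtain U \<Phi> where "(U, \<Phi>) \<in> BA" "x \<in> U" by (rule triv_ex)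
  then show "\<exists>U \<Phi>. (U, \<Phi>) \<in> BA \<and> x \<in> U \<and> (\<forall>i<rk. \<Phi> (p x) i = \<Phi> (q x) i)" using assms(3) by blast
qed

lemma P_add_closed: "p \<in> carrier P \<Longrightarrow> q \<in> carrier P \<Longrightarrow> p \<oplus>\<^bsub>P\<^esub> q \<in> carrier P"
proof (rule P_I)
  fix U \<Phi> i assume *: "p \<in> carrier P" "q \<in> carrier P" "(U, \<Phi>) \<in> BA"
  show "smooth_on M U (\<lambda>x. \<Phi> ((p \<oplus>\<^bsub>P\<^esub> q) x) i)"
    by (rule smooth_on_cong[OF triv_open[OF *(3)] smooth_on_add[OF triv_open P_smooth P_smooth]])
      (use * P_coords(1)[OF *(3)] in auto)
qed (auto simp: P_simps add_fibre P_fibre)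

lemma P_smult_closed: "a \<in> carrier A \<Longrightarrow> p \<in> carrier P \<Longrightarrow> a \<odot>\<^bsub>P\<^esub> p \<in> carrier P"
proof (rule P_I)
  fix U \<Phi> i assume *: "a \<in> carrier A" "p \<in> carrier P" "(U, \<Phi>) \<in> BA"
  show "smooth_on M U (\<lambda>x. \<Phi> ((a \<odot>\<^bsub>P\<^esub> p) x) i)"
    by (rule smooth_on_cong[OF triv_open[OF *(3)] smooth_on_mult[OF triv_open[OF *(3)] A_smooth[OF *(1) triv_subset] P_smooth]])
      (use * P_coords(2)[OF *(3)] in auto)
qed (auto simp: P_simps scale_fibre P_fibre)

lemma P_zero_closed: "\<zero>\<^bsub>P\<^esub> \<in> carrier P"
proof (rule P_I)
  fix U \<Phi> i assume *: "(U, \<Phi>) \<in> BA"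
  show "smooth_on M U (\<lambda>x. \<Phi> (\<zero>\<^bsub>P\<^esub> x) i)"
    by (rule smooth_on_cong[OF triv_open[OF *] smooth_on_const[OF triv_open[OF *], of 0]])
      (use * P_coords(3) in auto)
qed (auto simp: P_simps zero_fibre)

lemma A_closed:
  "f \<in> carrier A \<Longrightarrow> g \<in> carrier A \<Longrightarrow> f \<oplus>\<^bsub>A\<^esub> g \<in> carrier A"
  "f \<in> carrier A \<Longrightarrow> g \<in> carrier A \<Longrightarrow> f \<otimes>\<^bsub>A\<^esub> g \<in> carrier A"
  "f \<in> carrier A \<Longrightarrow> r \<odot>\<^bsub>A\<^esub> f \<in> carrier A" "\<one>\<^bsub>A\<^esub> \<in> carrier A" "\<zero>\<^bsub>A\<^esub> \<in> carrier A"
  unfolding A_simps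
  by (intro restrict_in_A smooth_on_add smooth_on_mult smooth_on_const openin_topspace; simp add: carrier_A)+

lemma A_eqI:
  assumes "f \<in> carrier A" "g \<in> carrier A" "\<And>x. x \<in> X \<Longrightarrow> f x = g x"
  shows "f = g"
  using assms by (auto simp: carrier_A intro: extensionalityI)

lemma A_apply:
  assumes "x \<in> X"
  shows "(f \<otimes>\<^bsub>A\<^esub> g) x = f x * g x" "(f \<oplus>\<^bsub>A\<^esub> g) x = f x + g x"
  "(r \<odot>\<^bsub>A\<^esub> f) x = r * f x" "\<one>\<^bsub>A\<^esub> x = 1" "\<zero>\<^bsub>A\<^esub> x = 0"
  using assms by (simp_all add: A_simps)

lemma cring_A: "cring A"
proof (rule cringI)
  show "abelian_group A"
  proof (rule abelian_groupI)
    fix f assume f: "f \<in> carrier A"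
    show "\<exists>g\<in>carrier A. g \<oplus>\<^bsub>A\<^esub> f = \<zero>\<^bsub>A\<^esub>"
      by (intro bexI[of _ "(-1) \<odot>\<^bsub>A\<^esub> f"] A_eqI A_closed f) (simp add: A_apply)
  qed (auto intro!: A_eqI simp: A_closed A_apply)
  show "comm_monoid A"
    by (rule comm_monoidI) (auto intro!: A_eqI simp: A_closed A_apply)
qed (auto intro!: A_eqI simp: A_closed A_apply algebra_simps)

lemma module_P: "Module.module A P"
proof (rule moduleI[OF cring_A])
  show "abelian_group P"
  proof (rule abelian_groupI)
    fix p assume p: "p \<in> carrier P"
    have "\<one>\<^bsub>A\<^esub> \<in> carrier A" by (rule A_closed)
    then have n: "((-1) \<odot>\<^bsub>A\<^esub> \<one>\<^bsub>A\<^esub>) \<odot>\<^bsub>P\<^esub> p \<in> carrier P" using p by (intro P_smult_closed A_closed)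
    have "(((-1) \<odot>\<^bsub>A\<^esub> \<one>\<^bsub>A\<^esub>) \<odot>\<^bsub>P\<^esub> p) \<oplus>\<^bsub>P\<^esub> p = \<zero>\<^bsub>P\<^esub>"
    proof (rule P_eqI_all[OF P_add_closed[OF n p] P_zero_closed])
      fix U \<Phi> x i assume U: "(U, \<Phi>) \<in> BA" "x \<in> U"
      then have "x \<in> X" using triv_subset by blast
      then show "\<Phi> (((((-1) \<odot>\<^bsub>A\<^esub> \<one>\<^bsub>A\<^esub>) \<odot>\<^bsub>P\<^esub> p) \<oplus>\<^bsub>P\<^esub> p) x) i = \<Phi> (\<zero>\<^bsub>P\<^esub> x) i"
        using P_coords[OF U] n p by (simp add: A_apply)
    qed
    then show "\<exists>q\<in>carrier P. q \<oplus>\<^bsub>P\<^esub> p = \<zero>\<^bsub>P\<^esub>" using n by blast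
    show "\<zero>\<^bsub>P\<^esub> \<oplus>\<^bsub>P\<^esub> p = p"
      by (rule P_eqI_all) (use p in \<open>auto simp: P_coords P_add_closed P_zero_closed\<close>)
    fix q assume q: "q \<in> carrier P"
    show "p \<oplus>\<^bsub>P\<^esub> q = q \<oplus>\<^bsub>P\<^esub> p"
      by (rule P_eqI_all) (use p q in \<open>auto simp: P_coords P_add_closed\<close>)
    fix s assume s: "s \<in> carrier P"
    show "p \<oplus>\<^bsub>P\<^esub> q \<oplus>\<^bsub>P\<^esub> s = p \<oplus>\<^bsub>P\<^esub> (q \<oplus>\<^bsub>P\<^esub> s)"
      by (rule P_eqI_all) (use p q s in \<open>auto simp: P_coords P_add_closed\<close>)
  qed (auto simp: P_add_closed P_zero_closed)
  show "a \<odot>\<^bsub>P\<^esub> p \<in> carrier P" if "a \<in> carrier A" "p \<in> carrier P" for a p using that by (rule P_smult_closed)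
  have xX: "x \<in> X" if "(U, \<Phi>) \<in> BA" "x \<in> U" for U \<Phi> x using that triv_subset by blast
  show "(a \<oplus>\<^bsub>A\<^esub> b) \<odot>\<^bsub>P\<^esub> p = (a \<odot>\<^bsub>P\<^esub> p) \<oplus>\<^bsub>P\<^esub> (b \<odot>\<^bsub>P\<^esub> p)"
    if "a \<in> carrier A" "b \<in> carrier A" "p \<in> carrier P" for a b p
    by (rule P_eqI_all) (use that xX in \<open>auto simp: P_coords P_add_closed P_smult_closed A_closed A_apply algebra_simps\<close>)
  show "a \<odot>\<^bsub>P\<^esub> (p \<oplus>\<^bsub>P\<^esub> q) = (a \<odot>\<^bsub>P\<^esub> p) \<oplus>\<^bsub>P\<^esub> (a \<odot>\<^bsub>P\<^esub> q)"
    if "a \<in> carrier A" "p \<in> carrier P" "q \<in> carrier P" for a p q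
    by (rule P_eqI_all) (use that xX in \<open>auto simp: P_coords P_add_closed P_smult_closed algebra_simps\<close>)
  show "(a \<otimes>\<^bsub>A\<^esub> b) \<odot>\<^bsub>P\<^esub> p = a \<odot>\<^bsub>P\<^esub> (b \<odot>\<^bsub>P\<^esub> p)"
    if "a \<in> carrier A" "b \<in> carrier A" "p \<in> carrier P" for a b p
    by (rule P_eqI_all) (use that xX in \<open>auto simp: P_coords P_smult_closed A_closed A_apply\<close>)
  show "\<one>\<^bsub>A\<^esub> \<odot>\<^bsub>P\<^esub> p = p" if "p \<in> carrier P" for p
    by (rule P_eqI_all) (use that xX in \<open>auto simp: P_coords P_smult_closed A_closed A_apply\<close>)
qed

lemma diolic_module: "diolic_module A P (diolic A P)"
proof (intro diolic_module.intro diolic_module_axioms.intro module_P refl)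
  fix r s :: real and a
  show c: "r \<odot>\<^bsub>A\<^esub> \<one>\<^bsub>A\<^esub> \<in> carrier A" for r by (intro A_closed)
  show "r \<odot>\<^bsub>A\<^esub> a = r \<odot>\<^bsub>A\<^esub> \<one>\<^bsub>A\<^esub> \<otimes>\<^bsub>A\<^esub> a" if "a \<in> carrier A"
    by (rule A_eqI) (use that c in \<open>auto simp: A_closed A_apply\<close>)
  show "(r + s) \<odot>\<^bsub>A\<^esub> \<one>\<^bsub>A\<^esub> = r \<odot>\<^bsub>A\<^esub> \<one>\<^bsub>A\<^esub> \<oplus>\<^bsub>A\<^esub> s \<odot>\<^bsub>A\<^esub> \<one>\<^bsub>A\<^esub>"
    by (rule A_eqI) (use c in \<open>auto simp: A_closed A_apply\<close>)
  show "(r * s) \<odot>\<^bsub>A\<^esub> \<one>\<^bsub>A\<^esub> = r \<odot>\<^bsub>A\<^esub> \<one>\<^bsub>A\<^esub> \<otimes>\<^bsub>A\<^esub> (s \<odot>\<^bsub>A\<^esub> \<one>\<^bsub>A\<^esub>)"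
    by (rule A_eqI) (use c in \<open>auto simp: A_closed A_apply\<close>)
  show "1 \<odot>\<^bsub>A\<^esub> \<one>\<^bsub>A\<^esub> = \<one>\<^bsub>A\<^esub>"
    by (rule A_eqI) (auto simp: A_closed A_apply)
qed

text \<open>
  The section with the coordinates \<open>c\<close> in the trivialisation \<open>\<Phi>\<close>, extended by zero.
\<close>

definition local_section where
  "local_section U \<Phi> c = (\<lambda>x\<in>X. if x \<in> U then point \<Phi> x (c x) else fibre_zero E x)"

lemma local_section:
  assumes U: "(U, \<Phi>) \<in> BA" and K: "closedin (mtop M) K" "K \<subseteq> U"
    and c: "\<And>i. i < rk \<Longrightarrow> smooth_on M U (\<lambda>x. c x i)" "\<And>i x. i < rk \<Longrightarrow> x \<in> U - K \<Longrightarrow> c x i = 0"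
  shows "local_section U \<Phi> c \<in> carrier P"
    and "x \<in> U \<Longrightarrow> i < rk \<Longrightarrow> \<Phi> (local_section U \<Phi> c x) i = c x i"
    and "(V, \<Psi>) \<in> BA \<Longrightarrow> x \<in> V - U \<Longrightarrow> \<Psi> (local_section U \<Phi> c x) i = 0"
proof -
  show coord: "\<Phi> (local_section U \<Phi> c x) i = c x i" if "x \<in> U" "i < rk" for x i
    using that triv_subset[OF U] point(2)[OF U that(1)] by (auto simp: local_section_def)
  show out: "\<Psi> (local_section U \<Phi> c x) i = 0" if "(V, \<Psi>) \<in> BA" "x \<in> V - U" for V \<Psi> x i
    using that triv_subset[OF that(1)] triv_zero[OF that(1)] by (auto simp: local_section_def)
  show "local_section U \<Phi> c \<in> carrier P"
  proof (rule P_I)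
    show "local_section U \<Phi> c \<in> extensional X" by (simp add: local_section_def)
    show fib: "local_section U \<Phi> c x \<in> fibre E x" if "x \<in> X" for x
      using that point(1)[OF U] zero_fibre by (simp add: local_section_def)
    fix V \<Psi> i assume V: "(V, \<Psi>) \<in> BA" "i < rk"
    let ?g = "\<lambda>x. \<Sum>j<rk. c x j * transition \<Phi> \<Psi> x i j"
    have o: "openin (mtop M) (V \<inter> U)" using triv_open U V by auto
    have "smooth_on M V (\<lambda>x. if x \<in> U then ?g x else 0)"
    proof (rule smooth_on_extend_zero[OF triv_open[OF U] K triv_open[OF V(1)]])
      show "smooth_on M (V \<inter> U) ?g"
        unfolding transition_def
      proof (intro smooth_on_sum smooth_on_mult o)
        fix j assume "j \<in> {..<rk}"
        then have j: "j < rk" by simp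
        show "smooth_on M (V \<inter> U) (\<lambda>x. c x j)" by (rule smooth_on_subset[OF c(1)[OF j]]) simp
        show "smooth_on M (V \<inter> U) (\<lambda>x. \<Psi> (inv_into (fibre E x) \<Phi> (\<lambda>l. if l = j then 1 else 0)) i)"
          using triv_transition[OF U V j] by (simp only: Int_commute)
      qed
      show "?g x = 0" if "x \<in> V \<inter> U" "x \<notin> K" for x
        using that c(2) by (intro sum.neutral) auto
    qed
    then show "smooth_on M V (\<lambda>x. \<Psi> (local_section U \<Phi> c x) i)"
    proof (rule smooth_on_cong[OF triv_open[OF V(1)]])
      fix x assume x: "x \<in> V"
      show "(if x \<in> U then ?g x else 0) = \<Psi> (local_section U \<Phi> c x) i"
      proof (cases "x \<in> U")
        case True
        then show ?thesis
          using transition_formula[OF U True V(1) x fib] x triv_subset[OF V(1)] coord[OF True] by auto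
      next
        case False
        then show ?thesis using out[OF V(1)] x by simp
      qed
    qed
  qed
qed

text \<open>
  If \<open>a\<close> annihilates all sections, then it vanishes at each point, because there is a section that does not
  vanish there: one with the bump function \<open>\<eta>\<close> as coordinates.
\<close>

lemma faithful:
  assumes rk: "rk \<ge> 1" and a: "a \<in> carrier A" and 0: "\<And>p. p \<in> carrier P \<Longrightarrow> a \<odot>\<^bsub>P\<^esub> p = \<zero>\<^bsub>P\<^esub>"
  shows "a = \<zero>\<^bsub>A\<^esub>"
proof (rule A_eqI[OF a A_closed(5)])
  fix x0 assume x0: "x0 \<in> X"
  obtain U \<Phi> where U: "(U, \<Phi>) \<in> BA" "x0 \<in> U" using triv_ex[OF x0] .
  obtain N K \<eta> y D where *: "openin (mtop M) N" "N \<subseteq> U" "closedin (mtop M) K" "K \<subseteq> N"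
    "\<eta> \<in> carrier A" "\<eta> x0 > 0"  "\<And>x. x \<in> X - K \<Longrightarrow> \<eta> x = 0"
    by (rule local_vector_fields[OF triv_open[OF U(1)] U(2)]) blast
  note ls = local_section[OF U(1) *(3) subset_trans[OF *(4,2)], of "\<lambda>x i. \<eta> x"]
  have sm: "smooth_on M U \<eta>" "\<And>x. x \<in> U - K \<Longrightarrow> \<eta> x = 0"
    using A_smooth[OF *(5)] *(7) triv_subset[OF U(1)] by auto
  define p where "p = local_section U \<Phi> (\<lambda>x i. \<eta> x)"
  have p: "p \<in> carrier P" "\<Phi> (p x0) 0 = \<eta> x0"
    using ls(1,2) sm U(2) rk by (auto simp: p_def)
  have "a x0 * \<eta> x0 = 0"
    using P_coords(2)[OF U p(1), of a 0] P_coords(3)[OF U, of 0] 0[OF p(1)] p(2) by simp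
  then show "a x0 = \<zero>\<^bsub>A\<^esub> x0" using *(6) x0 by (simp add: A_apply)
qed

end

section \<open>Local frames of vector fields and partitions of unity\<close>

context smooth_mfd
begin

text \<open>
  A smooth function is continuous for the topology of \<open>M\<close>, since it is in every chart.
\<close>

lemma open_positive:
  assumes f: "smooth_on M X f"
  shows "openin (mtop M) {x \<in> X. f x > 0}"
proof (subst openin_subopen, intro ballI)
  fix x assume x: "x \<in> {x \<in> X. f x > 0}"
  then obtain U \<phi> where c: "(U, \<phi>) \<in> atlas M" "x \<in> U" using chart_ex by blast
  let ?g = "\<lambda>y. f (inv_into U \<phi> y)"
  note o = chartD(2)[OF c(1)]
  have "smooth_on M U f" by (rule smooth_on_subset[OF f chart_subset[OF c(1)]])
  then have "C_on n 0 (\<phi> ` U) ?g" using smooth_on_local_rep[OF c(1), of U f 0] by simp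
  from C_on_continuous[OF o this] have "openin (top_of_set (\<phi> ` U)) (\<phi> ` U \<inter> ?g -` {0<..})"
    by (rule continuous_openin_preimage_gen) simp
  then have T: "openin (Euclidean_space n) (\<phi> ` U \<inter> ?g -` {0<..})"
    using o by (subst Euclidean_space_eq_top_of_set, subst (asm) (1) Euclidean_space_eq_top_of_set)
      (rule openin_trans)
  have "{z \<in> U. \<phi> z \<in> \<phi> ` U \<inter> ?g -` {0<..}} \<subseteq> {x \<in> X. f x > 0}"
    using chart_subset[OF c(1)] by (auto dest!: inj_onD[OF chart_inj[OF c(1)]] simp: chart_inv[OF c(1)])
  moreover have "x \<in> {z \<in> U. \<phi> z \<in> \<phi> ` U \<inter> ?g -` {0<..}}" using c x by simp
  ultimately show "\<exists>T. openin (mtop M) T \<and> x \<in> T \<and> T \<subseteq> {x \<in> X. f x > 0}"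
    using chart_preimage_open[OF c(1) T] by blast
qed

text \<open>
  Supports may accumulate only at infinity: near each point, almost all members of the sequence vanish.
\<close>

definition locally_finite :: "(nat \<Rightarrow> 'a \<Rightarrow> real) \<Rightarrow> bool" where
  "locally_finite \<rho> \<longleftrightarrow> (\<forall>i. smooth_on M X (\<rho> i)) \<and>
     (\<forall>x\<in>X. \<exists>W m. openin (mtop M) W \<and> x \<in> W \<and> (\<forall>z\<in>W. \<forall>i\<ge>m. \<rho> i z = 0))"

definition loc_sum :: "(nat \<Rightarrow> 'a \<Rightarrow> real) \<Rightarrow> (nat \<Rightarrow> 'a \<Rightarrow> real) \<Rightarrow> 'a \<Rightarrow> real" where
  "loc_sum \<rho> g x = (\<Sum>i | \<rho> i x \<noteq> 0. \<rho> i x * g i x)"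

lemma loc_sum_eq:
  assumes "\<And>i. i \<ge> m \<Longrightarrow> \<rho> i x = 0"
  shows "loc_sum \<rho> g x = (\<Sum>i<m. \<rho> i x * g i x)"
  unfolding loc_sum_def
proof (rule sum.mono_neutral_left)
  show "{i. \<rho> i x \<noteq> 0} \<subseteq> {..<m}"
  proof
    fix i assume "i \<in> {i. \<rho> i x \<noteq> 0}"
    then show "i \<in> {..<m}" using assms[of i] by (cases "m \<le> i") simp_all
  qed
qed simp_all

lemma locally_finite_smooth: "locally_finite \<rho> \<Longrightarrow> smooth_on M X (\<rho> i)"
  by (simp add: locally_finite_def)

lemma locally_finite_nhd:
  assumes "locally_finite \<rho>" "x \<in> X"
  obtains W m where "openin (mtop M) W" "x \<in> W" "\<And>z i. z \<in> W \<Longrightarrow> i \<ge> m \<Longrightarrow> \<rho> i z = 0"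
proof -
  have "\<exists>W m. openin (mtop M) W \<and> x \<in> W \<and> (\<forall>z\<in>W. \<forall>i\<ge>m. \<rho> i z = 0)"
    by (rule bspec[OF conjunct2[OF assms(1)[unfolded locally_finite_def]] assms(2)])
  then obtain W m where W: "openin (mtop M) W \<and> x \<in> W \<and> (\<forall>z\<in>W. \<forall>i\<ge>m. \<rho> i z = 0)" by (elim exE)
  show thesis by (rule that[of W m]) (use W in simp_all)
qed

lemma locally_finite_bound:
  assumes "locally_finite \<rho>" "x \<in> X"
  obtains m where "\<And>i. i \<ge> m \<Longrightarrow> \<rho> i x = 0"
proof -
  obtain W m where W: "openin (mtop M) W" "x \<in> W" "\<And>z i. z \<in> W \<Longrightarrow> i \<ge> m \<Longrightarrow> \<rho> i z = 0"
    using locally_finite_nhd[OF assms] by blast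
  show thesis by (rule that[of m]) (rule W(3)[OF W(2)])
qed

lemma smooth_on_loc_sum:
  assumes \<rho>: "locally_finite \<rho>" and W: "openin (mtop M) W" and g: "\<And>i. smooth_on M W (g i)"
  shows "smooth_on M W (loc_sum \<rho> g)"
proof (rule smooth_on_local[OF W])
  fix x assume x: "x \<in> W"
  have WX: "W \<subseteq> X" using W openin_subset by blast
  obtain V m where V: "openin (mtop M) V" "x \<in> V" "\<And>z i. z \<in> V \<Longrightarrow> i \<ge> m \<Longrightarrow> \<rho> i z = 0"
    using locally_finite_nhd[OF \<rho> subsetD[OF WX x]] by blast
  have o: "openin (mtop M) (W \<inter> V)" using W V by blast
  have "smooth_on M (W \<inter> V) (\<lambda>x. \<Sum>i<m. \<rho> i x * g i x)"
    by (intro smooth_on_sum smooth_on_mult o smooth_on_subset[OF g]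
        smooth_on_subset[OF locally_finite_smooth[OF \<rho>]]) (use WX in auto)
  then have "smooth_on M (W \<inter> V) (loc_sum \<rho> g)"
    by (rule smooth_on_cong[OF o]) (use loc_sum_eq[of m \<rho>] V(3) in auto)
  then show "\<exists>N. openin (mtop M) N \<and> x \<in> N \<and> smooth_on M N (loc_sum \<rho> g)" using o x V by blast
qed

text \<open>
  Let \<open>h\<close> be the smooth function \<open>flat 0\<close>, which is positive on the positive numbers and zero elsewhere.
  The functions \<open>\<omega>\<^sub>i = \<Prod>\<^bsub>l<i\<^esub> h(1/(i+1) - \<theta>\<^sub>l)\<close> are locally finite: near a point with \<open>\<theta>\<^sub>l > 0\<close> they vanish for
  large \<open>i\<close>. At each point the first \<open>i\<close> with \<open>\<theta>\<^sub>i > 0\<close> has \<open>\<omega>\<^sub>i > 0\<close>, so that \<open>s = \<Sum>\<^sub>i \<omega>\<^sub>i \<theta>\<^sub>i\<close> is positive and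
  \<open>\<rho>\<^sub>i = \<omega>\<^sub>i / s\<close> is as desired.
\<close>

lemma partition_of_unity:
  assumes \<theta>: "\<And>i. smooth_on M X (\<theta> i)" "\<And>i x. x \<in> X \<Longrightarrow> \<theta> i x \<ge> 0"
    and cover: "\<And>x. x \<in> X \<Longrightarrow> \<exists>i::nat. \<theta> i x > 0"
  obtains \<rho> where "locally_finite \<rho>" "\<And>x. x \<in> X \<Longrightarrow> loc_sum \<rho> \<theta> x = 1"
proof -
  define \<omega> where "\<omega> i x = (\<Prod>l<i. flat 0 (1 / real (Suc i) - \<theta> l x))" for i x
  have \<omega>0: "\<omega> i x \<ge> 0" for i x by (auto simp: \<omega>_def flat_0_nonneg intro!: prod_nonneg)
  have sm: "smooth_on M X (\<omega> i)" for i
    unfolding \<omega>_def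
    by (intro smooth_on_prod smooth_on_compose_real[OF _ _ C1_on_flat] smooth_on_diff smooth_on_const
        openin_topspace \<theta>(1)) simp
  have lf: "locally_finite \<omega>"
    unfolding locally_finite_def
  proof (intro conjI allI sm ballI)
    fix x assume x: "x \<in> X"
    then obtain l where l: "\<theta> l x > 0" using cover by blast
    define c where "c = \<theta> l x / 2"
    have c: "c > 0" using l by (simp add: c_def)
    define W where "W = {z \<in> X. \<theta> l z - c > 0}"
    have W: "openin (mtop M) W" unfolding W_def
      by (intro open_positive smooth_on_diff smooth_on_const openin_topspace \<theta>(1))
    obtain k :: nat where k: "1 / real (Suc k) < c" using c nat_approx_posE by blast
    have "\<omega> i z = 0" if z: "z \<in> W" and i: "i \<ge> max k (Suc l)" for z i
    proof -
      have "1 / real (Suc i) \<le> 1 / real (Suc k)" using i by (intro divide_left_mono) auto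
      then have "1 / real (Suc i) - \<theta> l z \<le> 0" using z k by (simp add: W_def)
      then have "flat 0 (1 / real (Suc i) - \<theta> l z) = 0" by (simp add: flat_def)
      then show ?thesis unfolding \<omega>_def using i by (intro prod_zero) auto
    qed
    moreover have "x \<in> W" using x c by (simp add: W_def c_def)
    ultimately show "\<exists>W m. openin (mtop M) W \<and> x \<in> W \<and> (\<forall>z\<in>W. \<forall>i\<ge>m. \<omega> i z = 0)" using W by blast
  qed
  define s where "s = loc_sum \<omega> \<theta>"
  have s: "smooth_on M X s" unfolding s_def by (rule smooth_on_loc_sum[OF lf openin_topspace \<theta>(1)])
  have spos: "s x > 0" if x: "x \<in> X" for x
  proof -
    obtain m where m: "\<And>i. i \<ge> m \<Longrightarrow> \<omega> i x = 0" using locally_finite_bound[OF lf x] by blast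
    define i where "i = (LEAST i. \<theta> i x > 0)"
    have i: "\<theta> i x > 0" unfolding i_def by (rule LeastI_ex) (rule cover[OF x])
    have "\<theta> l x \<le> 0" if "l < i" for l using not_less_Least[of l] that unfolding i_def by (meson not_less)
    then have "0 < 1 / real (Suc i) - \<theta> l x" if "l < i" for l
      using that by (smt (verit) of_nat_0_less_iff zero_less_Suc divide_pos_pos)
    then have "\<omega> i x > 0"
      unfolding \<omega>_def by (intro prod_pos) (simp add: flat_0_pos_iff)
    then have "0 < \<omega> i x * \<theta> i x" "i < m" using i m[of i] by (auto simp: not_less[symmetric])
    then have "0 < (\<Sum>i<m. \<omega> i x * \<theta> i x)"
      using \<omega>0 \<theta>(2)[OF x] by (intro sum_pos2[where i = i]) auto
    then show ?thesis using loc_sum_eq[of m \<omega>] m by (simp add: s_def)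
  qed
  define \<rho> where "\<rho> i x = \<omega> i x * (1 / s x ^ 1)" for i x
  have "locally_finite \<rho>"
    unfolding locally_finite_def
  proof (intro conjI allI ballI)
    show "smooth_on M X (\<rho> i)" for i
      unfolding \<rho>_def
      by (rule smooth_on_mult[OF openin_topspace sm smooth_on_compose_real[OF openin_topspace s C1_on_power_inverse]])
        (use spos in auto)
    fix x assume "x \<in> X"
    then obtain W m where W: "openin (mtop M) W" "x \<in> W" "\<And>z i. z \<in> W \<Longrightarrow> i \<ge> m \<Longrightarrow> \<omega> i z = 0"
      by (rule locally_finite_nhd[OF lf]) blast
    show "\<exists>W m. openin (mtop M) W \<and> x \<in> W \<and> (\<forall>z\<in>W. \<forall>i\<ge>m. \<rho> i z = 0)"
      by (intro exI[of _ W] exI[of _ m] conjI ballI allI impI W(1,2)) (simp add: \<rho>_def W(3))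
  qed
  moreover have "loc_sum \<rho> \<theta> x = 1" if x: "x \<in> X" for x
  proof -
    obtain m where m: "\<And>i. i \<ge> m \<Longrightarrow> \<omega> i x = 0" using locally_finite_bound[OF lf x] by blast
    have "loc_sum \<rho> \<theta> x = (\<Sum>i<m. \<omega> i x * (1 / s x) * \<theta> i x)"
      using loc_sum_eq[of m \<rho> x \<theta>] m by (simp add: \<rho>_def)
    also have "\<dots> = (\<Sum>i<m. \<omega> i x * \<theta> i x) / s x" by (simp add: sum_divide_distrib)
    also have "\<dots> = 1" using loc_sum_eq[of m \<omega> x \<theta>] m spos[OF x] by (simp add: s_def)
    finally show ?thesis .
  qed
  ultimately show thesis by (rule that)
qed

end

context smooth_vbundle
begin

sublocale dm: diolic_module A P "diolic A P" by (rule diolic_module)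

abbreviation B where "B \<equiv> diolic A P"

lemma evaluate_finsum:
  assumes "finite I" "\<And>l. l \<in> I \<Longrightarrow> g l \<in> carrier B"
    and add: "\<And>u v. u \<in> carrier B \<Longrightarrow> v \<in> carrier B \<Longrightarrow> e (u \<oplus>\<^bsub>B\<^esub> v) = e u + (e v :: real)" and zero: "e \<zero>\<^bsub>B\<^esub> = 0"
  shows "e (\<Oplus>\<^bsub>B\<^esub>l\<in>I. g l) = (\<Sum>l\<in>I. e (g l))"
  using assms(1,2)
proof (induction I rule: finite_induct)
  case (insert a I)
  have "(\<Oplus>\<^bsub>B\<^esub>l\<in>insert a I. g l) = g a \<oplus>\<^bsub>B\<^esub> (\<Oplus>\<^bsub>B\<^esub>l\<in>I. g l)"
    using insert by (intro dm.B.finsum_insert) auto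
  moreover have "(\<Oplus>\<^bsub>B\<^esub>l\<in>I. g l) \<in> carrier B" using insert by (intro dm.B.finsum_closed) auto
  ultimately show ?case using insert by (simp add: add)
qed (simp add: zero)

text \<open>
  Evaluation of a derivation with values in \<open>B\<close> at a point yields tangent vectors, to which
  \<open>local_vector_fields\<close> applies.
\<close>

lemma B_derivation_points:
  assumes V: "dm.B_derivation V"
  shows "x \<in> X \<Longrightarrow> point_derivation x (\<lambda>f. fst (V f) x)"
    "(U, \<Psi>) \<in> BA \<Longrightarrow> x \<in> U \<Longrightarrow> point_derivation x (\<lambda>f. \<Psi> (snd (V f) x) i)"
proof -
  have c: "V f \<in> carrier B" if "f \<in> carrier A" for f
    using V that unfolding dm.B_derivation_def by blast
  have a: "V (f \<oplus>\<^bsub>A\<^esub> g) = V f \<oplus>\<^bsub>B\<^esub> V g" and m: "V (f \<otimes>\<^bsub>A\<^esub> g) = dm.emb0 f \<otimes>\<^bsub>B\<^esub> V g \<oplus>\<^bsub>B\<^esub> dm.emb0 g \<otimes>\<^bsub>B\<^esub> V f"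
    if "f \<in> carrier A" "g \<in> carrier A" for f g
    using V that unfolding dm.B_derivation_def by blast+
  have r: "V (r \<odot>\<^bsub>A\<^esub> f) = dm.scalar r \<otimes>\<^bsub>B\<^esub> V f" if "f \<in> carrier A" for r f
    using V that unfolding dm.B_derivation_def by blast
  have ra: "r \<odot>\<^bsub>A\<^esub> \<one>\<^bsub>A\<^esub> \<in> carrier A" for r by (intro A_closed)
  note c' = dm.fst_snd_closed[OF c]
  show "point_derivation x (\<lambda>f. fst (V f) x)" if x: "x \<in> X"
    unfolding point_derivation_def
  proof (intro conjI ballI allI)
    fix f g assume f: "f \<in> carrier A" "g \<in> carrier A"
    show "fst (V (f \<oplus>\<^bsub>A\<^esub> g)) x = fst (V f) x + fst (V g) x"
      unfolding a[OF f] dm.fst_snd_ops A_apply[OF x] ..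
    show "fst (V (f \<otimes>\<^bsub>A\<^esub> g)) x = f x * fst (V g) x + g x * fst (V f) x"
      unfolding m[OF f] dm.fst_snd_ops dm.fst_snd_emb A_apply[OF x] ..
  next
    fix r f assume f: "f \<in> carrier A"
    show "fst (V (r \<odot>\<^bsub>A\<^esub> f)) x = r * fst (V f) x"
      unfolding r[OF f] dm.fst_snd_ops dm.fst_snd_scalar A_apply[OF x] by simp
  qed
  show "point_derivation x (\<lambda>f. \<Psi> (snd (V f) x) i)" if U: "(U, \<Psi>) \<in> BA" "x \<in> U"
    unfolding point_derivation_def
  proof (intro conjI ballI allI)
    note PC = P_coords[OF U]
    have x: "x \<in> X" using U triv_subset by blast
    fix f g assume f: "f \<in> carrier A" "g \<in> carrier A"
    show "\<Psi> (snd (V (f \<oplus>\<^bsub>A\<^esub> g)) x) i = \<Psi> (snd (V f) x) i + \<Psi> (snd (V g) x) i"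
      unfolding a[OF f] dm.fst_snd_ops by (rule PC(1)) (use c' f in auto)
    show "\<Psi> (snd (V (f \<otimes>\<^bsub>A\<^esub> g)) x) i = f x * \<Psi> (snd (V g) x) i + g x * \<Psi> (snd (V f) x) i"
      unfolding m[OF f] dm.fst_snd_ops dm.fst_snd_emb
      using f c' PC by (simp add: P_smult_closed P_add_closed P_zero_closed)
  next
    have x: "x \<in> X" using U triv_subset by blast
    note PC = P_coords[OF U]
    fix r f assume f: "f \<in> carrier A"
    show "\<Psi> (snd (V (r \<odot>\<^bsub>A\<^esub> f)) x) i = r * \<Psi> (snd (V f) x) i"
      unfolding r[OF f] dm.fst_snd_ops dm.fst_snd_scalar
      using f c' ra PC x by (simp add: P_smult_closed P_add_closed P_zero_closed A_apply)
  qed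
qed

text \<open>
  The vector fields \<open>D\<^sub>l\<close> near the point lift to Der-operators \<open>\<nabla>\<^sub>l\<close> that differentiate the components of a
  section in a trivialisation. They vanish outside of the trivialisation, because the \<open>D\<^sub>l\<close> are cut off. The weight
  of the frame is \<open>\<eta>\<^sup>3\<close>.
\<close>

lemma frame_at:
  assumes x0: "x0 \<in> X"
  shows "\<exists>w. (\<exists>m y Y. dm.frame w m y Y) \<and> (\<forall>x\<in>X. w x \<ge> 0) \<and> w x0 > 0"
proof -
  obtain U \<Phi> where U: "(U, \<Phi>) \<in> BA" "x0 \<in> U" using triv_ex[OF x0] .
  note Uo = triv_open[OF U(1)] and UX = triv_subset[OF U(1)]
  show ?thesis
  proof (rule local_vector_fields[OF Uo U(2)])
  fix N K \<eta> y D
  assume N: "openin (mtop M) N" "N \<subseteq> U" and K: "closedin (mtop M) K" "K \<subseteq> N"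
    and \<eta>: "\<eta> \<in> carrier A" "\<And>x. x \<in> X \<Longrightarrow> \<eta> x \<ge> 0" "\<eta> x0 > 0"  "\<And>x. x \<in> X - K \<Longrightarrow> \<eta> x = 0"
    and y: "\<And>j. j \<le> n \<Longrightarrow> y j \<in> carrier A" and vf: "\<And>j. j \<le> n \<Longrightarrow> vector_field_on N (D j)"
    and D0: "\<And>j g x. j \<le> n \<Longrightarrow> x \<notin> K \<Longrightarrow> D j g x = 0"
    and main: "\<And>x v f. x \<in> X \<Longrightarrow> point_derivation x v \<Longrightarrow> f \<in> carrier A \<Longrightarrow>
        \<eta> x ^ 3 * v f = (\<Sum>j\<le>n. v (y j) * D j f x)"
  have NX: "N \<subseteq> X" and KU: "K \<subseteq> U" using N K UX by auto
  have Dsm: "smooth_on M X (D l g)" if "l \<le> n" "smooth_on M N g" for l g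
    using vf[OF that(1)] that(2) unfolding vector_field_on_def by blast
  have Dadd: "D l (\<lambda>x. f x + g x) x = D l f x + D l g x" if "l \<le> n" "smooth_on M N f" "smooth_on M N g" for l f g x
  proof (cases "x \<in> N")
    case True then show ?thesis using vf[OF that(1)] that(2,3) unfolding vector_field_on_def by blast
  qed (simp add: D0[OF that(1)] subsetD[OF K(2)] contra_subsetD[OF K(2)])
  have Dmult: "D l (\<lambda>x. f x * g x) x = f x * D l g x + g x * D l f x" if "l \<le> n" "smooth_on M N f" "smooth_on M N g" for l f g x
  proof (cases "x \<in> N")
    case True then show ?thesis using vf[OF that(1)] that(2,3) unfolding vector_field_on_def by blast
  qed (simp add: D0[OF that(1)] subsetD[OF K(2)] contra_subsetD[OF K(2)])
  have Dcong: "D l f x = D l g x" if "l \<le> n" "\<And>x. x \<in> N \<Longrightarrow> f x = g x" for l f g x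
    using vf[OF that(1)] that(2) unfolding vector_field_on_def by blast
  have Dconst: "D l (\<lambda>x. r) x = 0" if "l \<le> n" for l r x
    using vf[OF that(1)] unfolding vector_field_on_def by blast
  have fN: "smooth_on M N f" if "f \<in> carrier A" for f by (rule A_smooth[OF that NX])
  have pN: "smooth_on M N (\<lambda>z. \<Phi> (p z) i)" if "p \<in> carrier P" for p i
    by (rule smooth_on_subset[OF P_smooth[OF that U(1)] N(2)])
  define Df where "Df l f = restrict (D l f) X" for l f
  \<comment> \<open>the lift \<open>\<nabla>\<^sub>l\<close> of \<open>D\<^sub>l\<close> to sections\<close>
  define nab where "nab l p = local_section U \<Phi> (\<lambda>x i. D l (\<lambda>z. \<Phi> (p z) i) x)" for l p
  have DfA: "Df l f \<in> carrier A" if "l \<le> n" "f \<in> carrier A" for l f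
    unfolding Df_def by (rule restrict_in_A[OF Dsm[OF that(1) fN[OF that(2)]]])
  have Df: "Df l f x = D l f x" if "x \<in> X" for l f x using that by (simp add: Df_def)
  have ls: "nab l p \<in> carrier P" "x \<in> U \<Longrightarrow> i < rk \<Longrightarrow> \<Phi> (nab l p x) i = D l (\<lambda>z. \<Phi> (p z) i) x"
    "(V, \<Psi>) \<in> BA \<Longrightarrow> x \<in> V - U \<Longrightarrow> \<Psi> (nab l p x) i = 0"
    if "l \<le> n" "p \<in> carrier P" for l p x i V \<Psi>
  proof -
    have "smooth_on M U (\<lambda>x. D l (\<lambda>z. \<Phi> (p z) i) x)" for i
      by (rule smooth_on_subset[OF Dsm[OF that(1) pN[OF that(2)]] UX])
    note L = local_section[OF U(1) K(1) KU this D0[OF that(1)]]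
    show "nab l p \<in> carrier P" unfolding nab_def by (rule L(1)) auto
    show "x \<in> U \<Longrightarrow> i < rk \<Longrightarrow> \<Phi> (nab l p x) i = D l (\<lambda>z. \<Phi> (p z) i) x"
      unfolding nab_def by (rule L(2)) auto
    show "(V, \<Psi>) \<in> BA \<Longrightarrow> x \<in> V - U \<Longrightarrow> \<Psi> (nab l p x) i = 0"
      unfolding nab_def by (rule L(3)) auto
  qed
  have secI: "p = q" if "p \<in> carrier P" "q \<in> carrier P" "\<And>x i. x \<in> U \<Longrightarrow> i < rk \<Longrightarrow> \<Phi> (p x) i = \<Phi> (q x) i"
    "\<And>V \<Psi> x i. (V, \<Psi>) \<in> BA \<Longrightarrow> x \<in> V - U \<Longrightarrow> x \<in> X - K \<Longrightarrow> \<Psi> (p x) i = \<Psi> (q x) i" for p q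
  proof (rule P_eqI[OF that(1,2)])
    fix x assume x: "x \<in> X"
    show "\<exists>U \<Phi>. (U, \<Phi>) \<in> BA \<and> x \<in> U \<and> (\<forall>i<rk. \<Phi> (p x) i = \<Phi> (q x) i)"
    proof (cases "x \<in> U")
      case False
      obtain V \<Psi> where "(V, \<Psi>) \<in> BA" "x \<in> V" using triv_ex[OF x] .
      then show ?thesis using that(4) x False KU by blast
    qed (use that(3) U in blast)
  qed
  have nab_add: "nab l (p \<oplus>\<^bsub>P\<^esub> q) = nab l p \<oplus>\<^bsub>P\<^esub> nab l q" if l: "l \<le> n" and p: "p \<in> carrier P" "q \<in> carrier P" for l p q
  proof (rule secI)
    note pq = P_add_closed[OF p]
    show "nab l (p \<oplus>\<^bsub>P\<^esub> q) \<in> carrier P" "nab l p \<oplus>\<^bsub>P\<^esub> nab l q \<in> carrier P"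
      using ls(1)[OF l] p pq by (auto intro: P_add_closed)
    fix x i assume x: "x \<in> U" "i < rk"
    have "D l (\<lambda>z. \<Phi> ((p \<oplus>\<^bsub>P\<^esub> q) z) i) x = D l (\<lambda>z. \<Phi> (p z) i + \<Phi> (q z) i) x"
      by (rule Dcong[OF l]) (use N(2) P_coords(1)[OF U(1) _ p] in auto)
    then show "\<Phi> (nab l (p \<oplus>\<^bsub>P\<^esub> q) x) i = \<Phi> ((nab l p \<oplus>\<^bsub>P\<^esub> nab l q) x) i"
      using ls(2)[OF l pq x] ls(2)[OF l p(1) x] ls(2)[OF l p(2) x] P_coords(1)[OF U(1) x(1) ls(1)[OF l p(1)] ls(1)[OF l p(2)]]
        Dadd[OF l pN[OF p(1)] pN[OF p(2)]] by simp
  next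
    fix V \<Psi> x i assume V: "(V, \<Psi>) \<in> BA" "x \<in> V - U"
    then have xV: "x \<in> V" by simp
    show "\<Psi> (nab l (p \<oplus>\<^bsub>P\<^esub> q) x) i = \<Psi> ((nab l p \<oplus>\<^bsub>P\<^esub> nab l q) x) i"
      using ls(3)[OF l P_add_closed[OF p] V] ls(3)[OF l p(1) V] ls(3)[OF l p(2) V]
        P_coords(1)[OF V(1) xV ls(1)[OF l p(1)] ls(1)[OF l p(2)]] by simp
  qed
  have nab_smult: "nab l (a \<odot>\<^bsub>P\<^esub> p) = (a \<odot>\<^bsub>P\<^esub> nab l p) \<oplus>\<^bsub>P\<^esub> (Df l a \<odot>\<^bsub>P\<^esub> p)"
    if l: "l \<le> n" and a: "a \<in> carrier A" and p: "p \<in> carrier P" for l a p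
  proof (rule secI)
    note ap = P_smult_closed[OF a p] and an = P_smult_closed[OF a ls(1)[OF l p]] and dp = P_smult_closed[OF DfA[OF l a] p]
    show "nab l (a \<odot>\<^bsub>P\<^esub> p) \<in> carrier P" "(a \<odot>\<^bsub>P\<^esub> nab l p) \<oplus>\<^bsub>P\<^esub> (Df l a \<odot>\<^bsub>P\<^esub> p) \<in> carrier P"
      using ls(1)[OF l ap] P_add_closed[OF an dp] by auto
    {
      fix x i assume x: "x \<in> U" "i < rk"
      then have xX: "x \<in> X" using UX by blast
      have "D l (\<lambda>z. \<Phi> ((a \<odot>\<^bsub>P\<^esub> p) z) i) x = D l (\<lambda>z. a z * \<Phi> (p z) i) x"
        by (rule Dcong[OF l]) (use N(2) P_coords(2)[OF U(1) _ p] in auto)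
      then show "\<Phi> (nab l (a \<odot>\<^bsub>P\<^esub> p) x) i = \<Phi> (((a \<odot>\<^bsub>P\<^esub> nab l p) \<oplus>\<^bsub>P\<^esub> (Df l a \<odot>\<^bsub>P\<^esub> p)) x) i"
        using ls(2)[OF l ap x] ls(2)[OF l p x] P_coords(1)[OF U(1) x(1) an dp]
          P_coords(2)[OF U(1) x(1) ls(1)[OF l p]] P_coords(2)[OF U(1) x(1) p]
          Dmult[OF l fN[OF a] pN[OF p]] Df[OF xX] by simp
    }
    fix V \<Psi> x i assume V: "(V, \<Psi>) \<in> BA" "x \<in> V - U" and xK: "x \<in> X - K"
    then have xV: "x \<in> V" by simp
    show "\<Psi> (nab l (a \<odot>\<^bsub>P\<^esub> p) x) i = \<Psi> (((a \<odot>\<^bsub>P\<^esub> nab l p) \<oplus>\<^bsub>P\<^esub> (Df l a \<odot>\<^bsub>P\<^esub> p)) x) i"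
      using ls(3)[OF l ap V] ls(3)[OF l p V] P_coords(1)[OF V(1) xV an dp]
        P_coords(2)[OF V(1) xV ls(1)[OF l p]] P_coords(2)[OF V(1) xV p] Df[of x l a] D0[OF l, of x a] xK by simp
  qed
  have nab_zero: "nab l \<zero>\<^bsub>P\<^esub> = \<zero>\<^bsub>P\<^esub>" if l: "l \<le> n" for l
  proof (rule secI[OF ls(1)[OF l P_zero_closed] P_zero_closed])
    fix x i assume x: "x \<in> U" "i < rk"
    have "D l (\<lambda>z. \<Phi> (\<zero>\<^bsub>P\<^esub> z) i) x = D l (\<lambda>z. 0) x"
      by (rule Dcong[OF l]) (use N(2) P_coords(3)[OF U(1)] in auto)
    then show "\<Phi> (nab l \<zero>\<^bsub>P\<^esub> x) i = \<Phi> (\<zero>\<^bsub>P\<^esub> x) i"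
      using ls(2)[OF l P_zero_closed x] Dconst[OF l] P_coords(3)[OF U(1) x(1)] by simp
  next
    fix V \<Psi> x i assume V: "(V, \<Psi>) \<in> BA" "x \<in> V - U"
    then have xV: "x \<in> V" by simp
    show "\<Psi> (nab l \<zero>\<^bsub>P\<^esub> x) i = \<Psi> (\<zero>\<^bsub>P\<^esub> x) i"
      using ls(3)[OF l P_zero_closed V] P_coords(3)[OF V(1) xV] by simp
  qed
  have Df_add: "Df l (f \<oplus>\<^bsub>A\<^esub> g) = Df l f \<oplus>\<^bsub>A\<^esub> Df l g" if l: "l \<le> n" and f: "f \<in> carrier A" "g \<in> carrier A" for l f g
  proof (rule A_eqI)
    fix x assume x: "x \<in> X"
    have "D l (f \<oplus>\<^bsub>A\<^esub> g) x = D l (\<lambda>x. f x + g x) x"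
      by (rule Dcong[OF l]) (use NX A_apply in auto)
    then show "Df l (f \<oplus>\<^bsub>A\<^esub> g) x = (Df l f \<oplus>\<^bsub>A\<^esub> Df l g) x"
      using Dadd[OF l fN[OF f(1)] fN[OF f(2)]] Df[OF x] A_apply(2)[OF x] by simp
  qed (use DfA[OF l] f A_closed in auto)
  have Df_mult: "Df l (f \<otimes>\<^bsub>A\<^esub> g) = (f \<otimes>\<^bsub>A\<^esub> Df l g) \<oplus>\<^bsub>A\<^esub> (g \<otimes>\<^bsub>A\<^esub> Df l f)" if l: "l \<le> n" and f: "f \<in> carrier A" "g \<in> carrier A" for l f g
  proof (rule A_eqI)
    fix x assume x: "x \<in> X"
    have "D l (f \<otimes>\<^bsub>A\<^esub> g) x = D l (\<lambda>x. f x * g x) x"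
      by (rule Dcong[OF l]) (use NX A_apply in auto)
    then show "Df l (f \<otimes>\<^bsub>A\<^esub> g) x = ((f \<otimes>\<^bsub>A\<^esub> Df l g) \<oplus>\<^bsub>A\<^esub> (g \<otimes>\<^bsub>A\<^esub> Df l f)) x"
      using Dmult[OF l fN[OF f(1)] fN[OF f(2)]] Df[OF x] A_apply(1,2)[OF x] by simp
  qed (use DfA[OF l] f A_closed in auto)
  have Df_const: "Df l (r \<odot>\<^bsub>A\<^esub> \<one>\<^bsub>A\<^esub>) = \<zero>\<^bsub>A\<^esub>" if l: "l \<le> n" for l r
  proof (rule A_eqI)
    fix x assume x: "x \<in> X"
    have "D l (r \<odot>\<^bsub>A\<^esub> \<one>\<^bsub>A\<^esub>) x = D l (\<lambda>x. r) x"
      by (rule Dcong[OF l]) (use NX A_apply in auto)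
    then show "Df l (r \<odot>\<^bsub>A\<^esub> \<one>\<^bsub>A\<^esub>) x = \<zero>\<^bsub>A\<^esub> x" using Dconst[OF l] Df[OF x] A_apply(5)[OF x] by simp
  qed (use DfA[OF l] A_closed in auto)
  have Df_zero: "Df l \<zero>\<^bsub>A\<^esub> = \<zero>\<^bsub>A\<^esub>" if l: "l \<le> n" for l
  proof -
    have "\<zero>\<^bsub>A\<^esub> = 0 \<odot>\<^bsub>A\<^esub> \<one>\<^bsub>A\<^esub>" by (rule A_eqI) (auto simp: A_apply intro: A_closed)
    then show ?thesis using Df_const[OF l, of 0] by simp
  qed
  define Y where "Y l = (\<lambda>v\<in>carrier B. (Df l (fst v), nab l (snd v)))" for l
  have Yv: "fst (Y l v) = Df l (fst v)" "snd (Y l v) = nab l (snd v)" if "v \<in> carrier B" for l v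
    using that by (simp_all add: Y_def)
  have Ycl: "Y l v \<in> carrier B" if "l \<le> n" "v \<in> carrier B" for l v
    using DfA[OF that(1)] ls(1)[OF that(1)] dm.fst_snd_closed[OF that(2)] that(2) by (simp add: Y_def dm.carrier_B)
  have Yder: "Y l (dm.emb0 g \<otimes>\<^bsub>B\<^esub> v) = dm.emb0 g \<otimes>\<^bsub>B\<^esub> Y l v \<oplus>\<^bsub>B\<^esub> v \<otimes>\<^bsub>B\<^esub> Y l (dm.emb0 g)"
    if l: "l \<le> n" and g: "g \<in> carrier A" and v: "v \<in> carrier B" for l g v
  proof (rule dm.B_eqI)
    note v' = dm.fst_snd_closed[OF v] and eg = dm.emb_closed(1)[OF g]
    note egv = dm.B.m_closed[OF eg v]
    have sn: "snd (dm.emb0 g \<otimes>\<^bsub>B\<^esub> v) = g \<odot>\<^bsub>P\<^esub> snd v" using g v' by simp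
    show "fst (Y l (dm.emb0 g \<otimes>\<^bsub>B\<^esub> v)) = fst (dm.emb0 g \<otimes>\<^bsub>B\<^esub> Y l v \<oplus>\<^bsub>B\<^esub> v \<otimes>\<^bsub>B\<^esub> Y l (dm.emb0 g))"
      unfolding dm.fst_snd_ops Yv(1)[OF egv] Yv(1)[OF v] Yv(1)[OF eg] dm.fst_snd_emb by (rule Df_mult[OF l g v'(1)])
    show "snd (Y l (dm.emb0 g \<otimes>\<^bsub>B\<^esub> v)) = snd (dm.emb0 g \<otimes>\<^bsub>B\<^esub> Y l v \<oplus>\<^bsub>B\<^esub> v \<otimes>\<^bsub>B\<^esub> Y l (dm.emb0 g))"
      unfolding Yv(2)[OF egv] sn nab_smult[OF l g v'(2)]
      using g v' Yv[OF v] Yv[OF eg] nab_zero[OF l] DfA[OF l] ls(1)[OF l] by simp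
  qed
  have Y: "dm.der_op (Y l)" if l: "l \<le> n" for l
    unfolding dm.der_op_def
  proof (intro conjI ballI Yder[OF l])
    show "Y l \<in> dm.hom0"
    proof (rule dm.hom0I)
      show "Y l \<in> extensional (carrier B)" by (simp add: Y_def)
      show "Y l v \<in> carrier B" if "v \<in> carrier B" for v by (rule Ycl[OF l that])
      show "Y l (u \<oplus>\<^bsub>B\<^esub> v) = Y l u \<oplus>\<^bsub>B\<^esub> Y l v" if u: "u \<in> carrier B" and v: "v \<in> carrier B" for u v
      proof (rule dm.B_eqI)
        note uv = dm.B.a_closed[OF u v]
        show "fst (Y l (u \<oplus>\<^bsub>B\<^esub> v)) = fst (Y l u \<oplus>\<^bsub>B\<^esub> Y l v)"
          unfolding dm.fst_snd_ops Yv(1)[OF uv] Yv(1)[OF u] Yv(1)[OF v]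
          by (rule Df_add[OF l dm.fst_snd_closed(1)[OF u] dm.fst_snd_closed(1)[OF v]])
        show "snd (Y l (u \<oplus>\<^bsub>B\<^esub> v)) = snd (Y l u \<oplus>\<^bsub>B\<^esub> Y l v)"
          unfolding dm.fst_snd_ops Yv(2)[OF uv] Yv(2)[OF u] Yv(2)[OF v]
          by (rule nab_add[OF l dm.fst_snd_closed(2)[OF u] dm.fst_snd_closed(2)[OF v]])
      qed
      have r: "r \<odot>\<^bsub>A\<^esub> \<one>\<^bsub>A\<^esub> \<in> carrier A" for r by (intro A_closed)
      have "Y l (dm.scalar r) = \<zero>\<^bsub>B\<^esub>" for r
        by (rule dm.B_eqI) (use Yv[of "dm.scalar r" l] Df_const[OF l] nab_zero[OF l] in auto)
      then show "Y l (dm.scalar r \<otimes>\<^bsub>B\<^esub> v) = dm.scalar r \<otimes>\<^bsub>B\<^esub> Y l v" if "v \<in> carrier B" for r v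
        using Yder[OF l r[of r] that] Ycl[OF l that] that by (simp add: dm.scalar_def[symmetric])
      show "snd (Y l (dm.emb0 a)) = \<zero>\<^bsub>P\<^esub>" if "a \<in> carrier A" for a
        using Yv(2)[of "dm.emb0 a" l] that nab_zero[OF l] by simp
      show "fst (Y l (dm.emb1 p)) = \<zero>\<^bsub>A\<^esub>" if "p \<in> carrier P" for p
        using Yv(1)[of "dm.emb1 p" l] that Df_zero[OF l] by simp
    qed
  qed
  define w where "w = (\<eta> \<otimes>\<^bsub>A\<^esub> \<eta>) \<otimes>\<^bsub>A\<^esub> \<eta>"
  have w: "w \<in> carrier A" "\<And>x. x \<in> X \<Longrightarrow> w x = \<eta> x ^ 3"
    using \<eta>(1) by (auto simp: w_def A_apply power3_eq_cube intro: A_closed)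
  have fr: "dm.emb0 w \<otimes>\<^bsub>B\<^esub> V f = (\<Oplus>\<^bsub>B\<^esub>l\<in>{..n}. Y l (dm.emb0 f) \<otimes>\<^bsub>B\<^esub> V (y l))"
    if V: "dm.B_derivation V" and f: "f \<in> carrier A" for V f
  proof -
    have Vc: "V f \<in> carrier B" if "f \<in> carrier A" for f using V that unfolding dm.B_derivation_def by blast
    note Vc' = dm.fst_snd_closed[OF Vc] and ef = dm.emb_closed(1)[OF f]
    have summand: "Y l (dm.emb0 f) \<otimes>\<^bsub>B\<^esub> V (y l) \<in> carrier B"
      "fst (Y l (dm.emb0 f) \<otimes>\<^bsub>B\<^esub> V (y l)) = Df l f \<otimes>\<^bsub>A\<^esub> fst (V (y l))"
      "snd (Y l (dm.emb0 f) \<otimes>\<^bsub>B\<^esub> V (y l)) = Df l f \<odot>\<^bsub>P\<^esub> snd (V (y l))" if l: "l \<le> n" for l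
      using Ycl[OF l ef] Vc[OF y[OF l]] Yv[OF ef, of l] nab_zero[OF l] DfA[OF l f] Vc'[OF y[OF l]] by simp_all
    let ?R = "\<Oplus>\<^bsub>B\<^esub>l\<in>{..n}. Y l (dm.emb0 f) \<otimes>\<^bsub>B\<^esub> V (y l)"
    have Rc: "?R \<in> carrier B" using summand by (intro dm.B.finsum_closed) auto
    note Rc' = dm.fst_snd_closed[OF Rc]
    show ?thesis
    proof (rule dm.B_eqI)
      have "fst (dm.emb0 w \<otimes>\<^bsub>B\<^esub> V f) = w \<otimes>\<^bsub>A\<^esub> fst (V f)" by simp
      also have "\<dots> = fst ?R"
      proof (rule A_eqI[OF A_closed(2)[OF w(1) Vc'(1)[OF f]] Rc'(1)])
        fix x assume x: "x \<in> X"
        have "fst ?R x = (\<Sum>l\<in>{..n}. fst (Y l (dm.emb0 f) \<otimes>\<^bsub>B\<^esub> V (y l)) x)"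
          by (rule evaluate_finsum[where e = "\<lambda>u. fst u x"]) (use summand A_apply[OF x] in auto)
        also have "\<dots> = (\<Sum>l\<in>{..n}. fst (V (y l)) x * D l f x)"
          by (rule sum.cong) (use summand A_apply[OF x] Df[OF x] in auto)
        also have "\<dots> = \<eta> x ^ 3 * fst (V f) x"
          using main[OF x B_derivation_points(1)[OF V x] f] by simp
        finally show "(w \<otimes>\<^bsub>A\<^esub> fst (V f)) x = fst ?R x" using w(2)[OF x] A_apply(1)[OF x] by simp
      qed
      finally show "fst (dm.emb0 w \<otimes>\<^bsub>B\<^esub> V f) = fst ?R" .
      have "snd (dm.emb0 w \<otimes>\<^bsub>B\<^esub> V f) = w \<odot>\<^bsub>P\<^esub> snd (V f)" using w Vc'[OF f] by simp
      also have "\<dots> = snd ?R"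
      proof (rule P_eqI_all[OF P_smult_closed[OF w(1) Vc'(2)[OF f]] Rc'(2)])
        fix W \<Psi> x i assume W: "(W, \<Psi>) \<in> BA" "x \<in> W"
        then have x: "x \<in> X" using triv_subset by blast
        have "\<Psi> (snd ?R x) i = (\<Sum>l\<in>{..n}. \<Psi> (snd (Y l (dm.emb0 f) \<otimes>\<^bsub>B\<^esub> V (y l)) x) i)"
          by (rule evaluate_finsum[where e = "\<lambda>u. \<Psi> (snd u x) i"]) (use summand P_coords[OF W] in auto)
        also have "\<dots> = (\<Sum>l\<in>{..n}. \<Psi> (snd (V (y l)) x) i * D l f x)"
          by (rule sum.cong) (use summand P_coords(2)[OF W] Vc'(2)[OF y] Df[OF x] in auto)
        also have "\<dots> = \<eta> x ^ 3 * \<Psi> (snd (V f) x) i"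
          using main[OF x B_derivation_points(2)[OF V W] f] by simp
        finally show "\<Psi> ((w \<odot>\<^bsub>P\<^esub> snd (V f)) x) i = \<Psi> (snd ?R x) i"
          using P_coords(2)[OF W Vc'(2)[OF f]] w(2)[OF x] by simp
      qed
      finally show "snd (dm.emb0 w \<otimes>\<^bsub>B\<^esub> V f) = snd ?R" .
    qed
  qed
  have "dm.frame w n y Y" unfolding dm.frame_def using w(1) y Y fr by blast
  moreover have "\<forall>x\<in>X. w x \<ge> 0" "w x0 > 0" using w(2) \<eta>(2,3) x0 by auto
  ultimately show ?thesis by blast
  qed
qed

text \<open>
  A second countable space is a Lindelof space, so countably many of the sets where the weight of a frame is
  positive cover \<open>M\<close>.
\<close>

lemma countable_frames:
  obtains w where "\<And>i::nat. \<exists>m y Y. dm.frame (w i) m y Y" "\<And>i x. x \<in> X \<Longrightarrow> w i x \<ge> 0"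
    "\<And>x. x \<in> X \<Longrightarrow> \<exists>i. w i x > 0"
proof -
  define S where "S = {w. (\<exists>m y Y. dm.frame w m y Y) \<and> (\<forall>x\<in>X. w x \<ge> 0)}"
  have SA: "smooth_on M X w" if "w \<in> S" for w
    using that by (auto simp: S_def dm.frame_def carrier_A)
  have zero: "\<zero>\<^bsub>A\<^esub> \<in> S"
  proof -
    have "dm.frame \<zero>\<^bsub>A\<^esub> 0 (\<lambda>_. \<zero>\<^bsub>A\<^esub>) (\<lambda>_. dm.opzero)"
      unfolding dm.frame_def dm.der_op_def dm.B_derivation_def
      using dm.emb0_zero by (auto simp: A_closed)
    then show ?thesis by (auto simp: S_def A_apply)
  qed
  define pos where "pos w = {x \<in> X. w x > 0}" for w :: "'a \<Rightarrow> real"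
  have "Lindelof_space (mtop M)"
    by (rule second_countable_imp_Lindelof_space[OF conjunct1[OF conjunct2[OF smooth_manifold[unfolded smooth_manifold_def]]]])
  moreover have "\<Union>(pos ` S) = X"
  proof
    show "X \<subseteq> \<Union>(pos ` S)"
    proof
      fix x assume x: "x \<in> X"
      then obtain w where "w \<in> S" "w x > 0" using frame_at[OF x] by (auto simp: S_def)
      then show "x \<in> \<Union>(pos ` S)" using x by (auto simp: pos_def)
    qed
  qed (auto simp: pos_def)
  moreover have "openin (mtop M) V" if "V \<in> pos ` S" for V
    using that open_positive[OF SA] by (auto simp: pos_def)
  ultimately have "\<exists>\<V>. countable \<V> \<and> \<V> \<subseteq> pos ` S \<and> \<Union>\<V> = X"
    by (intro Lindelof_spaceD[of "mtop M" "pos ` S"]) simp_all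
  then obtain \<V> where \<V>: "countable \<V>" "\<V> \<subseteq> pos ` S" "\<Union>\<V> = X" by (elim exE conjE)
  then obtain S' where S': "countable S'" "S' \<subseteq> S" "\<V> = pos ` S'"
    by (meson countable_subset_image)
  \<comment> \<open>the zero weight makes the set nonempty, as it is required for an enumeration, also if \<open>M\<close> is empty\<close>
  define S'' where "S'' = insert \<zero>\<^bsub>A\<^esub> S'"
  have c: "countable S''" "S'' \<noteq> {}" "S'' \<subseteq> S" using S' zero by (auto simp: S''_def)
  define w where "w = from_nat_into S''"
  have r: "range w = S''" unfolding w_def by (rule range_from_nat_into[OF c(2,1)])
  have wS: "w i \<in> S" for i using r c(3) by blast
  show thesis
  proof (rule that[of w])
    show "\<exists>m y Y. dm.frame (w i) m y Y" for i using wS[of i] unfolding S_def by blast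
    show "w i x \<ge> 0" if "x \<in> X" for i x using wS[of i] that unfolding S_def by blast
    fix x assume "x \<in> X"
    then obtain v where "v \<in> S'" "v x > 0" using \<V>(3) S'(3) by (auto simp: pos_def)
    then have "v \<in> range w" using r by (simp add: S''_def)
    then show "\<exists>i. w i x > 0" using \<open>v x > 0\<close> by blast
  qed
qed

definition triv_at where "triv_at x = snd (SOME t. t \<in> BA \<and> x \<in> fst t)"

lemma triv_at:
  assumes "x \<in> X"
  obtains U where "(U, triv_at x) \<in> BA" "x \<in> U"
proof -
  obtain U \<Phi> where "(U, \<Phi>) \<in> BA" "x \<in> U" using triv_ex[OF assms] .
  then have "\<exists>t. t \<in> BA \<and> x \<in> fst t" by force
  from someI_ex[OF this] have t: "(SOME t. t \<in> BA \<and> x \<in> fst t) \<in> BA" "x \<in> fst (SOME t. t \<in> BA \<and> x \<in> fst t)"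
    by (rule conjunct1, rule conjunct2)
  show thesis by (rule that[of "fst (SOME t. t \<in> BA \<and> x \<in> fst t)"]) (unfold triv_at_def prod.collapse, (rule t)+)
qed

text \<open>
  At each point the sum is taken in a chosen trivialisation. Transition functions are linear on the
  fibres, hence the same formula holds in every other trivialisation.
\<close>

definition section_sum where
  "section_sum \<rho> p = (\<lambda>x\<in>X. point (triv_at x) x (\<lambda>b. loc_sum \<rho> (\<lambda>i z. triv_at x (p i z) b) x))"

lemma section_sum:
  assumes \<rho>: "locally_finite \<rho>" and p: "\<And>i. p i \<in> carrier P"
  shows "section_sum \<rho> p \<in> carrier P"
    and "(V, \<Psi>) \<in> BA \<Longrightarrow> x \<in> V \<Longrightarrow> \<Psi> (section_sum \<rho> p x) b = loc_sum \<rho> (\<lambda>i z. \<Psi> (p i z) b) x"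
proof -
  have fib: "section_sum \<rho> p x \<in> fibre E x" if x: "x \<in> X" for x
  proof -
    obtain U where U: "(U, triv_at x) \<in> BA" "x \<in> U" using triv_at[OF x] .
    show ?thesis using point(1)[OF U] x by (simp add: section_sum_def)
  qed
  have coord: "\<Psi> (section_sum \<rho> p x) b = loc_sum \<rho> (\<lambda>i z. \<Psi> (p i z) b) x"
    if V: "(V, \<Psi>) \<in> BA" "x \<in> V" for V \<Psi> x b
  proof -
    have x: "x \<in> X" using V triv_subset by blast
    obtain U where U: "(U, triv_at x) \<in> BA" "x \<in> U" using triv_at[OF x] .
    obtain m where m: "\<And>i. i \<ge> m \<Longrightarrow> \<rho> i x = 0" using locally_finite_bound[OF \<rho> x] by blast
    note ls = loc_sum_eq[of m \<rho> x, OF m]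
    let ?T = "transition (triv_at x) \<Psi> x b"
    have "\<Psi> (section_sum \<rho> p x) b = (\<Sum>j<rk. triv_at x (section_sum \<rho> p x) j * ?T j)"
      by (rule transition_formula[OF U V fib[OF x]])
    also have "\<dots> = (\<Sum>j<rk. (\<Sum>i<m. \<rho> i x * triv_at x (p i x) j) * ?T j)"
      using point(2)[OF U] x by (intro sum.cong) (auto simp: section_sum_def ls)
    also have "\<dots> = (\<Sum>j<rk. \<Sum>i<m. \<rho> i x * (triv_at x (p i x) j * ?T j))"
      by (simp add: sum_distrib_right mult.assoc)
    also have "\<dots> = (\<Sum>i<m. \<Sum>j<rk. \<rho> i x * (triv_at x (p i x) j * ?T j))" by (rule sum.swap)
    also have "\<dots> = (\<Sum>i<m. \<rho> i x * \<Psi> (p i x) b)"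
      using transition_formula[OF U V P_fibre[OF p x], of _ b] by (simp add: sum_distrib_left)
    finally show ?thesis by (simp add: ls)
  qed
  then show "(V, \<Psi>) \<in> BA \<Longrightarrow> x \<in> V \<Longrightarrow> \<Psi> (section_sum \<rho> p x) b = loc_sum \<rho> (\<lambda>i z. \<Psi> (p i z) b) x" .
  show "section_sum \<rho> p \<in> carrier P"
  proof (rule P_I)
    show "section_sum \<rho> p \<in> extensional X" by (simp add: section_sum_def)
    show "section_sum \<rho> p x \<in> fibre E x" if "x \<in> X" for x by (rule fib[OF that])
    fix V \<Psi> b assume V: "(V, \<Psi>) \<in> BA"
    show "smooth_on M V (\<lambda>x. \<Psi> (section_sum \<rho> p x) b)"
      by (rule smooth_on_cong[OF triv_open[OF V] smooth_on_loc_sum[OF \<rho> triv_open[OF V] P_smooth[OF p V]]])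
        (simp add: coord[OF V])
  qed
qed

definition glue where
  "glue \<rho> g = (\<lambda>x\<in>X. loc_sum \<rho> (\<lambda>i. fst (g i)) x, section_sum \<rho> (\<lambda>i. snd (g i)))"

lemma loc_sum_linear:
  assumes "locally_finite \<rho>" "x \<in> X"
  shows "loc_sum \<rho> (\<lambda>i z. a i z + b i z) x = loc_sum \<rho> a x + loc_sum \<rho> b x"
    "loc_sum \<rho> (\<lambda>i z. h z * a i z) x = h x * loc_sum \<rho> a x"
    "loc_sum \<rho> (\<lambda>i z. h z * a i z + k z * b i z) x = h x * loc_sum \<rho> a x + k x * loc_sum \<rho> b x"
    "loc_sum \<rho> (\<lambda>i z. a i z * h z) x = loc_sum \<rho> a x * h x"
proof -
  obtain m where m: "\<And>i. i \<ge> m \<Longrightarrow> \<rho> i x = 0" using locally_finite_bound[OF assms] by blast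
  note ls = loc_sum_eq[of m \<rho> x, OF m]
  show "loc_sum \<rho> (\<lambda>i z. a i z + b i z) x = loc_sum \<rho> a x + loc_sum \<rho> b x"
    "loc_sum \<rho> (\<lambda>i z. h z * a i z) x = h x * loc_sum \<rho> a x"
    "loc_sum \<rho> (\<lambda>i z. h z * a i z + k z * b i z) x = h x * loc_sum \<rho> a x + k x * loc_sum \<rho> b x"
    "loc_sum \<rho> (\<lambda>i z. a i z * h z) x = loc_sum \<rho> a x * h x"
    by (simp_all add: ls sum.distrib sum_distrib_left sum_distrib_right algebra_simps)
qed

lemma loc_sum_cong: "(\<And>i. a i x = b i x) \<Longrightarrow> loc_sum \<rho> a x = loc_sum \<rho> b x"
  by (simp add: loc_sum_def)

lemma loc_sum_zero: "(\<And>i. a i x = 0) \<Longrightarrow> loc_sum \<rho> a x = 0"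
  by (simp add: loc_sum_def)

lemma glue_closed:
  assumes \<rho>: "locally_finite \<rho>" and g: "\<And>i. g i \<in> carrier B"
  shows "glue \<rho> g \<in> carrier B"
proof -
  note g' = dm.fst_snd_closed[OF g]
  have "smooth_on M X (loc_sum \<rho> (\<lambda>i. fst (g i)))"
    by (rule smooth_on_loc_sum[OF \<rho> openin_topspace A_smooth[OF g'(1) order_refl]])
  then show ?thesis unfolding glue_def dm.carrier_B
    by (intro SigmaI restrict_in_A section_sum(1)[OF \<rho> g'(2)])
qed

lemma gluing_glue:
  assumes \<rho>: "locally_finite \<rho>"
  shows "dm.gluing (glue \<rho>)"
  unfolding dm.gluing_def
proof (intro allI impI conjI ballI)
  fix g assume "\<forall>i::nat. g i \<in> carrier B"
  then have g: "g i \<in> carrier B" for i by blast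
  note g' = dm.fst_snd_closed[OF g] and gc = glue_closed[OF \<rho> g]
  note lin = loc_sum_linear[OF \<rho>]
  show "glue \<rho> g \<in> carrier B" by (rule gc)
  {
    fix h assume "\<forall>i::nat. h i \<in> carrier B"
    then have h: "h i \<in> carrier B" for i by blast
    note h' = dm.fst_snd_closed[OF h] and hc = glue_closed[OF \<rho> h]
    have gh: "g i \<oplus>\<^bsub>B\<^esub> h i \<in> carrier B" for i using g h by simp
    note ghc = glue_closed[OF \<rho> gh] and gh' = dm.fst_snd_closed[OF gh]
    note s = dm.B.a_closed[OF gc hc]
    show "glue \<rho> (\<lambda>i. g i \<oplus>\<^bsub>B\<^esub> h i) = glue \<rho> g \<oplus>\<^bsub>B\<^esub> glue \<rho> h"
    proof (rule dm.B_eqI)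
      show "fst (glue \<rho> (\<lambda>i. g i \<oplus>\<^bsub>B\<^esub> h i)) = fst (glue \<rho> g \<oplus>\<^bsub>B\<^esub> glue \<rho> h)"
      proof (rule A_eqI[OF dm.fst_snd_closed(1)[OF ghc] dm.fst_snd_closed(1)[OF s]])
        fix x assume x: "x \<in> X"
        have "loc_sum \<rho> (\<lambda>i. fst (g i \<oplus>\<^bsub>B\<^esub> h i)) x = loc_sum \<rho> (\<lambda>i z. fst (g i) z + fst (h i) z) x"
          by (rule loc_sum_cong) (simp add: A_apply[OF x])
        then show "fst (glue \<rho> (\<lambda>i. g i \<oplus>\<^bsub>B\<^esub> h i)) x = fst (glue \<rho> g \<oplus>\<^bsub>B\<^esub> glue \<rho> h) x"
          using x by (simp add: glue_def A_apply[OF x] lin(1)[OF x])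
      qed
      show "snd (glue \<rho> (\<lambda>i. g i \<oplus>\<^bsub>B\<^esub> h i)) = snd (glue \<rho> g \<oplus>\<^bsub>B\<^esub> glue \<rho> h)"
      proof (rule P_eqI_all[OF dm.fst_snd_closed(2)[OF ghc] dm.fst_snd_closed(2)[OF s]])
        fix V \<Psi> x b assume V: "(V, \<Psi>) \<in> BA" "x \<in> V"
        then have x: "x \<in> X" using triv_subset by blast
        have "loc_sum \<rho> (\<lambda>i z. \<Psi> (snd (g i \<oplus>\<^bsub>B\<^esub> h i) z) b) x
            = loc_sum \<rho> (\<lambda>i z. \<Psi> (snd (g i) z) b + \<Psi> (snd (h i) z) b) x"
          by (rule loc_sum_cong) (simp add: P_coords(1)[OF V g'(2) h'(2)])
        then show "\<Psi> (snd (glue \<rho> (\<lambda>i. g i \<oplus>\<^bsub>B\<^esub> h i)) x) b = \<Psi> (snd (glue \<rho> g \<oplus>\<^bsub>B\<^esub> glue \<rho> h) x) b"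
          using section_sum(2)[OF \<rho> gh'(2) V] section_sum(2)[OF \<rho> g'(2) V] section_sum(2)[OF \<rho> h'(2) V]
            P_coords(1)[OF V section_sum(1)[OF \<rho> g'(2)] section_sum(1)[OF \<rho> h'(2)]]
          by (simp only: glue_def snd_conv dm.fst_snd_ops lin(1)[OF x])
      qed
    qed
  }
  {
    fix z assume z: "z \<in> carrier B"
    note z' = dm.fst_snd_closed[OF z]
    have zg: "z \<otimes>\<^bsub>B\<^esub> g i \<in> carrier B" for i using g z by simp
    note zgc = glue_closed[OF \<rho> zg] and zg' = dm.fst_snd_closed[OF zg]
    note s = dm.B.m_closed[OF z gc]
    show "glue \<rho> (\<lambda>i. z \<otimes>\<^bsub>B\<^esub> g i) = z \<otimes>\<^bsub>B\<^esub> glue \<rho> g"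
    proof (rule dm.B_eqI)
      show "fst (glue \<rho> (\<lambda>i. z \<otimes>\<^bsub>B\<^esub> g i)) = fst (z \<otimes>\<^bsub>B\<^esub> glue \<rho> g)"
      proof (rule A_eqI[OF dm.fst_snd_closed(1)[OF zgc] dm.fst_snd_closed(1)[OF s]])
        fix x assume x: "x \<in> X"
        have "loc_sum \<rho> (\<lambda>i. fst (z \<otimes>\<^bsub>B\<^esub> g i)) x = loc_sum \<rho> (\<lambda>i y. fst z y * fst (g i) y) x"
          by (rule loc_sum_cong) (simp add: A_apply[OF x])
        then show "fst (glue \<rho> (\<lambda>i. z \<otimes>\<^bsub>B\<^esub> g i)) x = fst (z \<otimes>\<^bsub>B\<^esub> glue \<rho> g) x"
          using x by (simp add: glue_def A_apply[OF x] lin(2)[OF x])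
      qed
      show "snd (glue \<rho> (\<lambda>i. z \<otimes>\<^bsub>B\<^esub> g i)) = snd (z \<otimes>\<^bsub>B\<^esub> glue \<rho> g)"
      proof (rule P_eqI_all[OF dm.fst_snd_closed(2)[OF zgc] dm.fst_snd_closed(2)[OF s]])
        fix V \<Psi> x b assume V: "(V, \<Psi>) \<in> BA" "x \<in> V"
        then have x: "x \<in> X" using triv_subset by blast
        have sg: "section_sum \<rho> (\<lambda>i. snd (g i)) \<in> carrier P" by (rule section_sum(1)[OF \<rho> g'(2)])
        have lA: "(\<lambda>x\<in>X. loc_sum \<rho> (\<lambda>i. fst (g i)) x) \<in> carrier A"
          using dm.fst_snd_closed(1)[OF gc] by (simp add: glue_def)
        have "loc_sum \<rho> (\<lambda>i y. \<Psi> (snd (z \<otimes>\<^bsub>B\<^esub> g i) y) b) x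
            = loc_sum \<rho> (\<lambda>i y. fst z y * \<Psi> (snd (g i) y) b + \<Psi> (snd z y) b * fst (g i) y) x"
          by (rule loc_sum_cong)
            (simp add: P_coords[OF V] P_smult_closed z' g')
        also have "\<dots> = fst z x * loc_sum \<rho> (\<lambda>i y. \<Psi> (snd (g i) y) b) x + \<Psi> (snd z x) b * loc_sum \<rho> (\<lambda>i. fst (g i)) x"
          by (rule lin(3)[OF x])
        finally show "\<Psi> (snd (glue \<rho> (\<lambda>i. z \<otimes>\<^bsub>B\<^esub> g i)) x) b = \<Psi> (snd (z \<otimes>\<^bsub>B\<^esub> glue \<rho> g) x) b"
          using section_sum(2)[OF \<rho> zg'(2) V] section_sum(2)[OF \<rho> g'(2) V] x
            P_coords(1)[OF V P_smult_closed[OF z'(1) sg] P_smult_closed[OF lA z'(2)]]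
            P_coords(2)[OF V sg] P_coords(2)[OF V z'(2)]
          by (simp add: glue_def)
      qed
    qed
  }
  show "fst (glue \<rho> g) = \<zero>\<^bsub>A\<^esub>" if z: "\<forall>i. fst (g i) = \<zero>\<^bsub>A\<^esub>"
  proof (rule A_eqI[OF dm.fst_snd_closed(1)[OF gc] A_closed(5)])
    fix x assume x: "x \<in> X"
    have "loc_sum \<rho> (\<lambda>i. fst (g i)) x = 0" by (rule loc_sum_zero) (simp add: z A_apply[OF x])
    then show "fst (glue \<rho> g) x = \<zero>\<^bsub>A\<^esub> x" using x by (simp add: glue_def A_apply[OF x])
  qed
  show "snd (glue \<rho> g) = \<zero>\<^bsub>P\<^esub>" if z: "\<forall>i. snd (g i) = \<zero>\<^bsub>P\<^esub>"
  proof (rule P_eqI_all[OF dm.fst_snd_closed(2)[OF gc] P_zero_closed])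
    fix V \<Psi> x b assume V: "(V, \<Psi>) \<in> BA" "x \<in> V"
    have "loc_sum \<rho> (\<lambda>i y. \<Psi> (snd (g i) y) b) x = 0"
      by (rule loc_sum_zero) (simp add: z P_coords(3)[OF V])
    then show "\<Psi> (snd (glue \<rho> g) x) b = \<Psi> (\<zero>\<^bsub>P\<^esub> x) b"
      using section_sum(2)[OF \<rho> g'(2) V] P_coords(3)[OF V] by (simp only: glue_def snd_conv)
  qed
qed

text \<open>
  If \<open>\<Sum>\<^sub>i \<rho>\<^sub>i \<theta>\<^sub>i = 1\<close>, then gluing undoes the multiplication by the \<open>\<theta>\<^sub>i\<close>.
\<close>

lemma glue_unit:
  assumes \<rho>: "locally_finite \<rho>" and \<theta>: "\<And>i. \<theta> i \<in> carrier A" "\<And>x. x \<in> X \<Longrightarrow> loc_sum \<rho> \<theta> x = 1"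
    and z: "z \<in> carrier B"
  shows "glue \<rho> (\<lambda>i. dm.emb0 (\<theta> i) \<otimes>\<^bsub>B\<^esub> z) = z"
proof (rule dm.B_eqI)
  note z' = dm.fst_snd_closed[OF z] and lin = loc_sum_linear[OF \<rho>]
  have tz: "dm.emb0 (\<theta> i) \<otimes>\<^bsub>B\<^esub> z \<in> carrier B" for i using z \<theta>(1) by simp
  note gc = glue_closed[OF \<rho> tz] and tz' = dm.fst_snd_closed[OF tz]
  show "fst (glue \<rho> (\<lambda>i. dm.emb0 (\<theta> i) \<otimes>\<^bsub>B\<^esub> z)) = fst z"
  proof (rule A_eqI[OF dm.fst_snd_closed(1)[OF gc] z'(1)])
    fix x assume x: "x \<in> X"
    have "loc_sum \<rho> (\<lambda>i. fst (dm.emb0 (\<theta> i) \<otimes>\<^bsub>B\<^esub> z)) x = loc_sum \<rho> (\<lambda>i y. \<theta> i y * fst z y) x"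
      by (rule loc_sum_cong) (simp add: A_apply[OF x])
    then show "fst (glue \<rho> (\<lambda>i. dm.emb0 (\<theta> i) \<otimes>\<^bsub>B\<^esub> z)) x = fst z x"
      using x \<theta>(2)[OF x] by (simp add: glue_def lin(4)[OF x])
  qed
  show "snd (glue \<rho> (\<lambda>i. dm.emb0 (\<theta> i) \<otimes>\<^bsub>B\<^esub> z)) = snd z"
  proof (rule P_eqI_all[OF dm.fst_snd_closed(2)[OF gc] z'(2)])
    fix V \<Psi> x b assume V: "(V, \<Psi>) \<in> BA" "x \<in> V"
    then have x: "x \<in> X" using triv_subset by blast
    have "loc_sum \<rho> (\<lambda>i y. \<Psi> (snd (dm.emb0 (\<theta> i) \<otimes>\<^bsub>B\<^esub> z) y) b) x = loc_sum \<rho> (\<lambda>i y. \<theta> i y * \<Psi> (snd z y) b) x"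
      by (rule loc_sum_cong) (simp add: P_coords[OF V] P_smult_closed P_zero_closed z' \<theta>)
    then show "\<Psi> (snd (glue \<rho> (\<lambda>i. dm.emb0 (\<theta> i) \<otimes>\<^bsub>B\<^esub> z)) x) b = \<Psi> (snd z x) b"
      using section_sum(2)[OF \<rho> tz'(2) V] \<theta>(2)[OF x] lin(4)[OF x, of \<theta> "\<lambda>y. \<Psi> (snd z y) b"]
      by (simp only: glue_def snd_conv mult_1_left)
  qed
qed

text \<open>
  The operators provided by the frames have the symbols \<open>w\<^sub>i\<^bsup>2j\<^esup> T\<close>. They are glued with
  functions \<open>\<rho>\<^sub>i\<close> such that \<open>\<Sum>\<^sub>i \<rho>\<^sub>i w\<^sub>i\<^bsup>2j\<^esup> = 1\<close>.
\<close>

theorem symbols_surjective: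
  assumes T: "dm.sym_der j T"
  shows "\<exists>\<phi>. dm.order_le (Suc j) \<phi> \<and> (\<forall>fs\<in>tuples A j. \<forall>x\<in>carrier B. dm.symb \<phi> fs x = T fs x)"
proof (rule countable_frames)
  fix w assume w: "\<And>i::nat. \<exists>m y Y. dm.frame (w i) m y Y" "\<And>i x. x \<in> X \<Longrightarrow> w i x \<ge> 0"
    "\<And>x. x \<in> X \<Longrightarrow> \<exists>i. w i x > 0"
  have wA: "w i \<in> carrier A" for i using w(1)[of i] unfolding dm.frame_def by blast
  define \<theta> where "\<theta> i = w i [^]\<^bsub>A\<^esub> (2 * j)" for i
  have \<theta>A: "\<theta> i \<in> carrier A" for i unfolding \<theta>_def by (rule dm.R.nat_pow_closed[OF wA])
  have pow: "(a [^]\<^bsub>A\<^esub> (N::nat)) x = a x ^ N" if "x \<in> X" for a N x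
    by (induction N) (simp_all add: A_apply[OF that])
  have \<theta>: "\<theta> i x = w i x ^ (2 * j)" if "x \<in> X" for i x unfolding \<theta>_def by (rule pow[OF that])
  have "smooth_on M X (\<theta> i)" for i by (rule A_smooth[OF \<theta>A order_refl])
  moreover have "\<theta> i x \<ge> 0" if "x \<in> X" for i x using \<theta>[OF that] w(2)[OF that] by simp
  moreover have "\<exists>i. \<theta> i x > 0" if x: "x \<in> X" for x
  proof -
    obtain i where "w i x > 0" using w(3)[OF x] by blast
    then have "\<theta> i x > 0" unfolding \<theta>[OF x] by (rule zero_less_power)
    then show ?thesis ..
  qed
  ultimately obtain \<rho> where \<rho>: "locally_finite \<rho>" "\<And>x. x \<in> X \<Longrightarrow> loc_sum \<rho> \<theta> x = 1"
    using partition_of_unity[of \<theta>] by blast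
  show ?thesis
  proof (rule dm.global_surjectivity[OF w(1) gluing_glue[OF \<rho>(1)] _ T])
    show "glue \<rho> (\<lambda>i. dm.emb0 (w i [^]\<^bsub>A\<^esub> (2 * j)) \<otimes>\<^bsub>B\<^esub> z) = z" if "z \<in> carrier B" for z
      using glue_unit[OF \<rho>(1) \<theta>A \<rho>(2) that] by (simp only: \<theta>_def)
  qed
qed

end

theorem theorem43:
  fixes M :: "'a manifold" and E :: "('a, 'e) vbundle" and m k :: nat
  assumes "smooth_manifold M"
    and "vector_bundle M E" and "bundle_rank E = m" and "m \<ge> 1"
    and "k \<ge> 1"
  shows "let A = smooth_functions M; P = smooth_sections M E in
    Module.module A (diolic_smbl A P k) \<and>
    Module.module A (diolic_multiderivations A P k) \<and>
    (\<exists>\<Theta> \<in> module_iso A (diolic_smbl A P k) (diolic_multiderivations A P k).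
       \<forall>\<phi> \<in> carrier (diolic_diff A P k).
         \<Theta> (carrier (diolic_diff A P (k - 1)) +>\<^bsub>diolic_diff A P k\<^esub> \<phi>)
           = diolic_multisymbol A P k \<phi>)"
proof -
  interpret smooth_vbundle M E
    using assms(1,2) by (simp add: smooth_vbundle_def smooth_mfd_def smooth_vbundle_axioms_def)
  have "bundle_rank E \<ge> 1" using assms(3,4) by simp
  note iso = dm.diolic_symbols_iso[OF faithful[OF this] symbols_surjective, of "k - 1"]
  have "Suc (k - 1) = k" using assms(5) by simp
  with iso show ?thesis by (simp add: Let_def)
qed

end
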